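(* Let $(R,\mathfrak m,\Bbbk)$ be a domain that is an algebra with pseudocoefficient field $K$, and assume that $\operatorname{Frac}(R)/K$ is separable. Then $\mathrm{s}^{\mathrm{diff}}_K(R)\le 1$.
   Context: Algebra with pseudocoefficient field: a triple $(R,\mathfrak m,\Bbbk)$ is an algebra with pseudocoefficient field $K$ if $K$ is a field and $R\neq 0$ is a commutative $K$-algebra that is either $\mathbb N$-graded and finitely generated over $R_0=K$ (with $\mathfrak m$ the homogeneous maximal ideal), or local and essentially of finite type over $K$ (with $\mathfrak m$ the maximal ideal), and $K\to \Bbbk=R/\mathfrak m$ is a finite separable field extension. Differential operators: $D^0_{R|K}=\operatorname{Hom}_R(R,R)$ and $D^n_{R|K}=\{\delta\in\operatorname{Hom}_K(R,R) : [\delta,r]\in D^{n-1}_{R|K}\ \forall r\in R\}$. Differential powers: $\mathfrak m^{\langle n\rangle_K}=\{f\in R : \delta(f)\in\mathfrak m \text{ for all }\delta\in D^{n-1}_{R|K}\}$. Differential signature: with $d=\dim R$ and $\lambda_R$ denoting length, $\mathrm{s}^{\mathrm{diff}}_K(R)=\limsup_{n\to\infty}\dfrac{\lambda_R(R/\mathfrak m^{\langle n\rangle_K})}{n^d/d!}$. *)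

theory Defs
  imports "HOL-Algebra.Algebra" "HOL-Algebra.Indexed_Polynomials" "HOL-Algebra.Generated_Fields"
    "HOL-Library.Extended_Real"
begin

section \<open>Modules, length and Krull dimension\<close>

definition mod_hom :: "('r, 'x) ring_scheme \<Rightarrow> ('r, 'm, 'y) module_scheme \<Rightarrow>
    ('r, 'n, 'z) module_scheme \<Rightarrow> ('m \<Rightarrow> 'n) set" where
  "mod_hom R M N = {f \<in> carrier M \<rightarrow> carrier N.
     (\<forall>x\<in>carrier M. \<forall>y\<in>carrier M. f (x \<oplus>\<^bsub>M\<^esub> y) = f x \<oplus>\<^bsub>N\<^esub> f y) \<and>
     (\<forall>r\<in>carrier R. \<forall>x\<in>carrier M. f (r \<odot>\<^bsub>M\<^esub> x) = r \<odot>\<^bsub>N\<^esub> f x)}"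

definition regular_module :: "('a, 'x) ring_scheme \<Rightarrow> ('a, 'a) module" where
  "regular_module R = \<lparr>carrier = carrier R, monoid.mult = monoid.mult R,
     monoid.one = monoid.one R, ring.zero = ring.zero R, ring.add = ring.add R,
     smult = monoid.mult R\<rparr>"

definition quotient_module :: "('a, 'x) ring_scheme \<Rightarrow> 'a set \<Rightarrow> ('a, 'a set) module" where
  "quotient_module R I = \<lparr>carrier = carrier (R Quot I),
     monoid.mult = monoid.mult (R Quot I), monoid.one = monoid.one (R Quot I),
     ring.zero = ring.zero (R Quot I), ring.add = ring.add (R Quot I),
     smult = \<lambda>r. monoid.mult (R Quot I) (I +>\<^bsub>R\<^esub> r)\<rparr>"

definition module_length :: "('r, 'x) ring_scheme \<Rightarrow> ('r, 'm, 'y) module_scheme \<Rightarrow> enat" where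
  "module_length R M = Sup {enat n | n. \<exists>N. (\<forall>i\<le>n. submodule (N i) R M) \<and>
     (\<forall>i<n. N i \<subset> N (Suc i))}"

definition krull_dim :: "('a, 'x) ring_scheme \<Rightarrow> enat" where
  "krull_dim R = Sup {enat n | n. \<exists>P. (\<forall>i\<le>n. primeideal (P i) R) \<and> (\<forall>i<n. P i \<subset> P (Suc i))}"

section \<open>Localizations\<close>

definition is_localization :: "('a, 'x) ring_scheme \<Rightarrow> 'a set \<Rightarrow> ('b, 'y) ring_scheme \<Rightarrow>
    ('a \<Rightarrow> 'b) \<Rightarrow> bool" where
  "is_localization A S B f \<longleftrightarrow> cring A \<and> cring B \<and> submonoid S A \<and> f \<in> ring_hom A B \<and>
     f ` S \<subseteq> Units B \<and>
     (\<forall>b\<in>carrier B. \<exists>a\<in>carrier A. \<exists>s\<in>S. b \<otimes>\<^bsub>B\<^esub> f s = f a) \<and>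
     (\<forall>a\<in>carrier A. f a = \<zero>\<^bsub>B\<^esub> \<longleftrightarrow> (\<exists>s\<in>S. s \<otimes>\<^bsub>A\<^esub> a = \<zero>\<^bsub>A\<^esub>))"

definition is_fraction_field :: "('a, 'x) ring_scheme \<Rightarrow> ('f, 'y) ring_scheme \<Rightarrow>
    ('a \<Rightarrow> 'f) \<Rightarrow> bool" where
  "is_fraction_field R F \<iota> \<longleftrightarrow> field F \<and> is_localization R (carrier R - {\<zero>\<^bsub>R\<^esub>}) F \<iota>"

section \<open>Separable field extensions\<close>

text \<open>Extensions are given by a subfield \<open>K\<close> of the ambient ring, as in the theories on
  embedded algebras and finite extensions.\<close>

context ring
begin

text \<open>Polynomials are coefficient lists with the leading coefficient first.\<close>

definition formal_deriv :: "'a list \<Rightarrow> 'a list" where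
  "formal_deriv p = normalize (map (\<lambda>i. add_pow R i (coeff p i)) (rev [1..<length p]))"

text \<open>Algebraic, with a minimal polynomial that is relatively prime to its derivative.\<close>

definition separable_over :: "'a set \<Rightarrow> 'a \<Rightarrow> bool" where
  "separable_over K x \<longleftrightarrow> (algebraic over K) x \<and>
     (\<forall>q\<in>carrier (K[X]). q divides\<^bsub>K[X]\<^esub> Irr K x \<and> q divides\<^bsub>K[X]\<^esub> formal_deriv (Irr K x)
        \<longrightarrow> q \<in> Units (K[X]))"

definition finite_separable_extension :: "'a set \<Rightarrow> 'a set \<Rightarrow> bool" where
  "finite_separable_extension K E \<longleftrightarrow> finite_dimension K E \<and> (\<forall>x\<in>E. separable_over K x)"

text \<open>Evaluation of a multivariate polynomial whose variables are indexed by ring elements,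
  each variable being sent to its index.\<close>

definition tautological_eval :: "('a multiset \<Rightarrow> 'a) \<Rightarrow> 'a" where
  "tautological_eval P = (\<Oplus>m \<in> {m. P m \<noteq> \<zero>}. P m \<otimes> (\<Otimes>b \<in> set_mset m. b [^] count m b))"

definition algebraically_independent :: "'a set \<Rightarrow> 'a set \<Rightarrow> bool" where
  "algebraically_independent K B \<longleftrightarrow>
     (\<forall>P \<in> indexed_pset B K. tautological_eval P = \<zero> \<longrightarrow> P = (\<lambda>_. \<zero>))"

definition separably_generated :: "'a set \<Rightarrow> 'a set \<Rightarrow> bool" where
  "separably_generated K E \<longleftrightarrow> (\<exists>B\<subseteq>E. algebraically_independent K B \<and>
     (\<forall>x\<in>E. separable_over (generate_field R (K \<union> B)) x))"

text \<open>Separability of a not necessarily algebraic extension: every finitely generated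
  subextension is separably generated.\<close>

definition separable_extension :: "'a set \<Rightarrow> 'a set \<Rightarrow> bool" where
  "separable_extension K E \<longleftrightarrow>
     (\<forall>S\<subseteq>E. finite S \<longrightarrow> separably_generated K (generate_field R (K \<union> S)))"

end

section \<open>Algebras with pseudocoefficient field\<close>

definition scalars :: "('k, 'x) ring_scheme \<Rightarrow> ('k, 'a, 'y) module_scheme \<Rightarrow> 'a set" where
  "scalars K R = (\<lambda>c. c \<odot>\<^bsub>R\<^esub> \<one>\<^bsub>R\<^esub>) ` carrier K"

definition fin_gen_algebra :: "('k, 'x) ring_scheme \<Rightarrow> ('k, 'a, 'y) module_scheme \<Rightarrow> bool" where
  "fin_gen_algebra K R \<longleftrightarrow> algebra K R \<and>
     (\<exists>T. finite T \<and> T \<subseteq> carrier R \<and> carrier R = generate_ring R (scalars K R \<union> T))"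

definition graded_components :: "('a, 'x) ring_scheme \<Rightarrow> (nat \<Rightarrow> 'a set) \<Rightarrow> 'a \<Rightarrow> (nat \<Rightarrow> 'a) \<Rightarrow> bool"
  where
  "graded_components R G x c \<longleftrightarrow> (\<forall>i. c i \<in> G i) \<and> finite {i. c i \<noteq> \<zero>\<^bsub>R\<^esub>} \<and>
     x = (\<Oplus>\<^bsub>R\<^esub>i \<in> {i. c i \<noteq> \<zero>\<^bsub>R\<^esub>}. c i)"

definition nat_grading :: "('a, 'x) ring_scheme \<Rightarrow> (nat \<Rightarrow> 'a set) \<Rightarrow> bool" where
  "nat_grading R G \<longleftrightarrow> (\<forall>i. additive_subgroup (G i) R) \<and>
     (\<forall>i j. \<forall>x\<in>G i. \<forall>y\<in>G j. x \<otimes>\<^bsub>R\<^esub> y \<in> G (i + j)) \<and>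
     (\<forall>x\<in>carrier R. \<exists>!c. graded_components R G x c)"

definition homogeneous_ideal :: "('a, 'x) ring_scheme \<Rightarrow> (nat \<Rightarrow> 'a set) \<Rightarrow> 'a set \<Rightarrow> bool" where
  "homogeneous_ideal R G I \<longleftrightarrow> ideal I R \<and>
     (\<forall>x\<in>I. \<forall>c. graded_components R G x c \<longrightarrow> (\<forall>i. c i \<in> I))"

text \<open>Since the degree zero part is a field, there is exactly one homogeneous maximal ideal.\<close>

definition graded_case :: "('k, 'x) ring_scheme \<Rightarrow> ('k, 'a, 'y) module_scheme \<Rightarrow> 'a set \<Rightarrow> bool" where
  "graded_case K R \<mm> \<longleftrightarrow> fin_gen_algebra K R \<and>
     (\<exists>G. nat_grading R G \<and> G 0 = scalars K R \<and> maximalideal \<mm> R \<and> homogeneous_ideal R G \<mm>)"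

text \<open>Taking the finitely generated algebra on the same type as \<open>R\<close> loses nothing: \<open>R\<close> is then
  also a localization of the image of that algebra in \<open>R\<close>.\<close>

definition ess_finite_type :: "('k, 'x) ring_scheme \<Rightarrow> ('k, 'a, 'y) module_scheme \<Rightarrow> bool" where
  "ess_finite_type K R \<longleftrightarrow> (\<exists>(A :: ('k, 'a) module) S f. fin_gen_algebra K A \<and>
     is_localization A S R f \<and> f \<in> mod_hom K A R)"

definition local_case :: "('k, 'x) ring_scheme \<Rightarrow> ('k, 'a, 'y) module_scheme \<Rightarrow> 'a set \<Rightarrow> bool" where
  "local_case K R \<mm> \<longleftrightarrow> ess_finite_type K R \<and> maximalideal \<mm> R \<and>
     (\<forall>J. maximalideal J R \<longrightarrow> J = \<mm>)"

definition pseudocoefficient_algebra ::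
    "('k, 'x) ring_scheme \<Rightarrow> ('k, 'a, 'y) module_scheme \<Rightarrow> 'a set \<Rightarrow> bool" where
  "pseudocoefficient_algebra K R \<mm> \<longleftrightarrow> field K \<and> algebra K R \<and> carrier R \<noteq> {\<zero>\<^bsub>R\<^esub>} \<and>
     (graded_case K R \<mm> \<or> local_case K R \<mm>) \<and>
     ring.finite_separable_extension (R Quot \<mm>)
       ((\<lambda>a. \<mm> +>\<^bsub>R\<^esub> a) ` scalars K R) (carrier (R Quot \<mm>))"

section \<open>Differential operators and differential signature\<close>

text \<open>Maps are total functions on the carrier type; membership in the following sets depends only
  on their restriction to the carrier.\<close>

primrec diff_op :: "('k, 'x) ring_scheme \<Rightarrow> ('k, 'a, 'y) module_scheme \<Rightarrow> nat \<Rightarrow> ('a \<Rightarrow> 'a) set" where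
  "diff_op K R 0 = mod_hom R (regular_module R) (regular_module R)"
| "diff_op K R (Suc n) = {\<delta> \<in> mod_hom K R R.
     \<forall>r\<in>carrier R. (\<lambda>x. \<delta> (r \<otimes>\<^bsub>R\<^esub> x) \<ominus>\<^bsub>R\<^esub> r \<otimes>\<^bsub>R\<^esub> \<delta> x) \<in> diff_op K R n}"

text \<open>The value at \<open>0\<close> uses the convention that there are no nonzero operators of order \<open>-1\<close>.\<close>

primrec diff_power :: "('k, 'x) ring_scheme \<Rightarrow> ('k, 'a, 'y) module_scheme \<Rightarrow> 'a set \<Rightarrow> nat \<Rightarrow> 'a set"
  where
  "diff_power K R \<mm> 0 = carrier R"
| "diff_power K R \<mm> (Suc n) = {f \<in> carrier R. \<forall>\<delta>\<in>diff_op K R n. \<delta> f \<in> \<mm>}"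

text \<open>The dimension is finite whenever \<open>R\<close> is essentially of finite type over a field.\<close>

definition diff_signature :: "('k, 'x) ring_scheme \<Rightarrow> ('k, 'a, 'y) module_scheme \<Rightarrow> 'a set \<Rightarrow> ereal"
  where
  "diff_signature K R \<mm> = (let d = the_enat (krull_dim R) in
     limsup (\<lambda>n. ereal_of_enat (module_length R (quotient_module R (diff_power K R \<mm> n))) /
       ereal (real n ^ d / fact d)))"

end

theory Submission
  imports Defs
begin

text \<open>Let \<open>d\<close> be the Krull dimension. An element \<open>r\<close> is constant to order \<open>n\<close> modulo \<open>\<mm>\<close> if
  \<open>\<delta>(r g) \<equiv> r \<delta>(g)\<close> for all operators \<open>\<delta>\<close> of order at most \<open>n\<close>. By separability of the residue
  field and Newton iteration, every residue class contains such an element. Hence a chain of length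
  \<open>N\<close> above \<open>\<mm>\<^bsup>\<langle>n+1\<rangle>\<^esup>\<close> yields operators \<open>\<delta>\<^sub>i\<close> of order at most \<open>n\<close> and elements \<open>f\<^sub>i\<close> with a triangular
  matrix \<open>\<delta>\<^sub>i(f\<^sub>l)\<close>. A separating transcendence basis of the fraction field, which has at most \<open>d\<close>
  elements, gives at most \<open>d\<close> elements of \<open>R\<close> such that a derivation vanishing on them is zero, and
  then an operator of order at most \<open>n\<close> is determined by its values on the monomials of degree at
  most \<open>n\<close> in them. As \<open>R\<close> is a domain, \<open>N\<close> is at most the number \<open>(n + d choose d)\<close> of monomials.

  The bound of the transcendence degree by \<open>d\<close> at an arbitrary maximal ideal avoids going-down: a
  Noether normalization is chosen with all variables in \<open>\<mm>\<close>, and the lexicographic valuation shows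
  that \<open>0\<close> is in no iterated boundary monoid of the variables over the complement of \<open>\<mm>\<close>, which
  gives a chain of primes of the required length.\<close>

section \<open>Linear relations over subrings\<close>

text \<open>Two obstacles shape the proof. Operators are linear only over \<open>K\<close>, while
  length is counted over the residue field, which need not embed in \<open>R\<close>; since only one
  order \<open>n\<close> is considered at a time, a subring of \<open>R\<close> depending on
  \<open>n\<close> can play the part of a coefficient field. The other obstacle is the exponent: the
  signature divides by a power given by the Krull dimension of \<open>R\<close> itself, so this
  number has to bound the size of the transcendence basis. For that bound a second polynomial ring
  with the same fraction field is used, in which every variable of the normalization is divisible by
  the first one. If \<open>u\<close> is integral over the first ring, and \<open>u\<close> divided
  by that variable is integral over the second, then the lower coefficients of the minimal
  polynomial of \<open>u\<close> have constant term zero. That the coefficients lie in the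
  respective rings is seen by inverting the reversed minimal polynomial as a power series: the
  inverse has coefficients with a common denominator, and the Dedekind-Mertens content formula
  carries it over to all powers of the coefficients sought.\<close>

context cring
begin

lemma finsum_swap:
  assumes "finite I" "finite J" "\<And>i j. i \<in> I \<Longrightarrow> j \<in> J \<Longrightarrow> f i j \<in> carrier R"
  shows "(\<Oplus>i\<in>I. (\<Oplus>j\<in>J. f i j)) = (\<Oplus>j\<in>J. (\<Oplus>i\<in>I. f i j))"
  using assms(1,3)
proof (induction I rule: finite_induct)
  case empty
  then show ?case by simp
next
  case (insert i I)
  have "(\<Oplus>k\<in>insert i I. (\<Oplus>j\<in>J. f k j)) = (\<Oplus>j\<in>J. f i j) \<oplus> (\<Oplus>k\<in>I. (\<Oplus>j\<in>J. f k j))"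
    using insert by (intro finsum_insert) auto
  also have "\<dots> = (\<Oplus>j\<in>J. f i j \<oplus> (\<Oplus>k\<in>I. f k j))"
    using insert by (subst finsum_addf) auto
  also have "\<dots> = (\<Oplus>j\<in>J. (\<Oplus>k\<in>insert i I. f k j))"
  proof (intro finsum_cong' refl)
    show "(\<lambda>j. \<Oplus>k\<in>insert i I. f k j) \<in> J \<rightarrow> carrier R"
      using insert.prems by (auto intro!: finsum_closed)
    fix j assume "j \<in> J"
    then show "f i j \<oplus> (\<Oplus>k\<in>I. f k j) = (\<Oplus>k\<in>insert i I. f k j)"
      using insert by (intro finsum_insert[symmetric]) auto
  qed
  finally show ?case .
qed

lemma finsum_in_subring:
  assumes "subring K R" "finite I" "f \<in> I \<rightarrow> K"
  shows "(\<Oplus>i\<in>I. f i) \<in> K"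
  using assms(2,3)
proof (induction I rule: finite_induct)
  case empty
  then show ?case using subringE(2)[OF assms(1)] by simp
next
  case (insert i I)
  have K: "K \<subseteq> carrier R" by (rule subringE(1)[OF assms(1)])
  have "(\<Oplus>j\<in>insert i I. f j) = f i \<oplus> (\<Oplus>j\<in>I. f j)"
    using insert K by (intro finsum_insert) auto
  then show ?case using insert subringE(7)[OF assms(1)] by auto
qed

end

text \<open>Gaussian elimination without division: a pivot \<open>p\<close> is cleared by
  cross-multiplication. The coefficients therefore stay in the subring, and a solution of the
  reduced system stays nonzero after multiplication by \<open>p\<close> because there are no zero
  divisors.\<close>

lemma (in domain) exists_linear_relation:
  assumes K: "subring K R" and "finite J" "finite I" "card J < card I"
    and "\<And>i j. i \<in> I \<Longrightarrow> j \<in> J \<Longrightarrow> a i j \<in> K"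
  shows "\<exists>c\<in>I \<rightarrow> K. (\<exists>i\<in>I. c i \<noteq> \<zero>) \<and> (\<forall>j\<in>J. (\<Oplus>i\<in>I. c i \<otimes> a i j) = \<zero>)"
  using assms(2-5)
proof (induction J arbitrary: I a rule: finite_induct)
  case empty
  then obtain i where "i \<in> I" by fastforce
  then show ?case using subringE(3)[OF K] by (intro bexI[of _ "\<lambda>_. \<one>"]) auto
next
  case (insert j0 J)
  note Kc = subsetD[OF subringE(1)[OF K]]
  note Kcl = subringE(2,3,5,6,7)[OF K]
  show ?case
  proof (cases "\<forall>i\<in>I. a i j0 = \<zero>")
    case True
    have "card J < card I" using insert by simp
    then obtain c where c: "c \<in> I \<rightarrow> K" "\<exists>i\<in>I. c i \<noteq> \<zero>" "\<forall>j\<in>J. (\<Oplus>i\<in>I. c i \<otimes> a i j) = \<zero>"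
      using insert.IH[OF \<open>finite I\<close>, of a] insert.prems by blast
    have "(\<Oplus>i\<in>I. c i \<otimes> a i j0) = (\<Oplus>i\<in>I. \<zero>)"
      using c(1) True Kc by (intro finsum_cong') (auto simp: Pi_iff)
    then show ?thesis using c by (intro bexI[of _ c]) auto
  next
    case False
    then obtain i0 where i0: "i0 \<in> I" "a i0 j0 \<noteq> \<zero>" by blast
    define p where "p = a i0 j0"
    define I' where "I' = I - {i0}"
    have I': "finite I'" "i0 \<notin> I'" "I = insert i0 I'" using i0 insert.prems unfolding I'_def by auto
    have aK: "a i j \<in> K" if "i \<in> I" "j = j0 \<or> j \<in> J" for i j using insert.prems that by auto
    have pK: "p \<in> K" using aK i0 unfolding p_def by auto
    define a' where "a' i j = p \<otimes> a i j \<oplus> (\<ominus> a i j0) \<otimes> a i0 j" for i j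
    have a'K: "a' i j \<in> K" if "i \<in> I'" "j \<in> J" for i j
      using that aK i0 pK I' Kcl unfolding a'_def by simp
    have "card J < card I'" using insert.prems insert.hyps I' by auto
    then obtain c where c: "c \<in> I' \<rightarrow> K" "\<exists>i\<in>I'. c i \<noteq> \<zero>" "\<forall>j\<in>J. (\<Oplus>i\<in>I'. c i \<otimes> a' i j) = \<zero>"
      using insert.IH[OF I'(1), of a'] a'K by blast
    define s where "s = (\<Oplus>i\<in>I'. c i \<otimes> (\<ominus> a i j0))"
    \<comment> \<open>Back substitution: the coefficient at the pivot is dictated by column
      \<open>j0\<close>. That column is then satisfied identically because all
      \<open>a' i j0\<close> vanish.\<close>
    define d where "d i = (if i = i0 then s else c i \<otimes> p)" for i
    have cK: "c i \<in> K" if "i \<in> I'" for i using c(1) that by auto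
    have sK: "s \<in> K" unfolding s_def
      using cK aK I' Kcl by (intro finsum_in_subring[OF K]) auto
    have dK: "d \<in> I \<rightarrow> K" using sK cK pK Kcl I' unfolding d_def by auto
    have "\<exists>i\<in>I. d i \<noteq> \<zero>"
    proof -
      obtain i where "i \<in> I'" "c i \<noteq> \<zero>" using c(2) by blast
      then have "d i \<noteq> \<zero>" "i \<in> I"
        using I' cK pK Kc i0(2) unfolding d_def p_def by (auto simp: integral_iff)
      then show ?thesis by blast
    qed
    moreover have "(\<Oplus>i\<in>I. d i \<otimes> a i j) = (\<Oplus>i\<in>I'. c i \<otimes> a' i j)" if j: "j = j0 \<or> j \<in> J" for j
    proof -
      have aj: "a i j \<in> carrier R" "a i j0 \<in> carrier R" if "i \<in> I" for i using aK Kc that j by blast+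
      have cc: "c i \<in> carrier R" if "i \<in> I'" for i using cK Kc that by blast
      have pc: "p \<in> carrier R" "s \<in> carrier R" using pK sK Kc by auto
      have "(\<Oplus>i\<in>I. d i \<otimes> a i j) = s \<otimes> a i0 j \<oplus> (\<Oplus>i\<in>I'. d i \<otimes> a i j)"
        using I' aj cc pc unfolding I'(3) by (subst finsum_insert) (auto simp: d_def)
      also have "(\<Oplus>i\<in>I'. d i \<otimes> a i j) = (\<Oplus>i\<in>I'. (c i \<otimes> p) \<otimes> a i j)"
        using I' aj cc pc by (intro finsum_cong') (auto simp: d_def)
      also have "s \<otimes> a i0 j = (\<Oplus>i\<in>I'. (c i \<otimes> (\<ominus> a i j0)) \<otimes> a i0 j)"
        unfolding s_def using I' aj cc by (subst finsum_ldistr) auto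
      also have "\<dots> \<oplus> (\<Oplus>i\<in>I'. (c i \<otimes> p) \<otimes> a i j) =
          (\<Oplus>i\<in>I'. (c i \<otimes> (\<ominus> a i j0)) \<otimes> a i0 j \<oplus> (c i \<otimes> p) \<otimes> a i j)"
        using I' aj cc pc by (subst finsum_addf) auto
      also have "\<dots> = (\<Oplus>i\<in>I'. c i \<otimes> a' i j)"
      proof (intro finsum_cong' refl)
        show "(\<lambda>i. c i \<otimes> a' i j) \<in> I' \<rightarrow> carrier R" using cc aj pc I' by (auto simp: a'_def)
        fix i assume "i \<in> I'"
        then have "c i \<in> carrier R" "a i j0 \<in> carrier R" "a i j \<in> carrier R" "a i0 j \<in> carrier R"
          using cc aj I' by auto
        then show "(c i \<otimes> (\<ominus> a i j0)) \<otimes> a i0 j \<oplus> (c i \<otimes> p) \<otimes> a i j = c i \<otimes> a' i j"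
          unfolding a'_def using pc by algebra
      qed
      finally show ?thesis .
    qed
    moreover have "(\<Oplus>i\<in>I'. c i \<otimes> a' i j0) = \<zero>"
    proof -
      have "a' i j0 = \<zero>" if "i \<in> I'" for i
      proof -
        have "a i j0 \<in> carrier R" "p \<in> carrier R" using aK that I' Kc pK by auto
        then show ?thesis unfolding a'_def p_def[symmetric] by algebra
      qed
      then have "(\<Oplus>i\<in>I'. c i \<otimes> a' i j0) = (\<Oplus>i\<in>I'. \<zero>)"
        using cK Kc by (intro finsum_cong') auto
      then show ?thesis by simp
    qed
    ultimately show ?thesis using dK c(3) by (intro bexI[of _ d]) auto
  qed
qed

text \<open>If \<open>J\<close> were smaller, the rows of \<open>a\<close> would be dependent, and
  by \<open>det\<close> the same relation would hold between the rows of \<open>b\<close>. At the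
  least index \<open>l\<close> with \<open>c l\<close> nonzero only
  \<open>c l \<otimes> b l l\<close> survives in it. Both the bound on lengths and the bound on the
  number of elements that determine derivations rest on this count.\<close>

lemma (in domain) triangular_le_card:
  fixes N :: nat
  assumes "finite J"
    and a: "\<And>i j. i < N \<Longrightarrow> j \<in> J \<Longrightarrow> a i j \<in> carrier R"
    and b: "\<And>i l. i < N \<Longrightarrow> l < N \<Longrightarrow> b i l \<in> carrier R"
    and tri: "\<And>i l. l < i \<Longrightarrow> i < N \<Longrightarrow> b i l = \<zero>" and diag: "\<And>i. i < N \<Longrightarrow> b i i \<noteq> \<zero>"
    and det: "\<And>c l. c \<in> {..<N} \<rightarrow> carrier R \<Longrightarrow> \<forall>j\<in>J. (\<Oplus>i\<in>{..<N}. c i \<otimes> a i j) = \<zero> \<Longrightarrow> l < N \<Longrightarrow>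
        (\<Oplus>i\<in>{..<N}. c i \<otimes> b i l) = \<zero>"
  shows "N \<le> card J"
proof (rule ccontr)
  assume "\<not> N \<le> card J"
  then obtain c where c: "c \<in> {..<N} \<rightarrow> carrier R" "\<exists>i\<in>{..<N}. c i \<noteq> \<zero>"
      "\<forall>j\<in>J. (\<Oplus>i\<in>{..<N}. c i \<otimes> a i j) = \<zero>"
    using exists_linear_relation[OF carrier_is_subring \<open>finite J\<close>, of "{..<N}" a] a by auto
  define l where "l = (LEAST i. i < N \<and> c i \<noteq> \<zero>)"
  have l: "l < N" "c l \<noteq> \<zero>" using c(2) LeastI_ex[of "\<lambda>i. i < N \<and> c i \<noteq> \<zero>"] unfolding l_def by auto
  have less: "c i = \<zero>" if "i < l" for i
    using not_less_Least[of i "\<lambda>i. i < N \<and> c i \<noteq> \<zero>"] that l(1) unfolding l_def[symmetric] by auto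
  have cb: "c i \<otimes> b i l = (if l = i then c i \<otimes> b i l else \<zero>)" if "i < N" for i
    using less[of i] tri[of l i] that b l c(1) by (cases i l rule: linorder_cases) (auto simp: Pi_iff)
  have "(\<Oplus>i\<in>{..<N}. c i \<otimes> b i l) = (\<Oplus>i\<in>{..<N}. if l = i then c i \<otimes> b i l else \<zero>)"
    using cb c(1) b l(1) by (intro finsum_cong') (auto simp: Pi_iff)
  also have "\<dots> = c l \<otimes> b l l"
    using l c(1) b by (intro finsum_singleton) auto
  finally have "c l \<otimes> b l l = \<zero>" using det[OF c(1,3) l(1)] by simp
  then show False using l diag[OF l(1)] b[of l l] c(1) by (auto simp: integral_iff Pi_iff)
qed

section \<open>Spans over a subring\<close>

inductive_set (in ring) lspan :: "'a set \<Rightarrow> 'a set \<Rightarrow> 'a set" for B V where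
  zero: "\<zero> \<in> lspan B V"
| add: "b \<in> B \<Longrightarrow> v \<in> V \<Longrightarrow> x \<in> lspan B V \<Longrightarrow> b \<otimes> v \<oplus> x \<in> lspan B V"

context cring
begin

lemma lspan_carrier:
  assumes "B \<subseteq> carrier R" "V \<subseteq> carrier R" shows "lspan B V \<subseteq> carrier R"
proof
  fix x assume "x \<in> lspan B V"
  then show "x \<in> carrier R" using assms by induction auto
qed

lemma lspan_least:
  assumes "\<zero> \<in> S" "\<And>b v x. b \<in> B \<Longrightarrow> v \<in> V \<Longrightarrow> x \<in> S \<Longrightarrow> b \<otimes> v \<oplus> x \<in> S"
  shows "lspan B V \<subseteq> S"
proof
  fix x assume "x \<in> lspan B V" then show "x \<in> S" using assms by induction auto
qed

lemma lspan_mono: "B \<subseteq> B' \<Longrightarrow> V \<subseteq> V' \<Longrightarrow> lspan B V \<subseteq> lspan B' V'"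
  by (rule lspan_least) (auto intro: lspan.intros)

lemma lspan_add_closed:
  assumes "B \<subseteq> carrier R" "V \<subseteq> carrier R" "x \<in> lspan B V" "y \<in> lspan B V"
  shows "x \<oplus> y \<in> lspan B V"
  using assms(3)
proof induction
  case zero
  then show ?case using assms lspan_carrier[OF assms(1,2)] by auto
next
  case (add b v x)
  have "b \<in> carrier R" "v \<in> carrier R" "x \<in> carrier R" "y \<in> carrier R"
    using add assms lspan_carrier[OF assms(1,2)] by auto
  then have "b \<otimes> v \<oplus> x \<oplus> y = b \<otimes> v \<oplus> (x \<oplus> y)" by algebra
  then show ?case using add by (auto intro: lspan.add)
qed

text \<open>Multiplication by \<open>r\<close> may lead from one span into another, and only
  products with single terms are checked. This form covers multiplication tables, changes of
  generators and the clearing of denominators.\<close>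

lemma lspan_scale:
  assumes "B \<subseteq> carrier R" "V \<subseteq> carrier R" "V' \<subseteq> carrier R" "r \<in> carrier R"
    and "\<And>b v. b \<in> B \<Longrightarrow> v \<in> V \<Longrightarrow> r \<otimes> (b \<otimes> v) \<in> lspan B V'" "x \<in> lspan B V"
  shows "r \<otimes> x \<in> lspan B V'"
  using assms(6)
proof induction
  case zero
  then show ?case using assms by (auto intro: lspan.zero)
next
  case (add b v x)
  have "b \<in> carrier R" "v \<in> carrier R" "x \<in> carrier R"
    using add assms lspan_carrier[OF assms(1,2)] by auto
  then have "r \<otimes> (b \<otimes> v \<oplus> x) = r \<otimes> (b \<otimes> v) \<oplus> r \<otimes> x" using assms(4) by algebra
  then show ?case using add assms(5)[of b v] lspan_add_closed[OF assms(1,3)] by auto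
qed

lemma lspan_smult_closed:
  assumes "subring B R" "V \<subseteq> carrier R" "b \<in> B" "x \<in> lspan B V"
  shows "b \<otimes> x \<in> lspan B V"
proof (rule lspan_scale[OF _ assms(2) assms(2) _ _ assms(4)])
  show B: "B \<subseteq> carrier R" by (rule subringE(1)[OF assms(1)])
  show "b \<in> carrier R" using B assms by auto
  fix b' v assume *: "b' \<in> B" "v \<in> V"
  have "b \<otimes> (b' \<otimes> v) = (b \<otimes> b') \<otimes> v \<oplus> \<zero>" using * B assms by (auto simp: m_assoc subsetD)
  then show "b \<otimes> (b' \<otimes> v) \<in> lspan B V"
    using * subringE(6)[OF assms(1)] assms(3) by (auto intro: lspan.intros)
qed

lemma lspan_incl:
  assumes "subring B R" "V \<subseteq> carrier R" "v \<in> V"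
  shows "v \<in> lspan B V"
proof -
  have "v = \<one> \<otimes> v \<oplus> \<zero>" using assms by auto
  then show ?thesis using lspan.add[OF subringE(3)[OF assms(1)] assms(3) lspan.zero] by simp
qed

lemma lspan_uminus_closed:
  assumes "subring B R" "V \<subseteq> carrier R" "x \<in> lspan B V"
  shows "\<ominus> x \<in> lspan B V"
proof -
  have "x \<in> carrier R" using lspan_carrier subringE(1)[OF assms(1)] assms by blast
  then have "\<ominus> x = (\<ominus> \<one>) \<otimes> x" by algebra
  then show ?thesis
    using lspan_smult_closed[OF assms(1,2) _ assms(3), of "\<ominus> \<one>"] subringE(3,5)[OF assms(1)] by simp
qed

lemma lspan_minus_closed:
  assumes "subring B R" "V \<subseteq> carrier R" "x \<in> lspan B V" "y \<in> lspan B V"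
  shows "x \<ominus> y \<in> lspan B V"
  unfolding a_minus_def
  by (intro lspan_add_closed lspan_uminus_closed subringE(1)[OF assms(1)] assms)

lemma lspan_sum_closed:
  assumes "subring B R" "V \<subseteq> carrier R" "finite I" "f \<in> I \<rightarrow> lspan B V"
  shows "(\<Oplus>i\<in>I. f i) \<in> lspan B V"
  using assms(3,4)
proof (induction I rule: finite_induct)
  case empty
  then show ?case by (simp add: lspan.zero)
next
  case (insert i I)
  have "(\<Oplus>j\<in>insert i I. f j) = f i \<oplus> (\<Oplus>j\<in>I. f j)"
    using insert lspan_carrier[OF subringE(1)[OF assms(1)] assms(2)]
    by (intro finsum_insert) auto
  then show ?case using insert lspan_add_closed[OF subringE(1)[OF assms(1)] assms(2)] by auto
qed

lemma lspan_trans: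
  assumes "subring C R" "W \<subseteq> carrier R"
    and "\<And>b v. b \<in> B \<Longrightarrow> v \<in> V \<Longrightarrow> b \<otimes> v \<in> lspan C W"
  shows "lspan B V \<subseteq> lspan C W"
  by (rule lspan_least)
    (auto intro: lspan.zero lspan_add_closed[OF subringE(1)[OF assms(1)] assms(2)] assms(3))

lemma lspan_subset:
  assumes "subring C R" "W \<subseteq> carrier R" "B \<subseteq> C" "V \<subseteq> lspan C W"
  shows "lspan B V \<subseteq> lspan C W"
  using assms by (intro lspan_trans lspan_smult_closed) auto

lemma lspan_mult:
  assumes "subring B R" "V \<subseteq> carrier R" "W \<subseteq> carrier R" "U \<subseteq> carrier R"
    and VW: "\<And>v w. v \<in> V \<Longrightarrow> w \<in> W \<Longrightarrow> v \<otimes> w \<in> lspan B U"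
    and "x \<in> lspan B V" "y \<in> lspan B W"
  shows "x \<otimes> y \<in> lspan B U"
proof -
  have B: "B \<subseteq> carrier R" by (rule subringE(1)[OF assms(1)])
  have c: "x \<in> carrier R" "y \<in> carrier R"
    using lspan_carrier[OF B assms(2)] lspan_carrier[OF B assms(3)] assms(6,7) by auto
  have "y \<otimes> x \<in> lspan B U"
  proof (rule lspan_scale[OF B \<open>V \<subseteq> carrier R\<close> \<open>U \<subseteq> carrier R\<close> c(2) _ \<open>x \<in> lspan B V\<close>])
    fix b v assume bv: "b \<in> B" "v \<in> V"
    then have bvc: "b \<in> carrier R" "v \<in> carrier R" using B assms by auto
    have "v \<otimes> y \<in> lspan B U"
    proof (rule lspan_scale[OF B \<open>W \<subseteq> carrier R\<close> \<open>U \<subseteq> carrier R\<close> bvc(2) _ \<open>y \<in> lspan B W\<close>])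
      fix b' w assume *: "b' \<in> B" "w \<in> W"
      then have "b' \<in> carrier R" "w \<in> carrier R" using B assms by auto
      then have "v \<otimes> (b' \<otimes> w) = b' \<otimes> (v \<otimes> w)" using bvc by algebra
      then show "v \<otimes> (b' \<otimes> w) \<in> lspan B U"
        using VW[OF bv(2) *(2)] lspan_smult_closed[OF assms(1,4) *(1)] by simp
    qed
    moreover have "y \<otimes> (b \<otimes> v) = b \<otimes> (v \<otimes> y)" using bvc c by algebra
    ultimately show "y \<otimes> (b \<otimes> v) \<in> lspan B U"
      using lspan_smult_closed[OF assms(1,4) bv(1)] by simp
  qed
  then show ?thesis using c m_comm by simp
qed

lemma lspan_image_finite:
  assumes B: "subring B R" and I: "finite I" "v ` I \<subseteq> carrier R" "x \<in> lspan B (v ` I)"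
  shows "\<exists>a\<in>I \<rightarrow> B. x = (\<Oplus>i\<in>I. a i \<otimes> v i)"
  using I(3)
proof induction
  case zero
  have "(\<Oplus>i\<in>I. \<zero> \<otimes> v i) = (\<Oplus>i\<in>I. \<zero>)" using I by (intro finsum_cong') auto
  then show ?case using subringE(2)[OF B] by (intro bexI[of _ "\<lambda>_. \<zero>"]) auto
next
  case (add b w x)
  then obtain a i0 where a: "a \<in> I \<rightarrow> B" "x = (\<Oplus>i\<in>I. a i \<otimes> v i)" and i0: "i0 \<in> I" "w = v i0" by blast
  have Bc: "B \<subseteq> carrier R" by (rule subringE(1)[OF B])
  define e where "e i = (if i0 = i then b else \<zero>)" for i
  have e: "e \<in> I \<rightarrow> B" using add subringE(2)[OF B] by (auto simp: e_def)
  have "b \<otimes> w = (\<Oplus>i\<in>I. if i0 = i then b \<otimes> v i else \<zero>)"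
    unfolding i0(2) using add i0 Bc I by (intro finsum_singleton[symmetric]) auto
  also have "\<dots> = (\<Oplus>i\<in>I. e i \<otimes> v i)"
    using add Bc I by (intro finsum_cong') (auto simp: e_def subset_iff)
  finally have bv: "b \<otimes> w = (\<Oplus>i\<in>I. e i \<otimes> v i)" .
  have "b \<otimes> w \<oplus> x = (\<Oplus>i\<in>I. e i \<otimes> v i \<oplus> a i \<otimes> v i)"
    using a e Bc I(2) unfolding bv a(2) by (subst finsum_addf) (auto simp: Pi_iff subset_iff)
  also have "\<dots> = (\<Oplus>i\<in>I. (e i \<oplus> a i) \<otimes> v i)"
    using a e Bc I by (intro finsum_cong') (auto simp: l_distr subset_iff Pi_iff)
  finally show ?case using a e subringE(7)[OF B] by (intro bexI[of _ "\<lambda>i. e i \<oplus> a i"]) auto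
qed

end

lemma (in domain) lspan_dependent:
  assumes K: "subring K R" and G: "finite G" "G \<subseteq> carrier R" and I: "finite I" "card G < card I"
    and v: "\<And>i. i \<in> I \<Longrightarrow> v i \<in> lspan K G"
  shows "\<exists>c\<in>I \<rightarrow> K. (\<exists>i\<in>I. c i \<noteq> \<zero>) \<and> (\<Oplus>i\<in>I. c i \<otimes> v i) = \<zero>"
proof -
  have Kc: "K \<subseteq> carrier R" by (rule subringE(1)[OF K])
  have "\<forall>i\<in>I. \<exists>a\<in>G \<rightarrow> K. v i = (\<Oplus>g\<in>G. a g \<otimes> g)" using lspan_image_finite[OF K G(1), of "\<lambda>g. g"] G v by auto
  then obtain a where a: "\<And>i. i \<in> I \<Longrightarrow> a i \<in> G \<rightarrow> K" "\<And>i. i \<in> I \<Longrightarrow> v i = (\<Oplus>g\<in>G. a i g \<otimes> g)"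
    by metis
  obtain c where c: "c \<in> I \<rightarrow> K" "\<exists>i\<in>I. c i \<noteq> \<zero>" "\<forall>g\<in>G. (\<Oplus>i\<in>I. c i \<otimes> a i g) = \<zero>"
    using exists_linear_relation[OF K G(1) I, of a] a(1) by blast
  have cc: "c i \<in> carrier R" "a i g \<in> carrier R" if "i \<in> I" "g \<in> G" for i g
    using c(1) a(1) Kc that by blast+
  have ci: "c i \<in> carrier R" if "i \<in> I" for i using c(1) Kc that by blast
  have "(\<Oplus>i\<in>I. c i \<otimes> v i) = (\<Oplus>i\<in>I. (\<Oplus>g\<in>G. (c i \<otimes> a i g) \<otimes> g))"
  proof (intro finsum_cong' refl)
    show "(\<lambda>i. \<Oplus>g\<in>G. (c i \<otimes> a i g) \<otimes> g) \<in> I \<rightarrow> carrier R"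
      using cc G by (auto intro!: finsum_closed)
    fix i assume i: "i \<in> I"
    have "c i \<otimes> v i = (\<Oplus>g\<in>G. c i \<otimes> (a i g \<otimes> g))"
      unfolding a(2)[OF i] using ci[OF i] cc[OF i] G by (intro finsum_rdistr) (auto simp: subset_iff)
    also have "\<dots> = (\<Oplus>g\<in>G. (c i \<otimes> a i g) \<otimes> g)"
      using cc[OF i] G by (intro finsum_cong') (auto simp: m_assoc subset_iff)
    finally show "c i \<otimes> v i = (\<Oplus>g\<in>G. (c i \<otimes> a i g) \<otimes> g)" .
  qed
  also have "\<dots> = (\<Oplus>g\<in>G. (\<Oplus>i\<in>I. (c i \<otimes> a i g) \<otimes> g))"
    using cc G I by (intro finsum_swap) (auto simp: subset_iff)
  also have "\<dots> = (\<Oplus>g\<in>G. \<zero>)"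
  proof (intro finsum_cong' refl)
    fix g assume g: "g \<in> G"
    have "(\<Oplus>i\<in>I. (c i \<otimes> a i g) \<otimes> g) = (\<Oplus>i\<in>I. c i \<otimes> a i g) \<otimes> g"
      using g cc G I by (subst finsum_ldistr) (auto simp: subset_iff)
    then show "(\<Oplus>i\<in>I. (c i \<otimes> a i g) \<otimes> g) = \<zero>" using c(3) g G by auto
  qed auto
  finally show ?thesis using c by auto
qed

text \<open>Over a field a dependence can be solved for its last term with a nonzero coefficient.
  The ordered form has two uses: it yields the first power of an element that depends on the lower
  powers, and it contradicts the independence of an enumerated family of monomials.\<close>

lemma (in domain) lspan_descending_member:
  assumes K: "subfield K R" and G: "finite G" "G \<subseteq> carrier R" and n: "card G < n"
    and v: "\<And>i. i < n \<Longrightarrow> v i \<in> lspan K G"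
  shows "\<exists>i<n. v i \<in> lspan K (v ` {..<i})"
proof -
  have Ks: "subring K R" and Kc: "K \<subseteq> carrier R" using subfieldE[OF K] by auto
  have vc: "v i \<in> carrier R" if "i < n" for i using v[OF that] lspan_carrier[OF Kc G(2)] by auto
  obtain c where c: "c \<in> {..<n} \<rightarrow> K" "\<exists>i\<in>{..<n}. c i \<noteq> \<zero>" "(\<Oplus>i\<in>{..<n}. c i \<otimes> v i) = \<zero>"
    using lspan_dependent[OF Ks G, of "{..<n}" v] n v by auto
  define m where "m = Max {i. i < n \<and> c i \<noteq> \<zero>}"
  have fin: "finite {i. i < n \<and> c i \<noteq> \<zero>}" by simp
  have "{i. i < n \<and> c i \<noteq> \<zero>} \<noteq> {}" using c(2) by auto
  then have m: "m < n" "c m \<noteq> \<zero>" using Max_in[OF fin] unfolding m_def by blast+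
  have gt: "c i = \<zero>" if "m < i" "i < n" for i
    using Max_ge[OF fin, of i] that unfolding m_def[symmetric] by auto
  have cc: "c i \<in> carrier R" if "i < n" for i using c(1) that Kc by auto
  have "(\<Oplus>i\<in>{..<n}. c i \<otimes> v i) = (\<Oplus>i\<in>insert m {..<m}. c i \<otimes> v i)"
    using gt m cc vc by (intro add.finprod_mono_neutral_cong_right) auto
  also have "\<dots> = c m \<otimes> v m \<oplus> (\<Oplus>i\<in>{..<m}. c i \<otimes> v i)"
    using m cc vc by (intro finsum_insert) auto
  finally have eq: "c m \<otimes> v m \<oplus> (\<Oplus>i\<in>{..<m}. c i \<otimes> v i) = \<zero>" using c(3) by simp
  have s: "(\<Oplus>i\<in>{..<m}. c i \<otimes> v i) \<in> lspan K (v ` {..<m})"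
  proof (rule lspan_sum_closed[OF Ks])
    show "(\<lambda>i. c i \<otimes> v i) \<in> {..<m} \<rightarrow> lspan K (v ` {..<m})"
    proof
      fix i assume "i \<in> {..<m}"
      then show "c i \<otimes> v i \<in> lspan K (v ` {..<m})"
        using c(1) m vc by (intro lspan_smult_closed[OF Ks] lspan_incl[OF Ks]) auto
    qed
  qed (use vc m in auto)
  have cm: "c m \<in> K - {\<zero>}" using c(1) m by auto
  define s where "s = (\<Oplus>i\<in>{..<m}. c i \<otimes> v i)"
  have inv: "inv (c m) \<in> K" "inv (c m) \<otimes> c m = \<one>"
    using subfield_m_inv[OF K cm] by auto
  have sc: "s \<in> carrier R" unfolding s_def using cc vc m by (intro finsum_closed) auto
  have ic: "inv (c m) \<in> carrier R" using inv Kc by auto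
  have "v m = inv (c m) \<otimes> (\<ominus> s)"
  proof -
    have "c m \<otimes> v m = \<ominus> s" using eq sc cc[OF m(1)] vc[OF m(1)] unfolding s_def[symmetric]
      by (simp add: add.inv_equality)
    then have "inv (c m) \<otimes> (c m \<otimes> v m) = inv (c m) \<otimes> (\<ominus> s)" by simp
    then show ?thesis using m_assoc[OF ic cc[OF m(1)] vc[OF m(1)]] inv vc[OF m(1)] by simp
  qed
  moreover have "inv (c m) \<otimes> (\<ominus> s) \<in> lspan K (v ` {..<m})"
    using s inv vc m unfolding s_def by (intro lspan_smult_closed[OF Ks] lspan_uminus_closed[OF Ks]) auto
  ultimately show ?thesis using m by auto
qed

section \<open>Completely integrally closed subrings\<close>

definition (in ring) fracs :: "'a set \<Rightarrow> 'a set" where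
  "fracs B = {a \<otimes> inv b | a b. a \<in> B \<and> b \<in> B - {\<zero>}}"

text \<open>One common denominator for all powers is exactly what the power series argument for
  minimal polynomials produces. The property also passes to polynomial rings by inspection of
  degrees and leading coefficients.\<close>

definition (in ring) comp_int_closed :: "'a set \<Rightarrow> bool" where
  "comp_int_closed B \<longleftrightarrow> (\<forall>d\<in>fracs B. \<forall>c\<in>B - {\<zero>}. (\<forall>n::nat. c \<otimes> d [^] n \<in> B) \<longrightarrow> d \<in> B)"

lemma (in domain) mult_nonzero:
  "a \<in> carrier R \<Longrightarrow> b \<in> carrier R \<Longrightarrow> a \<noteq> \<zero> \<Longrightarrow> b \<noteq> \<zero> \<Longrightarrow> a \<otimes> b \<noteq> \<zero>"
  using integral by blast

lemma (in domain) nat_pow_nonzero: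
  "a \<in> carrier R \<Longrightarrow> a \<noteq> \<zero> \<Longrightarrow> a [^] (n::nat) \<noteq> \<zero>"
  by (induction n) (auto simp: integral_iff)

lemma (in cring) nat_pow_in_subring:
  "subring B R \<Longrightarrow> x \<in> B \<Longrightarrow> x [^] (n::nat) \<in> B"
  by (induction n) (auto simp: subringE(3,6))

context field
begin

lemma inv_nonzero_closed: "b \<in> carrier R \<Longrightarrow> b \<noteq> \<zero> \<Longrightarrow> inv b \<in> carrier R"
  using field_Units by auto

lemma inv_mult_cancel:
  assumes "b \<in> carrier R" "b \<noteq> \<zero>"
  shows "b \<otimes> inv b = \<one>" "inv b \<otimes> b = \<one>"
  using assms field_Units by auto

lemma fracs_carrier: "B \<subseteq> carrier R \<Longrightarrow> fracs B \<subseteq> carrier R"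
  unfolding fracs_def using inv_nonzero_closed by auto

lemma fracsI:
  assumes "B \<subseteq> carrier R" "b \<in> B" "b \<noteq> \<zero>" "d \<in> carrier R" "b \<otimes> d \<in> B"
  shows "d \<in> fracs B"
proof -
  have "b \<in> carrier R" using assms by auto
  then have "d = (b \<otimes> d) \<otimes> inv b"
    using inv_mult_cancel[of b] inv_nonzero_closed[of b] assms m_comm[of "b \<otimes> d" "inv b"]
      m_assoc[of "inv b" b d] by auto
  then show ?thesis unfolding fracs_def using assms by blast
qed

lemma fracsE:
  assumes "B \<subseteq> carrier R" "d \<in> fracs B"
  obtains b where "b \<in> B" "b \<noteq> \<zero>" "b \<otimes> d \<in> B"
proof -
  obtain a b where ab: "d = a \<otimes> inv b" "a \<in> B" "b \<in> B" "b \<noteq> \<zero>"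
    using assms unfolding fracs_def by auto
  have c: "a \<in> carrier R" "b \<in> carrier R" using ab assms by auto
  have "b \<otimes> d = (b \<otimes> inv b) \<otimes> a"
    unfolding ab using c inv_nonzero_closed[OF c(2) ab(4)] by algebra
  then have "b \<otimes> d = a" using inv_mult_cancel[OF c(2) ab(4)] c by simp
  then show ?thesis using that ab by auto
qed

lemma fracs_incl:
  assumes "subring B R" shows "B \<subseteq> fracs B"
  using subringE(1,3)[OF assms] by (auto intro!: fracsI[of _ \<one>])

lemma fracs_subfield:
  assumes B: "subring B R" shows "subfield (fracs B) R"
proof -
  note Bc = subringE(1)[OF B] and cl = subringE(2,3,5,6,7)[OF B]
  have fc: "x \<in> carrier R" if "x \<in> fracs B" for x using fracs_carrier[OF Bc] that by auto
  show ?thesis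
  proof (intro subfieldI' subringI)
    show "fracs B \<subseteq> carrier R" by (rule fracs_carrier[OF Bc])
    show "\<one> \<in> fracs B" using fracs_incl[OF B] cl by auto
  next
    fix h assume h: "h \<in> fracs B"
    then obtain b where b: "b \<in> B" "b \<noteq> \<zero>" "b \<otimes> h \<in> B" by (rule fracsE[OF Bc])
    have "b \<otimes> (\<ominus> h) = \<ominus> (b \<otimes> h)" using fc[OF h] b(1) Bc by (auto simp: r_minus subsetD)
    then show "\<ominus> h \<in> fracs B" using b cl fc[OF h] by (intro fracsI[OF Bc b(1,2)]) auto
  next
    fix h k assume hk: "h \<in> fracs B" "k \<in> fracs B"
    obtain b where b: "b \<in> B" "b \<noteq> \<zero>" "b \<otimes> h \<in> B" using hk(1) by (rule fracsE[OF Bc])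
    obtain b' where b': "b' \<in> B" "b' \<noteq> \<zero>" "b' \<otimes> k \<in> B" using hk(2) by (rule fracsE[OF Bc])
    have c: "b \<in> carrier R" "b' \<in> carrier R" "h \<in> carrier R" "k \<in> carrier R" using b b' Bc hk fc by auto
    have nz: "b \<otimes> b' \<noteq> \<zero>" "b \<otimes> b' \<in> B" using b b' c mult_nonzero cl by auto
    have "(b \<otimes> b') \<otimes> (h \<otimes> k) = (b \<otimes> h) \<otimes> (b' \<otimes> k)"
      "(b \<otimes> b') \<otimes> (h \<oplus> k) = b' \<otimes> (b \<otimes> h) \<oplus> b \<otimes> (b' \<otimes> k)" using c by algebra+
    then show "h \<otimes> k \<in> fracs B" "h \<oplus> k \<in> fracs B"
      using b b' c cl by (auto intro!: fracsI[OF Bc nz(2,1)])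
  next
    fix k assume k: "k \<in> fracs B - {\<zero>}"
    then obtain b where b: "b \<in> B" "b \<noteq> \<zero>" "b \<otimes> k \<in> B" using fracsE[OF Bc] by blast
    have c: "b \<in> carrier R" "k \<in> carrier R" "k \<noteq> \<zero>" using b Bc k fc by auto
    have "(b \<otimes> k) \<otimes> inv k = b \<otimes> (k \<otimes> inv k)" using c inv_nonzero_closed by (auto simp: m_assoc)
    then have "(b \<otimes> k) \<otimes> inv k = b" using inv_mult_cancel c by simp
    then show "inv k \<in> fracs B"
      using b c inv_nonzero_closed mult_nonzero by (intro fracsI[OF Bc b(3)]) auto
  qed
qed

lemma fracs_least:
  assumes "subfield L R" "B \<subseteq> L" shows "fracs B \<subseteq> L"
proof
  fix d assume "d \<in> fracs B"
  then obtain a b where ab: "d = a \<otimes> inv b" "a \<in> B" "b \<in> B" "b \<noteq> \<zero>"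
    unfolding fracs_def by auto
  then have "inv b \<in> L" using subfield_m_inv[OF assms(1)] assms(2) by auto
  then show "d \<in> L" using ab assms subringE(6)[OF subfieldE(1)[OF assms(1)]] by auto
qed

lemma common_denominator:
  assumes B: "subring B R" and "finite D" "D \<subseteq> fracs B"
  shows "\<exists>b\<in>B. b \<noteq> \<zero> \<and> (\<forall>d\<in>D. b \<otimes> d \<in> B)"
  using assms(2,3)
proof (induction D rule: finite_induct)
  case empty
  then show ?case using subringE(3)[OF B] by (intro bexI[of _ \<one>]) auto
next
  case (insert d D)
  note Bc = subringE(1)[OF B] and cl = subringE(2,3,5,6,7)[OF B]
  obtain b where b: "b \<in> B" "b \<noteq> \<zero>" "\<forall>d\<in>D. b \<otimes> d \<in> B" using insert by auto
  obtain b' where b': "b' \<in> B" "b' \<noteq> \<zero>" "b' \<otimes> d \<in> B"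
    using fracsE[OF Bc, of d] insert.prems by auto
  have c: "b \<in> carrier R" "b' \<in> carrier R" using b b' Bc by auto
  show ?case
  proof (intro bexI[of _ "b' \<otimes> b"] conjI ballI)
    show "b' \<otimes> b \<noteq> \<zero>" "b' \<otimes> b \<in> B" using b b' c mult_nonzero cl by auto
    fix e assume e: "e \<in> insert d D"
    then have ec: "e \<in> carrier R" using insert.prems fracs_carrier[OF Bc] by auto
    have eq: "(b' \<otimes> b) \<otimes> e = b' \<otimes> (b \<otimes> e)" "(b' \<otimes> b) \<otimes> e = b \<otimes> (b' \<otimes> e)"
      using ec c by algebra+
    show "(b' \<otimes> b) \<otimes> e \<in> B"
    proof (cases "e = d")
      case True
      then show ?thesis unfolding eq(2) using b b' cl by auto
    next
      case False
      then show ?thesis unfolding eq(1) using e b b' cl by auto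
    qed
  qed
qed

lemma comp_int_closed_subfield:
  assumes "subfield K R" shows "comp_int_closed K"
  using fracs_least[OF assms] unfolding comp_int_closed_def by auto

lemma pow_diff_denominator:
  assumes D: "subring D R" and "d \<in> carrier R" "c \<in> carrier R" "q \<in> D" "\<And>n::nat. c \<otimes> d [^] n \<in> D"
  shows "c \<otimes> (d \<ominus> q) [^] (n::nat) \<in> D"
proof -
  note cl = subringE(2,3,5,6,7)[OF D]
  have qc: "q \<in> carrier R" using assms subringE(1)[OF D] by auto
  \<comment> \<open>The extra factor \<open>d [^] m\<close> makes the induction on \<open>n\<close>
    work: a factor \<open>d \<ominus> q\<close> that is peeled off either raises \<open>m\<close> by
    one or turns into the scalar \<open>q\<close>.\<close>
  have "c \<otimes> d [^] m \<otimes> (d \<ominus> q) [^] n \<in> D" for m :: nat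
  proof (induction n arbitrary: m)
    case 0
    then show ?case using assms by simp
  next
    case (Suc n)
    define e where "e = (d \<ominus> q) [^] n"
    define f where "f = d [^] m"
    have ef: "e \<in> carrier R" "f \<in> carrier R" using assms qc by (auto simp: e_def f_def)
    have "c \<otimes> d [^] m \<otimes> (d \<ominus> q) [^] Suc n = c \<otimes> f \<otimes> (e \<otimes> (d \<ominus> q))"
      by (simp add: e_def f_def)
    also have "\<dots> = c \<otimes> (f \<otimes> d) \<otimes> e \<ominus> q \<otimes> (c \<otimes> f \<otimes> e)"
      using ef assms(2,3) qc by algebra
    also have "\<dots> = c \<otimes> d [^] Suc m \<otimes> (d \<ominus> q) [^] n \<ominus> q \<otimes> (c \<otimes> d [^] m \<otimes> (d \<ominus> q) [^] n)"
      by (simp add: e_def f_def)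
    finally show ?case using Suc[of "Suc m"] Suc[of m] cl assms(4) by (simp add: a_minus_def)
  qed
  from this[of 0] show ?thesis using assms by simp
qed

end

section \<open>Complete integral closedness of polynomial rings\<close>

lemma (in domain) transcendentalI:
  assumes "subring C R" "x \<in> carrier R" "\<And>p. p \<in> carrier (C[X]) \<Longrightarrow> eval p x = \<zero> \<Longrightarrow> p = []"
  shows "(transcendental over C) x"
proof -
  have "a_kernel (C[X]) R (\<lambda>p. eval p x) = {[]}"
    using assms(3) unfolding a_kernel_def' by (auto simp: univ_poly_def)
  then show ?thesis using trivial_ker_imp_transcendental[OF assms(1,2)] by simp
qed

lemma (in domain) univ_poly_pow:
  assumes K: "subring K R" and p: "p \<in> carrier (K[X])" "p \<noteq> []"
  shows "p [^]\<^bsub>K[X]\<^esub> (n::nat) \<in> carrier (K[X])" "p [^]\<^bsub>K[X]\<^esub> n \<noteq> []"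
    "degree (p [^]\<^bsub>K[X]\<^esub> n) = n * degree p" "lead_coeff (p [^]\<^bsub>K[X]\<^esub> n) = lead_coeff p [^] n"
proof -
  interpret UP: domain "K[X]" by (rule univ_poly_is_domain[OF K])
  have "p [^]\<^bsub>K[X]\<^esub> n \<in> carrier (K[X]) \<and> p [^]\<^bsub>K[X]\<^esub> n \<noteq> [] \<and>
    degree (p [^]\<^bsub>K[X]\<^esub> n) = n * degree p \<and> lead_coeff (p [^]\<^bsub>K[X]\<^esub> n) = lead_coeff p [^] n"
  proof (induction n)
    case 0
    then show ?case using UP.one_closed by (simp add: univ_poly_one)
  next
    case (Suc n)
    have pp: "polynomial K p" "polynomial K (p [^]\<^bsub>K[X]\<^esub> n)" using p Suc by (auto simp: univ_poly_carrier)
    have eq: "p [^]\<^bsub>K[X]\<^esub> Suc n = poly_mult (p [^]\<^bsub>K[X]\<^esub> n) p" by (simp add: univ_poly_mult)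
    have "poly_mult (p [^]\<^bsub>K[X]\<^esub> n) p \<noteq> []" using poly_mult_integral[OF K pp(2,1)] Suc p by auto
    then show ?case
      using Suc p(2) poly_mult_degree_eq[OF K pp(2,1)] poly_mult_lead_coeff[OF K pp(2,1)]
        UP.nat_pow_closed[OF p(1), of "Suc n"] unfolding eq by (cases p) (auto simp: algebra_simps)
  qed
  then show "p [^]\<^bsub>K[X]\<^esub> n \<in> carrier (K[X])" "p [^]\<^bsub>K[X]\<^esub> n \<noteq> []"
    "degree (p [^]\<^bsub>K[X]\<^esub> n) = n * degree p" "lead_coeff (p [^]\<^bsub>K[X]\<^esub> n) = lead_coeff p [^] n"
    by auto
qed

context domain
begin

lemma eval_mult_pow:
  assumes K: "subring K R" and x: "x \<in> carrier R" and p: "p \<in> carrier (K[X])" "q \<in> carrier (K[X])"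
  shows "eval (p \<otimes>\<^bsub>K[X]\<^esub> q [^]\<^bsub>K[X]\<^esub> (n::nat)) x = eval p x \<otimes> eval q x [^] n"
proof -
  interpret UP: domain "K[X]" by (rule univ_poly_is_domain[OF K])
  interpret ev: ring_hom_ring "K[X]" R "\<lambda>p. eval p x" by (rule eval_ring_hom[OF K x])
  have "eval (q [^]\<^bsub>K[X]\<^esub> n) x = eval q x [^] n"
    using p(2) by (induction n) auto
  then show ?thesis using p by simp
qed

lemma eval_inj:
  assumes K: "subring K R" and t: "(transcendental over K) x"
    and "p \<in> carrier (K[X])" "q \<in> carrier (K[X])" "eval p x = eval q x"
  shows "p = q"
  using assms unfolding over_def transcendental_def by (auto dest: inj_onD)

end

context field
begin

lemma transcendental_fracs:
  assumes C: "subring C R" and x: "x \<in> carrier R" and t: "(transcendental over C) x"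
  shows "(transcendental over (fracs C)) x"
proof (rule transcendentalI[OF subfieldE(1)[OF fracs_subfield[OF C]] x])
  fix p assume p: "p \<in> carrier ((fracs C)[X])" "eval p x = \<zero>"
  then have sp: "set p \<subseteq> fracs C" by (auto simp: univ_poly_carrier[symmetric] polynomial_def)
  have spc: "set p \<subseteq> carrier R" using sp fracs_carrier[OF subringE(1)[OF C]] by auto
  obtain b where b: "b \<in> C" "b \<noteq> \<zero>" "\<forall>d\<in>set p. b \<otimes> d \<in> C"
    using common_denominator[OF C _ sp] by auto
  have bc: "b \<in> carrier R" using b subringE(1)[OF C] by auto
  define q where "q = map (\<lambda>d. b \<otimes> d) p"
  have "eval q x = b \<otimes> eval p x" using spc unfolding q_def
  proof (induction p)
    case Nil
    then show ?case using bc by simp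
  next
    case (Cons a p)
    have c: "a \<in> carrier R" "x [^] length p \<in> carrier R" "eval p x \<in> carrier R"
      using Cons.prems x eval_in_carrier by auto
    show ?case using Cons c bc by (simp add: r_distr m_assoc)
  qed
  then have "eval q x = \<zero>" using p bc by simp
  moreover have "q \<in> carrier (C[X])"
  proof (cases p)
    case (Cons a p')
    then have "a \<noteq> \<zero>" using p by (auto simp: univ_poly_carrier[symmetric] polynomial_def)
    then show ?thesis
      using Cons b bc spc mult_nonzero by (auto simp: q_def univ_poly_carrier[symmetric] polynomial_def)
  qed (auto simp: q_def univ_poly_zero_closed)
  ultimately have "q = []" using eval_transcendental[OF t] by auto
  then show "p = []" by (simp add: q_def)
qed

lemma simple_extension_subring:
  assumes "subring C R" "x \<in> carrier R"
  shows "subring (simple_extension C x) R"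
proof -
  interpret ev: ring_hom_ring "C[X]" R "\<lambda>p. eval p x" by (rule eval_ring_hom[OF assms])
  show ?thesis
    using ev.img_is_subring[OF ev.R.carrier_is_subring]
    unfolding simple_extension_as_eval_img[OF subringE(1)[OF assms(1)] assms(2)] .
qed

text \<open>Division with remainder writes \<open>d\<close> as a polynomial plus a fraction of
  negative degree. The degrees of the powers of a nonzero such fraction tend to minus infinity, so
  no fixed \<open>c\<close> can clear all their denominators.\<close>

lemma comp_int_closed_simple_extension_subfield:
  assumes M: "subfield M R" and y: "y \<in> carrier R" and t: "(transcendental over M) y"
  shows "comp_int_closed (simple_extension M y)"
  unfolding comp_int_closed_def
proof (intro ballI impI)
  note Ms = subfieldE(1)[OF M]
  let ?E = "simple_extension M y" and ?P = "M[X]"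
  interpret UP: domain ?P by (rule univ_poly_is_domain[OF Ms])
  interpret ev: ring_hom_ring ?P R "\<lambda>p. eval p y" by (rule eval_ring_hom[OF Ms y])
  have E: "subring ?E R" by (rule simple_extension_subring[OF Ms y])
  have Eev: "?E = (\<lambda>p. eval p y) ` carrier ?P"
    by (rule simple_extension_as_eval_img[OF subringE(1)[OF Ms] y])
  fix d c assume d: "d \<in> fracs ?E" and c: "c \<in> ?E - {\<zero>}" and all: "\<forall>n::nat. c \<otimes> d [^] n \<in> ?E"
  obtain b where b: "b \<in> ?E" "b \<noteq> \<zero>" "b \<otimes> d \<in> ?E" by (rule fracsE[OF subringE(1)[OF E] d])
  have dc: "d \<in> carrier R" using d fracs_carrier[OF subringE(1)[OF E]] by auto
  have cc: "c \<in> carrier R" using c subringE(1)[OF E] by auto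
  obtain f g cp where f: "f \<in> carrier ?P" "b \<otimes> d = eval f y" and g: "g \<in> carrier ?P" "b = eval g y"
    and cp: "cp \<in> carrier ?P" "c = eval cp y"
    using b c unfolding Eev by auto
  have g0: "g \<noteq> []" "cp \<noteq> []" using g b cp c by auto
  obtain q r where qr: "q \<in> carrier ?P" "r \<in> carrier ?P" "f = (g \<otimes>\<^bsub>?P\<^esub> q) \<oplus>\<^bsub>?P\<^esub> r"
      "r = [] \<or> degree r < degree g"
    using field_long_division_theorem_shell[OF M f(1) g(1)] g0 by (auto simp: univ_poly_zero)
  have qE: "eval q y \<in> ?E" unfolding Eev using qr by auto
  have evc: "eval q y \<in> carrier R" "eval r y \<in> carrier R" "eval g y \<in> carrier R"
    using qr g by (auto intro: ev.hom_closed)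
  have ffd: "eval g y \<otimes> d = eval g y \<otimes> eval q y \<oplus> eval r y"
    using f g qr by simp
  have "eval g y \<otimes> (d \<ominus> eval q y) = eval g y \<otimes> d \<ominus> eval g y \<otimes> eval q y"
    using evc dc by algebra
  also have "\<dots> = eval r y" unfolding ffd using evc by algebra
  finally have rd: "eval r y = eval g y \<otimes> (d \<ominus> eval q y)" by simp
  have "r = []"
  proof (rule ccontr)
    assume r0: "r \<noteq> []"
    \<comment> \<open>In \<open>c * r^n = h * g^n\<close> the degree of \<open>r\<close> is smaller
      than that of \<open>g\<close> by at least one, which forces \<open>n\<close> to be at most the
      degree of \<open>cp\<close>; hence one more is taken.\<close>
    define n where "n = degree cp + 1"
    have "c \<otimes> (d \<ominus> eval q y) [^] n \<in> ?E"
      using pow_diff_denominator[OF E dc cc qE] all by blast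
    then obtain h where h: "h \<in> carrier ?P" "c \<otimes> (d \<ominus> eval q y) [^] n = eval h y" unfolding Eev by auto
    define e where "e = d \<ominus> eval q y"
    have ec: "e \<in> carrier R" using dc evc by (simp add: e_def)
    have "eval (cp \<otimes>\<^bsub>?P\<^esub> r [^]\<^bsub>?P\<^esub> n) y = c \<otimes> (eval g y \<otimes> e) [^] n"
      using eval_mult_pow[OF Ms y cp(1) qr(2)] cp rd unfolding e_def by simp
    also have "\<dots> = eval h y \<otimes> eval g y [^] n"
    proof -
      have "c \<otimes> (eval g y [^] n \<otimes> e [^] n) = (c \<otimes> e [^] n) \<otimes> eval g y [^] n"
        using cc ec evc nat_pow_closed by algebra
      then show ?thesis
        using h(2) ec evc unfolding e_def[symmetric] by (simp add: nat_pow_distrib)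
    qed
    also have "\<dots> = eval (h \<otimes>\<^bsub>?P\<^esub> g [^]\<^bsub>?P\<^esub> n) y"
      using eval_mult_pow[OF Ms y h(1) g(1)] by simp
    finally have eq: "cp \<otimes>\<^bsub>?P\<^esub> r [^]\<^bsub>?P\<^esub> n = h \<otimes>\<^bsub>?P\<^esub> g [^]\<^bsub>?P\<^esub> n"
      using eval_inj[OF Ms t] cp qr h g by auto
    note rp = univ_poly_pow[OF Ms qr(2) r0, of n] and gp = univ_poly_pow[OF Ms g(1) g0(1), of n]
    have pol: "polynomial M cp" "polynomial M (r [^]\<^bsub>?P\<^esub> n)" "polynomial M h" "polynomial M (g [^]\<^bsub>?P\<^esub> n)"
      using cp rp h gp by (auto simp: univ_poly_carrier)
    have "cp \<otimes>\<^bsub>?P\<^esub> r [^]\<^bsub>?P\<^esub> n \<noteq> []"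
      using poly_mult_integral[OF Ms pol(1,2)] g0 rp by (auto simp: univ_poly_mult)
    then have h0: "h \<noteq> []" using eq by (auto simp: univ_poly_mult)
    have "degree cp + n * degree r = degree h + n * degree g"
      using arg_cong[OF eq, of degree] poly_mult_degree_eq[OF Ms pol(1,2)] poly_mult_degree_eq[OF Ms pol(3,4)]
        g0 h0 rp gp by (simp add: univ_poly_mult)
    moreover have "n * (degree r + 1) \<le> n * degree g" using qr(4) r0 by (intro mult_le_mono2) auto
    ultimately show False unfolding n_def by (simp add: algebra_simps)
  qed
  then have "eval g y \<otimes> (d \<ominus> eval q y) = \<zero>" using rd by simp
  then have "d \<ominus> eval q y = \<zero>" using integral[of "eval g y" "d \<ominus> eval q y"] evc dc b g by blast
  then have "d = eval q y" using dc evc by simp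
  then show "d \<in> ?E" using qE by simp
qed

text \<open>Over the fraction field of \<open>C\<close> the previous lemma already makes
  \<open>d\<close> a polynomial in \<open>y\<close>. The powers of its leading coefficient
  \<open>a\<close> have the leading coefficient of \<open>cp\<close> as a common denominator, so
  \<open>a\<close> lies in \<open>C\<close>; subtracting the leading term keeps \<open>c\<close> a
  common denominator of all powers, and the argument repeats.\<close>

lemma comp_int_closed_simple_extension:
  assumes C: "subring C R" "comp_int_closed C" and y: "y \<in> carrier R" and t: "(transcendental over C) y"
  shows "comp_int_closed (simple_extension C y)"
proof -
  let ?M = "fracs C" and ?D = "simple_extension C y" and ?P = "(fracs C)[X]"
  have M: "subfield ?M R" by (rule fracs_subfield[OF C(1)])
  note Ms = subfieldE(1)[OF M]
  have tM: "(transcendental over ?M) y" by (rule transcendental_fracs[OF C(1) y t])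
  have D: "subring ?D R" by (rule simple_extension_subring[OF C(1) y])
  have Dev: "?D = (\<lambda>p. eval p y) ` carrier (C[X])"
    by (rule simple_extension_as_eval_img[OF subringE(1)[OF C(1)] y])
  have E: "subring (simple_extension ?M y) R" by (rule simple_extension_subring[OF Ms y])
  have Eev: "simple_extension ?M y = (\<lambda>p. eval p y) ` carrier ?P"
    by (rule simple_extension_as_eval_img[OF subringE(1)[OF Ms] y])
  have DE: "?D \<subseteq> simple_extension ?M y" by (rule mono_simple_extension[OF fracs_incl[OF C(1)]])
  have CP: "carrier (C[X]) \<subseteq> carrier ?P"
    using fracs_incl[OF C(1)] by (auto simp: univ_poly_carrier[symmetric] polynomial_def subset_iff)
  interpret UP: domain ?P by (rule univ_poly_is_domain[OF Ms])
  have main: "eval p y \<in> ?D"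
    if "p \<in> carrier ?P" "c \<in> ?D - {\<zero>}" "\<And>n::nat. c \<otimes> eval p y [^] n \<in> ?D" for p c
    using that
  proof (induction "length p" arbitrary: p rule: less_induct)
    case less
    show ?case
    proof (cases p)
      case Nil
      then show ?thesis using subringE(2)[OF D] by simp
    next
      case (Cons a q)
      have p0: "p \<noteq> []" "lead_coeff p = a" using Cons by auto
      have aM: "a \<in> ?M" "set q \<subseteq> ?M" "a \<noteq> \<zero>"
        using less.prems(1) Cons by (auto simp: univ_poly_carrier[symmetric] polynomial_def)
      have qc: "set q \<subseteq> carrier R" "a \<in> carrier R" using aM subringE(1)[OF Ms] by auto
      obtain cp where cp: "cp \<in> carrier (C[X])" "c = eval cp y" using less.prems(2) unfolding Dev by auto
      have cp0: "cp \<noteq> []" using cp less.prems(2) by auto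
      have hdC: "lead_coeff cp \<in> C" "lead_coeff cp \<noteq> \<zero>"
        using cp cp0 by (auto simp: univ_poly_carrier[symmetric] polynomial_def)
      have "lead_coeff cp \<otimes> a [^] n \<in> C" for n :: nat
      proof -
        obtain h where h: "h \<in> carrier (C[X])" "c \<otimes> eval p y [^] n = eval h y"
          using less.prems(3)[of n] unfolding Dev by auto
        note pp = univ_poly_pow[OF Ms less.prems(1) p0(1), of n]
        have "eval (cp \<otimes>\<^bsub>?P\<^esub> p [^]\<^bsub>?P\<^esub> n) y = eval h y"
          using eval_mult_pow[OF Ms y _ less.prems(1)] cp h CP by auto
        then have eq: "cp \<otimes>\<^bsub>?P\<^esub> p [^]\<^bsub>?P\<^esub> n = h"
          using eval_inj[OF Ms tM, of "cp \<otimes>\<^bsub>?P\<^esub> p [^]\<^bsub>?P\<^esub> n" h] cp(1) h(1) CP pp(1) UP.m_closed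
          by blast
        have pol: "polynomial ?M cp" "polynomial ?M (p [^]\<^bsub>?P\<^esub> n)"
          using cp CP pp by (auto simp: univ_poly_carrier)
        have "h \<noteq> []" using poly_mult_integral[OF Ms pol] cp0 pp eq by (auto simp: univ_poly_mult)
        then have "lead_coeff h \<in> C" using h by (auto simp: univ_poly_carrier[symmetric] polynomial_def)
        moreover have "lead_coeff h = lead_coeff cp \<otimes> a [^] n"
          using poly_mult_lead_coeff[OF Ms pol cp0 pp(2)] eq pp(4) p0 by (simp add: univ_poly_mult)
        ultimately show ?thesis by simp
      qed
      then have aC: "a \<in> C" using C(2) aM hdC unfolding comp_int_closed_def by auto
      define m where "m = a \<otimes> y [^] length q"
      have aD: "a \<in> ?D" "y \<in> ?D"
        using aC simple_extension_incl[OF subringE(1)[OF C(1)] y] simple_extension_mem[OF C(1) y] by auto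
      have mD: "m \<in> ?D" unfolding m_def
        using aD subringE(6)[OF D] nat_pow_in_subring[OF D] by auto
      have ec: "eval q y \<in> carrier R" "m \<in> carrier R" using eval_in_carrier[OF qc(1) y] mD subringE(1)[OF D] by auto
      have evp: "eval p y = m \<oplus> eval q y" using Cons by (simp add: m_def)
      have "eval p y \<ominus> m = eval q y" unfolding evp using ec by algebra
      then have evq: "eval (normalize q) y = eval p y \<ominus> m" using eval_normalize[OF qc(1) y] by simp
      have "eval (normalize q) y \<in> ?D"
      proof (rule less.hyps)
        show "length (normalize q) < length p" using normalize_length_le[of q] Cons by auto
        show "normalize q \<in> carrier ?P"
          using normalize_gives_polynomial[OF aM(2)] by (simp add: univ_poly_carrier)
        show "c \<in> ?D - {\<zero>}" by (rule less.prems)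
        show "c \<otimes> eval (normalize q) y [^] n \<in> ?D" for n :: nat
          unfolding evq using less.prems ec mD subringE(1)[OF D]
          by (intro pow_diff_denominator[OF D]) (auto simp: evp)
      qed
      then show ?thesis using evq mD ec evp eval_normalize[OF qc(1) y] subringE(7)[OF D] by simp
    qed
  qed
  show ?thesis unfolding comp_int_closed_def
  proof (intro ballI impI)
    fix d c assume d: "d \<in> fracs ?D" and c: "c \<in> ?D - {\<zero>}" and all: "\<forall>n::nat. c \<otimes> d [^] n \<in> ?D"
    have "d \<in> fracs (simple_extension ?M y)" using d DE unfolding fracs_def by blast
    moreover have "\<forall>n::nat. c \<otimes> d [^] n \<in> simple_extension ?M y" using all DE by auto
    ultimately have "d \<in> simple_extension ?M y"
      using comp_int_closed_simple_extension_subfield[OF M y tM] c DE unfolding comp_int_closed_def by blast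
    then obtain p where "p \<in> carrier ?P" "d = eval p y" unfolding Eev by auto
    then show "d \<in> ?D" using main[of p c] c all by auto
  qed
qed

end

section \<open>Coefficients of minimal relations\<close>

primrec (in ring) prods :: "'a set \<Rightarrow> nat \<Rightarrow> 'a set" where
  "prods H 0 = {\<one>}"
| "prods H (Suc n) = {x \<otimes> y | x y. x \<in> H \<and> y \<in> prods H n}"

text \<open>Coefficients of the product of the power series \<open>a\<close> and the polynomial with coefficients
  \<open>b 0, \<dots>, b l\<close>.\<close>

primrec (in ring) conv :: "(nat \<Rightarrow> 'a) \<Rightarrow> nat \<Rightarrow> (nat \<Rightarrow> 'a) \<Rightarrow> nat \<Rightarrow> 'a" where
  "conv a 0 b t = a t \<otimes> b 0"
| "conv a (Suc l) b t = a t \<otimes> b 0 \<oplus> (case t of 0 \<Rightarrow> \<zero> | Suc s \<Rightarrow> conv a l (\<lambda>j. b (Suc j)) s)"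

context cring
begin

lemma prods_carrier: "H \<subseteq> carrier R \<Longrightarrow> prods H n \<subseteq> carrier R"
  by (induction n) auto

lemma conv_closed:
  "range a \<subseteq> carrier R \<Longrightarrow> (\<And>j. j \<le> l \<Longrightarrow> b j \<in> carrier R) \<Longrightarrow> conv a l b t \<in> carrier R"
proof (induction l arbitrary: b t)
  case (Suc l)
  have "a i \<in> carrier R" for i using Suc.prems(1) by auto
  then show ?case using Suc.IH[of "\<lambda>j. b (Suc j)"] Suc.prems by (auto split: nat.split)
qed auto

lemma conv_in:
  assumes "range a \<subseteq> carrier R" "y \<in> carrier R" "\<zero> \<in> M" "\<And>x z. x \<in> M \<Longrightarrow> z \<in> M \<Longrightarrow> x \<oplus> z \<in> M"
    and "\<And>j. j \<le> l \<Longrightarrow> b j \<in> carrier R"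
    and "\<And>i j. i \<le> t \<Longrightarrow> j \<le> l \<Longrightarrow> y \<otimes> (a i \<otimes> b j) \<in> M"
  shows "y \<otimes> conv a l b t \<in> M"
  using assms(5,6)
proof (induction l arbitrary: b t)
  case 0
  then show ?case by auto
next
  case (Suc l)
  show ?case
  proof (cases t)
    case 0
    moreover have "a 0 \<in> carrier R" using assms(1) by auto
    ultimately show ?thesis using Suc.prems(1)[of 0] Suc.prems(2)[of 0 0] assms(2) by simp
  next
    case (Suc s)
    have c: "conv a l (\<lambda>j. b (Suc j)) s \<in> carrier R" using assms(1) Suc.prems by (intro conv_closed) auto
    have "y \<otimes> conv a l (\<lambda>j. b (Suc j)) s \<in> M"
      using Suc.prems Suc by (intro Suc.IH) auto
    then have "y \<otimes> (a t \<otimes> b 0) \<oplus> y \<otimes> conv a l (\<lambda>j. b (Suc j)) s \<in> M"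
      using Suc.prems(2)[of t 0] assms(4) by auto
    moreover have "a t \<otimes> b 0 \<in> carrier R" using assms(1) Suc.prems(1)[of 0] by auto
    ultimately show ?thesis using c assms(2) Suc by (simp add: r_distr)
  qed
qed

text \<open>Induction on the degree \<open>l\<close> of the polynomial \<open>b\<close>: its
  constant coefficient is dropped and the remaining ones are shifted. This is the Dedekind-Mertens
  formula: the content of \<open>a\<close> to the power \<open>l + 1\<close> times the content of
  \<open>b\<close> is contained in the content of \<open>a\<close> to the power \<open>l\<close>
  times the content of the product, for which \<open>W\<close> stands.\<close>

lemma dedekind_mertens:
  assumes B: "subring B R" and a: "range a \<subseteq> carrier R"
  shows "\<lbrakk>\<And>j. j \<le> l \<Longrightarrow> b j \<in> carrier R; W \<subseteq> carrier R; \<And>t. conv a l b t \<in> lspan B W;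
    x \<in> prods (range a) (Suc l); j \<le> l\<rbrakk> \<Longrightarrow>
    x \<otimes> b j \<in> lspan B {y \<otimes> w | y w. y \<in> prods (range a) l \<and> w \<in> W}"
proof (induction l arbitrary: b W x j)
  case 0
  have ac: "a i \<in> carrier R" for i using a by auto
  have "{y \<otimes> w | y w. y \<in> prods (range a) 0 \<and> w \<in> W} = W" using 0 by (force simp: subset_iff)
  moreover obtain i where "x = a i" using 0(4) ac by auto
  ultimately show ?case using 0(3)[of i] 0(5) by simp
next
  case (Suc l)
  have Bc: "B \<subseteq> carrier R" by (rule subringE(1)[OF B])
  have ac: "a i \<in> carrier R" for i using a by auto
  define b' where "b' j = b (Suc j)" for j
  define U where "U n V = {y \<otimes> w | y w. y \<in> prods (range a) n \<and> w \<in> V}" for n V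
  \<comment> \<open>The coefficients of the shifted product differ from the old ones by
    \<open>b 0\<close> times coefficients of \<open>a\<close>, and these differences join the
    generators.\<close>
  define W' where "W' = W \<union> (\<lambda>h. b 0 \<otimes> h) ` range a"
  define N where "N = lspan B (U (Suc l) W)"
  have pc: "y \<in> carrier R" if "y \<in> prods (range a) n" for y n using prods_carrier[OF a] that by auto
  have bc: "b 0 \<in> carrier R" "\<And>j. j \<le> l \<Longrightarrow> b' j \<in> carrier R" using Suc.prems(1) by (auto simp: b'_def)
  have Wc: "W \<subseteq> carrier R" "W' \<subseteq> carrier R" using Suc.prems bc ac by (auto simp: W'_def)
  have Uc: "U n V \<subseteq> carrier R" if "V \<subseteq> carrier R" for n V using pc that by (auto simp: U_def)
  have g: "conv a l b' s \<in> lspan B W'" for s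
  proof -
    have c: "conv a l b' s \<in> carrier R" "a (Suc s) \<in> carrier R" using a bc ac by (auto intro: conv_closed)
    have "conv a (Suc l) b (Suc s) = a (Suc s) \<otimes> b 0 \<oplus> conv a l b' s" by (simp add: b'_def[abs_def])
    then have "conv a l b' s = conv a (Suc l) b (Suc s) \<ominus> b 0 \<otimes> a (Suc s)" using c bc by algebra
    moreover have "conv a (Suc l) b (Suc s) \<in> lspan B W'"
      using Suc.prems(3)[of "Suc s"] lspan_mono[of B B W W'] by (auto simp: W'_def)
    moreover have "b 0 \<otimes> a (Suc s) \<in> lspan B W'" using lspan_incl[OF B Wc(2)] by (auto simp: W'_def)
    ultimately show ?thesis using lspan_minus_closed[OF B Wc(2)] by simp
  qed
  have IH: "y \<otimes> b' j \<in> lspan B (U l W')" if "y \<in> prods (range a) (Suc l)" "j \<le> l" for y j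
    using Suc.IH[of b' W', OF bc(2) Wc(2) g that] unfolding U_def .
  \<comment> \<open>A generator \<open>b 0 \<otimes> a m\<close> from the induction hypothesis is
    harmless once \<open>H\<close> is known: exchanging \<open>a i\<close> and \<open>a m\<close>
    turns the term into a product of \<open>l + 1\<close> coefficients times
    \<open>a i \<otimes> b 0\<close>.\<close>
  have F1: "a i \<otimes> (y \<otimes> b' j) \<in> N"
    if y: "y \<in> prods (range a) (Suc l)" "j \<le> l" and H: "\<And>y'. y' \<in> prods (range a) (Suc l) \<Longrightarrow> y' \<otimes> (a i \<otimes> b 0) \<in> N"
    for i y j
    unfolding N_def
  proof (rule lspan_scale[OF Bc Uc[OF Wc(2)] Uc[OF Wc(1)] ac _ IH[OF y]])
    fix \<beta> z assume \<beta>: "\<beta> \<in> B" and "z \<in> U l W'"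
    then obtain y' w where z: "z = y' \<otimes> w" "y' \<in> prods (range a) l" "w \<in> W'" unfolding U_def by auto
    have c: "\<beta> \<in> carrier R" "y' \<in> carrier R" "w \<in> carrier R" using \<beta> Bc pc z Wc by auto
    show "a i \<otimes> (\<beta> \<otimes> z) \<in> lspan B (U (Suc l) W)"
    proof (cases "w \<in> W")
      case True
      have "a i \<otimes> y' \<in> prods (range a) (Suc l)" using z(2) by auto
      then have "(a i \<otimes> y') \<otimes> w \<in> U (Suc l) W" using True unfolding U_def by blast
      moreover have "a i \<otimes> (\<beta> \<otimes> z) = \<beta> \<otimes> ((a i \<otimes> y') \<otimes> w)" unfolding z using c ac by algebra
      ultimately show ?thesis
        using lspan_smult_closed[OF B Uc[OF Wc(1)] \<beta>] lspan_incl[OF B Uc[OF Wc(1)]] by simp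
    next
      case False
      then obtain m where m: "w = b 0 \<otimes> a m" using z unfolding W'_def by auto
      have "a m \<otimes> y' \<in> prods (range a) (Suc l)" using z(2) by auto
      then have "(a m \<otimes> y') \<otimes> (a i \<otimes> b 0) \<in> N" by (rule H)
      moreover have "a i \<otimes> (\<beta> \<otimes> z) = \<beta> \<otimes> ((a m \<otimes> y') \<otimes> (a i \<otimes> b 0))"
        unfolding z m using c ac[of i] ac[of m] bc by algebra
      ultimately show ?thesis
        using lspan_smult_closed[OF B Uc[OF Wc(1)] \<beta>] unfolding N_def by simp
    qed
  qed
  have yW: "y \<otimes> z \<in> N" if y: "y \<in> prods (range a) (Suc l)" and z: "z \<in> lspan B W" for y z
    unfolding N_def
  proof (rule lspan_scale[OF Bc Wc(1) Uc[OF Wc(1)] pc[OF y] _ z])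
    fix \<beta> w assume bw: "\<beta> \<in> B" "w \<in> W"
    then have "y \<otimes> (\<beta> \<otimes> w) = \<beta> \<otimes> (y \<otimes> w)" using pc[OF y] Bc Wc by (auto intro!: m_lcomm)
    moreover have "y \<otimes> w \<in> U (Suc l) W" using bw y unfolding U_def by blast
    ultimately show "y \<otimes> (\<beta> \<otimes> w) \<in> lspan B (U (Suc l) W)"
      using lspan_smult_closed[OF B Uc[OF Wc(1)] bw(1)] lspan_incl[OF B Uc[OF Wc(1)]] by simp
  qed
  \<comment> \<open>Strong induction on \<open>i\<close>: the term \<open>a i \<otimes> b 0\<close>
    is the coefficient of index \<open>i\<close> of the product, minus terms
    \<open>a i' \<otimes> b' j'\<close> with \<open>i' < i\<close>. To these \<open>F1\<close>
    applies, its premise \<open>H\<close> being the claim for \<open>i'\<close>.\<close>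
  have F2: "y \<otimes> (a i \<otimes> b 0) \<in> N" if "y \<in> prods (range a) (Suc l)" for i y
    using that
  proof (induction i arbitrary: y rule: less_induct)
    case (less i)
    have yc: "y \<in> carrier R" using pc less.prems by blast
    define r where "r = (case i of 0 \<Rightarrow> \<zero> | Suc s \<Rightarrow> conv a l b' s)"
    have rc: "r \<in> carrier R" using conv_closed[OF a bc(2)] by (auto simp: r_def split: nat.split)
    have "y \<otimes> r \<in> N"
    proof (cases i)
      case 0
      then show ?thesis using yc by (simp add: r_def N_def lspan.zero)
    next
      case (Suc s)
      have "y \<otimes> conv a l b' s \<in> N"
      proof (rule conv_in[OF a yc _ _ bc(2)])
        show "\<zero> \<in> N" "\<And>x z. x \<in> N \<Longrightarrow> z \<in> N \<Longrightarrow> x \<oplus> z \<in> N"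
          unfolding N_def by (auto intro: lspan.zero lspan_add_closed[OF Bc Uc[OF Wc(1)]])
        fix i' j' assume ij: "i' \<le> s" "j' \<le> l"
        have "a i' \<otimes> (y \<otimes> b' j') \<in> N" using less.IH[of i'] ij Suc by (intro F1[OF less.prems]) auto
        moreover have "y \<otimes> (a i' \<otimes> b' j') = a i' \<otimes> (y \<otimes> b' j')"
          using yc ac bc(2)[OF ij(2)] by (intro m_lcomm) auto
        ultimately show "y \<otimes> (a i' \<otimes> b' j') \<in> N" by simp
      qed
      then show ?thesis using Suc by (simp add: r_def)
    qed
    moreover have "y \<otimes> conv a (Suc l) b i \<in> N" by (rule yW[OF less.prems Suc.prems(3)])
    moreover have "conv a (Suc l) b i = a i \<otimes> b 0 \<oplus> r" unfolding r_def b'_def[abs_def] by simp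
    moreover have "y \<otimes> (a i \<otimes> b 0) = y \<otimes> (a i \<otimes> b 0 \<oplus> r) \<ominus> y \<otimes> r" using yc ac[of i] bc(1) rc by algebra
    ultimately show ?case using lspan_minus_closed[OF B Uc[OF Wc(1)]] unfolding N_def by simp
  qed
  obtain i y where x: "x = a i \<otimes> y" "y \<in> prods (range a) (Suc l)"
    using Suc.prems(4) unfolding prods.simps(2)[of "range a" "Suc l"] by blast
  have yc: "y \<in> carrier R" using pc x by blast
  have "x \<otimes> b j \<in> N"
  proof (cases j)
    case 0
    have "x \<otimes> b 0 = y \<otimes> (a i \<otimes> b 0)" unfolding x using yc ac[of i] bc(1) by algebra
    then show ?thesis using F2[OF x(2)] 0 by simp
  next
    case (Suc j')
    then have j': "j' \<le> l" using Suc.prems by simp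
    have "x \<otimes> b j = a i \<otimes> (y \<otimes> b' j')" unfolding x b'_def Suc[symmetric]
      using yc ac[of i] Suc.prems(1,5) by (intro m_assoc) auto
    then show ?thesis using F1[OF x(2) j' F2] by simp
  qed
  then show ?case unfolding N_def U_def .
qed

lemma conv_eq_finsum:
  assumes "range a \<subseteq> carrier R" "\<And>j. j \<le> l \<Longrightarrow> b j \<in> carrier R"
  shows "conv a l b t = (\<Oplus>j\<in>{..l}. if j \<le> t then a (t - j) \<otimes> b j else \<zero>)"
  using assms(2)
proof (induction l arbitrary: b t)
  case 0
  have "a t \<in> carrier R" using assms(1) by auto
  moreover have "{..0::nat} = insert 0 {}" by auto
  ultimately show ?case using 0[of 0] by (simp add: finsum_insert)
next
  case (Suc l)
  have ac: "a i \<in> carrier R" for i using assms(1) by auto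
  have "(\<Oplus>j\<in>{..Suc l}. if j \<le> t then a (t - j) \<otimes> b j else \<zero>) =
      (\<Oplus>j\<in>{..l}. if Suc j \<le> t then a (t - Suc j) \<otimes> b (Suc j) else \<zero>) \<oplus> a t \<otimes> b 0"
    using ac Suc.prems by (subst finsum_Suc2) auto
  also have "(\<Oplus>j\<in>{..l}. if Suc j \<le> t then a (t - Suc j) \<otimes> b (Suc j) else \<zero>) =
      (case t of 0 \<Rightarrow> \<zero> | Suc s \<Rightarrow> conv a l (\<lambda>j. b (Suc j)) s)"
  proof (cases t)
    case (Suc s)
    show ?thesis
      using Suc.IH[of "\<lambda>j. b (Suc j)" s] Suc.prems unfolding Suc diff_Suc_Suc Suc_le_mono by simp
  qed simp
  finally show ?case
    using ac[of t] Suc.prems[of 0] conv_closed[OF assms(1), of l "\<lambda>j. b (Suc j)"] Suc.prems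
    by (auto split: nat.split intro: a_comm)
qed

end

context field
begin

text \<open>This is a linear functional over \<open>L\<close> in disguise: its value is one at
  \<open>v\<close> and zero on \<open>Z\<close>, and its value at \<open>w\<close> is the scalar
  \<open>l\<close>. A vector of \<open>W\<close> is added to \<open>Z\<close>, and so gets the value
  zero, unless its value is already forced.\<close>

lemma lspan_hyperplane:
  assumes L: "subfield L R" and U: "U \<subseteq> carrier R" and v: "v \<in> carrier R" "v \<notin> lspan L U"
    and W: "finite W" "W \<subseteq> carrier R"
  shows "\<exists>Z. U \<subseteq> Z \<and> Z \<subseteq> carrier R \<and> v \<notin> lspan L Z \<and> (\<forall>w\<in>W. \<exists>l\<in>L. w \<ominus> l \<otimes> v \<in> lspan L Z)"
  using W
proof (induction W rule: finite_induct)
  case empty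
  then show ?case using U v by auto
next
  case (insert w W)
  note Ls = subfieldE(1)[OF L] and Lc = subfieldE(3)[OF L]
  obtain Z where Z: "U \<subseteq> Z" "Z \<subseteq> carrier R" "v \<notin> lspan L Z" "\<forall>w\<in>W. \<exists>l\<in>L. w \<ominus> l \<otimes> v \<in> lspan L Z"
    using insert by auto
  have wc: "w \<in> carrier R" using insert by auto
  show ?case
  proof (cases "\<exists>l\<in>L. w \<ominus> l \<otimes> v \<in> lspan L Z")
    case True
    then show ?thesis using Z by auto
  next
    case False
    have dec: "\<exists>l\<in>L. \<exists>z\<in>lspan L Z. x = l \<otimes> w \<oplus> z" if "x \<in> lspan L (insert w Z)" for x
      using that
    proof induction
      case zero
      have "\<zero> = \<zero> \<otimes> w \<oplus> \<zero>" using wc by simp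
      then show ?case using subringE(2)[OF Ls] lspan.zero by blast
    next
      case (add b y x)
      then obtain l z where lz: "l \<in> L" "z \<in> lspan L Z" "x = l \<otimes> w \<oplus> z" by auto
      have c: "b \<in> carrier R" "l \<in> carrier R" "z \<in> carrier R" "y \<in> carrier R"
        using add lz Lc lspan_carrier[OF Lc Z(2)] wc Z by auto
      show ?case
      proof (cases "y = w")
        case True
        have "b \<otimes> y \<oplus> x = (b \<oplus> l) \<otimes> w \<oplus> z" unfolding lz True using c wc by algebra
        then show ?thesis using lz add subringE(7)[OF Ls] by blast
      next
        case False
        have "b \<otimes> y \<oplus> x = l \<otimes> w \<oplus> (b \<otimes> y \<oplus> z)" unfolding lz using c wc by algebra
        moreover have "b \<otimes> y \<oplus> z \<in> lspan L Z" using False add lz by (auto intro: lspan.add)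
        ultimately show ?thesis using lz by blast
      qed
    qed
    have "v \<notin> lspan L (insert w Z)"
    proof
      assume "v \<in> lspan L (insert w Z)"
      then obtain l z where lz: "l \<in> L" "z \<in> lspan L Z" "v = l \<otimes> w \<oplus> z" using dec by blast
      have c: "l \<in> carrier R" "z \<in> carrier R" using lz Lc lspan_carrier[OF Lc Z(2)] by auto
      have l0: "l \<noteq> \<zero>" using lz Z(3) wc c by auto
      have il: "inv l \<in> L" "inv l \<otimes> l = \<one>" using subfield_m_inv[OF L, of l] lz l0 by auto
      have ic: "inv l \<in> carrier R" using il Lc by auto
      have "w \<ominus> inv l \<otimes> v = (\<one> \<ominus> inv l \<otimes> l) \<otimes> w \<ominus> inv l \<otimes> z"
        unfolding lz(3) using c ic wc by algebra
      also have "\<dots> = \<ominus> (inv l \<otimes> z)" unfolding il(2) using c ic wc by algebra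
      finally have "w \<ominus> inv l \<otimes> v \<in> lspan L Z"
        using lspan_uminus_closed[OF Ls Z(2) lspan_smult_closed[OF Ls Z(2) il(1) lz(2)]] by simp
      then show False using False il by blast
    qed
    moreover have "w \<ominus> \<zero> \<otimes> v \<in> lspan L (insert w Z)"
    proof -
      have "w \<ominus> \<zero> \<otimes> v = w" using wc v by algebra
      then show ?thesis using lspan_incl[OF Ls, of "insert w Z"] wc Z by auto
    qed
    moreover have "lspan L Z \<subseteq> lspan L (insert w Z)" by (rule lspan_mono) auto
    ultimately show ?thesis
      using Z wc subringE(2)[OF Ls] by (intro exI[of _ "insert w Z"]) blast
  qed
qed

text \<open>The leading coordinates of the powers of \<open>u\<close> are the coefficients of the inverse power series
  of the reversed minimal polynomial, and they have a common denominator.\<close>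

lemma minimal_relation_coeffs:
  assumes B: "subring B R" "comp_int_closed B" and W: "finite W" "W \<subseteq> carrier R"
    and u: "u \<in> carrier R" "\<And>n::nat. u [^] n \<in> lspan B W"
    and k: "0 < (k::nat)" "u [^] (k - 1) \<notin> lspan (fracs B) ((\<lambda>i. u [^] i) ` {..<k - 1})"
    and b: "\<And>j. j \<le> k \<Longrightarrow> b j \<in> fracs B" "b 0 = \<one>"
    and rel: "(\<Oplus>j\<in>{..k}. b j \<otimes> u [^] (k - j)) = \<zero>"
    and j: "j \<le> k"
  shows "b j \<in> B"
proof -
  define L where "L = fracs B"
  have L: "subfield L R" unfolding L_def by (rule fracs_subfield[OF B(1)])
  note Ls = subfieldE(1)[OF L] and Lc = subfieldE(3)[OF L]
  note cl = subringE(2,3,5,6,7)[OF B(1)] and Bc = subringE(1)[OF B(1)]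
  have BL: "B \<subseteq> L" unfolding L_def by (rule fracs_incl[OF B(1)])
  have bc: "b j \<in> carrier R" if "j \<le> k" for j using b(1)[OF that] Lc unfolding L_def by auto
  have up: "u [^] n \<in> carrier R" for n :: nat using u(1) by simp
  \<comment> \<open>The functional to be built reads off the coordinate along the highest power
    below \<open>k\<close> and kills all lower powers.\<close>
  define v where "v = u [^] (k - 1)"
  have vc: "v \<in> carrier R" unfolding v_def by (rule up)
  obtain Z where Z: "(\<lambda>i. u [^] i) ` {..<k - 1} \<subseteq> Z" "Z \<subseteq> carrier R" "v \<notin> lspan L Z"
      "\<forall>w\<in>W. \<exists>l\<in>L. w \<ominus> l \<otimes> v \<in> lspan L Z"
    using lspan_hyperplane[OF L _ vc _ W, of "(\<lambda>i. u [^] i) ` {..<k - 1}"] k(2) up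
    unfolding v_def[symmetric] L_def[symmetric] by (metis imageE subsetI)
  have inZ: "l = \<zero>" if "l \<in> L" "l \<otimes> v \<in> lspan L Z" for l
  proof (rule ccontr)
    assume "l \<noteq> \<zero>"
    then have il: "inv l \<in> L" "inv l \<otimes> l = \<one>" using subfield_m_inv[OF L, of l] that by auto
    have "inv l \<otimes> (l \<otimes> v) \<in> lspan L Z" by (rule lspan_smult_closed[OF Ls Z(2) il(1) that(2)])
    moreover have "inv l \<otimes> (l \<otimes> v) = v" using il that(1) Lc vc by (simp add: m_assoc[symmetric] subsetD)
    ultimately show False using Z(3) by simp
  qed
  obtain lw where lw: "\<And>w. w \<in> W \<Longrightarrow> lw w \<in> L" "\<And>w. w \<in> W \<Longrightarrow> w \<ominus> lw w \<otimes> v \<in> lspan L Z"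
    using Z(4) by metis
  obtain c where c: "c \<in> B" "c \<noteq> \<zero>" "\<And>w. w \<in> W \<Longrightarrow> c \<otimes> lw w \<in> B"
  proof -
    have "finite (lw ` W)" "lw ` W \<subseteq> fracs B" using W lw(1) unfolding L_def by auto
    from common_denominator[OF B(1) this] show ?thesis using that by auto
  qed
  have cc: "c \<in> carrier R" using c Bc by auto
  have "\<exists>s\<in>L. c \<otimes> s \<in> B \<and> x \<ominus> s \<otimes> v \<in> lspan L Z" if "x \<in> lspan B W" for x
    using that
  proof induction
    case zero
    have "\<zero> \<ominus> \<zero> \<otimes> v = \<zero>" using vc by algebra
    then show ?case using subringE(2)[OF Ls] cl cc lspan.zero by (intro bexI[of _ \<zero>]) auto
  next
    case (add \<beta> w x)
    then obtain s where s: "s \<in> L" "c \<otimes> s \<in> B" "x \<ominus> s \<otimes> v \<in> lspan L Z" by auto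
    have cs: "\<beta> \<in> carrier R" "w \<in> carrier R" "x \<in> carrier R" "s \<in> carrier R" "lw w \<in> carrier R"
      using add s lw(1) Lc Bc W(2) lspan_carrier[OF Bc W(2)] by auto
    have "\<beta> \<otimes> lw w \<oplus> s \<in> L"
      using add s lw(1) BL subringE(6,7)[OF Ls] by auto
    moreover have "c \<otimes> (\<beta> \<otimes> lw w \<oplus> s) = \<beta> \<otimes> (c \<otimes> lw w) \<oplus> c \<otimes> s" using cs cc by algebra
    then have "c \<otimes> (\<beta> \<otimes> lw w \<oplus> s) \<in> B" using c(3) s(2) cl add by auto
    moreover have "\<beta> \<otimes> w \<oplus> x \<ominus> (\<beta> \<otimes> lw w \<oplus> s) \<otimes> v = \<beta> \<otimes> (w \<ominus> lw w \<otimes> v) \<oplus> (x \<ominus> s \<otimes> v)"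
      using cs vc by algebra
    then have "\<beta> \<otimes> w \<oplus> x \<ominus> (\<beta> \<otimes> lw w \<oplus> s) \<otimes> v \<in> lspan L Z"
      using lspan_add_closed[OF Lc Z(2) lspan_smult_closed[OF Ls Z(2) _ lw(2)] s(3)] add BL by auto
    ultimately show ?case by blast
  qed
  then have "\<exists>s\<in>L. c \<otimes> s \<in> B \<and> u [^] n \<ominus> s \<otimes> v \<in> lspan L Z" for n :: nat using u(2) by blast
  \<comment> \<open>\<open>s n\<close> is the value of the functional at \<open>u [^] n\<close>. One
    \<open>c\<close> clears the denominators of all these values, since all powers lie in the
    \<open>B\<close>-span of the finite set \<open>W\<close>.\<close>
  then obtain s where s: "\<And>n::nat. s n \<in> L" "\<And>n. c \<otimes> s n \<in> B" "\<And>n. u [^] n \<ominus> s n \<otimes> v \<in> lspan L Z"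
    by metis
  have sc: "s n \<in> carrier R" for n using s(1) Lc by auto
  have s0: "s i = \<zero>" if "i < k - 1" for i
  proof (rule inZ[OF s(1)])
    have "u [^] i \<in> lspan L Z" using that Z by (intro lspan_incl[OF Ls]) auto
    moreover have "s i \<otimes> v = u [^] i \<ominus> (u [^] i \<ominus> s i \<otimes> v)" using up[of i] vc sc[of i] by algebra
    ultimately show "s i \<otimes> v \<in> lspan L Z" using lspan_minus_closed[OF Ls Z(2) _ s(3)] by metis
  qed
  have s1: "s (k - 1) = \<one>"
  proof -
    have "(\<one> \<ominus> s (k - 1)) \<otimes> v = u [^] (k - 1) \<ominus> s (k - 1) \<otimes> v"
      unfolding v_def[symmetric] using vc sc[of "k - 1"] by algebra
    then have "\<one> \<ominus> s (k - 1) = \<zero>"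
      using s(3)[of "k - 1"] s(1) subringE(3,5,7)[OF Ls] by (intro inZ) (auto simp: a_minus_def)
    then show ?thesis using sc by simp
  qed
  \<comment> \<open>The functional is applied to \<open>u [^] n\<close> times the relation, which
    turns the relation into a linear recurrence for \<open>s\<close>.\<close>
  have rec: "(\<Oplus>j\<in>{..k}. b j \<otimes> s (n + k - j)) = \<zero>" for n
  proof -
    define S where "S = (\<Oplus>j\<in>{..k}. b j \<otimes> s (n + k - j))"
    have SL: "S \<in> L" unfolding S_def
      using b(1) s(1) subringE(6)[OF Ls] by (intro finsum_in_subring[OF Ls]) (auto simp: L_def)
    have Sc: "S \<in> carrier R" using SL Lc by auto
    have "(\<Oplus>j\<in>{..k}. b j \<otimes> (u [^] (n + k - j) \<ominus> s (n + k - j) \<otimes> v)) \<in> lspan L Z"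
    proof (rule lspan_sum_closed[OF Ls Z(2)])
      show "(\<lambda>j. b j \<otimes> (u [^] (n + k - j) \<ominus> s (n + k - j) \<otimes> v)) \<in> {..k} \<rightarrow> lspan L Z"
        using b(1)[folded L_def] s(3) by (auto intro: lspan_smult_closed[OF Ls Z(2)])
    qed simp
    also have "(\<Oplus>j\<in>{..k}. b j \<otimes> (u [^] (n + k - j) \<ominus> s (n + k - j) \<otimes> v)) =
        (\<Oplus>j\<in>{..k}. u [^] n \<otimes> (b j \<otimes> u [^] (k - j)) \<oplus> (\<ominus> v) \<otimes> (b j \<otimes> s (n + k - j)))"
    proof (intro finsum_cong' refl)
      show "(\<lambda>j. u [^] n \<otimes> (b j \<otimes> u [^] (k - j)) \<oplus> (\<ominus> v) \<otimes> (b j \<otimes> s (n + k - j))) \<in> {..k} \<rightarrow> carrier R"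
        using bc up sc vc by auto
      fix j assume "j \<in> {..k}"
      then have "n + k - j = n + (k - j)" "b j \<in> carrier R" using bc by auto
      moreover have "u [^] (n + (k - j)) = u [^] n \<otimes> u [^] (k - j)" using u(1) by (simp add: nat_pow_mult)
      ultimately show "b j \<otimes> (u [^] (n + k - j) \<ominus> s (n + k - j) \<otimes> v) =
          u [^] n \<otimes> (b j \<otimes> u [^] (k - j)) \<oplus> (\<ominus> v) \<otimes> (b j \<otimes> s (n + k - j))"
        using up[of n] up[of "k - j"] vc sc[of "n + (k - j)"] by simp algebra
    qed
    also have "\<dots> = (\<Oplus>j\<in>{..k}. u [^] n \<otimes> (b j \<otimes> u [^] (k - j))) \<oplus>
        (\<Oplus>j\<in>{..k}. (\<ominus> v) \<otimes> (b j \<otimes> s (n + k - j)))"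
      using bc up sc vc by (intro finsum_addf) auto
    also have "(\<Oplus>j\<in>{..k}. u [^] n \<otimes> (b j \<otimes> u [^] (k - j))) = u [^] n \<otimes> (\<Oplus>j\<in>{..k}. b j \<otimes> u [^] (k - j))"
      using bc up by (intro finsum_rdistr[symmetric]) auto
    also have "(\<Oplus>j\<in>{..k}. (\<ominus> v) \<otimes> (b j \<otimes> s (n + k - j))) = (\<ominus> v) \<otimes> S"
      unfolding S_def using bc sc vc by (intro finsum_rdistr[symmetric]) auto
    also have "u [^] n \<otimes> (\<Oplus>j\<in>{..k}. b j \<otimes> u [^] (k - j)) \<oplus> (\<ominus> v) \<otimes> S = (\<ominus> S) \<otimes> v"
      unfolding rel using up[of n] Sc vc by algebra
    finally have "\<ominus> S = \<zero>" using SL subringE(5)[OF Ls] by (intro inZ) auto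
    then show ?thesis unfolding S_def[symmetric] using Sc by (metis minus_minus minus_zero)
  qed
  define a where "a t = s (t + k - 1)" for t
  have ac: "range a \<subseteq> carrier R" using sc by (auto simp: a_def)
  have a0: "a 0 = \<one>" using s1 by (simp add: a_def)
  \<comment> \<open>With the index shifted by \<open>k - 1\<close> the sequence starts with one, and
    the recurrence together with the leading zeros of \<open>s\<close> says that the series
    \<open>a\<close> times the polynomial with coefficients \<open>b\<close> is the constant one.
    Its content is thus generated by \<open>\<one>\<close>.\<close>
  have conv: "conv a k b t \<in> lspan B {\<one>}" for t
  proof (cases t)
    case 0
    have "conv a k b 0 = a 0 \<otimes> b 0" using k(1) bc[of 0] a0 by (cases k) auto
    then have "conv a k b 0 = \<one>" using a0 b(2) by simp
    then show ?thesis using lspan_incl[OF B(1), of "{\<one>}"] 0 by simp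
  next
    case (Suc n)
    have "conv a k b t = (\<Oplus>j\<in>{..k}. if j \<le> t then a (t - j) \<otimes> b j else \<zero>)"
      by (rule conv_eq_finsum[OF ac bc])
    also have "\<dots> = (\<Oplus>j\<in>{..k}. b j \<otimes> s (n + k - j))"
    proof (intro finsum_cong' refl)
      show "(\<lambda>j. b j \<otimes> s (n + k - j)) \<in> {..k} \<rightarrow> carrier R" using bc sc by auto
      fix j assume j: "j \<in> {..k}"
      show "(if j \<le> t then a (t - j) \<otimes> b j else \<zero>) = b j \<otimes> s (n + k - j)"
      proof (cases "j \<le> t")
        case True
        then have "t - j + k - 1 = n + k - j" using Suc k(1) j by auto
        then show ?thesis using True sc bc j by (auto simp: a_def m_comm)
      next
        case False
        then have "n + k - j < k - 1" using Suc k(1) j by auto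
        then show ?thesis using False s0 bc j by auto
      qed
    qed
    finally show ?thesis using rec lspan.zero by simp
  qed
  \<comment> \<open>The span of \<open>S\<close> will be stable under \<open>b j\<close>: the
    content formula leads from products of \<open>k + 1\<close> coefficients to products of
    \<open>k\<close>, and the factor \<open>a 0 = \<one>\<close> fills these up again to
    \<open>k + 1\<close>.\<close>
  define S where "S = prods (range a) (Suc k)"
  have Sc: "S \<subseteq> carrier R" unfolding S_def by (rule prods_carrier[OF ac])
  have one: "\<one> \<in> prods (range a) n" for n
  proof (induction n)
    case (Suc n)
    then have "a 0 \<otimes> \<one> \<in> prods (range a) (Suc n)" unfolding prods.simps by blast
    then show ?case using a0 by (simp del: prods.simps)
  qed simp
  have "prods (range a) k \<subseteq> S"
  proof
    fix y assume y: "y \<in> prods (range a) k"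
    then have "y \<in> carrier R" using prods_carrier[OF ac] by blast
    then have "y = a 0 \<otimes> y" using a0 by simp
    moreover have "a 0 \<otimes> y \<in> S" unfolding S_def using y unfolding prods.simps by blast
    ultimately show "y \<in> S" by simp
  qed
  then have "lspan B {y \<otimes> w | y w. y \<in> prods (range a) k \<and> w \<in> {\<one>}} \<subseteq> lspan B S"
    using prods_carrier[OF ac, of k] by (intro lspan_mono) (auto simp: subset_iff)
  then have xb: "x \<otimes> b j \<in> lspan B S" if "x \<in> S" for x
    using dedekind_mertens[OF B(1) ac bc _ conv _ j, of x] that unfolding S_def by auto
  have pow: "b j [^] n \<in> lspan B S" for n :: nat
  proof (induction n)
    case 0
    then show ?case using one[of "Suc k"] lspan_incl[OF B(1) Sc] unfolding S_def by simp
  next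
    case (Suc n)
    have "b j \<otimes> b j [^] n \<in> lspan B S"
    proof (rule lspan_scale[OF Bc Sc Sc bc[OF j] _ Suc])
      fix \<beta> x assume *: "\<beta> \<in> B" "x \<in> S"
      then have "b j \<otimes> (\<beta> \<otimes> x) = \<beta> \<otimes> (x \<otimes> b j)" using bc[OF j] Bc Sc by (simp add: subset_iff m_ac)
      then show "b j \<otimes> (\<beta> \<otimes> x) \<in> lspan B S" using lspan_smult_closed[OF B(1) Sc *(1) xb[OF *(2)]] by simp
    qed
    then show ?case using bc[OF j] by (simp add: m_comm)
  qed
  have cp: "c [^] n \<otimes> x \<in> B" if "x \<in> prods (range a) n" for n x
    using that
  proof (induction n arbitrary: x)
    case 0
    then show ?case using cl by simp
  next
    case (Suc n)
    then obtain i y where x: "x = a i \<otimes> y" "y \<in> prods (range a) n" by auto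
    have ccs: "c [^] n \<in> carrier R" "y \<in> carrier R" "a i \<in> carrier R"
      using cc x prods_carrier[OF ac] ac by auto
    have "c [^] Suc n \<otimes> x = (c \<otimes> a i) \<otimes> (c [^] n \<otimes> y)" unfolding x nat_pow_Suc using ccs cc by algebra
    then show ?case using Suc.IH[OF x(2)] s(2) cl by (auto simp: a_def)
  qed
  \<comment> \<open>Every element of \<open>S\<close> has \<open>k + 1\<close> factors, each with
    denominator \<open>c\<close>. As the powers of \<open>b j\<close> all lie in the span of
    \<open>S\<close>, one power of \<open>c\<close> serves for all of them.\<close>
  have "c [^] Suc k \<otimes> x \<in> B" if "x \<in> lspan B S" for x
    using that
  proof induction
    case zero
    then show ?case using cl cc by simp
  next
    case (add \<beta> y x)
    have ccs: "c [^] Suc k \<in> carrier R" "\<beta> \<in> carrier R" "y \<in> carrier R" "x \<in> carrier R"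
      using add cc Bc Sc lspan_carrier[OF Bc Sc] by auto
    have "c [^] Suc k \<otimes> (\<beta> \<otimes> y \<oplus> x) = \<beta> \<otimes> (c [^] Suc k \<otimes> y) \<oplus> c [^] Suc k \<otimes> x"
      using ccs by algebra
    then show ?case using add cp[of y "Suc k"] cl unfolding S_def by auto
  qed
  then have "\<forall>n::nat. c [^] Suc k \<otimes> b j [^] n \<in> B" using pow by blast
  moreover have "c [^] Suc k \<in> B - {\<zero>}"
    using nat_pow_in_subring[OF B(1) c(1)] nat_pow_nonzero[OF cc c(2)] by blast
  ultimately show ?thesis using B(2) b(1)[OF j] unfolding comp_int_closed_def by blast
qed

end

section \<open>Polynomial subrings and module-finite extensions\<close>

definition (in ring) pring :: "'a set \<Rightarrow> (nat \<Rightarrow> 'a) \<Rightarrow> nat \<Rightarrow> 'a set" where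
  "pring K z i = generate_ring R (K \<union> z ` {..<i})"

text \<open>The tower form, in which only univariate polynomials over the previous stage occur, fits
  inductions along the variables. The passage from the multivariate notion is a separate
  lemma.\<close>

definition (in ring) alg_indep :: "'a set \<Rightarrow> (nat \<Rightarrow> 'a) \<Rightarrow> nat \<Rightarrow> bool" where
  "alg_indep K z e \<longleftrightarrow> (\<forall>i<e. z i \<in> carrier R \<and> (transcendental over (pring K z i)) (z i))"

context cring
begin

lemma pring_subring:
  assumes "K \<subseteq> carrier R" "\<And>j. j < i \<Longrightarrow> z j \<in> carrier R"
  shows "subring (pring K z i) R"
  unfolding pring_def using assms by (intro generate_ring_is_subring) auto

lemma pring_base: "K \<subseteq> pring K z i"
  unfolding pring_def by (auto intro: generate_ring.incl)

lemma pring_gen: "j < i \<Longrightarrow> z j \<in> pring K z i"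
  unfolding pring_def by (auto intro: generate_ring.incl)

lemma pring_least:
  assumes "subring E R" "K \<subseteq> E" "\<And>j. j < i \<Longrightarrow> z j \<in> E"
  shows "pring K z i \<subseteq> E"
  unfolding pring_def using assms subringE(1)[OF assms(1)]
  by (intro generate_ring_min_subring1) auto

lemma pring_0: "subring K R \<Longrightarrow> pring K z 0 = K"
  using pring_least[of K K 0 z] pring_base[of K z 0] by auto

lemma lspan_tower:
  assumes "subring C R" "subring B R" "V \<subseteq> carrier R" "W \<subseteq> carrier R" "B \<subseteq> lspan C V"
  shows "lspan B W \<subseteq> lspan C {v \<otimes> w | v w. v \<in> V \<and> w \<in> W}" (is "_ \<subseteq> lspan C ?U")
proof -
  have U: "?U \<subseteq> carrier R" using assms by auto
  note Cc = subringE(1)[OF assms(1)] and Bc = subringE(1)[OF assms(2)]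
  show ?thesis
  proof (rule lspan_trans[OF assms(1) U])
    fix b w assume bw: "b \<in> B" "w \<in> W"
    have wc: "w \<in> carrier R" using bw assms by auto
    have "w \<otimes> b \<in> lspan C ?U"
    proof (rule lspan_scale[OF Cc assms(3) U wc])
      show "b \<in> lspan C V" using bw assms by auto
      fix c v assume cv: "c \<in> C" "v \<in> V"
      then have "w \<otimes> (c \<otimes> v) = c \<otimes> (v \<otimes> w)" using wc Cc assms(3) by (simp add: m_ac subset_iff)
      moreover have "v \<otimes> w \<in> ?U" using cv bw by blast
      ultimately show "w \<otimes> (c \<otimes> v) \<in> lspan C ?U"
        using lspan_smult_closed[OF assms(1) U cv(1)] lspan_incl[OF assms(1) U] by simp
    qed
    then show "b \<otimes> w \<in> lspan C ?U" using wc bw Bc by (simp add: m_comm subset_iff)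
  qed
qed

end

context field
begin

lemma pring_Suc:
  assumes "subring K R" "\<And>j. j \<le> i \<Longrightarrow> z j \<in> carrier R"
  shows "pring K z (Suc i) = simple_extension (pring K z i) (z i)"
proof
  have Kc: "K \<subseteq> carrier R" by (rule subringE(1)[OF assms(1)])
  have P: "subring (pring K z i) R" "subring (pring K z (Suc i)) R"
    using Kc assms(2) by (auto intro!: pring_subring)
  interpret ev: ring_hom_ring "(pring K z i)[X]" R "\<lambda>p. eval p (z i)"
    using P(1) assms(2) by (intro eval_ring_hom) auto
  have S: "subring (simple_extension (pring K z i) (z i)) R"
    using ev.img_is_subring[OF ev.R.carrier_is_subring]
      simple_extension_as_eval_img[OF subringE(1)[OF P(1)] assms(2)[of i]] by simp
  have inc: "pring K z i \<subseteq> simple_extension (pring K z i) (z i)"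
    using simple_extension_incl[OF subringE(1)[OF P(1)] assms(2)[of i]] by simp
  show "pring K z (Suc i) \<subseteq> simple_extension (pring K z i) (z i)"
  proof (rule pring_least[OF S])
    show "K \<subseteq> simple_extension (pring K z i) (z i)" using inc pring_base[of K z i] by auto
    fix j assume "j < Suc i"
    then show "z j \<in> simple_extension (pring K z i) (z i)"
      using simple_extension_mem[OF P(1) assms(2)[of i]] inc pring_gen[of j i z K]
      by (cases "j = i") auto
  qed
  show "simple_extension (pring K z i) (z i) \<subseteq> pring K z (Suc i)"
  proof (rule simple_extension_subring_incl[OF P(2)])
    show "pring K z i \<subseteq> pring K z (Suc i)"
      using pring_base[of K z] pring_gen[of _ "Suc i" z K] by (intro pring_least[OF P(2)]) auto
  qed (auto intro: pring_gen subsetD[OF pring_base])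
qed

lemma alg_indep_mono: "alg_indep K z e \<Longrightarrow> i \<le> e \<Longrightarrow> alg_indep K z i"
  unfolding alg_indep_def by auto

lemma comp_int_closed_pring:
  assumes "subfield K R" "alg_indep K z e" shows "comp_int_closed (pring K z e)"
  using assms(2)
proof (induction e)
  case 0
  then show ?case using pring_0[OF subfieldE(1)[OF assms(1)]] comp_int_closed_subfield[OF assms(1)] by simp
next
  case (Suc e)
  have z: "z j \<in> carrier R" if "j \<le> e" for j using Suc.prems that unfolding alg_indep_def by auto
  have "comp_int_closed (simple_extension (pring K z e) (z e))"
  proof (rule comp_int_closed_simple_extension)
    show "subring (pring K z e) R"
      using z subfieldE(3)[OF assms(1)] by (intro pring_subring) auto
    show "comp_int_closed (pring K z e)" using Suc alg_indep_mono by auto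
  qed (use Suc.prems z in \<open>auto simp: alg_indep_def\<close>)
  then show ?case using pring_Suc[OF subfieldE(1)[OF assms(1)] z] by simp
qed

lemma simple_extension_lspan:
  assumes B: "subring B R" and x: "x \<in> carrier R" and n: "x [^] n \<in> lspan B ((\<lambda>j. x [^] j) ` {..<n::nat})"
  shows "simple_extension B x \<subseteq> lspan B ((\<lambda>j. x [^] j) ` {..<n})" (is "_ \<subseteq> lspan B ?V")
proof
  have V: "?V \<subseteq> carrier R" using x by auto
  note Bc = subringE(1)[OF B]
  have n0: "0 < n"
  proof (rule ccontr)
    assume "\<not> 0 < n"
    then have "\<one> \<in> lspan B {}" using n by simp
    moreover have "lspan B {} \<subseteq> {\<zero>}" by (rule lspan_least) auto
    ultimately show False by auto
  qed
  fix y assume "y \<in> simple_extension B x"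
  then show "y \<in> lspan B ?V"
  proof induction
    case zero
    then show ?case by (rule lspan.zero)
  next
    case (lin y b)
    have yc: "y \<in> carrier R" using lspan_carrier[OF Bc V] lin by auto
    have "x \<otimes> y \<in> lspan B ?V"
    proof (rule lspan_scale[OF Bc V V x _ lin.IH])
      fix c v assume c: "c \<in> B" and "v \<in> ?V"
      then obtain j where j: "j < n" "v = x [^] j" by auto
      have "x \<otimes> (c \<otimes> v) = c \<otimes> x [^] Suc j" using c Bc x unfolding j by (simp add: m_ac subset_iff)
      moreover have "x [^] Suc j \<in> lspan B ?V"
      proof (cases "Suc j = n")
        case False
        then show ?thesis using j by (intro lspan_incl[OF B V] imageI) auto
      qed (use n in simp)
      ultimately show "x \<otimes> (c \<otimes> v) \<in> lspan B ?V" using lspan_smult_closed[OF B V c] by simp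
    qed
    moreover have "b \<otimes> \<one> \<in> lspan B ?V"
    proof (rule lspan_smult_closed[OF B V lin.hyps(2)], rule lspan_incl[OF B V])
      show "\<one> \<in> ?V" using n0 by (force intro: image_eqI[of _ _ 0])
    qed
    moreover have "y \<otimes> x \<oplus> b = x \<otimes> y \<oplus> b \<otimes> \<one>" using yc x lin.hyps(2) Bc by (simp add: m_comm subset_iff)
    ultimately show ?case using lspan_add_closed[OF Bc V] by simp
  qed
qed

text \<open>Each \<open>t i\<close> satisfies a monic relation over \<open>A\<close> itself, hence
  over every intermediate ring, so the powers of the \<open>t i\<close> below the degrees
  \<open>n i\<close> generate successively.\<close>

lemma pring_finite:
  assumes A: "subring A R"
  shows "(\<And>i. i < r \<Longrightarrow> t i \<in> carrier R \<and> t i [^] n i \<in> lspan A ((\<lambda>j. t i [^] j) ` {..<n i :: nat})) \<Longrightarrow>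
    \<exists>W. finite W \<and> W \<subseteq> pring A t r \<and> pring A t r \<subseteq> lspan A W"
proof (induction r)
  case 0
  have "A \<subseteq> lspan A {\<one>}"
  proof
    fix a assume a: "a \<in> A"
    then have "a \<otimes> \<one> \<in> lspan A {\<one>}"
      using lspan_incl[OF A, of "{\<one>}"] by (intro lspan_smult_closed[OF A]) auto
    then show "a \<in> lspan A {\<one>}" using a subringE(1)[OF A] by auto
  qed
  then show ?case using pring_0[OF A] subringE(3)[OF A] by (intro exI[of _ "{\<one>}"]) auto
next
  case (Suc r)
  note Ac = subringE(1)[OF A]
  have t: "t i \<in> carrier R" if "i \<le> r" for i using Suc.prems[of i] that by auto
  have P: "subring (pring A t r) R" "subring (pring A t (Suc r)) R" using t Ac by (auto intro!: pring_subring)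
  have sub: "pring A t r \<subseteq> pring A t (Suc r)"
    using pring_base[of A t] pring_gen[of _ "Suc r" t A] by (intro pring_least[OF P(2)]) auto
  obtain W where W: "finite W" "W \<subseteq> pring A t r" "pring A t r \<subseteq> lspan A W" using Suc by auto
  have Wc: "W \<subseteq> carrier R" using W subringE(1)[OF P(1)] by auto
  define V where "V = (\<lambda>j. t r [^] j) ` {..<n r}"
  have V: "finite V" "V \<subseteq> carrier R" "V \<subseteq> pring A t (Suc r)"
    using t[of r] nat_pow_in_subring[OF P(2) pring_gen[of r "Suc r" t A]] unfolding V_def by auto
  have "lspan A V \<subseteq> lspan (pring A t r) V" by (rule lspan_mono) (auto intro: pring_gen subsetD[OF pring_base])
  then have "t r [^] n r \<in> lspan (pring A t r) V" using Suc.prems[of r] unfolding V_def by auto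
  then have "pring A t (Suc r) \<subseteq> lspan (pring A t r) V"
    using pring_Suc[OF A t] simple_extension_lspan[OF P(1) t[of r]] unfolding V_def by auto
  also have "\<dots> \<subseteq> lspan A {w \<otimes> v | w v. w \<in> W \<and> v \<in> V}"
    by (rule lspan_tower[OF A P(1) Wc V(2) W(3)])
  finally have "pring A t (Suc r) \<subseteq> lspan A ((\<lambda>(w, v). w \<otimes> v) ` (W \<times> V))"
    by (rule subset_trans) (intro lspan_mono; auto)
  moreover have "(\<lambda>(w, v). w \<otimes> v) ` (W \<times> V) \<subseteq> pring A t (Suc r)"
    using W(2) V(3) sub subringE(6)[OF P(2)] by (auto simp: subset_iff)
  ultimately show ?case using W V by (intro exI[of _ "(\<lambda>(w, v). w \<otimes> v) ` (W \<times> V)"]) auto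
qed

section \<open>Noether normalization\<close>

text \<open>A bound for the degree in \<open>x\<close> of some representation. Since
  \<open>x\<close> may be algebraic over \<open>Z\<close>, the degree is not a function of the
  element, and leading terms are not unique either; this is what allows zero to have a leading term
  below.\<close>

definition low :: "'a set \<Rightarrow> 'a \<Rightarrow> nat \<Rightarrow> 'a set" where
  "low Z x w = lspan Z ((\<lambda>j. x [^] j) ` {..<w})"

lemma low_props:
  assumes Z: "subring Z R" and x: "x \<in> carrier R"
  shows low_carrier: "low Z x w \<subseteq> carrier R"
    and low_mono: "w \<le> w' \<Longrightarrow> low Z x w \<subseteq> low Z x w'"
    and low_add: "\<lbrakk>a \<in> low Z x w; b \<in> low Z x w\<rbrakk> \<Longrightarrow> a \<oplus> b \<in> low Z x w"
    and low_smult: "\<lbrakk>c \<in> Z; a \<in> low Z x w\<rbrakk> \<Longrightarrow> c \<otimes> a \<in> low Z x w"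
    and low_pow: "i < w \<Longrightarrow> x [^] i \<in> low Z x w"
    and low_mult: "\<lbrakk>a \<in> low Z x w; b \<in> low Z x w'\<rbrakk> \<Longrightarrow> a \<otimes> b \<in> low Z x (w + w')"
    and low_pow_mult: "b \<in> low Z x w' \<Longrightarrow> x [^] i \<otimes> b \<in> low Z x (i + w')"
proof -
  have V: "(\<lambda>j. x [^] j) ` {..<w} \<subseteq> carrier R" for w :: nat using x by auto
  note Zc = subringE(1)[OF Z]
  show "low Z x w \<subseteq> carrier R" unfolding low_def by (rule lspan_carrier[OF Zc V])
  show "w \<le> w' \<Longrightarrow> low Z x w \<subseteq> low Z x w'" unfolding low_def by (intro lspan_mono) auto
  show "\<lbrakk>a \<in> low Z x w; b \<in> low Z x w\<rbrakk> \<Longrightarrow> a \<oplus> b \<in> low Z x w"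
    unfolding low_def by (rule lspan_add_closed[OF Zc V])
  show "\<lbrakk>c \<in> Z; a \<in> low Z x w\<rbrakk> \<Longrightarrow> c \<otimes> a \<in> low Z x w"
    unfolding low_def by (rule lspan_smult_closed[OF Z V])
  have pow: "x [^] i \<in> low Z x w" if "i < w" for i w
    unfolding low_def using that by (intro lspan_incl[OF Z V]) auto
  show "i < w \<Longrightarrow> x [^] i \<in> low Z x w" by (rule pow)
  show "\<lbrakk>a \<in> low Z x w; b \<in> low Z x w'\<rbrakk> \<Longrightarrow> a \<otimes> b \<in> low Z x (w + w')"
    unfolding low_def
  proof (rule lspan_mult[OF Z V V V])
    fix v u assume "v \<in> (\<lambda>j. x [^] j) ` {..<w}" "u \<in> (\<lambda>j. x [^] j) ` {..<w'}"
    then obtain i j where "i < w" "j < w'" "v = x [^] i" "u = x [^] j" by auto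
    then show "v \<otimes> u \<in> lspan Z ((\<lambda>j. x [^] j) ` {..<w + w'})"
      using pow[of "i + j" "w + w'"] x unfolding low_def by (simp add: nat_pow_mult)
  qed
  show "b \<in> low Z x w' \<Longrightarrow> x [^] i \<otimes> b \<in> low Z x (i + w')"
    unfolding low_def
  proof (rule lspan_scale[OF Zc V V])
    fix c v assume c: "c \<in> Z" and "v \<in> (\<lambda>j. x [^] j) ` {..<w'}"
    then obtain j where j: "j < w'" "v = x [^] j" by auto
    have "x [^] i \<otimes> (c \<otimes> v) = c \<otimes> x [^] (i + j)"
      using c Zc x unfolding j nat_pow_mult[OF x, symmetric] by (simp add: m_ac subset_iff)
    then show "x [^] i \<otimes> (c \<otimes> v) \<in> lspan Z ((\<lambda>j. x [^] j) ` {..<i + w'})"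
      using lspan_smult_closed[OF Z V c] pow[of "i + j" "i + w'"] j unfolding low_def by simp
  qed (use x in auto)
qed

text \<open>Elements whose leading term in \<open>x\<close> is \<open>\<kappa> x\<^sup>w\<close>.\<close>

definition mono_lead :: "'a set \<Rightarrow> 'a \<Rightarrow> 'a \<Rightarrow> nat \<Rightarrow> 'a set" where
  "mono_lead Z x \<kappa> w = {f \<in> carrier R. f \<ominus> \<kappa> \<otimes> x [^] w \<in> low Z x w}"

lemma mono_lead_mult:
  assumes Z: "subring Z R" and x: "x \<in> carrier R" and \<kappa>: "\<kappa> \<in> Z" "\<kappa>' \<in> Z"
    and f: "f \<in> mono_lead Z x \<kappa> w" "g \<in> mono_lead Z x \<kappa>' w'"
  shows "f \<otimes> g \<in> mono_lead Z x (\<kappa> \<otimes> \<kappa>') (w + w')"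
proof -
  define l l' where "l = f \<ominus> \<kappa> \<otimes> x [^] w" and "l' = g \<ominus> \<kappa>' \<otimes> x [^] w'"
  have l: "l \<in> low Z x w" "l' \<in> low Z x w'" using f by (auto simp: mono_lead_def l_def l'_def)
  have c: "f \<in> carrier R" "g \<in> carrier R" "\<kappa> \<in> carrier R" "\<kappa>' \<in> carrier R" "x [^] w \<in> carrier R" "x [^] w' \<in> carrier R"
    using f \<kappa> x subringE(1)[OF Z] by (auto simp: mono_lead_def)
  have lc: "l \<in> carrier R" "l' \<in> carrier R" using c by (auto simp: l_def l'_def)
  have fl: "f = \<kappa> \<otimes> x [^] w \<oplus> l" "g = \<kappa>' \<otimes> x [^] w' \<oplus> l'"
    unfolding l_def l'_def using c by algebra+
  have "f \<otimes> g \<ominus> (\<kappa> \<otimes> \<kappa>') \<otimes> x [^] (w + w') =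
      \<kappa> \<otimes> (x [^] w \<otimes> l') \<oplus> \<kappa>' \<otimes> (x [^] w' \<otimes> l) \<oplus> l \<otimes> l'"
    unfolding nat_pow_mult[OF x, symmetric] fl using c(3-6) lc by algebra
  moreover have "x [^] w' \<otimes> l \<in> low Z x (w + w')"
    using low_pow_mult[OF Z x l(1), of w'] by (simp add: add.commute)
  ultimately have "f \<otimes> g \<ominus> (\<kappa> \<otimes> \<kappa>') \<otimes> x [^] (w + w') \<in> low Z x (w + w')"
    using low_pow_mult[OF Z x l(2), of w] low_mult[OF Z x l] \<kappa>
    by (auto intro!: low_add[OF Z x] low_smult[OF Z x])
  then show ?thesis using c by (auto simp: mono_lead_def)
qed

lemma mono_lead_low:
  assumes Z: "subring Z R" and x: "x \<in> carrier R" and \<kappa>: "\<kappa> \<in> Z"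
    and f: "f \<in> mono_lead Z x \<kappa> w" "w < w'"
  shows "f \<in> low Z x w'"
proof -
  have c: "f \<in> carrier R" "\<kappa> \<in> carrier R" "x [^] w \<in> carrier R"
    using f \<kappa> x subringE(1)[OF Z] by (auto simp: mono_lead_def)
  have "f = (f \<ominus> \<kappa> \<otimes> x [^] w) \<oplus> \<kappa> \<otimes> x [^] w" using c by algebra
  moreover have "f \<ominus> \<kappa> \<otimes> x [^] w \<in> low Z x w'"
    using low_mono[OF Z x, of w w'] f by (auto simp: mono_lead_def)
  ultimately show ?thesis
    using low_add[OF Z x] low_smult[OF Z x \<kappa> low_pow[OF Z x f(2)]] by metis
qed

lemma mono_lead_pow:
  assumes Z: "subring Z R" and x: "x \<in> carrier R" and f: "f \<in> mono_lead Z x \<one> w"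
  shows "f [^] n \<in> mono_lead Z x \<one> (n * w)"
proof (induction n)
  case 0
  have "\<one> \<ominus> \<one> \<otimes> x [^] (0::nat) = \<zero>" using x by simp
  then show ?case by (auto simp: mono_lead_def low_def lspan.zero a_minus_def r_neg)
next
  case (Suc n)
  have "f [^] n \<otimes> f \<in> mono_lead Z x (\<one> \<otimes> \<one>) (n * w + w)"
    using Suc f subringE(3)[OF Z] by (intro mono_lead_mult[OF Z x]) auto
  then show ?case by (simp add: add.commute)
qed

text \<open>With \<open>t i = y i + x\<^bsup>N^i\<^esup>\<close> the monomials with exponents below \<open>N\<close> get distinct degrees in \<open>x\<close>,
  so no cancellation of leading terms occurs for large \<open>N\<close>.\<close>

lemma nagata_lead:
  assumes K: "subfield K R" and x: "x \<in> carrier R"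
    and Z: "\<And>N. 0 < N \<Longrightarrow> subring (Z N) R" "\<And>N. 0 < N \<Longrightarrow> K \<subseteq> Z N"
    and t: "\<And>N i. 0 < N \<Longrightarrow> i < r \<Longrightarrow> t i \<in> mono_lead (Z N) x \<one> (N ^ i)"
  shows "i \<le> r \<Longrightarrow> f \<in> pring K t i \<Longrightarrow> f \<noteq> \<zero> \<Longrightarrow>
      \<exists>N0>0. \<forall>N\<ge>N0. \<exists>w<N ^ i. \<exists>\<kappa>\<in>K - {\<zero>}. f \<in> mono_lead (Z N) x \<kappa> w"
    and "i < r \<Longrightarrow> p \<in> carrier ((pring K t i)[X]) \<Longrightarrow> p \<noteq> [] \<Longrightarrow>
      \<exists>N0>0. \<forall>N\<ge>N0. \<exists>w<N ^ Suc i. \<exists>\<kappa>\<in>K - {\<zero>}. eval p (t i) \<in> mono_lead (Z N) x \<kappa> w"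
proof -
  note Ks = subfieldE(1)[OF K] and Kc = subfieldE(3)[OF K]
  have tc: "t i \<in> carrier R" if "i < r" for i using t[of 1 i] that by (auto simp: mono_lead_def)
  have P: "subring (pring K t i) R" if "i \<le> r" for i
    using that tc Kc by (intro pring_subring) auto
  define E where "E i f \<longleftrightarrow> (\<exists>N0>0. \<forall>N\<ge>N0. \<exists>w<N ^ i. \<exists>\<kappa>\<in>K - {\<zero>}. f \<in> mono_lead (Z N) x \<kappa> w)" for i f
  \<comment> \<open>The list \<open>p\<close> is nonzero, but its value at \<open>t i\<close> may be
    zero. In that case the leading term found here is an integral relation for \<open>x\<close>, up
    to the nonzero factor from \<open>K\<close>.\<close>
  have poly: "E (Suc i) (eval p (t i))"
    if i: "i < r" and Ei: "\<And>f. f \<in> pring K t i \<Longrightarrow> f \<noteq> \<zero> \<Longrightarrow> E i f"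
      and p: "p \<in> carrier ((pring K t i)[X])" "p \<noteq> []" for i p
  proof -
    \<comment> \<open>Everything after the leading term of \<open>p\<close> is handled by degree
      alone: the coefficients have degree below \<open>N ^ i\<close>, and \<open>t i\<close> has
      degree \<open>N ^ i\<close>.\<close>
    have low: "\<exists>N0>0. \<forall>N\<ge>N0. eval q (t i) \<in> low (Z N) x (length q * N ^ i)" if "set q \<subseteq> pring K t i" for q
      using that
    proof (induction q)
      case Nil
      then show ?case by (auto simp: low_def lspan.zero)
    next
      case (Cons a q)
      obtain N0 where N0: "N0 > 0" "\<And>N. N \<ge> N0 \<Longrightarrow> eval q (t i) \<in> low (Z N) x (length q * N ^ i)"
        using Cons by auto
      obtain N1 where N1: "N1 > 0" "\<And>N. N \<ge> N1 \<Longrightarrow> a \<in> low (Z N) x (N ^ i)"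
      proof (cases "a = \<zero>")
        case True
        then show ?thesis using that[of 1] by (auto simp: low_def lspan.zero)
      next
        case False
        then obtain N1 where *: "N1 > 0" "\<And>N. N \<ge> N1 \<Longrightarrow> \<exists>w<N ^ i. \<exists>\<kappa>\<in>K - {\<zero>}. a \<in> mono_lead (Z N) x \<kappa> w"
          using Ei[of a] Cons.prems unfolding E_def by auto
        show ?thesis
        proof (rule that[OF *(1)])
          fix N assume N: "N \<ge> N1"
          then obtain w \<kappa> where "w < N ^ i" "\<kappa> \<in> K" "a \<in> mono_lead (Z N) x \<kappa> w" using *(2) by blast
          then show "a \<in> low (Z N) x (N ^ i)"
            using Z[of N] N *(1) by (intro mono_lead_low[OF _ x, of _ \<kappa> a w]) auto
        qed
      qed
      have "eval (a # q) (t i) \<in> low (Z N) x (length (a # q) * N ^ i)" if N: "N \<ge> max N0 N1" for N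
      proof -
        have Np: "0 < N" using N N0 by auto
        note ZN = Z(1)[OF Np]
        define n where "n = length q"
        have "t i [^] n \<in> mono_lead (Z N) x \<one> (n * N ^ i)" by (rule mono_lead_pow[OF ZN x t[OF Np i]])
        then have "t i [^] n \<in> low (Z N) x (n * N ^ i + 1)"
          using subringE(3)[OF ZN] by (intro mono_lead_low[OF ZN x]) auto
        moreover have "a \<in> low (Z N) x (N ^ i)" using N1 N by auto
        ultimately have "a \<otimes> t i [^] n \<in> low (Z N) x (Suc n * N ^ i)"
        proof -
          have tn: "t i [^] n \<ominus> \<one> \<otimes> x [^] (n * N ^ i) \<in> low (Z N) x (n * N ^ i)"
            using mono_lead_pow[OF ZN x t[OF Np i], of n] by (simp add: mono_lead_def)
          have ac: "a \<in> carrier R" using low_carrier[OF ZN x] \<open>a \<in> low (Z N) x (N ^ i)\<close> by auto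
          have c: "t i [^] n \<in> carrier R" "x [^] (n * N ^ i) \<in> carrier R" using tc[OF i] x by auto
          have "a \<otimes> t i [^] n = x [^] (n * N ^ i) \<otimes> a \<oplus> a \<otimes> (t i [^] n \<ominus> \<one> \<otimes> x [^] (n * N ^ i))"
            using ac c by algebra
          moreover have "x [^] (n * N ^ i) \<otimes> a \<in> low (Z N) x (n * N ^ i + N ^ i)"
            by (rule low_pow_mult[OF ZN x \<open>a \<in> low (Z N) x (N ^ i)\<close>])
          moreover have "a \<otimes> (t i [^] n \<ominus> \<one> \<otimes> x [^] (n * N ^ i)) \<in> low (Z N) x (N ^ i + n * N ^ i)"
            by (rule low_mult[OF ZN x \<open>a \<in> low (Z N) x (N ^ i)\<close> tn])
          ultimately show ?thesis using low_add[OF ZN x] by (simp add: algebra_simps)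
        qed
        moreover have "eval q (t i) \<in> low (Z N) x (Suc n * N ^ i)"
          using N0(2)[of N] N low_mono[OF ZN x, of "n * N ^ i" "Suc n * N ^ i"] unfolding n_def by auto
        ultimately show ?thesis using low_add[OF ZN x] unfolding n_def by auto
      qed
      then show ?case using N0(1) by (intro exI[of _ "max N0 N1"]) auto
    qed
    obtain a q where aq: "p = a # q" using p by (cases p) auto
    have a: "a \<in> pring K t i" "a \<noteq> \<zero>" "set q \<subseteq> pring K t i"
      using p aq by (auto simp: univ_poly_carrier[symmetric] polynomial_def)
    obtain N0 where N0: "N0 > 0" "\<And>N. N \<ge> N0 \<Longrightarrow> \<exists>w<N ^ i. \<exists>\<kappa>\<in>K - {\<zero>}. a \<in> mono_lead (Z N) x \<kappa> w"
      using Ei[OF a(1,2)] unfolding E_def by auto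
    obtain N1 where N1: "N1 > 0" "\<And>N. N \<ge> N1 \<Longrightarrow> eval q (t i) \<in> low (Z N) x (length q * N ^ i)"
      using low[OF a(3)] by auto
    define n where "n = length q"
    \<comment> \<open>Besides passing the thresholds for the coefficients, \<open>N\<close> has to
      exceed the degree \<open>n\<close> of \<open>p\<close>. Then \<open>w + n * N ^ i\<close>
      stays below \<open>N ^ Suc i\<close>, as for digits in base \<open>N\<close>.\<close>
    have "\<exists>w<N ^ Suc i. \<exists>\<kappa>\<in>K - {\<zero>}. eval p (t i) \<in> mono_lead (Z N) x \<kappa> w"
      if N: "N \<ge> max (max N0 N1) (n + 1)" for N
    proof -
      have Np: "0 < N" using N N0 by auto
      note ZN = Z(1)[OF Np]
      obtain w \<kappa> where w: "w < N ^ i" "\<kappa> \<in> K - {\<zero>}" "a \<in> mono_lead (Z N) x \<kappa> w" using N0(2)[of N] N by auto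
      have \<kappa>Z: "\<kappa> \<in> Z N" using w Z(2)[OF Np] by auto
      have "a \<otimes> t i [^] n \<in> mono_lead (Z N) x (\<kappa> \<otimes> \<one>) (w + n * N ^ i)"
        using mono_lead_pow[OF ZN x t[OF Np i], of n] w \<kappa>Z subringE(3)[OF ZN]
        by (intro mono_lead_mult[OF ZN x]) auto
      then have m: "a \<otimes> t i [^] n \<in> mono_lead (Z N) x \<kappa> (w + n * N ^ i)" using w Kc by auto
      have e: "eval q (t i) \<in> low (Z N) x (w + n * N ^ i)"
        using N1(2)[of N] N low_mono[OF ZN x, of "n * N ^ i" "w + n * N ^ i"] unfolding n_def by auto
      have c: "a \<otimes> t i [^] n \<in> carrier R" "eval q (t i) \<in> carrier R" "\<kappa> \<otimes> x [^] (w + n * N ^ i) \<in> carrier R"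
        using m e low_carrier[OF ZN x] w Kc x by (auto simp: mono_lead_def)
      have "eval p (t i) \<ominus> \<kappa> \<otimes> x [^] (w + n * N ^ i) =
          (a \<otimes> t i [^] n \<ominus> \<kappa> \<otimes> x [^] (w + n * N ^ i)) \<oplus> eval q (t i)"
        using c unfolding aq by (simp add: n_def[symmetric]) algebra
      then have "eval p (t i) \<in> mono_lead (Z N) x \<kappa> (w + n * N ^ i)"
        using m e low_add[OF ZN x] c unfolding aq by (auto simp: mono_lead_def n_def)
      moreover have "w + n * N ^ i < N ^ Suc i"
      proof -
        have "w + n * N ^ i < N ^ i + n * N ^ i" using w by simp
        also have "\<dots> = (n + 1) * N ^ i" by simp
        also have "\<dots> \<le> N * N ^ i" using N by (intro mult_le_mono1) auto
        finally show ?thesis by simp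
      qed
      ultimately show ?thesis using w by blast
    qed
    then show ?thesis unfolding E_def using N0(1) by (intro exI[of _ "max (max N0 N1) (n + 1)"]) auto
  qed
  have E: "i \<le> r \<Longrightarrow> f \<in> pring K t i \<Longrightarrow> f \<noteq> \<zero> \<Longrightarrow> E i f" for i f
  proof (induction i arbitrary: f)
    case 0
    then have f: "f \<in> K" using pring_0[OF Ks] by auto
    then have "f \<ominus> f \<otimes> x [^] (0::nat) = \<zero>" using Kc by (auto simp: r_right_minus_eq)
    then have "f \<in> mono_lead (Z N) x f 0" for N
      using f Kc by (auto simp: mono_lead_def low_def lspan.zero)
    then show ?case unfolding E_def using f 0 by (intro exI[of _ 1]) auto
  next
    case (Suc i)
    have "f \<in> simple_extension (pring K t i) (t i)"
      using Suc.prems pring_Suc[OF Ks, of i t] tc by auto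
    then obtain p where p: "p \<in> carrier ((pring K t i)[X])" "f = eval p (t i)"
      using simple_extension_as_eval_img[OF subringE(1)[OF P[of i]], of "t i"] Suc.prems tc[of i] by auto
    have "p \<noteq> []" using p(2) Suc.prems by auto
    then show ?case using poly[of i p] p Suc.IH Suc.prems by auto
  qed
  show "i \<le> r \<Longrightarrow> f \<in> pring K t i \<Longrightarrow> f \<noteq> \<zero> \<Longrightarrow>
      \<exists>N0>0. \<forall>N\<ge>N0. \<exists>w<N ^ i. \<exists>\<kappa>\<in>K - {\<zero>}. f \<in> mono_lead (Z N) x \<kappa> w"
    using E unfolding E_def .
  show "i < r \<Longrightarrow> p \<in> carrier ((pring K t i)[X]) \<Longrightarrow> p \<noteq> [] \<Longrightarrow>
      \<exists>N0>0. \<forall>N\<ge>N0. \<exists>w<N ^ Suc i. \<exists>\<kappa>\<in>K - {\<zero>}. eval p (t i) \<in> mono_lead (Z N) x \<kappa> w"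
    using poly[of i p] E[of i] unfolding E_def by auto
qed

text \<open>The set \<open>J\<close> will be a maximal ideal. Closure under differences and products
  suffices, because the new elements arise from the given ones by subtracting positive powers of
  \<open>t 0\<close>; in this way all variables of the normalization stay in the ideal.\<close>

theorem noether_normalization:
  assumes K: "subfield K R" and J: "J \<subseteq> carrier R" "\<And>a b. a \<in> J \<Longrightarrow> b \<in> J \<Longrightarrow> a \<ominus> b \<in> J"
      "\<And>a b. a \<in> J \<Longrightarrow> b \<in> J \<Longrightarrow> a \<otimes> b \<in> J"
  shows "(\<And>i. i < r \<Longrightarrow> t i \<in> J) \<Longrightarrow>
    \<exists>e z W. (\<forall>i<e. z i \<in> J \<inter> pring K t r) \<and> alg_indep K z e \<and> finite W \<and> W \<subseteq> pring K t r \<and>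
      pring K t r \<subseteq> lspan (pring K z e) W"
proof (induction r arbitrary: t)
  case 0
  note Ks = subfieldE(1)[OF K]
  have "pring K t 0 \<subseteq> lspan (pring K t 0) {\<one>}"
    using pring_finite[OF Ks, of 0 t] lspan_smult_closed[OF Ks, of "{\<one>}" _ \<one>]
      lspan_incl[OF Ks, of "{\<one>}" \<one>] subringE(1)[OF Ks] by (auto simp: pring_0[OF Ks] subset_iff)
  then show ?case using pring_0[OF Ks, of t] subringE(3)[OF Ks]
    by (intro exI[of _ 0] exI[of _ t] exI[of _ "{\<one>}"]) (auto simp: alg_indep_def)
next
  case (Suc r)
  note Ks = subfieldE(1)[OF K] and Kc = subfieldE(3)[OF K]
  have tc: "t i \<in> carrier R" if "i < Suc r" for i using Suc.prems J that by auto
  have P: "subring (pring K t i) R" if "i \<le> Suc r" for i using that tc Kc by (intro pring_subring) auto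
  show ?case
  proof (cases "alg_indep K t (Suc r)")
    case True
    have "a \<in> lspan (pring K t (Suc r)) {\<one>}" if "a \<in> pring K t (Suc r)" for a
      using lspan_smult_closed[OF P[of "Suc r"] _ that lspan_incl[OF P[of "Suc r"]], of "{\<one>}" \<one>]
        that subringE(1)[OF P[of "Suc r"]] by auto
    then show ?thesis using True Suc.prems pring_gen[of _ "Suc r" t K] subringE(3)[OF P[of "Suc r"]]
      by (intro exI[of _ "Suc r"] exI[of _ t] exI[of _ "{\<one>}"]) auto
  next
    case False
    then obtain i where i: "i < Suc r" "\<not> (transcendental over (pring K t i)) (t i)"
      using tc unfolding alg_indep_def by auto
    obtain p where p: "p \<in> carrier ((pring K t i)[X])" "p \<noteq> []" "eval p (t i) = \<zero>"
      using transcendentalI[OF P[of i] tc[OF i(1)]] i by auto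
    define x where "x = t 0"
    define y where "y N j = t (Suc j) \<ominus> x [^] (N ^ Suc j)" for N j :: nat
    have x: "x \<in> carrier R" "x \<in> J" unfolding x_def using tc Suc.prems by auto
    have xp: "x [^] Suc n \<in> J" for n :: nat using x J(3) by (induction n) auto
    \<comment> \<open>\<open>J\<close> need not contain \<open>\<one>\<close>, so the exponent of
      \<open>x\<close> must not be zero; this is why \<open>N\<close> is taken positive
      throughout.\<close>
    have yJ: "y N j \<in> J" if "0 < N" "j < r" for N j
    proof -
      have "N ^ Suc j = Suc (N ^ Suc j - 1)" using that by auto
      then have "x [^] (N ^ Suc j) \<in> J" using xp[of "N ^ Suc j - 1"] by simp
      then show ?thesis unfolding y_def using Suc.prems[of "Suc j"] that J(2) by auto
    qed
    have Z: "subring (pring K (y N) r) R" if "0 < N" for N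
      using yJ[OF that] J(1) Kc by (intro pring_subring) auto
    have tm: "t i \<in> mono_lead (pring K (y N) r) x \<one> (N ^ i)" if N: "0 < N" and i: "i < Suc r" for N i
    proof -
      have "t i \<ominus> \<one> \<otimes> x [^] (N ^ i) \<in> low (pring K (y N) r) x (N ^ i)"
      proof (cases i)
        case 0
        then have "t i \<ominus> \<one> \<otimes> x [^] (N ^ i) = \<zero>" using x unfolding x_def by (simp add: a_minus_def r_neg)
        then show ?thesis by (simp add: low_def lspan.zero)
      next
        case (Suc j)
        have "y N j \<otimes> x [^] (0::nat) \<in> low (pring K (y N) r) x (N ^ i)"
          using Suc i N by (intro low_smult[OF Z[OF N] x(1)] low_pow[OF Z[OF N] x(1)] pring_gen) auto
        moreover have "y N j \<in> carrier R" using yJ[OF N, of j] i Suc J(1) by auto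
        ultimately show ?thesis using Suc x by (simp add: y_def)
      qed
      then show ?thesis using tc[OF i] by (simp add: mono_lead_def)
    qed
    \<comment> \<open>The value of \<open>p\<close> at \<open>t i\<close> is zero, so a leading term
      for it, divided by its constant \<kappa>, makes \<open>x\<close> integral over the ring
      generated by the \<open>y N j\<close>.\<close>
    obtain N where N: "0 < N" "\<exists>w<N ^ Suc i. \<exists>\<kappa>\<in>K - {\<zero>}. eval p (t i) \<in> mono_lead (pring K (y N) r) x \<kappa> w"
      using nagata_lead(2)[OF K x(1) Z _ tm i(1) p(1,2)] pring_base by blast
    then obtain w \<kappa> where w: "\<kappa> \<in> K - {\<zero>}" "\<zero> \<in> mono_lead (pring K (y N) r) x \<kappa> w" using p(3) by auto
    let ?Z = "pring K (y N) r"
    note ZN = Z[OF N(1)]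
    define V where "V = (\<lambda>j. x [^] j) ` {..<w}"
    have V: "V \<subseteq> carrier R" "finite V" unfolding V_def using x by auto
    have \<kappa>: "inv \<kappa> \<in> K" "inv \<kappa> \<otimes> \<kappa> = \<one>" using subfield_m_inv[OF K w(1)] by auto
    have "x [^] w \<in> lspan ?Z V"
    proof -
      have c: "\<kappa> \<in> carrier R" "inv \<kappa> \<in> carrier R" "x [^] w \<in> carrier R" using w \<kappa> Kc x by auto
      have "\<zero> \<ominus> \<kappa> \<otimes> x [^] w \<in> lspan ?Z V" using w unfolding mono_lead_def low_def V_def by auto
      then have "inv \<kappa> \<otimes> (\<ominus> (\<zero> \<ominus> \<kappa> \<otimes> x [^] w)) \<in> lspan ?Z V"
        using \<kappa> pring_base by (intro lspan_smult_closed[OF ZN V(1)] lspan_uminus_closed[OF ZN V(1)]) auto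
      moreover have "inv \<kappa> \<otimes> (\<ominus> (\<zero> \<ominus> \<kappa> \<otimes> x [^] w)) = inv \<kappa> \<otimes> \<kappa> \<otimes> x [^] w" using c by algebra
      ultimately show ?thesis using \<kappa>(2) c by simp
    qed
    then have se: "simple_extension ?Z x \<subseteq> lspan ?Z V"
      unfolding V_def by (rule simple_extension_lspan[OF ZN x(1)])
    have S: "subring (simple_extension ?Z x) R" by (rule simple_extension_subring[OF ZN x(1)])
    have ZS: "?Z \<subseteq> simple_extension ?Z x" "x \<in> simple_extension ?Z x"
      using simple_extension_incl[OF subringE(1)[OF ZN] x(1)] simple_extension_mem[OF ZN x(1)] by auto
    have "pring K t (Suc r) \<subseteq> simple_extension ?Z x"
    proof (rule pring_least[OF S])
      show "K \<subseteq> simple_extension ?Z x" using pring_base[of K "y N" r] ZS by auto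
      fix j assume j: "j < Suc r"
      show "t j \<in> simple_extension ?Z x"
      proof (cases j)
        case 0
        then show ?thesis using ZS x_def by simp
      next
        case (Suc m)
        have xc: "x [^] (N ^ Suc m) \<in> carrier R" using x by simp
        have "t j = y N m \<oplus> x [^] (N ^ Suc m)" unfolding y_def Suc using tc[OF j] xc Suc by algebra
        moreover have "y N m \<in> ?Z" using j Suc by (intro pring_gen) auto
        ultimately show ?thesis
          using ZS nat_pow_in_subring[OF S ZS(2)] subringE(7)[OF S] by auto
      qed
    qed
    then have tZ: "pring K t (Suc r) \<subseteq> lspan ?Z V" using se by auto
    have tP: "t j \<in> pring K t (Suc r)" if "j < Suc r" for j using that by (rule pring_gen)
    have xP: "x [^] n \<in> pring K t (Suc r)" for n :: nat
      using tP[of 0] nat_pow_in_subring[OF P[of "Suc r"]] unfolding x_def by auto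
    have Zt: "?Z \<subseteq> pring K t (Suc r)"
    proof (rule pring_least[OF P[of "Suc r"]])
      fix j assume "j < r"
      then show "y N j \<in> pring K t (Suc r)"
        unfolding y_def a_minus_def using tP[of "Suc j"] xP subringE(5,7)[OF P[of "Suc r"]] by auto
    qed (auto simp: pring_base)
    obtain e z W where IH: "\<forall>i<e. z i \<in> J \<inter> ?Z" "alg_indep K z e" "finite W" "W \<subseteq> ?Z" "?Z \<subseteq> lspan (pring K z e) W"
      using Suc.IH[of "y N"] yJ[OF N(1)] by blast
    have zc: "subring (pring K z e) R" using IH(1) J(1) Kc by (intro pring_subring) auto
    have Wc: "W \<subseteq> carrier R" using IH(4) subringE(1)[OF ZN] by auto
    have "pring K t (Suc r) \<subseteq> lspan (pring K z e) {v \<otimes> w | v w. v \<in> W \<and> w \<in> V}"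
      using tZ lspan_tower[OF zc ZN Wc V(1) IH(5)] by auto
    also have "\<dots> \<subseteq> lspan (pring K z e) ((\<lambda>(w, v). w \<otimes> v) ` (W \<times> V))"
      by (intro lspan_mono) auto
    finally have fin: "pring K t (Suc r) \<subseteq> lspan (pring K z e) ((\<lambda>(w, v). w \<otimes> v) ` (W \<times> V))" .
    have sub: "(\<lambda>(w, v). w \<otimes> v) ` (W \<times> V) \<subseteq> pring K t (Suc r)"
      using IH(4) Zt xP subringE(6)[OF P[of "Suc r"]] unfolding V_def by (auto simp: subset_iff)
    show ?thesis
    proof (intro exI conjI)
      show "\<forall>i<e. z i \<in> J \<inter> pring K t (Suc r)" using IH(1) Zt by auto
      show "finite ((\<lambda>(w, v). w \<otimes> v) ` (W \<times> V))" using IH(3) V by auto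
    qed (fact fin sub IH(2))+
  qed
qed

end

section \<open>Primes over the origin of a polynomial subring\<close>

context field
begin

lemma transcendental_scale:
  assumes L: "subfield L R" and x: "x \<in> carrier R" and t: "(transcendental over L) x"
    and c: "c \<in> L" "c \<noteq> \<zero>"
  shows "(transcendental over L) (x \<otimes> c)"
proof -
  note Ls = subfieldE(1)[OF L] and Lc = subfieldE(3)[OF L]
  have cc: "c \<in> carrier R" using c Lc by auto
  have ex: "\<exists>q. length q = length p \<and> set q \<subseteq> L \<and> (p \<noteq> [] \<longrightarrow> hd p \<noteq> \<zero> \<longrightarrow> hd q \<noteq> \<zero>) \<and>
      eval q x = eval p (x \<otimes> c)" if "set p \<subseteq> L" for p
    using that
  proof (induction p)
    case Nil
    then show ?case by auto
  next
    case (Cons a p)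
    then obtain q where q: "length q = length p" "set q \<subseteq> L" "eval q x = eval p (x \<otimes> c)" by auto
    define a' where "a' = a \<otimes> c [^] length p"
    have ac: "a \<in> carrier R" "a \<in> L" using Cons.prems Lc by auto
    have cp: "c [^] length p \<in> L" "c [^] length p \<in> carrier R" "c [^] length p \<noteq> \<zero>"
      using nat_pow_in_subring[OF Ls c(1)] nat_pow_nonzero[OF cc c(2)] cc by auto
    have "a' \<in> L" unfolding a'_def using ac cp subringE(6)[OF Ls] by auto
    moreover have "a \<noteq> \<zero> \<Longrightarrow> a' \<noteq> \<zero>" unfolding a'_def using ac cp mult_nonzero by auto
    moreover have "eval (a' # q) x = eval (a # p) (x \<otimes> c)"
    proof -
      have "(a \<otimes> c [^] length p) \<otimes> x [^] length p = a \<otimes> (x [^] length p \<otimes> c [^] length p)"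
        using ac cp x by (simp add: m_ac)
      then show ?thesis using q x cc by (simp add: a'_def nat_pow_distrib)
    qed
    ultimately show ?case using q by (intro exI[of _ "a' # q"]) auto
  qed
  show ?thesis
  proof (rule transcendentalI[OF Ls])
    show "x \<otimes> c \<in> carrier R" using x cc by simp
    fix p assume p: "p \<in> carrier (L[X])" "eval p (x \<otimes> c) = \<zero>"
    then have sp: "set p \<subseteq> L" "p \<noteq> [] \<Longrightarrow> hd p \<noteq> \<zero>" by (auto simp: univ_poly_carrier[symmetric] polynomial_def)
    obtain q where q: "length q = length p" "set q \<subseteq> L" "p \<noteq> [] \<longrightarrow> hd p \<noteq> \<zero> \<longrightarrow> hd q \<noteq> \<zero>"
        "eval q x = \<zero>" using ex[OF sp(1)] p(2) by auto
    then have "q \<in> carrier (L[X])" using sp by (auto simp: univ_poly_carrier[symmetric] polynomial_def)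
    then have "q = []" using eval_transcendental[OF t] q by auto
    then show "p = []" using q by auto
  qed
qed

lemma transcendental_notin:
  assumes K: "subring K R" and t: "(transcendental over K) x" and x: "x \<in> carrier R"
  shows "x \<notin> K"
proof
  assume "x \<in> K"
  then have "[\<one>, \<ominus> x] \<in> carrier (K[X])"
    using subringE(3,5)[OF K] by (auto simp: univ_poly_carrier[symmetric] polynomial_def)
  moreover have "eval [\<one>, \<ominus> x] x = \<zero>" using x by (simp add: r_neg)
  ultimately show False using eval_transcendental[OF t] by blast
qed

lemma pring_mono:
  assumes "K \<subseteq> carrier R" "\<And>j. j < i' \<Longrightarrow> z j \<in> carrier R" "i \<le> i'"
  shows "pring K z i \<subseteq> pring K z i'"
  using assms by (intro pring_least pring_subring) (auto simp: pring_base intro: pring_gen)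

text \<open>The reason is that a variable is not a unit in a polynomial ring. Later variables are
  removed one at a time: if \<open>Y 0\<close> times a polynomial in \<open>Y i\<close> is one, a
  comparison of polynomials shows that this polynomial is a constant.\<close>

lemma unit_not_multiple_first:
  assumes K: "subfield K R" and Y: "alg_indep K Y e"
  shows "i \<le> e \<Longrightarrow> 0 < e \<Longrightarrow> \<beta> \<in> pring K Y i \<Longrightarrow> Y 0 \<otimes> \<beta> \<noteq> \<one>"
proof (induction i arbitrary: \<beta>)
  case 0
  note Ks = subfieldE(1)[OF K] and Kc = subfieldE(3)[OF K]
  have \<beta>: "\<beta> \<in> K" using 0 pring_0[OF Ks] by auto
  have Y0: "Y 0 \<in> carrier R" "(transcendental over K) (Y 0)"
    using Y 0 pring_0[OF Ks] unfolding alg_indep_def by auto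
  show ?case
  proof
    assume eq: "Y 0 \<otimes> \<beta> = \<one>"
    then have "\<beta> \<noteq> \<zero>" using Y0 by auto
    then have "inv \<beta> \<in> K" "\<beta> \<otimes> inv \<beta> = \<one>" using subfield_m_inv[OF K, of \<beta>] \<beta> by auto
    moreover have "Y 0 = (Y 0 \<otimes> \<beta>) \<otimes> inv \<beta>" using calculation Y0 \<beta> Kc by (simp add: m_assoc subset_iff)
    ultimately have "Y 0 \<in> K" using eq Kc by auto
    then show False using transcendental_notin[OF Ks Y0(2,1)] by blast
  qed
next
  case (Suc i)
  note Ks = subfieldE(1)[OF K] and Kc = subfieldE(3)[OF K]
  have Yc: "Y j \<in> carrier R" if "j \<le> i" for j using Y that Suc.prems unfolding alg_indep_def by auto
  have P: "subring (pring K Y i) R" using Yc Kc by (intro pring_subring) auto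
  have t: "(transcendental over (pring K Y i)) (Y i)" using Y Suc.prems unfolding alg_indep_def by auto
  obtain q where q: "q \<in> carrier ((pring K Y i)[X])" "\<beta> = eval q (Y i)"
    using Suc.prems(3) pring_Suc[OF Ks Yc] simple_extension_as_eval_img[OF subringE(1)[OF P], of "Y i"] Yc
    by auto
  have sq: "set q \<subseteq> pring K Y i" "q \<noteq> [] \<Longrightarrow> hd q \<noteq> \<zero>"
    using q by (auto simp: univ_poly_carrier[symmetric] polynomial_def)
  have sqc: "set q \<subseteq> carrier R" using sq subringE(1)[OF P] by auto
  show ?case
  proof
    assume eq: "Y 0 \<otimes> \<beta> = \<one>"
    show False
    proof (cases "i = 0")
      case True
      have "q \<noteq> []" using eq q Yc by auto
      then have "q @ [\<ominus> \<one>] \<in> carrier ((pring K Y i)[X])"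
        using sq subringE(3,5)[OF P] by (auto simp: univ_poly_carrier[symmetric] polynomial_def)
      moreover have "eval (q @ [\<ominus> \<one>]) (Y i) = eval q (Y i) \<otimes> Y i \<oplus> \<ominus> \<one>"
        using sqc Yc[of i] by (intro eval_append_aux) auto
      then have "eval (q @ [\<ominus> \<one>]) (Y i) = \<zero>"
        using eq q True Yc[of 0] eval_in_carrier[OF sqc, of "Y 0"] by (simp add: m_comm r_neg)
      ultimately show False using eval_transcendental[OF t] by blast
    next
      case False
      have Y0: "Y 0 \<in> pring K Y i" using False by (intro pring_gen) auto
      have Y00: "Y 0 \<noteq> \<zero>" using eq q Yc eval_in_carrier[OF sqc Yc[of i]] by auto
      define r where "r = map (\<lambda>a. Y 0 \<otimes> a) q"
      have "eval r (Y i) = Y 0 \<otimes> eval q (Y i)" using sqc unfolding r_def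
      proof (induction q)
        case Nil
        then show ?case using Yc[of 0] by simp
      next
        case (Cons a q)
        have c: "a \<in> carrier R" "Y i [^] length q \<in> carrier R" "eval q (Y i) \<in> carrier R"
          using Cons.prems Yc[of i] eval_in_carrier by auto
        show ?case using Cons c Yc[of 0] by (simp add: r_distr m_assoc)
      qed
      then have ev: "eval r (Y i) = eval [\<one>] (Y i)" using eq q Yc[of i] by simp
      have "r \<in> carrier ((pring K Y i)[X])"
      proof (cases q)
        case (Cons a q')
        then show ?thesis using sq sqc Y0 Y00 subringE(6)[OF P] Yc[of 0] mult_nonzero
          by (auto simp: r_def univ_poly_carrier[symmetric] polynomial_def)
      qed (auto simp: r_def univ_poly_zero_closed)
      moreover have "[\<one>] \<in> carrier ((pring K Y i)[X])"
        using subringE(3)[OF P] by (auto simp: univ_poly_carrier[symmetric] polynomial_def)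
      ultimately have "r = [\<one>]" using eval_inj[OF P t] ev by auto
      then obtain c where c: "q = [c]" unfolding r_def by auto
      then have "\<beta> = c" "c \<in> pring K Y i" using q sq sqc Yc[of i] by auto
      then show False using Suc.IH[of \<beta>] Suc.prems eq by auto
    qed
  qed
qed

text \<open>The rational functions \<open>z j / q j\<close> lie in the maximal ideal of the valuation ring of the
  lexicographic monomial order; the point is that an element of the module-finite extension \<open>A\<close> that
  is a combination of them lies in \<^emph>\<open>every\<close> prime of \<open>A\<close> over the origin. This replaces going-down.\<close>

lemma lex_combination_in_prime:
  assumes K: "subfield K R" and z: "alg_indep K z e" and A: "subring A R" "pring K z e \<subseteq> A"
    and W: "finite W" "W \<subseteq> A" "A \<subseteq> lspan (pring K z e) W"
    and P: "P \<subseteq> A" "\<zero> \<in> P" "\<And>a b. a \<in> P \<Longrightarrow> b \<in> P \<Longrightarrow> a \<oplus> b \<in> P" "\<And>a b. a \<in> A \<Longrightarrow> b \<in> P \<Longrightarrow> a \<otimes> b \<in> P"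
      "\<And>a n. a \<in> A \<Longrightarrow> a [^] (n::nat) \<in> P \<Longrightarrow> 0 < n \<Longrightarrow> a \<in> P"
    and zP: "\<And>i. i < e \<Longrightarrow> z i \<in> P"
    and q: "q 0 = \<one>" "\<And>j. j < e \<Longrightarrow> q (Suc j) = q j \<otimes> z j [^] (\<mu> j :: nat)"
    and u: "u \<in> A" "u \<in> lspan A ((\<lambda>j. z j \<otimes> inv (q j)) ` {..<e})"
  shows "u \<in> P"
proof (cases "e = 0")
  case True
  have "lspan A {} \<subseteq> {\<zero>}" by (rule lspan_least) auto
  then show ?thesis using u True P(2) by auto
next
  case False
  note Ks = subfieldE(1)[OF K] and Kc = subfieldE(3)[OF K] and Ac = subringE(1)[OF A(1)]
  note Acl = subringE(2,3,5,6,7)[OF A(1)]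
  have zc: "z j \<in> carrier R" if "j < e" for j using z that unfolding alg_indep_def by auto
  have Pz: "subring (pring K z j) R" if "j \<le> e" for j using zc that Kc by (intro pring_subring) auto
  have zt: "(transcendental over (pring K z j)) (z j)" if "j < e" for j using z that unfolding alg_indep_def by auto
  have z0: "z j \<noteq> \<zero>" if "j < e" for j
    using transcendental_notin[OF Pz zt zc] subringE(2)[OF Pz] that by force
  define B where "B = pring K z e"
  have B: "subring B R" "comp_int_closed B" unfolding B_def using Pz comp_int_closed_pring[OF K z] by auto
  note Bc = subringE(1)[OF B(1)]
  define L where "L = fracs B"
  have L: "subfield L R" unfolding L_def by (rule fracs_subfield[OF B(1)])
  note Ls = subfieldE(1)[OF L] and Lc = subfieldE(3)[OF L]
  have Lj: "subfield (fracs (pring K z j)) R" if "j \<le> e" for j by (rule fracs_subfield[OF Pz[OF that]])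
  have Ljmono: "fracs (pring K z i) \<subseteq> fracs (pring K z j)" if "i \<le> j" "j \<le> e" for i j
    using pring_mono[OF Kc _ that(1), of z] zc that fracs_incl[OF Pz[OF that(2)]]
    by (intro fracs_least[OF Lj[OF that(2)]]) auto
  have zL: "z i \<in> fracs (pring K z j)" if "i < j" "j \<le> e" for i j
    using fracs_incl[OF Pz[OF that(2)]] pring_gen[OF that(1), of z K] by auto
  have qz: "q j \<noteq> \<zero> \<and> q j \<in> fracs (pring K z j) \<and> q j \<in> carrier R" if "j \<le> e" for j
    using that
  proof (induction j)
    case 0
    then show ?case using q subringE(3)[OF subfieldE(1)[OF Lj[of 0]]] by simp
  next
    case (Suc j)
    have *: "z j [^] \<mu> j \<noteq> \<zero>" "z j [^] \<mu> j \<in> carrier R" "z j [^] \<mu> j \<in> fracs (pring K z (Suc j))"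
      using zc[of j] z0[of j] Suc.prems nat_pow_nonzero zL[of j "Suc j"]
        nat_pow_in_subring[OF subfieldE(1)[OF Lj[OF Suc.prems]]] by auto
    have qS: "q (Suc j) = q j \<otimes> z j [^] \<mu> j" using q(2) Suc.prems by simp
    show ?case using Suc * Ljmono[of j "Suc j"] subringE(6)[OF subfieldE(1)[OF Lj[OF Suc.prems]]] mult_nonzero
      unfolding qS by auto
  qed
  \<comment> \<open>For positive \<open>j\<close> this means \<open>z j = z 0 * q j * Y j\<close>.
    In \<open>K[Y]\<close> every \<open>z j\<close> becomes divisible by \<open>z 0\<close>, and the
    generators \<open>z j \<otimes> inv (q j)\<close> become \<open>z 0\<close> times elements of
    that ring.\<close>
  define Y where "Y j = (if j = 0 then z 0 else z j \<otimes> inv (z 0 \<otimes> q j))" for j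
  have iq: "inv (z 0 \<otimes> q j) \<in> fracs (pring K z j)" "inv (z 0 \<otimes> q j) \<noteq> \<zero>" "inv (z 0 \<otimes> q j) \<in> carrier R"
      "z 0 \<otimes> q j \<noteq> \<zero>" "z 0 \<otimes> q j \<in> carrier R"
    if j: "0 < j" "j < e" for j
  proof -
    have 1: "z 0 \<otimes> q j \<in> fracs (pring K z j)" "z 0 \<otimes> q j \<noteq> \<zero>"
      using qz[of j] j zL[of 0 j] z0[of 0] zc[of 0] mult_nonzero subringE(6)[OF subfieldE(1)[OF Lj[of j]]] by auto
    then show "inv (z 0 \<otimes> q j) \<in> fracs (pring K z j)" "inv (z 0 \<otimes> q j) \<noteq> \<zero>"
      using subfield_m_inv[OF Lj[of j], of "z 0 \<otimes> q j"] j by auto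
    then show "inv (z 0 \<otimes> q j) \<in> carrier R" using subfieldE(3)[OF Lj[of j]] j by auto
    show "z 0 \<otimes> q j \<noteq> \<zero>" "z 0 \<otimes> q j \<in> carrier R" using 1 qz[of j] zc[of 0] j by auto
  qed
  have Yc: "Y j \<in> carrier R" if "j < e" for j using iq[of j] zc that unfolding Y_def by auto
  have YL: "pring K Y j \<subseteq> fracs (pring K z j)" if "j \<le> e" for j
  proof (rule pring_least[OF subfieldE(1)[OF Lj[OF that]]])
    show "K \<subseteq> fracs (pring K z j)" using fracs_incl[OF Pz[OF that]] pring_base by fastforce
    fix i assume i: "i < j"
    show "Y i \<in> fracs (pring K z j)"
    proof (cases "i = 0")
      case True
      then show ?thesis using zL[OF i that] by (simp add: Y_def)
    next
      case False
      then have "inv (z 0 \<otimes> q i) \<in> fracs (pring K z j)" using iq(1)[of i] Ljmono[of i j] i that by auto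
      then show ?thesis using False zL[OF i that] subringE(6)[OF subfieldE(1)[OF Lj[OF that]]] by (auto simp: Y_def)
    qed
  qed
  have PY: "subring (pring K Y j) R" if "j \<le> e" for j using Yc that Kc by (intro pring_subring) auto
  have Y: "alg_indep K Y e"
    unfolding alg_indep_def
  proof (intro allI impI conjI)
    fix j assume j: "j < e"
    show "Y j \<in> carrier R" by (rule Yc[OF j])
    have t: "(transcendental over (fracs (pring K z j))) (z j)"
      using transcendental_fracs[OF Pz zc zt] j by auto
    \<comment> \<open>\<open>Y j\<close> is \<open>z j\<close> times a nonzero element of the
      fraction field of the earlier variables, so transcendence is inherited.\<close>
    have "(transcendental over (fracs (pring K z j))) (Y j)"
    proof (cases "j = 0")
      case True
      then show ?thesis using t by (simp add: Y_def)
    next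
      case False
      then show ?thesis using transcendental_scale[OF Lj zc t iq(1,2)[of j]] j by (simp add: Y_def)
    qed
    then have t': "eval p (Y j) = \<zero> \<Longrightarrow> p \<in> carrier ((fracs (pring K z j))[X]) \<Longrightarrow> p = []" for p
      using eval_transcendental by blast
    show "(transcendental over (pring K Y j)) (Y j)"
    proof (rule transcendentalI[OF PY Yc[OF j]])
      fix p assume "p \<in> carrier ((pring K Y j)[X])" "eval p (Y j) = \<zero>"
      then show "p = []" using t'[of p] YL[of j] j by (auto simp: univ_poly_carrier[symmetric] polynomial_def)
    qed (use j in auto)
  qed
  define C where "C = pring K Y e"
  have C: "subring C R" "comp_int_closed C" unfolding C_def using PY comp_int_closed_pring[OF K Y] by auto
  note Cc = subringE(1)[OF C(1)] and Ccl = subringE(2,3,5,6,7)[OF C(1)]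
  have YC: "Y j \<in> C" if "j < e" for j unfolding C_def by (rule pring_gen[OF that])
  have z0C: "z 0 \<in> C" using YC[of 0] False by (simp add: Y_def)
  \<comment> \<open>Both claims need a joint induction: \<open>q (Suc j)\<close> lies in
    \<open>C\<close> because \<open>z j\<close> does, and \<open>z (Suc j)\<close> is a multiple of
    \<open>z 0\<close> because \<open>q (Suc j)\<close> lies in \<open>C\<close>.\<close>
  have zmult: "\<exists>\<beta>\<in>C. z j = z 0 \<otimes> \<beta>" and qC: "q j \<in> C" if "j < e" for j
  proof -
    have "q j \<in> C \<and> (\<exists>\<beta>\<in>C. z j = z 0 \<otimes> \<beta>)" using that
    proof (induction j)
      case 0
      then show ?case using q Ccl zc[of 0] by (auto intro!: bexI[of _ \<one>])
    next
      case (Suc j)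
      then have "z j \<in> C" using z0C Ccl by auto
      moreover have qS: "q (Suc j) = q j \<otimes> z j [^] \<mu> j" using q(2) Suc.prems by simp
      ultimately have qq: "q (Suc j) \<in> C" unfolding qS using Suc Ccl nat_pow_in_subring[OF C(1)] by auto
      have c: "z (Suc j) \<in> carrier R" "z 0 \<in> carrier R" "q (Suc j) \<in> carrier R"
        using zc Suc.prems qz[of "Suc j"] by auto
      note i = iq[of "Suc j"]
      have "z 0 \<otimes> (Y (Suc j) \<otimes> q (Suc j)) = (inv (z 0 \<otimes> q (Suc j)) \<otimes> (z 0 \<otimes> q (Suc j))) \<otimes> z (Suc j)"
        unfolding Y_def using c i(3) Suc.prems by simp algebra
      also have "\<dots> = z (Suc j)" using inv_mult_cancel(2)[of "z 0 \<otimes> q (Suc j)"] i Suc.prems c by auto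
      finally have "z (Suc j) = z 0 \<otimes> (Y (Suc j) \<otimes> q (Suc j))" by simp
      then show ?case using qq YC[OF Suc.prems] Ccl by auto
    qed
    then show "\<exists>\<beta>\<in>C. z j = z 0 \<otimes> \<beta>" "q j \<in> C" by auto
  qed
  have zC: "z j \<in> C" if "j < e" for j using zmult[OF that] z0C Ccl by auto
  have BC: "B \<subseteq> C" unfolding B_def
    using zC by (intro pring_least[OF C(1)]) (auto simp: C_def pring_base)
  have CL: "C \<subseteq> L" unfolding C_def L_def B_def by (rule YL) simp
  have fC: "fracs C = L"
  proof
    show "fracs C \<subseteq> L" by (rule fracs_least[OF L CL])
    show "L \<subseteq> fracs C" unfolding L_def
      using BC fracs_incl[OF C(1)] by (intro fracs_least[OF fracs_subfield[OF C(1)]]) auto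
  qed
  have Wc: "W \<subseteq> carrier R" using W Ac by auto
  \<comment> \<open>\<open>M\<close> is closed under products because the products of elements of
    \<open>W\<close> lie in \<open>A\<close>. It is a ring between \<open>A\<close> and the field,
    generated over \<open>C\<close> as a module by the finite set \<open>W\<close>.\<close>
  define M where "M = lspan C W"
  have AM: "A \<subseteq> M" unfolding M_def using W(3) lspan_mono[OF BC, of W W] by (auto simp: B_def)
  have Mmult: "x \<otimes> y \<in> M" if "x \<in> M" "y \<in> M" for x y
  proof -
    have WW: "v \<otimes> w \<in> lspan C W" if "v \<in> W" "w \<in> W" for v w
    proof -
      have "v \<in> A" "w \<in> A" using that W(2) by auto
      then have "v \<otimes> w \<in> A" by (rule Acl(4))
      then show ?thesis using subsetD[OF AM] unfolding M_def by simp
    qed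
    show ?thesis unfolding M_def by (rule lspan_mult[OF C(1) Wc Wc Wc WW that[unfolded M_def]])
  qed
  have CM: "c \<otimes> x \<in> M" if "c \<in> C" "x \<in> M" for c x
    using that unfolding M_def by (intro lspan_smult_closed[OF C(1) Wc])
  have oneM: "\<one> \<in> M" using AM Acl by auto
  define w where "w = inv (z 0)"
  have w: "w \<in> carrier R" "z 0 \<otimes> w = \<one>" "w \<otimes> z 0 = \<one>" "w \<noteq> \<zero>"
    using inv_nonzero_closed inv_mult_cancel[of "z 0"] z0[of 0] zc[of 0] False
      unfolding w_def by (auto simp: nonzero_imp_inverse_nonzero)
  have z00: "z 0 \<in> carrier R" using zc False by auto
  \<comment> \<open>Here \<open>w\<close> is the inverse of \<open>z 0\<close>. It carries each
    generator of the span that contains \<open>u\<close> into \<open>C\<close>, so \<open>t\<close>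
    and all its powers lie in \<open>M\<close>.\<close>
  define t where "t = w \<otimes> u"
  have uc: "u \<in> carrier R" using u Ac by auto
  have tc: "t \<in> carrier R" unfolding t_def using w uc by auto
  have "lspan A ((\<lambda>j. z j \<otimes> inv (q j)) ` {..<e}) \<subseteq> {x \<in> carrier R. w \<otimes> x \<in> M}"
  proof (rule lspan_least)
    show "\<zero> \<in> {x \<in> carrier R. w \<otimes> x \<in> M}" using w by (simp add: M_def lspan.zero)
    fix a v x assume a: "a \<in> A" and "v \<in> (\<lambda>j. z j \<otimes> inv (q j)) ` {..<e}"
      and x: "x \<in> {x \<in> carrier R. w \<otimes> x \<in> M}"
    then obtain j where j: "j < e" "v = z j \<otimes> inv (q j)" by auto
    have iqc: "inv (q j) \<in> carrier R" using qz[of j] j inv_nonzero_closed by auto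
    have ac: "a \<in> carrier R" using a Ac by auto
    have "w \<otimes> v \<in> C"
    proof (cases "j = 0")
      case True
      have "inv \<one> = \<one>" by simp
      then show ?thesis using True j w q z00 Ccl by (simp add: m_assoc[symmetric])
    next
      case False
      have "inv (z 0 \<otimes> q j) = inv (q j) \<otimes> w"
      proof -
        have "(z 0 \<otimes> q j) \<otimes> (inv (q j) \<otimes> w) = (z 0 \<otimes> w) \<otimes> (q j \<otimes> inv (q j))"
        proof -
          have "q j \<in> carrier R" using qz[of j] j by simp
          then show ?thesis using iqc w(1) z00 by algebra
        qed
        then have "(z 0 \<otimes> q j) \<otimes> (inv (q j) \<otimes> w) = \<one>"
          using inv_mult_cancel(1)[of "q j"] qz[of j] j w by simp
        then show ?thesis using iqc w qz[of j] j z00 by (intro comm_inv_char) auto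
      qed
      then have "w \<otimes> v = Y j" using False j zc[of j] iqc w by (simp add: Y_def m_ac)
      then show ?thesis using YC j by simp
    qed
    then have "(w \<otimes> v) \<otimes> a \<in> M" using a AM CM by auto
    moreover have "w \<otimes> (a \<otimes> v) = (w \<otimes> v) \<otimes> a" using w(1) ac iqc zc[OF j(1)] unfolding j(2) by algebra
    moreover have "w \<otimes> (a \<otimes> v \<oplus> x) = w \<otimes> (a \<otimes> v) \<oplus> w \<otimes> x"
      using x w(1) ac iqc zc[OF j(1)] unfolding j(2) by (intro r_distr) auto
    ultimately show "a \<otimes> v \<oplus> x \<in> {x \<in> carrier R. w \<otimes> x \<in> M}"
      using x ac iqc zc[OF j(1)] lspan_add_closed[OF Cc Wc] unfolding j(2) M_def by simp
  qed
  then have "t \<in> M" using u(2) unfolding t_def by auto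
  then have tM: "t [^] n \<in> lspan C W" for n :: nat
    using oneM Mmult unfolding M_def[symmetric] by (induction n) auto
  have uB: "u [^] n \<in> lspan B W" for n :: nat
    using nat_pow_in_subring[OF A(1) u(1)] W(3) unfolding B_def by auto
  have up: "u [^] n \<in> carrier R" "t [^] n \<in> carrier R" "w [^] n \<in> carrier R" for n :: nat using uc tc w by auto
  \<comment> \<open>The least \<open>k\<close> with this property is the degree of \<open>u\<close>
    over \<open>L\<close>. The powers of \<open>t\<close> span the same spaces, since
    \<open>w\<close> and \<open>z 0\<close> are units of \<open>L\<close>.\<close>
  define dep where "dep k \<longleftrightarrow> u [^] k \<in> lspan L ((\<lambda>i. u [^] i) ` {..<k})" for k :: nat
  have "\<exists>k. dep k"
    unfolding dep_def
    using lspan_descending_member[OF L W(1) Wc, of "Suc (card W)" "\<lambda>i. u [^] i"] uB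
      lspan_mono[OF fracs_incl[OF B(1)], of W W] unfolding L_def by blast
  define k where "k = (LEAST k. dep k)"
  have k: "dep k" unfolding k_def using \<open>\<exists>k. dep k\<close> by (rule LeastI_ex)
  have kl: "\<not> dep i" if "i < k" for i using not_less_Least that unfolding k_def by blast
  have k0: "0 < k"
  proof (rule ccontr)
    assume "\<not> 0 < k"
    then have "\<one> \<in> lspan L {}" using k unfolding dep_def by simp
    moreover have "lspan L {} \<subseteq> {\<zero>}" by (rule lspan_least) auto
    ultimately show False by auto
  qed
  have nd: "u [^] (k - 1) \<notin> lspan L ((\<lambda>i. u [^] i) ` {..<k - 1})" using kl[of "k - 1"] k0 unfolding dep_def by auto
  obtain \<alpha> where \<alpha>: "\<alpha> \<in> {..<k} \<rightarrow> L" "u [^] k = (\<Oplus>i\<in>{..<k}. \<alpha> i \<otimes> u [^] i)"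
    using lspan_image_finite[OF Ls _ _ k[unfolded dep_def]] up by auto
  have \<alpha>c: "\<alpha> i \<in> carrier R" if "i < k" for i using \<alpha>(1) Lc that by auto
  define b where "b j = (if j = 0 then \<one> else \<ominus> \<alpha> (k - j))" for j
  have bL: "b j \<in> L" if "j \<le> k" for j
    using \<alpha>(1) that subringE(3,5)[OF Ls] unfolding b_def by (auto simp: Pi_iff)
  have bc: "b j \<in> carrier R" if "j \<le> k" for j using bL[OF that] Lc by auto
  have split: "{..k} = insert 0 {1..k}" by auto
  have sum0: "(\<Oplus>j\<in>{..k}. b j \<otimes> u [^] (k - j)) = u [^] k \<oplus> (\<Oplus>j\<in>{1..k}. b j \<otimes> u [^] (k - j))"
  proof -
    have "b 0 = \<one>" by (simp add: b_def)
    then show ?thesis unfolding split using bc up by (subst finsum_insert) auto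
  qed
  have "(\<Oplus>j\<in>{1..k}. b j \<otimes> u [^] (k - j)) = (\<Oplus>j\<in>{1..k}. (\<ominus> \<one>) \<otimes> (\<alpha> (k - j) \<otimes> u [^] (k - j)))"
    using \<alpha>c up by (intro finsum_cong') (auto simp: b_def l_minus)
  also have "\<dots> = (\<Oplus>i\<in>(\<lambda>j. k - j) ` {1..k}. (\<ominus> \<one>) \<otimes> (\<alpha> i \<otimes> u [^] i))"
    using \<alpha>c up by (intro finsum_reindex[symmetric]) (auto simp: inj_on_def)
  also have "(\<lambda>j. k - j) ` {1..k} = {..<k}"
  proof -
    have "i \<in> (\<lambda>j. k - j) ` {1..k}" if "i < k" for i using that by (intro image_eqI[of _ _ "k - i"]) auto
    then show ?thesis by auto
  qed
  also have "(\<Oplus>i\<in>{..<k}. (\<ominus> \<one>) \<otimes> (\<alpha> i \<otimes> u [^] i)) = (\<ominus> \<one>) \<otimes> u [^] k"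
    unfolding \<alpha>(2) using \<alpha>c up by (intro finsum_rdistr[symmetric]) auto
  finally have rel: "(\<Oplus>j\<in>{..k}. b j \<otimes> u [^] (k - j)) = \<zero>"
    unfolding sum0 using up[of k] by (simp add: l_minus r_neg)
  have bB: "b j \<in> B" if "j \<le> k" for j
    using minimal_relation_coeffs[OF B W(1) Wc uc uB k0 _ _ _ rel that] nd bL unfolding L_def b_def by auto
  have wL: "w \<in> L" unfolding w_def L_def B_def
    using subfield_m_inv(1)[OF Lj[of e], of "z 0"] zL[of 0 e] z0[of 0] False by auto
  have tu: "t [^] n = w [^] n \<otimes> u [^] n" for n :: nat unfolding t_def using w uc by (simp add: nat_pow_distrib)
  have zw: "z 0 [^] n \<otimes> w [^] n = \<one>" for n :: nat
    using w z00 by (simp add: nat_pow_distrib[symmetric])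
  \<comment> \<open>The minimal relation of \<open>t = u / z 0\<close> arises from that of
    \<open>u\<close> on division by \<open>z 0 [^] k\<close>, so that \<open>b j\<close> is divided
    by \<open>z 0 [^] j\<close>. Knowing that the quotient lies in \<open>C\<close> makes
    \<open>b j\<close> divisible by \<open>z 0\<close> there for positive \<open>j\<close>.\<close>
  define b' where "b' j = b j \<otimes> w [^] j" for j
  have b'C: "b' j \<in> C" if j: "j \<le> k" for j
  proof (rule minimal_relation_coeffs[OF C W(1) Wc tc tM k0 _ _ _ _ j])
    have uts: "lspan L ((\<lambda>i. t [^] i) ` {..<k - 1}) \<subseteq> lspan L ((\<lambda>i. u [^] i) ` {..<k - 1})"
    proof (rule lspan_subset[OF Ls])
      show "(\<lambda>i. t [^] i) ` {..<k - 1} \<subseteq> lspan L ((\<lambda>i. u [^] i) ` {..<k - 1})"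
      proof
        fix y assume "y \<in> (\<lambda>i. t [^] i) ` {..<k - 1}"
        then obtain i where i: "i < k - 1" "y = w [^] i \<otimes> u [^] i" unfolding tu by auto
        show "y \<in> lspan L ((\<lambda>i. u [^] i) ` {..<k - 1})"
          unfolding i(2) using up i(1) nat_pow_in_subring[OF Ls wL]
          by (intro lspan_smult_closed[OF Ls] lspan_incl[OF Ls]) auto
      qed
    qed (use up in auto)
    show "t [^] (k - 1) \<notin> lspan (fracs C) ((\<lambda>i. t [^] i) ` {..<k - 1})"
    proof
      assume "t [^] (k - 1) \<in> lspan (fracs C) ((\<lambda>i. t [^] i) ` {..<k - 1})"
      then have "t [^] (k - 1) \<in> lspan L ((\<lambda>i. u [^] i) ` {..<k - 1})" using uts unfolding fC by auto
      moreover have "z 0 [^] (k - 1) \<in> L"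
        using nat_pow_in_subring[OF Ls] zL[of 0 e] False unfolding L_def B_def by auto
      ultimately have "z 0 [^] (k - 1) \<otimes> t [^] (k - 1) \<in> lspan L ((\<lambda>i. u [^] i) ` {..<k - 1})"
        using up by (intro lspan_smult_closed[OF Ls]) auto
      also have "z 0 [^] (k - 1) \<otimes> t [^] (k - 1) = u [^] (k - 1)"
        unfolding tu using zw[of "k - 1"] z00 up m_assoc[of "z 0 [^] (k - 1)" "w [^] (k - 1)" "u [^] (k - 1)"] by simp
      finally show False using nd by simp
    qed
    show "b' j \<in> fracs C" if "j \<le> k" for j
      unfolding b'_def fC using bL[OF that] nat_pow_in_subring[OF Ls wL] subringE(6)[OF Ls] by auto
    show "b' 0 = \<one>" by (simp add: b'_def b_def)
    have "(\<Oplus>j\<in>{..k}. b' j \<otimes> t [^] (k - j)) = (\<Oplus>j\<in>{..k}. w [^] k \<otimes> (b j \<otimes> u [^] (k - j)))"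
    proof (intro finsum_cong' refl)
      show "(\<lambda>j. w [^] k \<otimes> (b j \<otimes> u [^] (k - j))) \<in> {..k} \<rightarrow> carrier R" using bc up by auto
      fix j assume "j \<in> {..k}"
      then have j: "j \<le> k" by simp
      have "w [^] k = w [^] j \<otimes> w [^] (k - j)" using w j by (simp add: nat_pow_mult)
      then show "b' j \<otimes> t [^] (k - j) = w [^] k \<otimes> (b j \<otimes> u [^] (k - j))"
        unfolding b'_def tu using up bc[OF j] by (simp add: m_ac)
    qed
    also have "\<dots> = w [^] k \<otimes> (\<Oplus>j\<in>{..k}. b j \<otimes> u [^] (k - j))"
      using bc up by (intro finsum_rdistr[symmetric]) auto
    finally show "(\<Oplus>j\<in>{..k}. b' j \<otimes> t [^] (k - j)) = \<zero>" using rel up by simp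
  qed
  \<comment> \<open>The elements of \<open>B\<close> that differ from some constant by an element of
    both \<open>P\<close> and \<open>z 0 * C\<close>. They form a subring that contains
    \<open>K\<close> and all \<open>z j\<close>, hence all of \<open>B\<close>; the constant plays
    the part of the constant term.\<close>
  define T where "T = {x \<in> B. \<exists>\<kappa>\<in>K. x \<ominus> \<kappa> \<in> P \<and> (\<exists>\<beta>\<in>C. x \<ominus> \<kappa> = z 0 \<otimes> \<beta>)}"
  have TI: "x \<in> T" if "x \<in> B" "\<kappa> \<in> K" "\<beta> \<in> C" "x \<ominus> \<kappa> = z 0 \<otimes> \<beta>" "x \<ominus> \<kappa> \<in> P" for x \<kappa> \<beta>
    unfolding T_def using that by blast
  have BA: "B \<subseteq> A" using A(2) unfolding B_def .
  have T: "B \<subseteq> T"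
  proof -
    have "subring T R"
    proof (rule subringI)
      show "T \<subseteq> carrier R" using Bc by (auto simp: T_def)
      have "\<one> \<ominus> \<one> = z 0 \<otimes> \<zero>" using z00 by (simp add: a_minus_def r_neg)
      moreover have "\<one> \<ominus> \<one> = \<zero>" by (simp add: a_minus_def r_neg)
      ultimately have "\<one> \<ominus> \<one> \<in> P \<and> (\<exists>\<beta>\<in>C. \<one> \<ominus> \<one> = z 0 \<otimes> \<beta>)" using P(2) Ccl(1) by metis
      then show "\<one> \<in> T" using subringE(3)[OF Ks] subringE(3)[OF B(1)] unfolding T_def by blast
    next
      fix x assume "x \<in> T"
      then obtain \<kappa> \<beta> where x: "x \<in> B" "\<kappa> \<in> K" "x \<ominus> \<kappa> \<in> P" "\<beta> \<in> C" "x \<ominus> \<kappa> = z 0 \<otimes> \<beta>" unfolding T_def by auto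
      have c: "x \<in> carrier R" "\<kappa> \<in> carrier R" "\<beta> \<in> carrier R" using x Bc Kc Cc by auto
      have "\<ominus> x \<ominus> (\<ominus> \<kappa>) = (\<ominus> \<one>) \<otimes> (x \<ominus> \<kappa>)" using c by algebra
      moreover have "(\<ominus> \<one>) \<otimes> (x \<ominus> \<kappa>) = z 0 \<otimes> (\<ominus> \<beta>)" unfolding x(5) using c z00 by algebra
      moreover have "(\<ominus> \<one>) \<otimes> (x \<ominus> \<kappa>) \<in> P" using P(4) x(3) Acl by auto
      ultimately show "\<ominus> x \<in> T"
        using x subringE(5)[OF B(1)] subringE(5)[OF Ks] Ccl(3) by (intro TI[of _ "\<ominus> \<kappa>" "\<ominus> \<beta>"]) auto
    next
      fix x y assume "x \<in> T" "y \<in> T"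
      then obtain \<kappa> \<beta> \<kappa>' \<beta>' where x: "x \<in> B" "\<kappa> \<in> K" "x \<ominus> \<kappa> \<in> P" "\<beta> \<in> C" "x \<ominus> \<kappa> = z 0 \<otimes> \<beta>"
        and y: "y \<in> B" "\<kappa>' \<in> K" "y \<ominus> \<kappa>' \<in> P" "\<beta>' \<in> C" "y \<ominus> \<kappa>' = z 0 \<otimes> \<beta>'" unfolding T_def by auto
      have c: "x \<in> carrier R" "\<kappa> \<in> carrier R" "\<beta> \<in> carrier R" "y \<in> carrier R" "\<kappa>' \<in> carrier R" "\<beta>' \<in> carrier R"
        using x y Bc Kc Cc by auto
      have "x \<oplus> y \<ominus> (\<kappa> \<oplus> \<kappa>') = (x \<ominus> \<kappa>) \<oplus> (y \<ominus> \<kappa>')" using c by algebra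
      moreover have "(x \<ominus> \<kappa>) \<oplus> (y \<ominus> \<kappa>') = z 0 \<otimes> (\<beta> \<oplus> \<beta>')" unfolding x(5) y(5) using c z00 by algebra
      moreover have "(x \<ominus> \<kappa>) \<oplus> (y \<ominus> \<kappa>') \<in> P" using P(3) x(3) y(3) by auto
      ultimately show "x \<oplus> y \<in> T"
        using x y subringE(7)[OF B(1)] subringE(7)[OF Ks] Ccl(5)
        by (intro TI[of _ "\<kappa> \<oplus> \<kappa>'" "\<beta> \<oplus> \<beta>'"]) auto
      have 1: "x \<otimes> y \<ominus> \<kappa> \<otimes> \<kappa>' = x \<otimes> (y \<ominus> \<kappa>') \<oplus> \<kappa>' \<otimes> (x \<ominus> \<kappa>)" using c by algebra
      have 2: "x \<otimes> (y \<ominus> \<kappa>') \<oplus> \<kappa>' \<otimes> (x \<ominus> \<kappa>) = z 0 \<otimes> (x \<otimes> \<beta>' \<oplus> \<kappa>' \<otimes> \<beta>)" unfolding x(5) y(5) using c z00 by algebra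
      have KB: "K \<subseteq> B" unfolding B_def by (rule pring_base)
      have 3: "x \<otimes> (y \<ominus> \<kappa>') \<oplus> \<kappa>' \<otimes> (x \<ominus> \<kappa>) \<in> P"
        using P(3,4) x y BA KB by (auto simp: subset_iff)
      have 4: "x \<otimes> \<beta>' \<oplus> \<kappa>' \<otimes> \<beta> \<in> C" using x y BC KB Ccl by (auto simp: subset_iff)
      show "x \<otimes> y \<in> T"
      proof (rule TI[OF _ _ 4])
        show "x \<otimes> y \<in> B" "\<kappa> \<otimes> \<kappa>' \<in> K" using x y subringE(6)[OF B(1)] subringE(6)[OF Ks] by auto
        show "x \<otimes> y \<ominus> \<kappa> \<otimes> \<kappa>' = z 0 \<otimes> (x \<otimes> \<beta>' \<oplus> \<kappa>' \<otimes> \<beta>)" using 1 2 by simp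
        show "x \<otimes> y \<ominus> \<kappa> \<otimes> \<kappa>' \<in> P" using 1 3 by simp
      qed
    qed
    moreover have "K \<subseteq> T"
    proof
      fix x assume x: "x \<in> K"
      then have "x \<ominus> x = \<zero>" "\<zero> = z 0 \<otimes> \<zero>" "x \<in> B" using Kc z00 subsetD[OF pring_base[of K z e]] unfolding B_def by (auto simp: a_minus_def r_neg)
      then have "x \<ominus> x \<in> P \<and> (\<exists>\<beta>\<in>C. x \<ominus> x = z 0 \<otimes> \<beta>)" "x \<in> B" using P(2) Ccl(1) by metis+
      then show "x \<in> T" unfolding T_def using x by blast
    qed
    moreover have "z j \<in> T" if j: "j < e" for j
    proof -
      have "z j \<ominus> \<zero> = z j" using zc[OF j] by (simp add: a_minus_def)
      then have "z j \<ominus> \<zero> \<in> P \<and> (\<exists>\<beta>\<in>C. z j \<ominus> \<zero> = z 0 \<otimes> \<beta>)" using zP[OF j] zmult[OF j] by simp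
      then show ?thesis
        using pring_gen[OF j, of z K] subringE(2)[OF Ks] unfolding T_def B_def by blast
    qed
    ultimately show ?thesis unfolding B_def by (intro pring_least)
  qed
  \<comment> \<open>\<open>b j\<close> is a multiple of \<open>z 0\<close> in \<open>C\<close>, and
    so is its difference from the constant \<kappa>. Thus \<kappa> is a multiple of
    \<open>z 0\<close> as well, which forces it to be zero because \<open>z 0 = Y 0\<close> is not a
    unit in \<open>C\<close>.\<close>
  have bP: "b j \<in> P" if j: "0 < j" "j \<le> k" for j
  proof -
    obtain \<kappa> \<beta> where \<kappa>: "\<kappa> \<in> K" "b j \<ominus> \<kappa> \<in> P" "\<beta> \<in> C" "b j \<ominus> \<kappa> = z 0 \<otimes> \<beta>"
      using bB[OF j(2)] T unfolding T_def by blast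
    obtain i where i: "j = Suc i" using j by (cases j) auto
    define \<beta>' where "\<beta>' = z 0 [^] i \<otimes> b' j"
    have \<beta>': "\<beta>' \<in> C" unfolding \<beta>'_def using b'C[OF j(2)] nat_pow_in_subring[OF C(1) z0C] Ccl by auto
    have c: "\<kappa> \<in> carrier R" "\<beta> \<in> carrier R" "\<beta>' \<in> carrier R" "b j \<in> carrier R" using \<kappa> \<beta>' Kc Cc bc[OF j(2)] by auto
    have "z 0 \<otimes> \<beta>' = (z 0 [^] j \<otimes> w [^] j) \<otimes> b j"
    proof -
      have "z 0 [^] i \<in> carrier R" "w [^] i \<in> carrier R" "b (Suc i) \<in> carrier R"
        using z00 up bc[OF j(2)] i by auto
      then show ?thesis unfolding \<beta>'_def b'_def i nat_pow_Suc using z00 w(1) by algebra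
    qed
    then have bj: "b j = z 0 \<otimes> \<beta>'" using zw[of j] bc[OF j(2)] by simp
    have "\<kappa> = \<zero>"
    proof (rule ccontr)
      assume "\<kappa> \<noteq> \<zero>"
      then have i\<kappa>: "inv \<kappa> \<in> K" "\<kappa> \<otimes> inv \<kappa> = \<one>" using subfield_m_inv[OF K, of \<kappa>] \<kappa>(1) by auto
      have ic: "inv \<kappa> \<in> carrier R" using i\<kappa> Kc by auto
      have "\<kappa> = b j \<ominus> (b j \<ominus> \<kappa>)" using c by algebra
      also have "\<dots> = z 0 \<otimes> (\<beta>' \<ominus> \<beta>)" unfolding \<kappa>(4) unfolding bj using c z00 by algebra
      finally have "\<kappa> \<otimes> inv \<kappa> = z 0 \<otimes> ((\<beta>' \<ominus> \<beta>) \<otimes> inv \<kappa>)" using c ic z00 by (simp add: m_assoc)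
      moreover have "(\<beta>' \<ominus> \<beta>) \<otimes> inv \<kappa> \<in> pring K Y e"
      proof -
        have "inv \<kappa> \<in> C" using i\<kappa> pring_base[of K Y e] unfolding C_def by auto
        then show ?thesis using \<beta>' \<kappa>(3) Ccl unfolding C_def[symmetric] a_minus_def by auto
      qed
      ultimately show False
        using unit_not_multiple_first[OF K Y order_refl] i\<kappa>(2) \<open>e \<noteq> 0\<close> by (simp add: Y_def) metis
    qed
    then show ?thesis using \<kappa>(2) c by (simp add: a_minus_def)
  qed
  have "(\<Oplus>j\<in>J. b j \<otimes> u [^] (k - j)) \<in> P" if "finite J" "J \<subseteq> {1..k}" for J
    using that
  proof (induction J rule: finite_induct)
    case empty
    then show ?case using P(2) by simp
  next
    case (insert j J)
    have "u [^] (k - j) \<otimes> b j \<in> P" using P(4) bP[of j] nat_pow_in_subring[OF A(1) u(1)] insert.prems by auto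
    moreover have "u [^] (k - j) \<otimes> b j = b j \<otimes> u [^] (k - j)" using bc[of j] up insert.prems by (intro m_comm) auto
    moreover have "(\<Oplus>j\<in>insert j J. b j \<otimes> u [^] (k - j)) = b j \<otimes> u [^] (k - j) \<oplus> (\<Oplus>j\<in>J. b j \<otimes> u [^] (k - j))"
      using insert bc up by (intro finsum_insert) auto
    ultimately show ?case using insert P(3) by auto
  qed
  then have s: "(\<Oplus>j\<in>{1..k}. b j \<otimes> u [^] (k - j)) \<in> P" by auto
  have "u [^] k = (\<ominus> \<one>) \<otimes> (\<Oplus>j\<in>{1..k}. b j \<otimes> u [^] (k - j))"
  proof -
    define s where "s = (\<Oplus>j\<in>{1..k}. b j \<otimes> u [^] (k - j))"
    have sc: "s \<in> carrier R" using s P(1) Ac unfolding s_def by auto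
    have "u [^] k \<oplus> s = \<zero>" using rel sum0 unfolding s_def by simp
    then have "u [^] k = \<ominus> s" using sc up[of k] by (simp add: add.inv_equality minus_equality)
    then show ?thesis using sc unfolding s_def[symmetric] by (simp add: l_minus)
  qed
  then have "u [^] k \<in> P" using P(4)[OF _ s, of "\<ominus> \<one>"] Acl by auto
  then show ?thesis using P(5)[OF u(1)] k0 by auto
qed

end

section \<open>Independent elements of a module-finite extension\<close>

primrec (in ring) mon :: "(nat \<Rightarrow> 'a) \<Rightarrow> nat \<Rightarrow> (nat \<Rightarrow> nat) \<Rightarrow> 'a" where
  "mon z 0 m = \<one>"
| "mon z (Suc r) m = mon z r m \<otimes> z r [^] m r"

context cring
begin

lemma mon_closed: "(\<And>i. i < e \<Longrightarrow> z i \<in> carrier R) \<Longrightarrow> mon z e m \<in> carrier R"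
  by (induction e) auto

lemma mon_cong: "(\<And>i. i < e \<Longrightarrow> m i = m' i) \<Longrightarrow> mon z e m = mon z e m'"
  by (induction e) auto

lemma mon_add:
  "(\<And>i. i < e \<Longrightarrow> z i \<in> carrier R) \<Longrightarrow> mon z e m \<otimes> mon z e m' = mon z e (\<lambda>i. m i + m' i)"
proof (induction e)
  case (Suc e)
  have c: "mon z e m \<in> carrier R" "mon z e m' \<in> carrier R" "z e [^] m e \<in> carrier R" "z e [^] m' e \<in> carrier R"
    using Suc.prems by (auto intro: mon_closed)
  have "mon z (Suc e) m \<otimes> mon z (Suc e) m' = (mon z e m \<otimes> mon z e m') \<otimes> (z e [^] m e \<otimes> z e [^] m' e)"
    using c by (simp add: m_ac)
  then show ?case using Suc by (simp add: nat_pow_mult)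
qed auto

lemma mon_zero: "(\<And>i. i < e \<Longrightarrow> z i \<in> carrier R) \<Longrightarrow> mon z e (\<lambda>_. 0) = \<one>"
  by (induction e) auto

lemma mon_single:
  "(\<And>i. i < e \<Longrightarrow> z i \<in> carrier R) \<Longrightarrow> i < e \<Longrightarrow> mon z e (\<lambda>j. if j = i then 1 else 0) = z i"
proof (induction e)
  case (Suc e)
  show ?case
  proof (cases "i = e")
    case True
    have "mon z e (\<lambda>j. if j = i then 1 else 0) = mon z e (\<lambda>_. 0)" using True by (intro mon_cong) auto
    then show ?thesis using True Suc.prems mon_zero[of e z] by simp
  qed (use Suc in auto)
qed auto

lemma mon_in: "subring A R \<Longrightarrow> (\<And>i. i < e \<Longrightarrow> z i \<in> A) \<Longrightarrow> mon z e m \<in> A"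
  by (induction e) (auto simp: subringE(3,6) nat_pow_in_subring)

lemma prods_mult:
  assumes "H \<subseteq> carrier R" "y \<in> prods H m" shows "x \<in> prods H n \<Longrightarrow> x \<otimes> y \<in> prods H (n + m)"
proof (induction n arbitrary: x)
  case 0
  moreover have "y \<in> carrier R" using assms prods_carrier[OF assms(1)] by blast
  ultimately show ?case using assms by simp
next
  case (Suc n)
  then obtain h x' where x: "x = h \<otimes> x'" "h \<in> H" "x' \<in> prods H n" by auto
  have "x' \<otimes> y \<in> prods H (n + m)" by (rule Suc.IH[OF x(3)])
  moreover have "x \<otimes> y = h \<otimes> (x' \<otimes> y)"
    using x assms prods_carrier[OF assms(1)] by (auto simp: m_assoc subset_iff)
  ultimately show ?case using x(2) by auto
qed

lemma prods_pow: "H \<subseteq> carrier R \<Longrightarrow> h \<in> H \<Longrightarrow> h [^] n \<in> prods H n"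
proof (induction n)
  case (Suc n)
  then have "h \<otimes> h [^] n \<in> prods H (Suc n)" by auto
  then show ?case using Suc.prems by (simp add: m_comm subset_iff del: prods.simps)
qed auto

lemma pring_lspan_mon:
  assumes K: "subring K R" and z: "\<And>i. i < e \<Longrightarrow> z i \<in> carrier R"
  shows "pring K z e \<subseteq> lspan K (range (mon z e))"
proof (rule pring_least)
  have mc: "range (mon z e) \<subseteq> carrier R" using mon_closed[of e z] z by auto
  note Kc = subringE(1)[OF K]
  have one: "\<one> \<in> range (mon z e)" using mon_zero[of e z] z rangeI[of "mon z e" "\<lambda>_. 0"] by simp
  show "K \<subseteq> lspan K (range (mon z e))"
  proof
    fix a assume a: "a \<in> K"
    then have "a \<otimes> \<one> \<in> lspan K (range (mon z e))"
      by (intro lspan_smult_closed[OF K mc] lspan_incl[OF K mc] one)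
    then show "a \<in> lspan K (range (mon z e))" using a Kc by auto
  qed
  show "z i \<in> lspan K (range (mon z e))" if "i < e" for i
    using mon_single[of e z i] z that by (intro lspan_incl[OF K mc]) (auto intro: range_eqI[OF sym])
  show "subring (lspan K (range (mon z e))) R"
  proof (rule subringI)
    show "lspan K (range (mon z e)) \<subseteq> carrier R" by (rule lspan_carrier[OF Kc mc])
    show "\<one> \<in> lspan K (range (mon z e))" by (rule lspan_incl[OF K mc one])
    fix h k assume hk: "h \<in> lspan K (range (mon z e))"
    then show "\<ominus> h \<in> lspan K (range (mon z e))" by (rule lspan_uminus_closed[OF K mc])
    assume k: "k \<in> lspan K (range (mon z e))"
    show "h \<oplus> k \<in> lspan K (range (mon z e))" by (rule lspan_add_closed[OF Kc mc hk k])
    show "h \<otimes> k \<in> lspan K (range (mon z e))"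
    proof (rule lspan_mult[OF K mc mc mc _ hk k])
      fix v w assume "v \<in> range (mon z e)" "w \<in> range (mon z e)"
      then show "v \<otimes> w \<in> lspan K (range (mon z e))"
        using mon_add[of e z] z by (intro lspan_incl[OF K mc]) auto
    qed
  qed
qed

end

context field
begin

text \<open>The monomials are enumerated by writing the index in base \<open>s + 1\<close>, with the
  exponent of the last variable as the leading digit. Its powers are then met in increasing order,
  and it is enough to look at the coefficient of the highest one.\<close>

lemma independent_monomials:
  assumes K: "subfield K R" and b: "alg_indep K b e"
  shows "\<exists>v. (\<forall>i<(s + 1) ^ e. v i \<in> carrier R \<and> v i \<notin> lspan K (v ` {..<i}) \<and>
      (\<exists>m. (\<forall>j<e. m j \<le> s) \<and> v i = mon b e m))"
  using b
proof (induction e)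
  case 0
  have "lspan K {} \<subseteq> {\<zero>}" by (rule lspan_least) auto
  then show ?case by (intro exI[of _ "\<lambda>_. \<one>"]) auto
next
  case (Suc e)
  note Ks = subfieldE(1)[OF K] and Kc = subfieldE(3)[OF K]
  have bc: "b j \<in> carrier R" if "j \<le> e" for j using Suc.prems that unfolding alg_indep_def by auto
  have t: "(transcendental over (pring K b e)) (b e)" using Suc.prems unfolding alg_indep_def by auto
  have P: "subring (pring K b e) R" using bc Kc by (intro pring_subring) auto
  note Pc = subringE(1)[OF P] and Pcl = subringE(2,3,5,6,7)[OF P]
  obtain v where v: "\<And>i. i < (s + 1) ^ e \<Longrightarrow> v i \<in> carrier R"
      "\<And>i. i < (s + 1) ^ e \<Longrightarrow> v i \<notin> lspan K (v ` {..<i})"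
      "\<And>i. i < (s + 1) ^ e \<Longrightarrow> \<exists>m. (\<forall>j<e. m j \<le> s) \<and> v i = mon b e m"
  proof -
    have "alg_indep K b e" using alg_indep_mono[OF Suc.prems] by simp
    from Suc.IH[OF this] show ?thesis using that by auto
  qed
  define q where "q = (s + 1) ^ e"
  have q0: "0 < q" unfolding q_def by simp
  have vP: "v i \<in> pring K b e" if "i < q" for i
    using v(3)[of i] that mon_in[OF P, of e b] pring_gen[of _ e b K] unfolding q_def by auto
  define x where "x = b e"
  have xc: "x \<in> carrier R" unfolding x_def using bc by simp
  have xp: "x [^] n \<in> carrier R" for n :: nat using xc by simp
  define w where "w n = v (n mod q) \<otimes> x [^] (n div q)" for n
  have add_term: "\<exists>p'. length p' = length p \<and> set p' \<subseteq> pring K b e \<and> eval p' x = y \<otimes> x [^] j \<oplus> eval p x"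
    if "set p \<subseteq> pring K b e" "y \<in> pring K b e" "j < length p" for p y j
    using that
  proof (induction p)
    case (Cons a p)
    have c: "a \<in> carrier R" "y \<in> carrier R" "eval p x \<in> carrier R"
      using Cons.prems Pc eval_in_carrier[OF _ xc, of p] by auto
    show ?case
    proof (cases "j = length p")
      case True
      have "eval ((y \<oplus> a) # p) x = y \<otimes> x [^] j \<oplus> eval (a # p) x"
        using True c xp[of "length p"] by simp algebra
      then show ?thesis using Cons.prems Pcl by (intro exI[of _ "(y \<oplus> a) # p"]) auto
    next
      case False
      then obtain p' where p': "length p' = length p" "set p' \<subseteq> pring K b e" "eval p' x = y \<otimes> x [^] j \<oplus> eval p x"
        using Cons by auto
      have "eval (a # p') x = y \<otimes> x [^] j \<oplus> eval (a # p) x"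
        using p' c xp[of "length p"] xp[of j] by simp algebra
      then show ?thesis using p' Cons.prems by (intro exI[of _ "a # p'"]) auto
    qed
  qed auto
  have "w n \<notin> lspan K (w ` {..<n})" if n: "n < q * (s + 1)" for n
  proof
    assume wn: "w n \<in> lspan K (w ` {..<n})"
    define i j where "i = n mod q" and "j = n div q"
    have i: "i < q" unfolding i_def using q0 by simp
    have vi: "v ` {..<i} \<subseteq> carrier R" using v(1) i unfolding q_def by auto
    \<comment> \<open>An upper bound for the span of the earlier monomials: a list of length
      \<open>j\<close> is a polynomial of degree below \<open>j\<close> in \<open>x\<close>, and the
      coefficient at \<open>x [^] j\<close> is confined to the span of the earlier
      \<open>v\<close>.\<close>
    define T where "T = {eval p x \<oplus> y \<otimes> x [^] j | p y. set p \<subseteq> pring K b e \<and> length p = j \<and> y \<in> lspan K (v ` {..<i})}"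
    have "lspan K (w ` {..<n}) \<subseteq> T"
    proof (rule lspan_least)
      have "eval (replicate j \<zero>) x = \<zero>" using eval_replicate[of "[]" x j] xc by simp
      moreover have "set (replicate j \<zero>) \<subseteq> pring K b e" using Pcl by auto
      moreover have "\<zero> = \<zero> \<oplus> \<zero> \<otimes> x [^] j" using xp by simp
      ultimately show "\<zero> \<in> T" unfolding T_def using lspan.zero
        by (intro CollectI exI[of _ "replicate j \<zero>"] exI[of _ \<zero>]) auto
      fix \<kappa> u y assume \<kappa>: "\<kappa> \<in> K" and "u \<in> w ` {..<n}" and "y \<in> T"
      then obtain n' p y' where n': "n' < n" "u = w n'" and p: "set p \<subseteq> pring K b e" "length p = j"
        "y' \<in> lspan K (v ` {..<i})" "y = eval p x \<oplus> y' \<otimes> x [^] j" unfolding T_def by auto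
      define i' j' where "i' = n' mod q" and "j' = n' div q"
      have i': "i' < q" unfolding i'_def using q0 by simp
      have c: "\<kappa> \<in> carrier R" "v i' \<in> carrier R" "eval p x \<in> carrier R" "y' \<in> carrier R"
        using \<kappa> Kc v(1)[of i'] i' p Pc eval_in_carrier[OF _ xc, of p] lspan_carrier[OF Kc vi]
        unfolding q_def by auto
      have u: "u = v i' \<otimes> x [^] j'" unfolding n' w_def i'_def j'_def by simp
      have jj: "j' \<le> j" unfolding j_def j'_def using n' by (intro div_le_mono) auto
      show "\<kappa> \<otimes> u \<oplus> y \<in> T"
      proof (cases "j' = j")
        case True
        then have "i' < i" using n'(1) div_mult_mod_eq[of n q] div_mult_mod_eq[of n' q]
          unfolding i_def i'_def j_def j'_def by (metis nat_add_left_cancel_less)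
        then have "\<kappa> \<otimes> v i' \<oplus> y' \<in> lspan K (v ` {..<i})" using \<kappa> p by (intro lspan.add) auto
        moreover have "\<kappa> \<otimes> u \<oplus> y = eval p x \<oplus> (\<kappa> \<otimes> v i' \<oplus> y') \<otimes> x [^] j"
          unfolding u p True using c xp[of j] by algebra
        ultimately show ?thesis unfolding T_def using p by blast
      next
        case False
        have "\<kappa> \<otimes> v i' \<in> pring K b e" using \<kappa> vP[OF i'] pring_base[of K b e] Pcl by auto
        then obtain p' where p': "length p' = length p" "set p' \<subseteq> pring K b e"
            "eval p' x = (\<kappa> \<otimes> v i') \<otimes> x [^] j' \<oplus> eval p x"
          using add_term[OF p(1), of "\<kappa> \<otimes> v i'" j'] p(2) jj False by auto
        have "\<kappa> \<otimes> u \<oplus> y = eval p' x \<oplus> y' \<otimes> x [^] j"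
          unfolding u p p' using c xp[of j] xp[of j'] by algebra
        then show ?thesis unfolding T_def
          by (intro CollectI exI[of _ p'] exI[of _ y']) (use p(2,3) p'(1,2) in auto)
      qed
    qed
    then obtain p y where p: "set p \<subseteq> pring K b e" "length p = j" "y \<in> lspan K (v ` {..<i})"
        "w n = eval p x \<oplus> y \<otimes> x [^] j" using wn unfolding T_def by auto
    have c: "v i \<in> carrier R" "eval p x \<in> carrier R" "y \<in> carrier R"
      using v(1)[of i] i p Pc eval_in_carrier[OF _ xc, of p] lspan_carrier[OF Kc vi] unfolding q_def by auto
    \<comment> \<open>\<open>d\<close> is nonzero because \<open>v i\<close> is not in the span of
      the earlier \<open>v\<close>. As the leading entry of a list it gives a nonzero polynomial
      that vanishes at the transcendental \<open>x\<close>.\<close>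
    define d where "d = y \<ominus> v i"
    have dP: "d \<in> pring K b e"
    proof -
      have "lspan K (v ` {..<i}) \<subseteq> pring K b e"
        using vP i Pcl pring_base[of K b e] by (intro lspan_least) (auto simp: subset_iff)
      then show ?thesis unfolding d_def a_minus_def using p vP[OF i] Pcl by auto
    qed
    have d0: "d \<noteq> \<zero>" using v(2)[of i] i p(3) c unfolding d_def q_def by auto
    have "eval (d # p) x = (eval p x \<oplus> y \<otimes> x [^] j) \<ominus> v i \<otimes> x [^] j"
      unfolding d_def using p(2) c xp[of j] by simp algebra
    also have "\<dots> = \<zero>" unfolding p(4)[symmetric] w_def i_def[symmetric] j_def[symmetric]
      using c xp by (simp add: a_minus_def r_neg)
    finally have "eval (d # p) x = \<zero>" .
    moreover have "d # p \<in> carrier ((pring K b e)[X])"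
      using dP d0 p by (auto simp: univ_poly_carrier[symmetric] polynomial_def)
    ultimately show False using eval_transcendental[OF t] unfolding x_def by blast
  qed
  moreover have "w n \<in> carrier R" for n
    using v(1)[of "n mod q"] q0 xp unfolding w_def q_def[symmetric] by auto
  moreover have "\<exists>m. (\<forall>j<Suc e. m j \<le> s) \<and> w n = mon b (Suc e) m" if n: "n < q * (s + 1)" for n
  proof -
    obtain m where m: "\<forall>j<e. m j \<le> s" "v (n mod q) = mon b e m"
      using v(3)[of "n mod q"] q0 unfolding q_def[symmetric] by auto
    have "n div q \<le> s" using n by (simp add: less_mult_imp_div_less mult.commute less_Suc_eq_le[symmetric])
    moreover have "mon b e (m(e := n div q)) = mon b e m" by (intro mon_cong) auto
    ultimately show ?thesis using m unfolding w_def x_def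
      by (intro exI[of _ "m(e := n div q)"]) auto
  qed
  ultimately show ?case unfolding q_def by (intro exI[of _ w]) (simp add: mult.commute)
qed

text \<open>A comparison of growth. The monomials in \<open>b\<close> with exponents at most
  \<open>s\<close> are \<open>(s + 1) ^ e\<close> independent elements; multiplied by a power of a
  common denominator they lie in a space with at most a constant times \<open>(s + 1) ^ e'\<close>
  generators, and for large \<open>s\<close> this leaves \<open>e \<le> e'\<close> only.\<close>

lemma alg_indep_le_normalization:
  assumes K: "subfield K R" and A: "subring A R" "K \<subseteq> A"
    and z: "\<And>i. i < e' \<Longrightarrow> z i \<in> A" and W: "finite W" "W \<subseteq> A" "A \<subseteq> lspan (pring K z e') W"
    and b: "alg_indep K b e" "\<And>i. i < e \<Longrightarrow> b i \<in> fracs A"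
  shows "e \<le> e'"
proof -
  note Ks = subfieldE(1)[OF K] and Kc = subfieldE(3)[OF K] and Ac = subringE(1)[OF A(1)]
  note Acl = subringE(2,3,5,6,7)[OF A(1)]
  have zc: "z i \<in> carrier R" if "i < e'" for i using z Ac that by auto
  have Wc: "W \<subseteq> carrier R" using W Ac by auto
  have mc: "mon z e' m \<in> carrier R" for m using zc by (rule mon_closed)
  define G where "G s = {w \<otimes> mon z e' m | w m. w \<in> W \<and> (\<forall>i<e'. m i \<le> s)}" for s :: nat
  define V where "V s = lspan K (G s)" for s
  have Gc: "G s \<subseteq> carrier R" for s using Wc mc unfolding G_def by auto
  have Gmono: "G s \<subseteq> G s'" if "s \<le> s'" for s s'
  proof
    fix g assume "g \<in> G s"
    then obtain w m where g: "g = w \<otimes> mon z e' m" "w \<in> W" "\<forall>i<e'. m i \<le> s" unfolding G_def by auto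
    have "\<forall>i<e'. m i \<le> s'" using g(3) that by (auto intro: order_trans)
    then show "g \<in> G s'" unfolding G_def using g by auto
  qed
  have Vmono: "V s \<subseteq> V s'" if "s \<le> s'" for s s' unfolding V_def by (rule lspan_mono[OF order_refl Gmono[OF that]])
  have Gimg: "G s = (\<lambda>(w, m). w \<otimes> mon z e' m) ` (W \<times> ({..<e'} \<rightarrow>\<^sub>E {..s}))" for s
  proof
    show "G s \<subseteq> (\<lambda>(w, m). w \<otimes> mon z e' m) ` (W \<times> ({..<e'} \<rightarrow>\<^sub>E {..s}))"
    proof
      fix g assume "g \<in> G s"
      then obtain w m where g: "g = w \<otimes> mon z e' m" "w \<in> W" "\<forall>i<e'. m i \<le> s" unfolding G_def by auto
      have "mon z e' m = mon z e' (restrict m {..<e'})" by (intro mon_cong) auto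
      then show "g \<in> (\<lambda>(w, m). w \<otimes> mon z e' m) ` (W \<times> ({..<e'} \<rightarrow>\<^sub>E {..s}))"
        using g by (intro image_eqI[of _ _ "(w, restrict m {..<e'})"]) auto
    qed
  qed (auto simp: G_def)
  have Gfin: "finite (G s)" for s unfolding Gimg using W by (auto intro!: finite_PiE)
  have Gcard: "card (G s) \<le> card W * (s + 1) ^ e'" for s
  proof -
    have "card (G s) \<le> card (W \<times> ({..<e'} \<rightarrow>\<^sub>E {..s}))"
      unfolding Gimg using W by (intro card_image_le) (auto intro!: finite_PiE)
    also have "\<dots> = card W * (s + 1) ^ e'" by (simp add: card_cartesian_product card_PiE)
    finally show ?thesis .
  qed
  have union: "\<exists>s. a \<in> V s" if "a \<in> A" for a
  proof -
    have "a \<in> lspan (pring K z e') W" using that W by auto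
    then show ?thesis
    proof induction
      case zero
      then show ?case unfolding V_def using lspan.zero by auto
    next
      case (add c w a)
      then obtain s where s: "a \<in> V s" by auto
      have wc: "w \<in> carrier R" using add Wc by auto
      have "c \<in> lspan K (range (mon z e'))" using pring_lspan_mon[OF Ks, of e' z] zc add by auto
      then have "\<exists>s. w \<otimes> c \<in> V s"
      proof induction
        case zero
        then show ?case using wc unfolding V_def by (auto intro: lspan.zero)
      next
        case (add \<kappa> x y)
        then obtain m s where m: "x = mon z e' m" "w \<otimes> y \<in> V s" by auto
        have yc: "y \<in> carrier R" using add.hyps lspan_carrier[OF Kc, of "range (mon z e')"] mc by auto
        define s' where "s' = max s (Max (insert 0 (m ` {..<e'})))"
        have "m i \<le> s'" if "i < e'" for i
          unfolding s'_def using that by (intro max.coboundedI2 Max_ge) auto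
        then have "w \<otimes> x \<in> G s'" unfolding G_def m using \<open>w \<in> W\<close> by blast
        moreover have "w \<otimes> (\<kappa> \<otimes> x \<oplus> y) = \<kappa> \<otimes> (w \<otimes> x) \<oplus> w \<otimes> y"
          using wc yc mc[of m] add.hyps Kc unfolding m by (simp add: r_distr m_ac subset_iff)
        moreover have "w \<otimes> y \<in> V s'" using m(2) Vmono[of s s'] unfolding s'_def by auto
        ultimately show ?case using add.hyps unfolding V_def by (metis lspan.add)
      qed
      then obtain s' where s': "w \<otimes> c \<in> V s'" by auto
      have "c \<in> carrier R" using add subringE(1)[OF pring_subring[OF Kc, of e' z]] zc by auto
      then have "c \<otimes> w = w \<otimes> c" using wc by (simp add: m_comm)
      then have "c \<otimes> w \<oplus> a \<in> V (max s s')"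
        using s s' Vmono[of s "max s s'"] Vmono[of s' "max s s'"] lspan_add_closed[OF Kc Gc[of "max s s'"]]
        unfolding V_def by auto
      then show ?case by blast
    qed
  qed
  have unionF: "\<exists>s. H \<subseteq> V s" if "finite H" "H \<subseteq> A" for H
    using that
  proof (induction H rule: finite_induct)
    case (insert h H)
    obtain s s' where "H \<subseteq> V s" "h \<in> V s'" using insert union[of h] by auto
    then show ?case using Vmono[of s "max s s'"] Vmono[of s' "max s s'"] by (intro exI[of _ "max s s'"]) auto
  qed auto
  \<comment> \<open>\<open>c\<close> bounds the exponents in the multiplication table of
    \<open>W\<close>. Multiplication therefore adds indices of the filtration \<open>V\<close> up to
    this constant error.\<close>
  obtain c where c: "\<And>w w'. w \<in> W \<Longrightarrow> w' \<in> W \<Longrightarrow> w \<otimes> w' \<in> V c"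
  proof -
    have "(\<lambda>(w, w'). w \<otimes> w') ` (W \<times> W) \<subseteq> A" using W(2) Acl by (auto simp: subset_iff)
    moreover have "finite ((\<lambda>(w, w'). w \<otimes> w') ` (W \<times> W))" using W(1) by simp
    ultimately obtain c where "(\<lambda>(w, w'). w \<otimes> w') ` (W \<times> W) \<subseteq> V c" using unionF by metis
    then show ?thesis using that[of c] by auto
  qed
  have Vmult: "x \<otimes> y \<in> V (s + t + c)" if xy: "x \<in> V s" "y \<in> V t" for x y s t
    unfolding V_def
  proof (rule lspan_mult[OF Ks Gc Gc Gc _ xy[unfolded V_def]])
    fix g h assume "g \<in> G s" "h \<in> G t"
    then obtain w m w' m' where gh: "g = w \<otimes> mon z e' m" "w \<in> W" "\<forall>i<e'. m i \<le> s"
        "h = w' \<otimes> mon z e' m'" "w' \<in> W" "\<forall>i<e'. m' i \<le> t" unfolding G_def by auto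
    have wc: "w \<in> carrier R" "w' \<in> carrier R" using gh Wc by auto
    define M where "M = mon z e' (\<lambda>i. m i + m' i)"
    have Mc: "M \<in> carrier R" unfolding M_def by (rule mc)
    have "g \<otimes> h = (mon z e' m \<otimes> mon z e' m') \<otimes> (w \<otimes> w')" unfolding gh using wc mc by (simp add: m_ac)
    then have eq: "g \<otimes> h = M \<otimes> (w \<otimes> w')" using mon_add[of e' z m m'] zc unfolding M_def by simp
    have "M \<otimes> (w \<otimes> w') \<in> lspan K (G (s + t + c))"
    proof (rule lspan_scale[OF Kc Gc Gc Mc _ c[OF gh(2,5), unfolded V_def]])
      fix \<kappa> k assume \<kappa>: "\<kappa> \<in> K" and "k \<in> G c"
      then obtain w2 m2 where k: "k = w2 \<otimes> mon z e' m2" "w2 \<in> W" "\<forall>i<e'. m2 i \<le> c" unfolding G_def by auto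
      have wc2: "w2 \<in> carrier R" using k Wc by auto
      have "M \<otimes> k = w2 \<otimes> (M \<otimes> mon z e' m2)" unfolding k using wc2 Mc mc by (simp add: m_ac)
      also have "M \<otimes> mon z e' m2 = mon z e' (\<lambda>i. m i + m' i + m2 i)"
        unfolding M_def using mon_add[of e' z] zc by simp
      finally have "M \<otimes> k \<in> G (s + t + c)"
        unfolding G_def using gh k(2,3) by (auto intro!: exI[of _ w2] exI[of _ "\<lambda>i. m i + m' i + m2 i"] add_mono)
      moreover have "M \<otimes> (\<kappa> \<otimes> k) = \<kappa> \<otimes> (M \<otimes> k)" using Mc \<kappa> Kc wc2 mc unfolding k by (simp add: m_ac subset_iff)
      ultimately show "M \<otimes> (\<kappa> \<otimes> k) \<in> lspan K (G (s + t + c))"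
        using lspan_smult_closed[OF Ks Gc \<kappa>] lspan_incl[OF Ks Gc] by simp
    qed
    then show "g \<otimes> h \<in> lspan K (G (s + t + c))" using eq by simp
  qed
  have bc: "b i \<in> carrier R" if "i < e" for i using b(2)[OF that] fracs_carrier[OF Ac] by auto
  have "finite (b ` {..<e})" "b ` {..<e} \<subseteq> fracs A" using b(2) by auto
  from common_denominator[OF A(1) this]
  obtain \<sigma> where \<sigma>: "\<sigma> \<in> A" "\<sigma> \<noteq> \<zero>" "\<And>i. i < e \<Longrightarrow> \<sigma> \<otimes> b i \<in> A" by auto
  have \<sigma>c: "\<sigma> \<in> carrier R" using \<sigma> Ac by auto
  \<comment> \<open>Including \<sigma> itself allows padding: a monomial with exponents at most
    \<open>s\<close>, multiplied by \<open>\<sigma> [^] (e * s)\<close>, is a product of exactly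
    \<open>e * s\<close> elements of \<open>H\<close>, whatever its degree.\<close>
  define H where "H = insert \<sigma> ((\<lambda>i. \<sigma> \<otimes> b i) ` {..<e})"
  have H: "finite H" "H \<subseteq> A" "H \<subseteq> carrier R" using \<sigma> Ac unfolding H_def by auto
  obtain s0 where s0: "insert \<one> H \<subseteq> V s0" using unionF[of "insert \<one> H"] H Acl by auto
  have prodV: "x \<in> V (n * (s0 + c) + s0)" if "x \<in> prods H n" for x n
    using that
  proof (induction n arbitrary: x)
    case 0
    then show ?case using s0 by auto
  next
    case (Suc n)
    then obtain h y where x: "x = h \<otimes> y" "h \<in> H" "y \<in> prods H n" by auto
    have "h \<otimes> y \<in> V (s0 + (n * (s0 + c) + s0) + c)" using Suc.IH[OF x(3)] s0 x(2) by (intro Vmult) auto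
    then show ?case unfolding x by (simp add: algebra_simps)
  qed
  have monH: "\<sigma> [^] (i * s) \<otimes> mon b i m \<in> prods H (i * s)" if "i \<le> e" "\<forall>j<i. m j \<le> s" for i m s
    using that
  proof (induction i)
    case 0
    then show ?case by simp
  next
    case (Suc i)
    have c: "mon b i m \<in> carrier R" "b i \<in> carrier R" using Suc.prems bc by (auto intro: mon_closed)
    have "\<sigma> [^] s = \<sigma> [^] (s - m i) \<otimes> \<sigma> [^] m i" using Suc.prems \<sigma>c by (simp add: nat_pow_mult)
    then have "\<sigma> [^] s \<otimes> b i [^] m i = \<sigma> [^] (s - m i) \<otimes> (\<sigma> \<otimes> b i) [^] m i"
      using \<sigma>c c by (simp add: nat_pow_distrib m_assoc)
    moreover have "\<sigma> [^] (s - m i) \<otimes> (\<sigma> \<otimes> b i) [^] m i \<in> prods H ((s - m i) + m i)"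
      using Suc.prems by (intro prods_mult[OF H(3)] prods_pow[OF H(3)]) (auto simp: H_def)
    ultimately have 1: "\<sigma> [^] s \<otimes> b i [^] m i \<in> prods H s" using Suc.prems by simp
    have 2: "\<sigma> [^] (i * s) \<otimes> mon b i m \<in> prods H (i * s)" using Suc by auto
    have "(\<sigma> [^] s \<otimes> b i [^] m i) \<otimes> (\<sigma> [^] (i * s) \<otimes> mon b i m) \<in> prods H (s + i * s)"
      by (rule prods_mult[OF H(3) 2 1])
    moreover have "(\<sigma> [^] s \<otimes> b i [^] m i) \<otimes> (\<sigma> [^] (i * s) \<otimes> mon b i m) = \<sigma> [^] (s + i * s) \<otimes> mon b (Suc i) m"
      using \<sigma>c c by (simp add: m_ac nat_pow_mult[symmetric])
    ultimately show ?case by simp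
  qed
  \<comment> \<open>Chosen so that \<open>Ns + 1 \<le> C * (s + 1)\<close> for every
    \<open>s\<close>, where \<open>Ns\<close> below is the index of the filtration reached by the
    products of \<open>e * s\<close> elements.\<close>
  define C where "C = e * (s0 + c) + s0 + 1"
  have count: "(s + 1) ^ e \<le> card W * C ^ e' * (s + 1) ^ e'" for s
  proof -
    define Ns where "Ns = e * s * (s0 + c) + s0"
    have "(s + 1) ^ e \<le> card (G Ns)"
    proof (rule ccontr)
      assume "\<not> (s + 1) ^ e \<le> card (G Ns)"
      then have lt: "card (G Ns) < (s + 1) ^ e" by simp
      obtain v where v: "\<And>i. i < (s + 1) ^ e \<Longrightarrow> v i \<in> carrier R"
          "\<And>i. i < (s + 1) ^ e \<Longrightarrow> v i \<notin> lspan K (v ` {..<i})"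
          "\<And>i. i < (s + 1) ^ e \<Longrightarrow> \<exists>m. (\<forall>j<e. m j \<le> s) \<and> v i = mon b e m"
        using independent_monomials[OF K b(1), of s] by auto
      define \<tau> where "\<tau> = \<sigma> [^] (e * s)"
      have \<tau>: "\<tau> \<in> carrier R" "\<tau> \<noteq> \<zero>" unfolding \<tau>_def using \<sigma>c nat_pow_nonzero[OF \<sigma>c \<sigma>(2)] by auto
      have "\<tau> \<otimes> v i \<in> lspan K (G Ns)" if "i < (s + 1) ^ e" for i
        using v(3)[OF that] monH[of e _ s] prodV unfolding \<tau>_def Ns_def V_def by auto
      then obtain i where i: "i < (s + 1) ^ e" "\<tau> \<otimes> v i \<in> lspan K ((\<lambda>i. \<tau> \<otimes> v i) ` {..<i})"
        using lspan_descending_member[OF K Gfin Gc lt, of "\<lambda>i. \<tau> \<otimes> v i"] by auto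
      have vc: "v ` {..<i} \<subseteq> carrier R" using v(1) i by auto
      have i\<tau>: "inv \<tau> \<in> carrier R" "inv \<tau> \<otimes> \<tau> = \<one>" using inv_nonzero_closed[OF \<tau>] inv_mult_cancel[OF \<tau>] by auto
      have "inv \<tau> \<otimes> (\<tau> \<otimes> v i) \<in> lspan K (v ` {..<i})"
      proof (rule lspan_scale[OF Kc _ vc i\<tau>(1) _ i(2)])
        show "(\<lambda>i. \<tau> \<otimes> v i) ` {..<i} \<subseteq> carrier R" using vc \<tau> by auto
        fix \<kappa> y assume \<kappa>: "\<kappa> \<in> K" and "y \<in> (\<lambda>i. \<tau> \<otimes> v i) ` {..<i}"
        then obtain j where j: "j < i" "y = \<tau> \<otimes> v j" by auto
        have "inv \<tau> \<otimes> (\<kappa> \<otimes> y) = \<kappa> \<otimes> ((inv \<tau> \<otimes> \<tau>) \<otimes> v j)"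
          unfolding j using \<kappa> Kc \<tau> i\<tau>(1) vc j(1) by (simp add: m_ac subset_iff)
        then have "inv \<tau> \<otimes> (\<kappa> \<otimes> y) = \<kappa> \<otimes> v j" using i\<tau>(2) vc j by auto
        then show "inv \<tau> \<otimes> (\<kappa> \<otimes> y) \<in> lspan K (v ` {..<i})"
          using lspan_smult_closed[OF Ks vc \<kappa>] lspan_incl[OF Ks vc] j by auto
      qed
      moreover have "inv \<tau> \<otimes> (\<tau> \<otimes> v i) = v i" using i\<tau> \<tau> v(1)[OF i(1)] by (simp add: m_assoc[symmetric])
      ultimately show False using v(2)[OF i(1)] by simp
    qed
    also have "\<dots> \<le> card W * (Ns + 1) ^ e'" by (rule Gcard)
    also have "\<dots> \<le> card W * (C * (s + 1)) ^ e'"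
      unfolding Ns_def C_def by (intro mult_le_mono2 power_mono) (auto simp: algebra_simps)
    finally show ?thesis unfolding power_mult_distrib mult.assoc .
  qed
  show ?thesis
  proof (rule ccontr)
    assume "\<not> e \<le> e'"
    \<comment> \<open>With this \<open>s\<close> the constant in the upper bound is \<open>s\<close>
      itself, while a larger \<open>e\<close> contributes at least one more factor
      \<open>s + 1\<close>.\<close>
    define s where "s = card W * C ^ e'"
    have "(s + 1) * (s + 1) ^ e' = (s + 1) ^ Suc e'" by simp
    also have "\<dots> \<le> (s + 1) ^ e" using \<open>\<not> e \<le> e'\<close> by (intro power_increasing) auto
    also have "\<dots> \<le> s * (s + 1) ^ e'" using count[of s] unfolding s_def .
    finally show False by simp
  qed
qed

end

section \<open>Chains of prime ideals\<close>

lemma (in cring) exists_prime_avoiding: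
  assumes I: "ideal I R" and S: "S \<subseteq> carrier R" "\<one> \<in> S" "\<And>s t. s \<in> S \<Longrightarrow> t \<in> S \<Longrightarrow> s \<otimes> t \<in> S"
    and IS: "I \<inter> S = {}"
  shows "\<exists>P. primeideal P R \<and> I \<subseteq> P \<and> P \<inter> S = {}"
proof -
  define Js where "Js = {J. ideal J R \<and> I \<subseteq> J \<and> J \<inter> S = {}}"
  have "\<exists>M\<in>Js. \<forall>H\<in>Js. M \<subseteq> H \<longrightarrow> H = M"
  proof (rule subset_Zorn_nonempty)
    show "Js \<noteq> {}" using I IS unfolding Js_def by auto
    fix Cs assume C: "Cs \<noteq> {}" "subset.chain Js Cs"
    have "subset.chain {J. ideal J R} Cs" using C(2) unfolding Js_def subset.chain_def by auto
    from chain_Union_is_ideal[OF this] have "ideal (\<Union>Cs) R" using C(1) by simp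
    then show "\<Union>Cs \<in> Js" using C unfolding Js_def subset.chain_def by auto
  qed
  then obtain M where M: "ideal M R" "I \<subseteq> M" "M \<inter> S = {}"
      "\<And>H. ideal H R \<Longrightarrow> M \<subseteq> H \<Longrightarrow> H \<inter> S = {} \<Longrightarrow> H = M"
    unfolding Js_def by auto
  interpret M: ideal M R by (rule M(1))
  have meet: "\<exists>p\<in>M. \<exists>r\<in>carrier R. p \<oplus> r \<otimes> a \<in> S" if a: "a \<in> carrier R" "a \<notin> M" for a
  proof -
    have H: "ideal (M <+>\<^bsub>R\<^esub> PIdl a) R" by (intro add_ideals M(1) cgenideal_ideal a(1))
    have "m \<in> M <+>\<^bsub>R\<^esub> PIdl a" if "m \<in> M" for m
    proof -
      have "m = m \<oplus> \<zero> \<otimes> a" using that a by simp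
      moreover have "\<zero> \<otimes> a \<in> PIdl a" using cgenideal_def by force
      ultimately show ?thesis using that unfolding set_add_def' by blast
    qed
    then have sub: "M \<subseteq> M <+>\<^bsub>R\<^esub> PIdl a" by auto
    have "a = \<zero> \<oplus> a" "\<zero> \<in> M" using a M.zero_closed by auto
    then have "a \<in> M <+>\<^bsub>R\<^esub> PIdl a" using cgenideal_self[OF a(1)] unfolding set_add_def' by blast
    then have "M <+>\<^bsub>R\<^esub> PIdl a \<noteq> M" using a(2) by auto
    then obtain s where "s \<in> M <+>\<^bsub>R\<^esub> PIdl a" "s \<in> S" using M(4)[OF H sub] by auto
    then show ?thesis unfolding set_add_def' cgenideal_def by auto
  qed
  have "primeideal M R"
  proof (rule primeidealI[OF M(1) is_cring])
    show "carrier R \<noteq> M" using S(2) M(3) by auto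
    fix a b assume ab: "a \<in> carrier R" "b \<in> carrier R" "a \<otimes> b \<in> M"
    show "a \<in> M \<or> b \<in> M"
    proof (rule ccontr)
      assume "\<not> (a \<in> M \<or> b \<in> M)"
      then obtain p r p' r' where p: "p \<in> M" "r \<in> carrier R" "p \<oplus> r \<otimes> a \<in> S"
          "p' \<in> M" "r' \<in> carrier R" "p' \<oplus> r' \<otimes> b \<in> S" using meet[OF ab(1)] meet[OF ab(2)] by auto
      have c: "p \<in> carrier R" "p' \<in> carrier R" using p M.Icarr by auto
      have "(p \<oplus> r \<otimes> a) \<otimes> (p' \<oplus> r' \<otimes> b) = (p' \<oplus> r' \<otimes> b) \<otimes> p \<oplus> ((r \<otimes> a) \<otimes> p' \<oplus> (r \<otimes> r') \<otimes> (a \<otimes> b))"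
        using c p(2,5) ab(1,2) by algebra
      moreover have "(p' \<oplus> r' \<otimes> b) \<otimes> p \<oplus> ((r \<otimes> a) \<otimes> p' \<oplus> (r \<otimes> r') \<otimes> (a \<otimes> b)) \<in> M"
      proof (intro M.a_closed)
        show "(p' \<oplus> r' \<otimes> b) \<otimes> p \<in> M" using p ab c by (intro M.I_l_closed) auto
        show "(r \<otimes> a) \<otimes> p' \<in> M" using p ab c by (intro M.I_l_closed) auto
        show "(r \<otimes> r') \<otimes> (a \<otimes> b) \<in> M" using p ab c by (intro M.I_l_closed[OF ab(3)]) auto
      qed
      ultimately show False using S(3)[OF p(3,6)] M(3) by auto
    qed
  qed
  then show ?thesis using M by auto
qed

text \<open>The iterated boundary monoids of Coquand and Lombardi: \<open>A\<close> has Krull dimension less than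
  \<open>e\<close> iff \<open>0\<close> lies in \<open>bdry A {1} x e\<close> for all \<open>x\<close>.\<close>

primrec (in ring) bdry :: "'a set \<Rightarrow> 'a set \<Rightarrow> (nat \<Rightarrow> 'a) \<Rightarrow> nat \<Rightarrow> 'a set" where
  "bdry A S x 0 = S"
| "bdry A S x (Suc i) = {x i [^] (\<mu>::nat) \<otimes> (s \<oplus> a \<otimes> x i) | \<mu> s a. s \<in> bdry A S x i \<and> a \<in> A}"

context cring
begin

lemma bdryI: "s \<in> bdry A S x i \<Longrightarrow> a \<in> A \<Longrightarrow> x i [^] (\<mu>::nat) \<otimes> (s \<oplus> a \<otimes> x i) \<in> bdry A S x (Suc i)"
  by auto

lemma bdry_closed:
  assumes S: "S \<subseteq> carrier R" "\<one> \<in> S" "\<And>s t. s \<in> S \<Longrightarrow> t \<in> S \<Longrightarrow> s \<otimes> t \<in> S"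
  shows "(\<And>j. j < i \<Longrightarrow> x j \<in> carrier R) \<Longrightarrow> bdry (carrier R) S x i \<subseteq> carrier R \<and> \<one> \<in> bdry (carrier R) S x i \<and>
    (\<forall>s\<in>bdry (carrier R) S x i. \<forall>t\<in>bdry (carrier R) S x i. s \<otimes> t \<in> bdry (carrier R) S x i)"
proof (induction i)
  case 0
  then show ?case using S by auto
next
  case (Suc i)
  let ?T = "bdry (carrier R) S x i"
  have T: "?T \<subseteq> carrier R" "\<one> \<in> ?T" "\<And>s t. s \<in> ?T \<Longrightarrow> t \<in> ?T \<Longrightarrow> s \<otimes> t \<in> ?T" using Suc by auto
  have xc: "x i \<in> carrier R" using Suc.prems by auto
  have "s \<otimes> t \<in> bdry (carrier R) S x (Suc i)"
    if "s \<in> bdry (carrier R) S x (Suc i)" "t \<in> bdry (carrier R) S x (Suc i)" for s t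
  proof -
    obtain \<mu> s' a \<nu> t' b where s: "s = x i [^] (\<mu>::nat) \<otimes> (s' \<oplus> a \<otimes> x i)" "s' \<in> ?T" "a \<in> carrier R"
      and t: "t = x i [^] (\<nu>::nat) \<otimes> (t' \<oplus> b \<otimes> x i)" "t' \<in> ?T" "b \<in> carrier R"
      using \<open>s \<in> bdry (carrier R) S x (Suc i)\<close> \<open>t \<in> bdry (carrier R) S x (Suc i)\<close> by auto
    have c: "s' \<in> carrier R" "t' \<in> carrier R" "x i [^] \<mu> \<in> carrier R" "x i [^] \<nu> \<in> carrier R" using s t T xc by auto
    have "s \<otimes> t = (x i [^] \<mu> \<otimes> x i [^] \<nu>) \<otimes> (s' \<otimes> t' \<oplus> (a \<otimes> t' \<oplus> s' \<otimes> b \<oplus> a \<otimes> b \<otimes> x i) \<otimes> x i)"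
      unfolding s t using c s(3) t(3) xc by algebra
    also have "x i [^] \<mu> \<otimes> x i [^] \<nu> = x i [^] (\<mu> + \<nu>)" using xc by (simp add: nat_pow_mult)
    finally show ?thesis using bdryI[OF T(3)[OF s(2) t(2)]] c s(3) t(3) xc by simp
  qed
  moreover have "\<one> \<in> bdry (carrier R) S x (Suc i)"
    using bdryI[OF T(2) zero_closed, where \<mu> = 0] xc by simp
  moreover have "bdry (carrier R) S x (Suc i) \<subseteq> carrier R" using T(1) xc by auto
  ultimately show ?case by blast
qed

text \<open>The chain is built from below. The monoid for \<open>Suc i\<close> contains
  \<open>x i\<close>, so \<open>P\<close> does not; and the ideal generated by \<open>P\<close> and
  \<open>x i\<close> still avoids the monoid for \<open>i\<close>, since
  \<open>p \<oplus> r \<otimes> x i\<close> in the latter would put \<open>p\<close> into the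
  former.\<close>

lemma prime_chain_avoiding:
  assumes S: "S \<subseteq> carrier R" "\<one> \<in> S" "\<And>s t. s \<in> S \<Longrightarrow> t \<in> S \<Longrightarrow> s \<otimes> t \<in> S"
  shows "(\<And>j. j < i \<Longrightarrow> x j \<in> carrier R) \<Longrightarrow> primeideal P R \<Longrightarrow> P \<inter> bdry (carrier R) S x i = {} \<Longrightarrow>
    \<exists>Q. Q 0 = P \<and> (\<forall>j\<le>i. primeideal (Q j) R) \<and> (\<forall>j<i. Q j \<subset> Q (Suc j))"
proof (induction i arbitrary: P)
  case 0
  then show ?case by (intro exI[of _ "\<lambda>_. P"]) auto
next
  case (Suc i)
  let ?T = "bdry (carrier R) S x i" and ?T' = "bdry (carrier R) S x (Suc i)"
  have T: "?T \<subseteq> carrier R" "\<one> \<in> ?T" "\<And>s t. s \<in> ?T \<Longrightarrow> t \<in> ?T \<Longrightarrow> s \<otimes> t \<in> ?T"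
    using bdry_closed[OF S, of i x] Suc.prems(1) by auto
  interpret P: primeideal P R by (rule Suc.prems(2))
  have xc: "x i \<in> carrier R" using Suc.prems by auto
  have "x i \<in> ?T'" using bdryI[OF T(2) zero_closed, where \<mu> = 1] xc by simp
  then have xP: "x i \<notin> P" using Suc.prems(3) by auto
  have H: "ideal (P <+>\<^bsub>R\<^esub> PIdl (x i)) R" by (intro add_ideals P.is_ideal cgenideal_ideal xc)
  have "(P <+>\<^bsub>R\<^esub> PIdl (x i)) \<inter> ?T = {}"
  proof (rule ccontr)
    assume "(P <+>\<^bsub>R\<^esub> PIdl (x i)) \<inter> ?T \<noteq> {}"
    then obtain p r where p: "p \<in> P" "r \<in> carrier R" "p \<oplus> r \<otimes> x i \<in> ?T"
      unfolding set_add_def' cgenideal_def by auto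
    have pc: "p \<in> carrier R" using p P.Icarr by auto
    have "x i [^] (0::nat) \<otimes> ((p \<oplus> r \<otimes> x i) \<oplus> (\<ominus> r) \<otimes> x i) \<in> ?T'" using p by (intro bdryI) auto
    moreover have "x i [^] (0::nat) \<otimes> ((p \<oplus> r \<otimes> x i) \<oplus> (\<ominus> r) \<otimes> x i) = p"
    proof -
      have "(p \<oplus> r \<otimes> x i) \<oplus> (\<ominus> r) \<otimes> x i = p" using pc p(2) xc by algebra
      then show ?thesis using pc by simp
    qed
    ultimately show False using p(1) Suc.prems(3) by auto
  qed
  then obtain P' where P': "primeideal P' R" "P <+>\<^bsub>R\<^esub> PIdl (x i) \<subseteq> P'" "P' \<inter> ?T = {}"
    using exists_prime_avoiding[OF H T] by auto
  obtain Q where Q: "Q 0 = P'" "\<forall>j\<le>i. primeideal (Q j) R" "\<forall>j<i. Q j \<subset> Q (Suc j)"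
    using Suc.IH[OF _ P'(1,3)] Suc.prems(1) by auto
  have "p \<in> P'" if "p \<in> P" for p
  proof -
    have "p = p \<oplus> \<zero> \<otimes> x i" using that P.Icarr xc by simp
    moreover have "\<zero> \<otimes> x i \<in> PIdl (x i)" using cgenideal_def by force
    ultimately show ?thesis using that P'(2) unfolding set_add_def' by blast
  qed
  moreover have "x i \<in> P'"
  proof -
    have "x i = \<zero> \<oplus> x i" "\<zero> \<in> P" using xc P.zero_closed by auto
    then show ?thesis using cgenideal_self[OF xc] P'(2) unfolding set_add_def' by blast
  qed
  ultimately have "P \<subset> P'" using xP by auto
  then show ?case using Q Suc.prems(2)
    by (intro exI[of _ "\<lambda>j. case j of 0 \<Rightarrow> P | Suc j \<Rightarrow> Q j"]) (auto split: nat.splits)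
qed

lemma exists_prime_chain:
  assumes S: "S \<subseteq> carrier R" "\<one> \<in> S" "\<And>s t. s \<in> S \<Longrightarrow> t \<in> S \<Longrightarrow> s \<otimes> t \<in> S"
    and x: "\<And>j. j < e \<Longrightarrow> x j \<in> carrier R" and "\<zero> \<notin> bdry (carrier R) S x e"
  shows "\<exists>Q. (\<forall>j\<le>e. primeideal (Q j) R) \<and> (\<forall>j<e. Q j \<subset> Q (Suc j))"
proof -
  have T: "bdry (carrier R) S x e \<subseteq> carrier R" "\<one> \<in> bdry (carrier R) S x e"
    "\<And>s t. s \<in> bdry (carrier R) S x e \<Longrightarrow> t \<in> bdry (carrier R) S x e \<Longrightarrow> s \<otimes> t \<in> bdry (carrier R) S x e"
    using bdry_closed[OF S, of e x] x by auto
  obtain P where "primeideal P R" "P \<inter> bdry (carrier R) S x e = {}"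
    using exists_prime_avoiding[OF zeroideal T] assms(5) by auto
  then show ?thesis using prime_chain_avoiding[OF S, of e x P] x by auto
qed

end

text \<open>Prime ideals of a subring are kept as plain subsets of the field, so that they can be
  compared directly with the polynomial subrings.\<close>

definition (in ring) prime_in :: "'a set \<Rightarrow> 'a set \<Rightarrow> bool" where
  "prime_in A P \<longleftrightarrow> P \<subseteq> A \<and> \<zero> \<in> P \<and> \<one> \<notin> P \<and> (\<forall>a\<in>P. \<forall>b\<in>P. a \<oplus> b \<in> P) \<and>
    (\<forall>a\<in>A. \<forall>b\<in>P. a \<otimes> b \<in> P) \<and> (\<forall>a\<in>A. \<forall>b\<in>A. a \<otimes> b \<in> P \<longrightarrow> a \<in> P \<or> b \<in> P)"

context field
begin

text \<open>Unfolding the nested monoid and factoring out the product \<open>q i\<close> of all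
  powers leaves an element of \<open>S\<close> plus a combination of the fractions
  \<open>z j \<otimes> inv (q j)\<close>. When the element is zero, the part from \<open>S\<close>
  is itself such a combination, and this is the input of the lexicographic argument.\<close>

lemma bdry_shape:
  assumes A: "subring A R" and S: "S \<subseteq> A"
  shows "(\<forall>j<i. z j \<in> carrier R \<and> z j \<noteq> \<zero>) \<Longrightarrow> s \<in> bdry A S z i \<Longrightarrow>
    \<exists>q \<mu> u w. q 0 = \<one> \<and> (\<forall>j. q (Suc j) = q j \<otimes> z j [^] (\<mu> j :: nat)) \<and> (\<forall>j\<le>i. q j \<in> carrier R \<and> q j \<noteq> \<zero>) \<and>
      u \<in> S \<and> w \<in> lspan A ((\<lambda>j. z j \<otimes> inv (q j)) ` {..<i}) \<and> s = q i \<otimes> (u \<oplus> w)"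
proof (induction i arbitrary: s)
  case 0
  have "s \<in> carrier R" using 0 S subringE(1)[OF A] by auto
  then have "s = \<one> \<otimes> (s \<oplus> \<zero>)" by simp
  moreover have "\<And>j. \<one> = \<one> \<otimes> z j [^] (0::nat)" by simp
  ultimately show ?case using 0 lspan.zero
    by (intro exI[of _ "\<lambda>_. \<one>"] exI[of _ "\<lambda>_. 0"] exI[of _ s] exI[of _ \<zero>]) auto
next
  case (Suc i)
  note Ac = subringE(1)[OF A]
  obtain \<nu> s' a where s: "s = z i [^] (\<nu>::nat) \<otimes> (s' \<oplus> a \<otimes> z i)" "s' \<in> bdry A S z i" "a \<in> A" using Suc.prems by auto
  obtain q \<mu> u w where q: "q 0 = \<one>" "\<And>j. q (Suc j) = q j \<otimes> z j [^] (\<mu> j :: nat)"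
      "\<And>j. j \<le> i \<Longrightarrow> q j \<in> carrier R \<and> q j \<noteq> \<zero>"
      "u \<in> S" "w \<in> lspan A ((\<lambda>j. z j \<otimes> inv (q j)) ` {..<i})" "s' = q i \<otimes> (u \<oplus> w)"
  proof -
    have "\<forall>j<i. z j \<in> carrier R \<and> z j \<noteq> \<zero>" using Suc.prems(1) by auto
    from Suc.IH[OF this s(2)] show ?thesis using that by (elim exE conjE) simp
  qed
  \<comment> \<open>Only the exponent at \<open>i\<close> is new. Since \<open>q' j\<close> involves
    exponents below \<open>j\<close> only, the fractions with index below \<open>i\<close> do not
    change.\<close>
  define \<mu>' where "\<mu>' = \<mu>(i := \<nu>)"
  define q' where "q' = rec_nat \<one> (\<lambda>j r. r \<otimes> z j [^] (\<mu>' j :: nat))"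
  have q'0: "q' 0 = \<one>" and q'S: "\<And>j. q' (Suc j) = q' j \<otimes> z j [^] (\<mu>' j)" by (simp_all add: q'_def)
  have q'q: "q' j = q j" if "j \<le> i" for j
    using that by (induction j) (auto simp: q'0 q'S q \<mu>'_def)
  have zi: "z i \<in> carrier R" "z i \<noteq> \<zero>" using Suc.prems(1) by auto
  have q'c: "q' j \<in> carrier R \<and> q' j \<noteq> \<zero>" if "j \<le> Suc i" for j
  proof (cases "j = Suc i")
    case True
    have "z i [^] \<mu>' i \<noteq> \<zero>" "z i [^] \<mu>' i \<in> carrier R" using nat_pow_nonzero[OF zi] zi by auto
    then show ?thesis using True q'S[of i] q'q[of i] q(3)[of i] mult_nonzero by auto
  next
    case False
    then show ?thesis using q'q[of j] q(3)[of j] that by auto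
  qed
  define V where "V i = (\<lambda>j. z j \<otimes> inv (q' j)) ` {..<i}" for i
  have V: "V (Suc i) \<subseteq> carrier R" using Suc.prems(1) q'c inv_nonzero_closed by (auto simp: V_def)
  have Vq: "V i = (\<lambda>j. z j \<otimes> inv (q j)) ` {..<i}" unfolding V_def using q'q by auto
  have Vm: "V i \<subseteq> V (Suc i)" unfolding V_def by auto
  have wV: "w \<in> lspan A (V (Suc i))" using q(5) lspan_mono[OF order_refl Vm, of A] unfolding Vq by auto
  have vi: "z i \<otimes> inv (q' i) \<in> V (Suc i)" unfolding V_def by auto
  define w' where "w' = a \<otimes> (z i \<otimes> inv (q' i)) \<oplus> w"
  have w'V: "w' \<in> lspan A (V (Suc i))" unfolding w'_def by (rule lspan.add[OF s(3) vi wV])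
  have c: "u \<in> carrier R" "w \<in> carrier R" "a \<in> carrier R" "q' i \<in> carrier R" "inv (q' i) \<in> carrier R"
      "z i [^] \<nu> \<in> carrier R"
    using q(4) S Ac lspan_carrier[OF Ac V] wV s(3) q'c[of i] inv_nonzero_closed zi by auto
  have "q' (Suc i) \<otimes> (u \<oplus> w') = z i [^] \<nu> \<otimes> (q' i \<otimes> (u \<oplus> w) \<oplus> a \<otimes> (q' i \<otimes> inv (q' i)) \<otimes> z i)"
  proof -
    have "\<mu>' i = \<nu>" by (simp add: \<mu>'_def)
    then show ?thesis unfolding q'S w'_def using c zi(1) by (simp only:) algebra
  qed
  also have "\<dots> = s" unfolding s(1) q(6) using q'q[of i] inv_mult_cancel(1)[of "q' i"] q'c[of i] c by simp
  finally have "s = q' (Suc i) \<otimes> (u \<oplus> w')" by simp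
  then show ?case using q'0 q'S q'c q(4) w'V unfolding V_def
    by (intro exI[of _ q'] exI[of _ \<mu>'] exI[of _ u] exI[of _ w']) auto
qed

text \<open>Witnesses of the strict inclusions are independent when taken from the top of the chain
  downwards. The invariant is that the ring generated over \<open>K\<close> by the first
  \<open>i\<close> of them meets \<open>Q (n - i)\<close> in zero only; for \<open>i = 0\<close>
  this says that a proper ideal contains no unit of \<open>K\<close>.\<close>

lemma prime_chain_alg_indep:
  assumes K: "subfield K R" and A: "subring A R" "K \<subseteq> A"
    and Q: "\<And>i. i \<le> n \<Longrightarrow> prime_in A (Q i)" "\<And>i. i < n \<Longrightarrow> Q i \<subset> Q (Suc i)"
  shows "\<exists>y. (\<forall>i<n. y i \<in> A) \<and> alg_indep K y n"
proof -
  note Ks = subfieldE(1)[OF K] and Kc = subfieldE(3)[OF K] and Ac = subringE(1)[OF A(1)]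
  note Acl = subringE(2,3,5,6,7)[OF A(1)]
  have "\<forall>i<n. \<exists>x. x \<in> Q (Suc i) \<and> x \<notin> Q i" using Q(2) by blast
  then obtain x where x: "\<And>i. i < n \<Longrightarrow> x i \<in> Q (Suc i) \<and> x i \<notin> Q i" by metis
  define y where "y j = x (n - 1 - j)" for j
  have y: "y j \<in> Q (n - j)" "y j \<notin> Q (n - Suc j)" if "j < n" for j
    using x[of "n - 1 - j"] that unfolding y_def by (auto simp: Suc_diff_Suc)
  have yA: "y j \<in> A" if "j < n" for j using y(1)[OF that] Q(1)[of "n - j"] by (auto simp: prime_in_def)
  have yc: "y j \<in> carrier R" if "j < n" for j using yA[OF that] Ac by auto
  have sub: "Q (n - Suc i) \<subseteq> Q (n - i)" if "i < n" for i
    using Q(2)[of "n - Suc i"] that by (auto simp: Suc_diff_Suc)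
  have "alg_indep K y i \<and> (\<forall>b\<in>pring K y i. b \<noteq> \<zero> \<longrightarrow> b \<notin> Q (n - i))" if "i \<le> n" for i
    using that
  proof (induction i)
    case 0
    have "b \<notin> Q n" if b: "b \<in> K" "b \<noteq> \<zero>" for b
    proof
      assume bQ: "b \<in> Q n"
      have "inv b \<in> K" "inv b \<otimes> b = \<one>" using subfield_m_inv[OF K, of b] b by auto
      then have "\<one> \<in> Q n" using bQ A(2) Q(1)[of n] unfolding prime_in_def by (metis subsetD order_refl)
      then show False using Q(1)[of n] unfolding prime_in_def by auto
    qed
    then show ?case using pring_0[OF Ks] by (auto simp: alg_indep_def)
  next
    case (Suc i)
    have i: "i < n" using Suc.prems by simp
    have P: "subring (pring K y i) R" using yc i Kc by (intro pring_subring) auto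
    have PA: "pring K y i \<subseteq> A" using yA i A by (intro pring_least) auto
    have IH: "alg_indep K y i" "\<And>b. b \<in> pring K y i \<Longrightarrow> b \<noteq> \<zero> \<Longrightarrow> b \<notin> Q (n - i)" using Suc by auto
    have Qi: "prime_in A (Q (n - i))" "prime_in A (Q (n - Suc i))" using Q(1) by auto
    have evA: "eval p (y i) \<in> A" if "set p \<subseteq> A" for p
      using that yA[OF i] by (induction p) (auto simp: Acl nat_pow_in_subring[OF A(1)])
    \<comment> \<open>Induction on the constant term \<open>c\<close> of \<open>p\<close>. If it is
      zero, the factor \<open>y i\<close> lies outside the prime and can be cancelled. Otherwise
      membership would put \<open>c\<close> into the next larger prime, which contains
      \<open>y i\<close>, against the invariant.\<close>
    have main: "eval p (y i) \<notin> Q (n - Suc i)" if "set p \<subseteq> pring K y i" "p \<noteq> []" "hd p \<noteq> \<zero>" for p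
      using that
    proof (induction p rule: rev_induct)
      case Nil
      then show ?case by simp
    next
      case (snoc c p)
      have pA: "set p \<subseteq> A" "c \<in> A" using snoc.prems PA by auto
      have pc: "set p \<subseteq> carrier R" "c \<in> carrier R" using pA Ac by auto
      have e: "eval (p @ [c]) (y i) = eval p (y i) \<otimes> y i \<oplus> c" by (rule eval_append_aux[OF pc yc[OF i]])
      have ec: "eval p (y i) \<in> carrier R" using evA[OF pA(1)] Ac by auto
      show ?case
      proof (cases "c = \<zero>")
        case True
        then have p: "p \<noteq> []" "hd p \<noteq> \<zero>" using snoc.prems by (cases p; auto)+
        then have "eval p (y i) \<notin> Q (n - Suc i)" using snoc by auto
        then have "eval p (y i) \<otimes> y i \<notin> Q (n - Suc i)"
          using Qi(2) evA[OF pA(1)] yA[OF i] y(2)[OF i] unfolding prime_in_def by auto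
        then show ?thesis unfolding e using True ec yc[OF i] by simp
      next
        case False
        show ?thesis
        proof
          assume "eval (p @ [c]) (y i) \<in> Q (n - Suc i)"
          then have 1: "eval p (y i) \<otimes> y i \<oplus> c \<in> Q (n - i)" using sub[OF i] e by auto
          have 2: "(\<ominus> eval p (y i)) \<otimes> y i \<in> Q (n - i)"
            using Qi(1) y(1)[OF i] evA[OF pA(1)] Acl(3) unfolding prime_in_def by auto
          have "(\<ominus> eval p (y i)) \<otimes> y i \<oplus> (eval p (y i) \<otimes> y i \<oplus> c) = c"
            using ec pc(2) yc[OF i] by algebra
          moreover have "(\<ominus> eval p (y i)) \<otimes> y i \<oplus> (eval p (y i) \<otimes> y i \<oplus> c) \<in> Q (n - i)"
            using Qi(1) 1 2 unfolding prime_in_def by auto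
          ultimately have "c \<in> Q (n - i)" by simp
          then show False using IH(2)[of c] False snoc.prems by auto
        qed
      qed
    qed
    have t: "(transcendental over (pring K y i)) (y i)"
    proof (rule transcendentalI[OF P yc[OF i]])
      fix p assume p: "p \<in> carrier ((pring K y i)[X])" "eval p (y i) = \<zero>"
      show "p = []"
      proof (rule ccontr)
        assume "p \<noteq> []"
        then have "\<zero> \<notin> Q (n - Suc i)"
          using main[of p] p by (auto simp: univ_poly_carrier[symmetric] polynomial_def)
        then show False using Qi(2) unfolding prime_in_def by auto
      qed
    qed
    have "alg_indep K y (Suc i)"
      using IH(1) t yc[OF i] unfolding alg_indep_def by (auto simp: less_Suc_eq)
    moreover have "b \<notin> Q (n - Suc i)" if b: "b \<in> pring K y (Suc i)" "b \<noteq> \<zero>" for b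
    proof -
      have "b \<in> (\<lambda>p. eval p (y i)) ` carrier ((pring K y i)[X])"
        using b(1) pring_Suc[OF Ks, of i y] yc i simple_extension_as_eval_img[OF subringE(1)[OF P] yc[OF i]] by auto
      then obtain p where p: "p \<in> carrier ((pring K y i)[X])" "b = eval p (y i)" by auto
      moreover have "p \<noteq> []" using p(2) b(2) by auto
      ultimately show ?thesis using main[of p] b(2) by (auto simp: univ_poly_carrier[symmetric] polynomial_def)
    qed
    ultimately show ?case by blast
  qed
  from this[of n] show ?thesis using yA by auto
qed

end

section \<open>Krull dimension and transcendence degree\<close>

lemma (in ring_hom_ring) generate_ring_image:
  assumes "H \<subseteq> carrier R"
  shows "h ` generate_ring R H = generate_ring S (h ` H)"
proof
  have Hc: "h ` H \<subseteq> carrier S" using assms by auto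
  have sub: "subring (generate_ring R H) R" by (rule R.generate_ring_is_subring[OF assms])
  show "generate_ring S (h ` H) \<subseteq> h ` generate_ring R H"
    by (rule S.generate_ring_min_subring1[OF Hc img_is_subring[OF sub]]) (auto intro: generate_ring.incl)
  show "h ` generate_ring R H \<subseteq> generate_ring S (h ` H)"
  proof (rule image_subsetI)
    fix x assume "x \<in> generate_ring R H"
    then show "h x \<in> generate_ring S (h ` H)"
    proof induction
      case one
      then show ?case using generate_ring.one[of S] by simp
    next
      case (incl x)
      then show ?case by (auto intro: generate_ring.incl)
    next
      case (a_inv x)
      then show ?case using R.generate_ring_in_carrier[OF assms] by (auto intro: generate_ring.a_inv)
    next
      case (eng_add x y)
      then show ?case using R.generate_ring_in_carrier[OF assms] by (auto intro: generate_ring.eng_add)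
    next
      case (eng_mult x y)
      then show ?case using R.generate_ring_in_carrier[OF assms] by (auto intro: generate_ring.eng_mult)
    qed
  qed
qed

lemma (in ring_hom_ring) nat_pow_image: "x \<in> carrier R \<Longrightarrow> h (x [^]\<^bsub>R\<^esub> (n::nat)) = h x [^]\<^bsub>S\<^esub> n"
  by (induction n) auto

lemma (in ring_hom_ring) lspan_image:
  assumes "B \<subseteq> carrier R" "V \<subseteq> carrier R" "x \<in> R.lspan B V"
  shows "x \<in> carrier R \<and> h x \<in> S.lspan (h ` B) (h ` V)"
  using assms(3)
proof induction
  case zero
  then show ?case by (auto intro: S.lspan.zero)
next
  case (add b v x)
  then have "b \<in> carrier R" "v \<in> carrier R" using assms by auto
  then show ?case using add S.lspan.add[of "h b" "h ` B" "h v" "h ` V" "h x"] by auto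
qed

lemma (in ring_hom_ring) bdry_image:
  assumes "T \<subseteq> carrier R"
  shows "\<forall>j<i. x j \<in> carrier R \<Longrightarrow> s \<in> R.bdry (carrier R) T x i \<Longrightarrow>
    s \<in> carrier R \<and> h s \<in> S.bdry (h ` carrier R) (h ` T) (\<lambda>j. h (x j)) i"
proof (induction i arbitrary: s)
  case 0
  then show ?case using assms by auto
next
  case (Suc i)
  then obtain \<mu> s' a where s: "s = x i [^]\<^bsub>R\<^esub> (\<mu>::nat) \<otimes>\<^bsub>R\<^esub> (s' \<oplus>\<^bsub>R\<^esub> a \<otimes>\<^bsub>R\<^esub> x i)"
      "s' \<in> R.bdry (carrier R) T x i" "a \<in> carrier R" by auto
  have c: "s' \<in> carrier R" "h s' \<in> S.bdry (h ` carrier R) (h ` T) (\<lambda>j. h (x j)) i" "x i \<in> carrier R"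
    using Suc.IH[OF _ s(2)] Suc.prems(1) by auto
  have "h s = h (x i) [^]\<^bsub>S\<^esub> \<mu> \<otimes>\<^bsub>S\<^esub> (h s' \<oplus>\<^bsub>S\<^esub> h a \<otimes>\<^bsub>S\<^esub> h (x i))"
    unfolding s(1) using c s(3) by (simp add: nat_pow_image)
  then show ?case using c s by auto
qed

text \<open>The witness is the number of variables of one Noether normalization, and all three
  claims are proved for it. The premises \<open>loc\<close> and \<open>alg\<close> hold for graded
  and local algebras alike: generators up to denominators outside \<open>\<mm>\<close>, each of them
  satisfying a monic equation over \<open>K\<close> modulo \<open>\<mm>\<close>.\<close>

lemma prime_chain_bounds:
  fixes R :: "('a, 'x) ring_scheme" and F :: "('f, 'z) ring_scheme"
  assumes R: "domain R" and F: "field F" and \<iota>: "\<iota> \<in> ring_hom R F" "inj_on \<iota> (carrier R)"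
    and frac: "carrier F \<subseteq> ring.fracs F (\<iota> ` carrier R)"
    and K: "K \<subseteq> carrier R" "subfield (\<iota> ` K) F"
    and T: "finite T" "T \<subseteq> carrier R"
    and m: "primeideal \<mm> R"
    and loc: "\<And>b. b \<in> carrier R \<Longrightarrow>
        \<exists>a\<in>generate_ring R (K \<union> T). \<exists>s\<in>generate_ring R (K \<union> T) - \<mm>. b \<otimes>\<^bsub>R\<^esub> s = a"
    and alg: "\<And>t. t \<in> T \<Longrightarrow> \<exists>n::nat. \<exists>y\<in>ring.lspan R K ((\<lambda>j. t [^]\<^bsub>R\<^esub> j) ` {..<n}). t [^]\<^bsub>R\<^esub> n \<ominus>\<^bsub>R\<^esub> y \<in> \<mm>"
  shows "\<exists>d. (\<exists>Q. (\<forall>i\<le>d. primeideal (Q i) R) \<and> (\<forall>i<d. Q i \<subset> Q (Suc i))) \<and>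
    (\<forall>n Q. (\<forall>i\<le>n. primeideal (Q i) R) \<and> (\<forall>i<n. Q i \<subset> Q (Suc i)) \<longrightarrow> n \<le> d) \<and>
    (\<forall>e b. (\<forall>i<e. b i \<in> carrier F) \<and> ring.alg_indep F (\<iota> ` K) b e \<longrightarrow> e \<le> d)"
proof -
  interpret R: domain R by (rule R)
  interpret F: field F by (rule F)
  interpret h: ring_hom_ring R F \<iota> by (rule ring_hom_ringI2[OF R.ring_axioms F.ring_axioms \<iota>(1)])
  interpret m: primeideal \<mm> R by (rule m)
  define K' where "K' = \<iota> ` K"
  have K': "subfield K' F" using K(2) by (simp add: K'_def)
  note Ks = subfieldE(1)[OF K'] and Kc = subfieldE(3)[OF K']
  obtain t r where t: "T = t ` {i. i < (r::nat)}" using finite_imp_nat_seg_image_inj_on[OF T(1)] by auto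
  have tT: "t i \<in> T" if "i < r" for i using t that by auto
  have tc: "t i \<in> carrier R" if "i < r" for i using tT[OF that] T by auto
  have "\<exists>n y. y \<in> R.lspan K ((\<lambda>j. t i [^]\<^bsub>R\<^esub> j) ` {..<n::nat}) \<and> t i [^]\<^bsub>R\<^esub> n \<ominus>\<^bsub>R\<^esub> y \<in> \<mm>" if "i < r" for i
    using alg[OF tT[OF that]] by blast
  then obtain n y where ny: "\<And>i. i < r \<Longrightarrow> y i \<in> R.lspan K ((\<lambda>j. t i [^]\<^bsub>R\<^esub> j) ` {..<n i::nat})"
      "\<And>i. i < r \<Longrightarrow> t i [^]\<^bsub>R\<^esub> n i \<ominus>\<^bsub>R\<^esub> y i \<in> \<mm>" by metis
  have powc: "(\<lambda>j. t i [^]\<^bsub>R\<^esub> j) ` {..<k::nat} \<subseteq> carrier R" if "i < r" for i k using tc[OF that] by auto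
  have yc: "y i \<in> carrier R" if "i < r" for i
    using ny(1)[OF that] R.lspan_carrier[OF K(1) powc[OF that]] by auto
  have n0: "0 < n i" if "i < r" for i
  proof (rule ccontr)
    assume n: "\<not> 0 < n i"
    have "R.lspan K {} \<subseteq> {\<zero>\<^bsub>R\<^esub>}" by (rule R.lspan_least) auto
    then have "y i = \<zero>\<^bsub>R\<^esub>" using ny(1)[OF that] n by auto
    then have "\<one>\<^bsub>R\<^esub> \<in> \<mm>" using ny(2)[OF that] n by (simp add: a_minus_def)
    then show False using m.I_notcarr m.one_imp_carrier by auto
  qed
  define \<tau> where "\<tau> i = \<iota> (t i)" for i
  \<comment> \<open>A generator need not lie in \<open>\<mm>\<close>, but its monic equation modulo
    \<open>\<mm>\<close> has a value that does. The generators are integral over the ring of these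
    values, so normalizing that ring puts all variables into \<open>\<mm>\<close>.\<close>
  define \<sigma> where "\<sigma> i = \<iota> (t i [^]\<^bsub>R\<^esub> n i \<ominus>\<^bsub>R\<^esub> y i)" for i
  have \<tau>c: "\<tau> i \<in> carrier F" if "i < r" for i unfolding \<tau>_def using tc[OF that] by auto
  define J where "J = \<iota> ` \<mm>"
  have J: "J \<subseteq> carrier F" "\<And>a b. a \<in> J \<Longrightarrow> b \<in> J \<Longrightarrow> a \<ominus>\<^bsub>F\<^esub> b \<in> J" "\<And>a b. a \<in> J \<Longrightarrow> b \<in> J \<Longrightarrow> a \<otimes>\<^bsub>F\<^esub> b \<in> J"
  proof -
    show "J \<subseteq> carrier F" unfolding J_def using m.Icarr by auto
    fix a b assume "a \<in> J" "b \<in> J"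
    then obtain a' b' where ab: "a' \<in> \<mm>" "b' \<in> \<mm>" "a = \<iota> a'" "b = \<iota> b'" unfolding J_def by auto
    have c: "a' \<in> carrier R" "b' \<in> carrier R" using ab m.Icarr by auto
    have "a \<ominus>\<^bsub>F\<^esub> b = \<iota> (a' \<ominus>\<^bsub>R\<^esub> b')" "a \<otimes>\<^bsub>F\<^esub> b = \<iota> (a' \<otimes>\<^bsub>R\<^esub> b')"
      unfolding ab using c by (auto simp: a_minus_def)
    moreover have "a' \<ominus>\<^bsub>R\<^esub> b' \<in> \<mm>" "a' \<otimes>\<^bsub>R\<^esub> b' \<in> \<mm>"
      unfolding a_minus_def using m.a_closed[OF ab(1) m.a_inv_closed[OF ab(2)]] m.I_l_closed[OF ab(2) c(1)]
      by simp_all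
    ultimately show "a \<ominus>\<^bsub>F\<^esub> b \<in> J" "a \<otimes>\<^bsub>F\<^esub> b \<in> J" unfolding J_def by auto
  qed
  have notJ: "\<iota> a \<notin> J" if "a \<in> carrier R" "a \<notin> \<mm>" for a
  proof
    assume "\<iota> a \<in> J"
    then obtain a' where a': "a' \<in> \<mm>" "\<iota> a = \<iota> a'" unfolding J_def by auto
    then have "a = a'" using inj_onD[OF \<iota>(2) a'(2) that(1) m.Icarr[OF a'(1)]] by simp
    then show False using a' that by simp
  qed
  have \<sigma>J: "\<sigma> i \<in> J" if "i < r" for i using ny(2)[OF that] unfolding \<sigma>_def J_def by auto
  have \<sigma>c: "\<sigma> i \<in> carrier F" if "i < r" for i using \<sigma>J[OF that] J(1) by auto
  define A where "A = F.pring K' \<tau> r"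
  define A0 where "A0 = F.pring K' \<sigma> r"
  have A: "subring A F" unfolding A_def using \<tau>c Kc by (intro F.pring_subring) auto
  have A0: "subring A0 F" unfolding A0_def using \<sigma>c Kc by (intro F.pring_subring) auto
  note Acl = subringE(2,3,5,6,7)[OF A] and Ac = subringE(1)[OF A]
  have KA: "K' \<subseteq> A" unfolding A_def by (rule F.pring_base)
  have \<tau>A: "\<tau> i \<in> A" if "i < r" for i unfolding A_def by (rule F.pring_gen[OF that])
  have Aimg: "A = \<iota> ` generate_ring R (K \<union> T)"
  proof -
    have "\<iota> ` T = \<tau> ` {..<r}" unfolding t \<tau>_def by auto
    then have "\<iota> ` (K \<union> T) = K' \<union> \<tau> ` {..<r}" unfolding K'_def by auto
    then show ?thesis
      using h.generate_ring_image[of "K \<union> T"] K(1) T(2) unfolding A_def F.pring_def by simp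
  qed
  have yF: "\<iota> (y i) \<in> F.lspan K' ((\<lambda>j. \<tau> i [^]\<^bsub>F\<^esub> j) ` {..<n i})" if "i < r" for i
  proof -
    have "\<iota> ` (\<lambda>j. t i [^]\<^bsub>R\<^esub> j) ` {..<n i} = (\<lambda>j. \<tau> i [^]\<^bsub>F\<^esub> j) ` {..<n i}"
      unfolding \<tau>_def image_image using h.nat_pow_image[OF tc[OF that]] by auto
    then show ?thesis using h.lspan_image[OF K(1) powc[OF that] ny(1)[OF that]] unfolding K'_def by simp
  qed
  have \<tau>pc: "(\<lambda>j. \<tau> i [^]\<^bsub>F\<^esub> j) ` {..<n i} \<subseteq> carrier F" if "i < r" for i using \<tau>c[OF that] by auto
  have \<sigma>\<tau>: "\<tau> i [^]\<^bsub>F\<^esub> n i = \<sigma> i \<oplus>\<^bsub>F\<^esub> \<iota> (y i)" if "i < r" for i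
  proof -
    have "\<iota> (t i [^]\<^bsub>R\<^esub> n i) \<in> carrier F" "\<iota> (y i) \<in> carrier F" using tc[OF that] yc[OF that] by auto
    moreover have "\<sigma> i = \<iota> (t i [^]\<^bsub>R\<^esub> n i) \<ominus>\<^bsub>F\<^esub> \<iota> (y i)"
      unfolding \<sigma>_def using tc[OF that] yc[OF that] by (auto simp: a_minus_def)
    ultimately have "\<iota> (t i [^]\<^bsub>R\<^esub> n i) = \<sigma> i \<oplus>\<^bsub>F\<^esub> \<iota> (y i)" by (simp add: a_minus_def F.add.m_assoc F.l_neg)
    then show ?thesis unfolding \<tau>_def using h.nat_pow_image[OF tc[OF that]] by simp
  qed
  have int: "\<tau> i \<in> carrier F \<and> \<tau> i [^]\<^bsub>F\<^esub> n i \<in> F.lspan A0 ((\<lambda>j. \<tau> i [^]\<^bsub>F\<^esub> j) ` {..<n i})" if i: "i < r" for i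
  proof -
    have "\<sigma> i \<otimes>\<^bsub>F\<^esub> \<tau> i [^]\<^bsub>F\<^esub> (0::nat) \<in> F.lspan A0 ((\<lambda>j. \<tau> i [^]\<^bsub>F\<^esub> j) ` {..<n i})"
      using n0[OF i] F.pring_gen[OF i, of \<sigma> K'] unfolding A0_def[symmetric]
      by (intro F.lspan_smult_closed[OF A0 \<tau>pc[OF i]] F.lspan_incl[OF A0 \<tau>pc[OF i]] imageI) auto
    moreover have "\<iota> (y i) \<in> F.lspan A0 ((\<lambda>j. \<tau> i [^]\<^bsub>F\<^esub> j) ` {..<n i})"
      using yF[OF i] F.lspan_mono[OF F.pring_base[of K' \<sigma> r] order_refl] unfolding A0_def by auto
    moreover have "\<sigma> i \<otimes>\<^bsub>F\<^esub> \<tau> i [^]\<^bsub>F\<^esub> (0::nat) = \<sigma> i" using \<sigma>c[OF i] by simp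
    ultimately show ?thesis
      using F.lspan_add_closed[OF subringE(1)[OF A0] \<tau>pc[OF i]] \<sigma>\<tau>[OF i] \<tau>c[OF i] by simp
  qed
  have \<sigma>A: "\<sigma> i \<in> A" if i: "i < r" for i
  proof -
    have "F.lspan K' ((\<lambda>j. \<tau> i [^]\<^bsub>F\<^esub> j) ` {..<n i}) \<subseteq> A"
      using KA F.nat_pow_in_subring[OF A \<tau>A[OF i]] Acl by (intro F.lspan_least) (auto simp: subset_iff)
    then have yA: "\<iota> (y i) \<in> A" using yF[OF i] by auto
    have "\<sigma> i = \<tau> i [^]\<^bsub>F\<^esub> n i \<oplus>\<^bsub>F\<^esub> \<ominus>\<^bsub>F\<^esub> \<iota> (y i)"
      unfolding \<sigma>\<tau>[OF i] using \<sigma>c[OF i] yc[OF i] by (simp add: F.add.m_assoc F.r_neg)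
    moreover have "\<tau> i [^]\<^bsub>F\<^esub> n i \<in> A" by (rule F.nat_pow_in_subring[OF A \<tau>A[OF i]])
    ultimately show ?thesis using yA Acl(3,5) by simp
  qed
  have A0A: "A0 \<subseteq> A" unfolding A0_def using \<sigma>A KA by (intro F.pring_least[OF A]) auto
  have "F.pring A0 \<tau> r = A"
  proof
    show "F.pring A0 \<tau> r \<subseteq> A" using A0A \<tau>A by (intro F.pring_least[OF A]) auto
    have "subring (F.pring A0 \<tau> r) F" using \<tau>c subringE(1)[OF A0] by (intro F.pring_subring) auto
    moreover have "K' \<subseteq> F.pring A0 \<tau> r"
      using F.pring_base[of A0 \<tau> r] F.pring_base[of K' \<sigma> r] unfolding A0_def by auto
    ultimately show "A \<subseteq> F.pring A0 \<tau> r" unfolding A_def by (intro F.pring_least F.pring_gen)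
  qed
  then obtain W1 where W1: "finite W1" "W1 \<subseteq> A" "A \<subseteq> F.lspan A0 W1"
    using F.pring_finite[OF A0, of r \<tau> n] int by metis
  have "\<exists>e z W. (\<forall>i<e. z i \<in> J \<inter> A0) \<and> F.alg_indep K' z e \<and> finite W \<and> W \<subseteq> A0 \<and>
      A0 \<subseteq> F.lspan (F.pring K' z e) W"
    unfolding A0_def by (rule F.noether_normalization[OF K']) (fact J \<sigma>J)+
  then obtain e z W0 where NN: "\<forall>i<e. z i \<in> J \<inter> A0" "F.alg_indep K' z e" "finite W0" "W0 \<subseteq> A0"
      "A0 \<subseteq> F.lspan (F.pring K' z e) W0"
    by (elim exE conjE) (rule that)
  have zA: "z i \<in> A" if "i < e" for i using NN(1) A0A that by auto
  have zc: "z i \<in> carrier F" if "i < e" for i using zA[OF that] Ac by auto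
  have B: "subring (F.pring K' z e) F" using zc Kc by (intro F.pring_subring) auto
  have BA: "F.pring K' z e \<subseteq> A" using zA KA by (intro F.pring_least[OF A]) auto
  define W where "W = (\<lambda>(v, w). v \<otimes>\<^bsub>F\<^esub> w) ` (W0 \<times> W1)"
  have W: "finite W" "W \<subseteq> A" "A \<subseteq> F.lspan (F.pring K' z e) W"
  proof -
    show "finite W" unfolding W_def using NN W1 by auto
    have W0A: "W0 \<subseteq> A" using NN(4) A0A by auto
    show "W \<subseteq> A" unfolding W_def using W0A W1(2) Acl(4) by (auto simp: subset_iff)
    have "A \<subseteq> F.lspan (F.pring K' z e) {v \<otimes>\<^bsub>F\<^esub> w | v w. v \<in> W0 \<and> w \<in> W1}"
      using F.lspan_tower[OF B A0 _ _ NN(5), of W1] W0A W1 Ac by auto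
    also have "\<dots> \<subseteq> F.lspan (F.pring K' z e) W" unfolding W_def by (intro F.lspan_mono) auto
    finally show "A \<subseteq> F.lspan (F.pring K' z e) W" .
  qed
  define RR where "RR = \<iota> ` carrier R"
  have RR: "subring RR F" unfolding RR_def by (rule h.img_is_subring[OF R.carrier_is_subring])
  note RRc = subringE(1)[OF RR]
  have fracF: "carrier F \<subseteq> F.fracs A"
  proof -
    have "\<iota> b \<in> F.fracs A" if b: "b \<in> carrier R" for b
    proof -
      obtain a s where as: "a \<in> generate_ring R (K \<union> T)" "s \<in> generate_ring R (K \<union> T)" "s \<notin> \<mm>" "b \<otimes>\<^bsub>R\<^esub> s = a"
        using loc[OF b] by blast
      have sc: "s \<in> carrier R" using R.generate_ring_in_carrier[of "K \<union> T" s] K(1) T(2) as by auto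
      have "\<iota> s \<noteq> \<zero>\<^bsub>F\<^esub>"
      proof
        assume "\<iota> s = \<zero>\<^bsub>F\<^esub>"
        then have "\<iota> s = \<iota> \<zero>\<^bsub>R\<^esub>" by simp
        then have "s = \<zero>\<^bsub>R\<^esub>" using inj_onD[OF \<iota>(2) _ sc] by simp
        then show False using as(3) m.zero_closed by simp
      qed
      moreover have "\<iota> s \<otimes>\<^bsub>F\<^esub> \<iota> b = \<iota> a" using as(4) b sc F.m_comm by auto
      ultimately show ?thesis using as b unfolding Aimg
        by (intro F.fracsI[OF _ imageI[OF as(2)]]) (use Ac in \<open>auto simp: Aimg\<close>)
    qed
    then have "RR \<subseteq> F.fracs A" unfolding RR_def by auto
    then have "F.fracs RR \<subseteq> F.fracs A" by (intro F.fracs_least[OF F.fracs_subfield[OF A]])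
    then show ?thesis using frac unfolding RR_def by auto
  qed
  have third: "k \<le> e" if "\<And>i. i < k \<Longrightarrow> b i \<in> carrier F" "F.alg_indep K' b k" for k b
    using F.alg_indep_le_normalization[OF K' A KA zA W that(2)] that(1) fracF by auto
  have second: "k \<le> e" if Q: "\<forall>i\<le>k. primeideal (Q i) R" "\<forall>i<k. Q i \<subset> Q (Suc i)" for k Q
  proof -
    have pin: "F.prime_in RR (\<iota> ` Q i)" if "i \<le> k" for i
    proof -
      interpret Q: primeideal "Q i" R using Q(1) that by auto
      have Qc: "Q i \<subseteq> carrier R" using Q.Icarr by auto
      have mem: "a \<in> Q i" if aQ: "\<iota> a \<in> \<iota> ` Q i" "a \<in> carrier R" for a
      proof -
        obtain a' where a': "a' \<in> Q i" "\<iota> a = \<iota> a'" using aQ(1) by auto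
        then have "a = a'" using inj_onD[OF \<iota>(2) a'(2) aQ(2) Q.Icarr[OF a'(1)]] by simp
        then show ?thesis using a' by simp
      qed
      show ?thesis unfolding F.prime_in_def
      proof (intro conjI ballI impI)
        show "\<iota> ` Q i \<subseteq> RR" unfolding RR_def using Qc by auto
        show "\<zero>\<^bsub>F\<^esub> \<in> \<iota> ` Q i" using Q.zero_closed by (intro image_eqI[of _ _ "\<zero>\<^bsub>R\<^esub>"]) auto
        show "\<one>\<^bsub>F\<^esub> \<notin> \<iota> ` Q i"
        proof
          assume "\<one>\<^bsub>F\<^esub> \<in> \<iota> ` Q i"
          then have "\<one>\<^bsub>R\<^esub> \<in> Q i" using mem[of "\<one>\<^bsub>R\<^esub>"] by simp
          then show False using Q.I_notcarr Q.one_imp_carrier by auto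
        qed
      next
        fix a b assume "a \<in> \<iota> ` Q i" "b \<in> \<iota> ` Q i"
        then obtain a' b' where ab: "a' \<in> Q i" "b' \<in> Q i" "a = \<iota> a'" "b = \<iota> b'" by auto
        then have "a \<oplus>\<^bsub>F\<^esub> b = \<iota> (a' \<oplus>\<^bsub>R\<^esub> b')" using Qc by auto
        then show "a \<oplus>\<^bsub>F\<^esub> b \<in> \<iota> ` Q i" using Q.a_closed[OF ab(1,2)] by (metis imageI)
      next
        fix a b assume "a \<in> RR" "b \<in> \<iota> ` Q i"
        then obtain a' b' where ab: "a' \<in> carrier R" "b' \<in> Q i" "a = \<iota> a'" "b = \<iota> b'" unfolding RR_def by auto
        then have "a \<otimes>\<^bsub>F\<^esub> b = \<iota> (a' \<otimes>\<^bsub>R\<^esub> b')" using Qc by auto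
        then show "a \<otimes>\<^bsub>F\<^esub> b \<in> \<iota> ` Q i" using Q.I_l_closed[OF ab(2,1)] by (metis imageI)
      next
        fix a b assume "a \<in> RR" "b \<in> RR" and abQ: "a \<otimes>\<^bsub>F\<^esub> b \<in> \<iota> ` Q i"
        then obtain a' b' where ab: "a' \<in> carrier R" "b' \<in> carrier R" "a = \<iota> a'" "b = \<iota> b'" unfolding RR_def by auto
        then have "\<iota> (a' \<otimes>\<^bsub>R\<^esub> b') \<in> \<iota> ` Q i" using abQ by simp
        then have "a' \<otimes>\<^bsub>R\<^esub> b' \<in> Q i" using mem[of "a' \<otimes>\<^bsub>R\<^esub> b'"] ab(1,2) by simp
        then have "a' \<in> Q i \<or> b' \<in> Q i" by (rule Q.I_prime[OF ab(1,2)])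
        then show "a \<in> \<iota> ` Q i \<or> b \<in> \<iota> ` Q i" using ab(3,4) by auto
      qed
    qed
    have strict: "\<iota> ` Q i \<subset> \<iota> ` Q (Suc i)" if "i < k" for i
    proof -
      have "Q (Suc i) \<subseteq> carrier R"
        using Q(1) that ideal.Icarr[OF primeideal.axioms(1)[of "Q (Suc i)" R]] by auto
      moreover have "Q i \<subset> Q (Suc i)" using Q(2) that by auto
      ultimately show ?thesis using \<iota>(2) inj_on_image_eq_iff[of \<iota> "carrier R" "Q i" "Q (Suc i)"] by auto
    qed
    have KR: "K' \<subseteq> RR" unfolding K'_def RR_def using K(1) by auto
    have "\<exists>b. (\<forall>i<k. b i \<in> RR) \<and> F.alg_indep K' b k"
      by (rule F.prime_chain_alg_indep[OF K' RR KR, of k "\<lambda>i. \<iota> ` Q i"]) (fact pin strict)+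
    then obtain b where "\<forall>i<k. b i \<in> RR" "F.alg_indep K' b k" by auto
    then show ?thesis using third[of k b] RRc by auto
  qed
  have first: "\<exists>Q. (\<forall>i\<le>e. primeideal (Q i) R) \<and> (\<forall>i<e. Q i \<subset> Q (Suc i))"
  proof -
    have "\<forall>i<e. \<exists>x\<in>\<mm>. \<iota> x = z i" using NN(1) unfolding J_def by (metis IntD1 imageE)
    then obtain x where x: "\<And>i. i < e \<Longrightarrow> x i \<in> \<mm> \<and> \<iota> (x i) = z i" by metis
    have xc: "x i \<in> carrier R" if "i < e" for i using x[OF that] m.Icarr by auto
    define S where "S = carrier R - \<mm>"
    have S: "S \<subseteq> carrier R" "\<one>\<^bsub>R\<^esub> \<in> S" "\<And>s t. s \<in> S \<Longrightarrow> t \<in> S \<Longrightarrow> s \<otimes>\<^bsub>R\<^esub> t \<in> S"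
      unfolding S_def using m.I_notcarr m.one_imp_carrier m.I_prime by auto
    have Sm: "\<iota> s \<otimes>\<^bsub>F\<^esub> \<iota> t \<notin> J" if "s \<in> S" "t \<in> S" for s t
    proof -
      have "\<iota> (s \<otimes>\<^bsub>R\<^esub> t) \<notin> J" using S(3)[OF that] notJ unfolding S_def by auto
      then show ?thesis using that S(1) by (auto simp: subset_iff)
    qed
    \<comment> \<open>The denominators at hand: images of elements outside \<open>\<mm>\<close> that
      already come from the finitely generated algebra \<open>A\<close>.\<close>
    define G where "G = (A \<inter> \<iota> ` S)"
    have Gm: "g \<otimes>\<^bsub>F\<^esub> g' \<in> G" if gG: "g \<in> G" "g' \<in> G" for g g'
    proof -
      obtain s s' where s: "s \<in> S" "s' \<in> S" "g = \<iota> s" "g' = \<iota> s'" using gG unfolding G_def by auto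
      then have "g \<otimes>\<^bsub>F\<^esub> g' = \<iota> (s \<otimes>\<^bsub>R\<^esub> s')" using S(1) by (auto simp: subset_iff)
      moreover have "g \<otimes>\<^bsub>F\<^esub> g' \<in> A" using gG Acl(4) unfolding G_def by auto
      ultimately show ?thesis using S(3)[OF s(1,2)] unfolding G_def by (metis IntI imageI)
    qed
    have Gc: "G \<subseteq> carrier F" "G \<subseteq> A" using Ac unfolding G_def by auto
    have G1: "\<one>\<^bsub>F\<^esub> \<in> G" unfolding G_def using S(2) Acl(2) by (auto intro!: image_eqI[of _ _ "\<one>\<^bsub>R\<^esub>"])
    have den: "\<exists>g\<in>G. g \<otimes>\<^bsub>F\<^esub> b \<in> A" if b: "b \<in> RR" for b
    proof -
      obtain b' where b': "b' \<in> carrier R" "b = \<iota> b'" using b unfolding RR_def by auto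
      obtain a s where as: "a \<in> generate_ring R (K \<union> T)" "s \<in> generate_ring R (K \<union> T)" "s \<notin> \<mm>" "b' \<otimes>\<^bsub>R\<^esub> s = a"
        using loc[OF b'(1)] by blast
      have sc: "s \<in> carrier R" using R.generate_ring_in_carrier[of "K \<union> T" s] K(1) T(2) as by auto
      have "\<iota> s \<otimes>\<^bsub>F\<^esub> b = \<iota> a" using as(4) b' sc F.m_comm by auto
      moreover have "\<iota> s \<in> G" unfolding G_def S_def Aimg using as sc by auto
      ultimately show ?thesis using as(1) unfolding Aimg by auto
    qed
    have "\<zero>\<^bsub>R\<^esub> \<notin> R.bdry (carrier R) S x e"
    proof
      assume zb: "\<zero>\<^bsub>R\<^esub> \<in> R.bdry (carrier R) S x e"
      have "\<forall>j<e. x j \<in> carrier R" using xc by simp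
      from conjunct2[OF h.bdry_image[OF S(1) this zb]]
      have b0: "\<zero>\<^bsub>F\<^esub> \<in> F.bdry RR (\<iota> ` S) (\<lambda>j. \<iota> (x j)) e" unfolding RR_def by (simp only: h.hom_zero)
      define zz where "zz j = \<iota> (x j)" for j
      have zz: "zz j = z j" if "j < e" for j using x[OF that] by (simp add: zz_def)
      have znz: "\<forall>j<e. zz j \<in> carrier F \<and> zz j \<noteq> \<zero>\<^bsub>F\<^esub>"
      proof (intro allI impI conjI)
        fix j assume j: "j < e"
        show "zz j \<in> carrier F" using zz[OF j] zc[OF j] by simp
        have Pj: "subring (F.pring K' z j) F" using zc j Kc by (intro F.pring_subring) auto
        have "z j \<notin> F.pring K' z j"
          using F.transcendental_notin[OF Pj _ zc[OF j]] NN(2) j unfolding F.alg_indep_def by auto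
        then show "zz j \<noteq> \<zero>\<^bsub>F\<^esub>" using subringE(2)[OF Pj] zz[OF j] by metis
      qed
      have SR: "\<iota> ` S \<subseteq> RR" using S(1) unfolding RR_def by auto
      obtain q \<mu> u w where q: "q 0 = \<one>\<^bsub>F\<^esub>" "\<And>j. q (Suc j) = q j \<otimes>\<^bsub>F\<^esub> zz j [^]\<^bsub>F\<^esub> (\<mu> j :: nat)"
          "\<And>j. j \<le> e \<Longrightarrow> q j \<in> carrier F \<and> q j \<noteq> \<zero>\<^bsub>F\<^esub>"
        and u: "u \<in> \<iota> ` S" "w \<in> F.lspan RR ((\<lambda>j. zz j \<otimes>\<^bsub>F\<^esub> inv\<^bsub>F\<^esub> (q j)) ` {..<e})" "\<zero>\<^bsub>F\<^esub> = q e \<otimes>\<^bsub>F\<^esub> (u \<oplus>\<^bsub>F\<^esub> w)"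
        using F.bdry_shape[OF RR SR znz b0[folded zz_def]] by (elim exE conjE) (rule that; simp)
      define V where "V = (\<lambda>j. z j \<otimes>\<^bsub>F\<^esub> inv\<^bsub>F\<^esub> (q j)) ` {..<e}"
      have Veq: "(\<lambda>j. zz j \<otimes>\<^bsub>F\<^esub> inv\<^bsub>F\<^esub> (q j)) ` {..<e} = V" unfolding V_def using zz by auto
      have Vc: "V \<subseteq> carrier F" unfolding V_def using zc q(3) F.inv_nonzero_closed by auto
      have wV: "w \<in> F.lspan RR V" using u(2) unfolding Veq .
      have wc: "w \<in> carrier F" using wV F.lspan_carrier[OF RRc Vc] by auto
      have uc: "u \<in> carrier F" "u \<in> RR" using u(1) SR RRc by auto
      have "u \<oplus>\<^bsub>F\<^esub> w = \<zero>\<^bsub>F\<^esub>" using u(3) q(3)[of e] uc wc F.integral[of "q e" "u \<oplus>\<^bsub>F\<^esub> w"] by auto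
      then have uw: "u = \<ominus>\<^bsub>F\<^esub> w" using uc wc F.minus_equality by (metis F.minus_minus F.a_comm)
      have uV: "u \<in> F.lspan RR V" unfolding uw by (rule F.lspan_uminus_closed[OF RR Vc wV])
      \<comment> \<open>The lexicographic argument needs coefficients in the module-finite ring
        \<open>A\<close>, whereas unfolding the boundary monoid gives coefficients in
        \<open>RR\<close>. A factor from \<open>G\<close> clears the difference.\<close>
      have "\<exists>g\<in>G. g \<otimes>\<^bsub>F\<^esub> v \<in> F.lspan A V" if "v \<in> F.lspan RR V" for v
        using that
      proof induction
        case zero
        then show ?case using G1 F.lspan.zero by (intro bexI[of _ "\<one>\<^bsub>F\<^esub>"]) auto
      next
        case (add b v x)
        then obtain g g' where g: "g \<in> G" "g \<otimes>\<^bsub>F\<^esub> x \<in> F.lspan A V" "g' \<in> G" "g' \<otimes>\<^bsub>F\<^esub> b \<in> A" using den by blast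
        have c: "b \<in> carrier F" "v \<in> carrier F" "x \<in> carrier F" "g \<in> carrier F" "g' \<in> carrier F"
          using add.hyps RRc Vc F.lspan_carrier[OF RRc Vc] g Gc by auto
        have "(g \<otimes>\<^bsub>F\<^esub> g') \<otimes>\<^bsub>F\<^esub> (b \<otimes>\<^bsub>F\<^esub> v \<oplus>\<^bsub>F\<^esub> x) = (g \<otimes>\<^bsub>F\<^esub> (g' \<otimes>\<^bsub>F\<^esub> b)) \<otimes>\<^bsub>F\<^esub> v \<oplus>\<^bsub>F\<^esub> g' \<otimes>\<^bsub>F\<^esub> (g \<otimes>\<^bsub>F\<^esub> x)"
          using c by algebra
        moreover have "(g \<otimes>\<^bsub>F\<^esub> (g' \<otimes>\<^bsub>F\<^esub> b)) \<otimes>\<^bsub>F\<^esub> v \<oplus>\<^bsub>F\<^esub> g' \<otimes>\<^bsub>F\<^esub> (g \<otimes>\<^bsub>F\<^esub> x) \<in> F.lspan A V"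
          by (rule F.lspan.add[OF _ add.hyps(2) F.lspan_smult_closed[OF A Vc _ g(2)]])
            (use g Gc(2) Acl(4) in auto)
        ultimately show ?case using Gm[OF g(1,3)] by metis
      qed
      then obtain g where g: "g \<in> G" "g \<otimes>\<^bsub>F\<^esub> u \<in> F.lspan A V" using uV by blast
      obtain g' where g': "g' \<in> G" "g' \<otimes>\<^bsub>F\<^esub> u \<in> A" using den uc by blast
      \<comment> \<open>A second factor brings \<open>u\<close> itself into \<open>A\<close>. As
        \<open>U\<close> is a product of three elements outside the prime ideal
        \<open>\<mm>\<close>, it cannot lie in \<open>J\<close>; the lexicographic argument puts it
        there.\<close>
      define U where "U = g' \<otimes>\<^bsub>F\<^esub> (g \<otimes>\<^bsub>F\<^esub> u)"
      have gc: "g \<in> carrier F" "g' \<in> carrier F" using g g' Gc by auto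
      have "U = g \<otimes>\<^bsub>F\<^esub> (g' \<otimes>\<^bsub>F\<^esub> u)" unfolding U_def using gc uc by (simp add: F.m_lcomm)
      then have UA: "U \<in> A" using Acl(4) g Gc(2) g' by auto
      have UV: "U \<in> F.lspan A V" unfolding U_def
        by (rule F.lspan_smult_closed[OF A Vc _ g(2)]) (use g' Gc(2) in auto)
      have "U \<in> J \<inter> A"
      proof (rule F.lex_combination_in_prime[OF K' NN(2) A BA W])
        show "J \<inter> A \<subseteq> A" by auto
        show "\<zero>\<^bsub>F\<^esub> \<in> J \<inter> A" unfolding J_def using m.zero_closed Acl(1) by (auto intro!: image_eqI[of _ _ "\<zero>\<^bsub>R\<^esub>"])
        show "z i \<in> J \<inter> A" if "i < e" for i using NN(1) zA that by auto
        show "q 0 = \<one>\<^bsub>F\<^esub>" by (rule q(1))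
        show "U \<in> A" by (rule UA)
      next
        fix a b assume "a \<in> J \<inter> A" "b \<in> J \<inter> A"
        then obtain a' b' where ab: "a' \<in> \<mm>" "b' \<in> \<mm>" "a = \<iota> a'" "b = \<iota> b'" "a \<in> A" "b \<in> A" unfolding J_def by auto
        then have "a \<oplus>\<^bsub>F\<^esub> b = \<iota> (a' \<oplus>\<^bsub>R\<^esub> b')" using m.Icarr by auto
        moreover have "a \<oplus>\<^bsub>F\<^esub> b \<in> A" using ab Acl(5) by simp
        ultimately show "a \<oplus>\<^bsub>F\<^esub> b \<in> J \<inter> A" using m.a_closed[OF ab(1,2)] unfolding J_def by (metis IntI imageI)
      next
        fix a b assume "a \<in> A" "b \<in> J \<inter> A"
        moreover have "A \<subseteq> RR" unfolding Aimg RR_def using R.generate_ring_incl[of "K \<union> T"] K(1) T(2) by auto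
        ultimately obtain a' b' where ab: "a' \<in> carrier R" "b' \<in> \<mm>" "a = \<iota> a'" "b = \<iota> b'" "a \<in> A" "b \<in> A"
          unfolding J_def RR_def by blast
        then have "a \<otimes>\<^bsub>F\<^esub> b = \<iota> (a' \<otimes>\<^bsub>R\<^esub> b')" using m.Icarr by auto
        moreover have "a \<otimes>\<^bsub>F\<^esub> b \<in> A" using ab Acl(4) by simp
        ultimately show "a \<otimes>\<^bsub>F\<^esub> b \<in> J \<inter> A" using m.I_l_closed[OF ab(2,1)] unfolding J_def by (metis IntI imageI)
      next
        fix a and k :: nat assume a: "a \<in> A" "a [^]\<^bsub>F\<^esub> k \<in> J \<inter> A"
        have "A \<subseteq> RR" unfolding Aimg RR_def using R.generate_ring_incl[of "K \<union> T"] K(1) T(2) by auto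
        then obtain a' where a': "a' \<in> carrier R" "a = \<iota> a'" using a(1) unfolding RR_def by auto
        have "a' \<in> \<mm>"
        proof (rule ccontr)
          assume "a' \<notin> \<mm>"
          then have "a' [^]\<^bsub>R\<^esub> i \<in> S" for i :: nat using S a'(1) unfolding S_def by (induction i) auto
          then have "\<iota> (a' [^]\<^bsub>R\<^esub> k) \<notin> J" using notJ unfolding S_def by auto
          then show False using a(2) h.nat_pow_image[OF a'(1)] a'(2) by auto
        qed
        then show "a \<in> J \<inter> A" using a a' unfolding J_def by auto
      next
        show "U \<in> F.lspan A ((\<lambda>j. z j \<otimes>\<^bsub>F\<^esub> inv\<^bsub>F\<^esub> (q j)) ` {..<e})" using UV unfolding V_def .
        show "q (Suc j) = q j \<otimes>\<^bsub>F\<^esub> z j [^]\<^bsub>F\<^esub> \<mu> j" if "j < e" for j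
          using q(2)[of j] zz[OF that] by simp
      qed
      moreover obtain s s' s'' where s: "g = \<iota> s" "g' = \<iota> s'" "u = \<iota> s''" "s \<in> S" "s' \<in> S" "s'' \<in> S"
        using g(1) g'(1) u(1) unfolding G_def by auto
      have "U = \<iota> (s' \<otimes>\<^bsub>R\<^esub> (s \<otimes>\<^bsub>R\<^esub> s''))" unfolding U_def s(1-3) using s(4-6) S(1) by (auto simp: subset_iff)
      moreover have "s' \<otimes>\<^bsub>R\<^esub> (s \<otimes>\<^bsub>R\<^esub> s'') \<in> S" by (intro S(3) s(4-6))
      ultimately show False using notJ[of "s' \<otimes>\<^bsub>R\<^esub> (s \<otimes>\<^bsub>R\<^esub> s'')"] unfolding S_def by auto
    qed
    then show ?thesis using R.exists_prime_chain[OF S xc] by auto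
  qed
  show ?thesis
    using first second third unfolding K'_def by (intro exI[of _ e]) auto
qed

section \<open>Differential operators over a subring of scalars\<close>

definition (in ring) lin :: "'a set \<Rightarrow> ('a \<Rightarrow> 'a) set" where
  "lin S = {\<delta> \<in> carrier R \<rightarrow> carrier R. (\<forall>x\<in>carrier R. \<forall>y\<in>carrier R. \<delta> (x \<oplus> y) = \<delta> x \<oplus> \<delta> y) \<and>
     (\<forall>s\<in>S. \<forall>x\<in>carrier R. \<delta> (s \<otimes> x) = s \<otimes> \<delta> x)}"

definition (in ring) com :: "('a \<Rightarrow> 'a) \<Rightarrow> 'a \<Rightarrow> 'a \<Rightarrow> 'a" where
  "com \<delta> r = (\<lambda>x. \<delta> (r \<otimes> x) \<ominus> r \<otimes> \<delta> x)"

primrec (in ring) dop :: "'a set \<Rightarrow> nat \<Rightarrow> ('a \<Rightarrow> 'a) set" where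
  "dop S 0 = lin (carrier R)"
| "dop S (Suc n) = {\<delta> \<in> lin S. \<forall>r\<in>carrier R. com \<delta> r \<in> dop S n}"

definition (in ring) der :: "'a set \<Rightarrow> ('a \<Rightarrow> 'a) set" where
  "der S = {d \<in> lin S. \<forall>x\<in>carrier R. \<forall>y\<in>carrier R. d (x \<otimes> y) = x \<otimes> d y \<oplus> y \<otimes> d x}"

context cring
begin

lemma linI:
  assumes "\<And>x. x \<in> carrier R \<Longrightarrow> \<delta> x \<in> carrier R"
    and "\<And>x y. x \<in> carrier R \<Longrightarrow> y \<in> carrier R \<Longrightarrow> \<delta> (x \<oplus> y) = \<delta> x \<oplus> \<delta> y"
    and "\<And>s x. s \<in> S \<Longrightarrow> x \<in> carrier R \<Longrightarrow> \<delta> (s \<otimes> x) = s \<otimes> \<delta> x"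
  shows "\<delta> \<in> lin S"
  using assms by (simp add: lin_def)

lemma linD:
  assumes "\<delta> \<in> lin S"
  shows "x \<in> carrier R \<Longrightarrow> \<delta> x \<in> carrier R"
    and "x \<in> carrier R \<Longrightarrow> y \<in> carrier R \<Longrightarrow> \<delta> (x \<oplus> y) = \<delta> x \<oplus> \<delta> y"
    and "s \<in> S \<Longrightarrow> x \<in> carrier R \<Longrightarrow> \<delta> (s \<otimes> x) = s \<otimes> \<delta> x"
  using assms by (auto simp: lin_def)

lemma lin_zero:
  assumes "\<delta> \<in> lin S"
  shows "\<delta> \<zero> = \<zero>"
proof -
  have "\<delta> \<zero> \<oplus> \<delta> \<zero> = \<delta> \<zero> \<oplus> \<zero>"
    using linD(2)[OF assms zero_closed zero_closed] linD(1)[OF assms zero_closed] by simp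
  thus ?thesis using linD(1)[OF assms zero_closed] add.l_cancel[OF _ _ zero_closed] by blast
qed

lemma lin_uminus:
  assumes "\<delta> \<in> lin S" "x \<in> carrier R"
  shows "\<delta> (\<ominus> x) = \<ominus> \<delta> x"
proof -
  have "\<delta> x \<oplus> \<delta> (\<ominus> x) = \<zero>"
    using linD(2)[OF assms a_inv_closed[OF assms(2)]] lin_zero[OF assms(1)] assms(2)
    by (simp add: r_neg)
  thus ?thesis using linD(1)[OF assms] linD(1)[OF assms(1) a_inv_closed[OF assms(2)]]
    by (metis a_comm minus_equality)
qed

lemma lin_antimono: "S \<subseteq> T \<Longrightarrow> lin T \<subseteq> lin S"
  by (auto simp: lin_def)

lemma lin_cong:
  assumes "\<delta> \<in> lin S" "S \<subseteq> carrier R" "\<And>x. x \<in> carrier R \<Longrightarrow> \<delta> x = \<epsilon> x"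
  shows "\<epsilon> \<in> lin S"
proof (rule linI)
  fix x y assume x: "x \<in> carrier R"
  show "\<epsilon> x \<in> carrier R" using linD(1)[OF assms(1) x] assms(3)[OF x] by simp
  { assume y: "y \<in> carrier R"
    show "\<epsilon> (x \<oplus> y) = \<epsilon> x \<oplus> \<epsilon> y"
      using linD(2)[OF assms(1) x y] assms(3)[OF x] assms(3)[OF y] assms(3)[OF add.m_closed[OF x y]]
      by simp }
  fix s assume s: "s \<in> S"
  hence s': "s \<in> carrier R" using assms(2) by auto
  show "\<epsilon> (s \<otimes> x) = s \<otimes> \<epsilon> x"
    using linD(3)[OF assms(1) s x] assms(3)[OF x] assms(3)[OF m_closed[OF s' x]] by simp
qed

lemma lin_comb:
  assumes "\<delta> \<in> lin S" "\<epsilon> \<in> lin S" "S \<subseteq> carrier R" "a \<in> carrier R" "b \<in> carrier R"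
  shows "(\<lambda>x. a \<otimes> \<delta> x \<oplus> b \<otimes> \<epsilon> x) \<in> lin S"
proof (rule linI)
  fix x y assume x: "x \<in> carrier R"
  have c: "\<delta> x \<in> carrier R" "\<epsilon> x \<in> carrier R"
    using linD(1)[OF assms(1) x] linD(1)[OF assms(2) x] by auto
  show "a \<otimes> \<delta> x \<oplus> b \<otimes> \<epsilon> x \<in> carrier R" using c assms(4,5) by simp
  { assume y: "y \<in> carrier R"
    have cy: "\<delta> y \<in> carrier R" "\<epsilon> y \<in> carrier R"
      using linD(1)[OF assms(1) y] linD(1)[OF assms(2) y] by auto
    show "a \<otimes> \<delta> (x \<oplus> y) \<oplus> b \<otimes> \<epsilon> (x \<oplus> y) = a \<otimes> \<delta> x \<oplus> b \<otimes> \<epsilon> x \<oplus> (a \<otimes> \<delta> y \<oplus> b \<otimes> \<epsilon> y)"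
      unfolding linD(2)[OF assms(1) x y] linD(2)[OF assms(2) x y] using c cy assms(4,5) by algebra }
  fix s assume s: "s \<in> S"
  hence s': "s \<in> carrier R" using assms(3) by auto
  show "a \<otimes> \<delta> (s \<otimes> x) \<oplus> b \<otimes> \<epsilon> (s \<otimes> x) = s \<otimes> (a \<otimes> \<delta> x \<oplus> b \<otimes> \<epsilon> x)"
    unfolding linD(3)[OF assms(1) s x] linD(3)[OF assms(2) s x] using c s' assms(4,5) by algebra
qed

lemma lin_com:
  assumes "\<delta> \<in> lin S" "S \<subseteq> carrier R" "r \<in> carrier R"
  shows "com \<delta> r \<in> lin S"
proof (rule linI)
  fix x y assume x: "x \<in> carrier R"
  have c: "\<delta> x \<in> carrier R" "\<delta> (r \<otimes> x) \<in> carrier R"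
    using linD(1)[OF assms(1)] x assms(3) by auto
  show "com \<delta> r x \<in> carrier R" using c assms(3) by (simp add: com_def)
  { assume y: "y \<in> carrier R"
    have cy: "\<delta> y \<in> carrier R" "\<delta> (r \<otimes> y) \<in> carrier R"
      using linD(1)[OF assms(1)] y assms(3) by auto
    have "\<delta> (r \<otimes> (x \<oplus> y)) = \<delta> (r \<otimes> x) \<oplus> \<delta> (r \<otimes> y)"
      using linD(2)[OF assms(1), of "r \<otimes> x" "r \<otimes> y"] x y assms(3) by (simp add: r_distr)
    thus "com \<delta> r (x \<oplus> y) = com \<delta> r x \<oplus> com \<delta> r y"
      unfolding com_def linD(2)[OF assms(1) x y] using c cy assms(3) by simp algebra }
  fix s assume s: "s \<in> S"
  hence s': "s \<in> carrier R" using assms(2) by auto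
  have "\<delta> (r \<otimes> (s \<otimes> x)) = s \<otimes> \<delta> (r \<otimes> x)"
    using linD(3)[OF assms(1) s, of "r \<otimes> x"] s' x assms(3) by (simp add: m_lcomm)
  thus "com \<delta> r (s \<otimes> x) = s \<otimes> com \<delta> r x"
    unfolding com_def linD(3)[OF assms(1) s x] using c s' assms(3) by simp algebra
qed

lemma dop_lin:
  assumes "\<delta> \<in> dop S n" "S \<subseteq> carrier R"
  shows "\<delta> \<in> lin S"
  using assms lin_antimono[OF assms(2)] by (cases n) auto

lemma dop_com:
  assumes "\<delta> \<in> dop S (Suc n)" "r \<in> carrier R"
  shows "com \<delta> r \<in> dop S n"
  using assms by simp

lemma dop_cong:
  assumes "\<delta> \<in> dop S n" "S \<subseteq> carrier R" "\<And>x. x \<in> carrier R \<Longrightarrow> \<delta> x = \<epsilon> x"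
  shows "\<epsilon> \<in> dop S n"
  using assms
proof (induction n arbitrary: \<delta> \<epsilon>)
  case 0
  thus ?case using lin_cong[of \<delta> "carrier R" \<epsilon>] by simp
next
  case (Suc n)
  have "com \<epsilon> r \<in> dop S n" if r: "r \<in> carrier R" for r
  proof (rule Suc.IH[OF dop_com[OF Suc.prems(1) r] Suc.prems(2)])
    fix x assume x: "x \<in> carrier R"
    show "com \<delta> r x = com \<epsilon> r x"
      using Suc.prems(3)[OF x] Suc.prems(3)[OF m_closed[OF r x]] by (simp add: com_def)
  qed
  moreover have "\<epsilon> \<in> lin S" using Suc.prems lin_cong[of \<delta> S \<epsilon>] by simp
  ultimately show ?case by simp
qed

lemma dop_comb:
  assumes "\<delta> \<in> dop S n" "\<epsilon> \<in> dop S n" "S \<subseteq> carrier R" "a \<in> carrier R" "b \<in> carrier R"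
  shows "(\<lambda>x. a \<otimes> \<delta> x \<oplus> b \<otimes> \<epsilon> x) \<in> dop S n"
  using assms
proof (induction n arbitrary: \<delta> \<epsilon>)
  case 0
  thus ?case using lin_comb[of \<delta> "carrier R" \<epsilon> a b] by simp
next
  case (Suc n)
  have l: "\<delta> \<in> lin S" "\<epsilon> \<in> lin S" using Suc.prems(1,2) by auto
  have "com (\<lambda>x. a \<otimes> \<delta> x \<oplus> b \<otimes> \<epsilon> x) r \<in> dop S n" if r: "r \<in> carrier R" for r
  proof (rule dop_cong[OF Suc.IH[OF dop_com[OF Suc.prems(1) r] dop_com[OF Suc.prems(2) r] assms(3-5)] assms(3)])
    fix x assume x: "x \<in> carrier R"
    have "\<delta> x \<in> carrier R" "\<delta> (r \<otimes> x) \<in> carrier R" "\<epsilon> x \<in> carrier R" "\<epsilon> (r \<otimes> x) \<in> carrier R"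
      using linD(1)[OF l(1)] linD(1)[OF l(2)] x r by auto
    thus "a \<otimes> com \<delta> r x \<oplus> b \<otimes> com \<epsilon> r x = com (\<lambda>x. a \<otimes> \<delta> x \<oplus> b \<otimes> \<epsilon> x) r x"
      unfolding com_def using r assms(4,5) by algebra
  qed
  moreover have "(\<lambda>x. a \<otimes> \<delta> x \<oplus> b \<otimes> \<epsilon> x) \<in> lin S" using lin_comb[OF l assms(3-5)] .
  ultimately show ?case by simp
qed

lemma zero_fun_dop:
  assumes "S \<subseteq> carrier R" "\<And>x. x \<in> carrier R \<Longrightarrow> \<delta> x = \<zero>"
  shows "\<delta> \<in> dop S n"
  using assms(2)
proof (induction n arbitrary: \<delta>)
  case 0
  thus ?case using linI[of \<delta> "carrier R"] by simp
next
  case (Suc n)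
  have "com \<delta> r \<in> dop S n" if r: "r \<in> carrier R" for r
  proof (rule Suc.IH)
    fix x assume x: "x \<in> carrier R"
    show "com \<delta> r x = \<zero>"
      using Suc.prems[OF x] Suc.prems[OF m_closed[OF r x]] r by (simp add: com_def a_minus_def)
  qed
  moreover have "\<delta> \<in> lin S" using linI[of \<delta> S] Suc.prems assms(1) by (simp add: subset_iff)
  ultimately show ?case by simp
qed

lemma dop_mono_Suc:
  assumes "\<delta> \<in> dop S n" "S \<subseteq> carrier R"
  shows "\<delta> \<in> dop S (Suc n)"
  using assms(1)
proof (induction n arbitrary: \<delta>)
  case 0
  have l: "\<delta> \<in> lin (carrier R)" using 0 by simp
  have "com \<delta> r \<in> dop S 0" if r: "r \<in> carrier R" for r
  proof (rule zero_fun_dop[OF assms(2)])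
    fix x assume x: "x \<in> carrier R"
    show "com \<delta> r x = \<zero>" using linD(3)[OF l r x] linD(1)[OF l x] r by (simp add: com_def r_neg a_minus_def)
  qed
  thus ?case using l lin_antimono[OF assms(2)] by auto
next
  case (Suc n)
  have "com \<delta> r \<in> dop S (Suc n)" if r: "r \<in> carrier R" for r
    using Suc.IH[OF dop_com[OF Suc.prems r]] .
  thus ?case using dop_lin[OF Suc.prems assms(2)] by simp
qed

text \<open>Precomposition with \<open>r\<close> is the sum of the commutator with \<open>r\<close>
  and \<open>r\<close> times the operator. This is what makes the differential powers
  ideals.\<close>

lemma dop_mult_right:
  assumes "\<delta> \<in> dop S n" "S \<subseteq> carrier R" "r \<in> carrier R"
  shows "(\<lambda>x. \<delta> (r \<otimes> x)) \<in> dop S n"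
proof -
  have l: "\<delta> \<in> lin S" using dop_lin[OF assms(1,2)] .
  have c: "com \<delta> r \<in> dop S n"
    using dop_com[OF dop_mono_Suc[OF assms(1,2)] assms(3)] .
  show ?thesis
  proof (rule dop_cong[OF dop_comb[OF c assms(1,2) one_closed assms(3)] assms(2)])
    fix x assume x: "x \<in> carrier R"
    have "\<delta> x \<in> carrier R" "\<delta> (r \<otimes> x) \<in> carrier R" using linD(1)[OF l] x assms(3) by auto
    thus "\<one> \<otimes> com \<delta> r x \<oplus> r \<otimes> \<delta> x = \<delta> (r \<otimes> x)" unfolding com_def using assms(3) by algebra
  qed
qed

text \<open>A Leibniz rule whose values are operators:
  \<open>[\<delta>, x y] = [\<delta>, x] y + x [\<delta>, y]\<close>. It becomes the ordinary rule
  as soon as \<open>[\<delta>, x]\<close> commutes with \<open>y\<close>, exactly or modulo the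
  maximal ideal, and both cases are exploited below.\<close>

lemma com_mult:
  assumes "\<delta> \<in> lin S" "x \<in> carrier R" "y \<in> carrier R" "g \<in> carrier R"
  shows "com \<delta> (x \<otimes> y) g = com \<delta> x (y \<otimes> g) \<oplus> x \<otimes> com \<delta> y g"
proof -
  have "\<delta> g \<in> carrier R" "\<delta> (y \<otimes> g) \<in> carrier R" "\<delta> (x \<otimes> (y \<otimes> g)) \<in> carrier R"
    using linD(1)[OF assms(1)] assms by auto
  moreover have "x \<otimes> y \<otimes> g = x \<otimes> (y \<otimes> g)" using assms m_assoc by simp
  ultimately show ?thesis unfolding com_def using assms by simp algebra
qed

lemma com_add:
  assumes "\<delta> \<in> lin S" "x \<in> carrier R" "y \<in> carrier R" "g \<in> carrier R"
  shows "com \<delta> (x \<oplus> y) g = com \<delta> x g \<oplus> com \<delta> y g"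
proof -
  have c: "\<delta> g \<in> carrier R" "\<delta> (y \<otimes> g) \<in> carrier R" "\<delta> (x \<otimes> g) \<in> carrier R"
    using linD(1)[OF assms(1)] assms by auto
  have "\<delta> ((x \<oplus> y) \<otimes> g) = \<delta> (x \<otimes> g) \<oplus> \<delta> (y \<otimes> g)"
    using linD(2)[OF assms(1), of "x \<otimes> g" "y \<otimes> g"] assms l_distr by simp
  thus ?thesis unfolding com_def using assms c by simp algebra
qed

lemma com_scalar:
  assumes "\<delta> \<in> lin S" "s \<in> S" "S \<subseteq> carrier R" "g \<in> carrier R"
  shows "com \<delta> s g = \<zero>"
  using assms linD(3)[OF assms(1,2,4)] linD(1)[OF assms(1,4)] 
  by (simp add: com_def a_minus_def r_neg subset_iff)

lemma derD:
  assumes "d \<in> der S"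
  shows "d \<in> lin S" "x \<in> carrier R \<Longrightarrow> y \<in> carrier R \<Longrightarrow> d (x \<otimes> y) = x \<otimes> d y \<oplus> y \<otimes> d x"
  using assms by (auto simp: der_def)

lemma der_comb:
  assumes "\<delta> \<in> der S" "\<epsilon> \<in> der S" "S \<subseteq> carrier R" "a \<in> carrier R" "b \<in> carrier R"
  shows "(\<lambda>x. a \<otimes> \<delta> x \<oplus> b \<otimes> \<epsilon> x) \<in> der S"
proof -
  note l = derD(1)[OF assms(1)] derD(1)[OF assms(2)]
  have "a \<otimes> \<delta> (x \<otimes> y) \<oplus> b \<otimes> \<epsilon> (x \<otimes> y) =
      x \<otimes> (a \<otimes> \<delta> y \<oplus> b \<otimes> \<epsilon> y) \<oplus> y \<otimes> (a \<otimes> \<delta> x \<oplus> b \<otimes> \<epsilon> x)"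
    if xy: "x \<in> carrier R" "y \<in> carrier R" for x y
  proof -
    have "\<delta> x \<in> carrier R" "\<delta> y \<in> carrier R" "\<epsilon> x \<in> carrier R" "\<epsilon> y \<in> carrier R"
      using linD(1)[OF l(1)] linD(1)[OF l(2)] xy by auto
    thus ?thesis unfolding derD(2)[OF assms(1) xy] derD(2)[OF assms(2) xy]
      using xy assms(4,5) by algebra
  qed
  thus ?thesis using lin_comb[OF l assms(3-5)] by (simp add: der_def)
qed

lemma zero_der: "S \<subseteq> carrier R \<Longrightarrow> (\<lambda>x. \<zero>) \<in> der S"
  using linI[of "\<lambda>x. \<zero>" S] by (simp add: der_def subset_iff)

end

text \<open>Elimination on operators: an element \<open>f\<close> in \<open>I 1\<close> outside
  \<open>I 0\<close> is detected by some \<open>d\<close>, and the operators that kill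
  \<open>f\<close> detect the rest of the chain. They kill \<open>f\<close> exactly and not only
  modulo the kernel of \<open>h\<close>, because \<open>d f * \<delta> - \<delta> f * d\<close>
  does; so the matrix is triangular over the ring itself. The lifts in \<open>C\<close> act as
  residue field scalars, with which the operators commute modulo the kernel.\<close>

lemma (in ring_hom_cring) quotient_chain_triangular:
  assumes S: "field S" and hR: "h ` carrier R = carrier S"
    and W: "\<And>a b \<delta> \<epsilon>. a \<in> carrier R \<Longrightarrow> b \<in> carrier R \<Longrightarrow> \<delta> \<in> W \<Longrightarrow> \<epsilon> \<in> W \<Longrightarrow>
       (\<lambda>x. a \<otimes> \<delta> x \<oplus> b \<otimes> \<epsilon> x) \<in> W"
    and Wc: "\<And>\<delta> x. \<delta> \<in> W \<Longrightarrow> x \<in> carrier R \<Longrightarrow> \<delta> x \<in> carrier R"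
    and Wa: "\<And>\<delta> x y. \<delta> \<in> W \<Longrightarrow> x \<in> carrier R \<Longrightarrow> y \<in> carrier R \<Longrightarrow> \<delta> (x \<oplus> y) = \<delta> x \<oplus> \<delta> y"
    and C: "C \<subseteq> carrier R" "\<And>c. c \<in> C \<Longrightarrow> \<ominus> c \<in> C" "\<And>a. a \<in> carrier R \<Longrightarrow> \<exists>c\<in>C. h c = h a"
    and WC: "\<And>\<delta> c x. \<delta> \<in> W \<Longrightarrow> c \<in> C \<Longrightarrow> x \<in> carrier R \<Longrightarrow> h (\<delta> (c \<otimes> x)) = h c \<otimes>\<^bsub>S\<^esub> h (\<delta> x)"
    and I: "\<And>i. i \<le> N \<Longrightarrow> I i \<subseteq> carrier R"
      "\<And>i x y c. i \<le> N \<Longrightarrow> x \<in> I i \<Longrightarrow> y \<in> I i \<Longrightarrow> c \<in> C \<Longrightarrow> x \<oplus> c \<otimes> y \<in> I i"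
      "\<And>i. i < N \<Longrightarrow> I i \<subset> I (Suc i)"
    and I0: "\<And>x. x \<in> carrier R \<Longrightarrow> (\<And>\<delta>. \<delta> \<in> W \<Longrightarrow> h (\<delta> x) = \<zero>\<^bsub>S\<^esub>) \<Longrightarrow> x \<in> I 0"
  shows "\<exists>D f. \<forall>i<N. D i \<in> W \<and> f i \<in> carrier R \<and> D i (f i) \<noteq> \<zero> \<and> (\<forall>l<i. D i (f l) = \<zero>)"
  using W Wc Wa WC I I0
proof (induction N arbitrary: W I)
  case 0
  show ?case by simp
next
  case (Suc N)
  interpret S: field S by fact
  note W = Suc.prems(1) and Wc = Suc.prems(2) and Wa = Suc.prems(3) and WC = Suc.prems(4)
    and I = Suc.prems(5-7) and I0 = Suc.prems(8)
  obtain f where f: "f \<in> I 1" "f \<notin> I 0" using I(3)[of 0] by auto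
  have fR: "f \<in> carrier R" using f(1) I(1)[of 1] by auto
  obtain d where d: "d \<in> W" "h (d f) \<noteq> \<zero>\<^bsub>S\<^esub>" using I0[OF fR] f(2) by blast
  have dfR: "d f \<in> carrier R" using Wc[OF d(1) fR] .
  obtain u where u: "u \<in> carrier R" "h u \<otimes>\<^bsub>S\<^esub> h (d f) = \<one>\<^bsub>S\<^esub>"
  proof -
    have "h (d f) \<in> Units S" using S.field_Units d(2) dfR by auto
    hence "inv\<^bsub>S\<^esub> h (d f) \<in> carrier S" "inv\<^bsub>S\<^esub> h (d f) \<otimes>\<^bsub>S\<^esub> h (d f) = \<one>\<^bsub>S\<^esub>" by auto
    thus thesis using that hR by (metis imageE)
  qed
  define W' where "W' = {\<delta> \<in> W. \<delta> f = \<zero>}"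
  have W'W: "\<delta> \<in> W" if "\<delta> \<in> W'" for \<delta> using that by (simp add: W'_def)
  have "\<exists>D g. \<forall>i<N. D i \<in> W' \<and> g i \<in> carrier R \<and> D i (g i) \<noteq> \<zero> \<and> (\<forall>l<i. D i (g l) = \<zero>)"
  proof (rule Suc.IH[of W' "\<lambda>i. I (Suc i)"])
    fix a b \<delta> \<epsilon> assume a: "a \<in> carrier R" "b \<in> carrier R" and w: "\<delta> \<in> W'" "\<epsilon> \<in> W'"
    have "\<delta> f = \<zero>" "\<epsilon> f = \<zero>" using w by (auto simp: W'_def)
    thus "(\<lambda>x. a \<otimes> \<delta> x \<oplus> b \<otimes> \<epsilon> x) \<in> W'"
      using W[OF a W'W[OF w(1)] W'W[OF w(2)]] a by (simp add: W'_def)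
  next
    fix x assume x: "x \<in> carrier R" and z: "\<And>\<delta>. \<delta> \<in> W' \<Longrightarrow> h (\<delta> x) = \<zero>\<^bsub>S\<^esub>"
    have dx: "d x \<in> carrier R" using Wc[OF d(1) x] .
    \<comment> \<open>\<open>c\<close> lifts \<open>- d x / d f\<close>. Because \<open>x\<close> is
      killed by \<open>d f * \<delta> - \<delta> f * d\<close> modulo the kernel, the element
      \<open>x \<oplus> c \<otimes> f\<close> is then killed by every operator of \<open>W\<close>
      and lies in \<open>I 0\<close>.\<close>
    obtain c where c: "c \<in> C" "h c = h (\<ominus> (u \<otimes> d x))" using C(3)[of "\<ominus> (u \<otimes> d x)"] u(1) dx by auto
    have cR: "c \<in> carrier R" using c(1) C(1) by auto
    have "x \<oplus> c \<otimes> f \<in> I 0"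
    proof (rule I0)
      show "x \<oplus> c \<otimes> f \<in> carrier R" using x cR fR by simp
      fix \<delta> assume e: "\<delta> \<in> W"
      have eR: "\<delta> x \<in> carrier R" "\<delta> f \<in> carrier R" "\<delta> (c \<otimes> f) \<in> carrier R"
        using Wc[OF e] x fR cR by auto
      have "(\<lambda>y. d f \<otimes> \<delta> y \<oplus> (\<ominus> \<delta> f) \<otimes> d y) \<in> W'"
        using W[OF dfR R.a_inv_closed[OF eR(2)] e d(1)] eR dfR
        by (simp add: W'_def R.l_minus R.m_comm[of "d f" "\<delta> f"] R.r_neg)
      hence "h (d f \<otimes> \<delta> x \<oplus> (\<ominus> \<delta> f) \<otimes> d x) = \<zero>\<^bsub>S\<^esub>" using z by blast
      hence 1: "h (d f) \<otimes>\<^bsub>S\<^esub> h (\<delta> x) = h (\<delta> f) \<otimes>\<^bsub>S\<^esub> h (d x)"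
        using dfR eR dx S.r_right_minus_eq[of "h (d f) \<otimes>\<^bsub>S\<^esub> h (\<delta> x)" "h (\<delta> f) \<otimes>\<^bsub>S\<^esub> h (d x)"]
        by (simp add: a_minus_def S.l_minus)
      have "h (\<delta> x) = (h u \<otimes>\<^bsub>S\<^esub> h (d f)) \<otimes>\<^bsub>S\<^esub> h (\<delta> x)" using u eR by simp
      also have "\<dots> = h u \<otimes>\<^bsub>S\<^esub> (h (\<delta> f) \<otimes>\<^bsub>S\<^esub> h (d x))" using 1 u(1) eR dfR by (simp add: S.m_assoc)
      finally have 2: "h (\<delta> x) = h u \<otimes>\<^bsub>S\<^esub> (h (\<delta> f) \<otimes>\<^bsub>S\<^esub> h (d x))" .
      have "h (\<delta> (x \<oplus> c \<otimes> f)) = h (\<delta> x) \<oplus>\<^bsub>S\<^esub> h c \<otimes>\<^bsub>S\<^esub> h (\<delta> f)"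
        using Wa[OF e x, of "c \<otimes> f"] WC[OF e c(1) fR] cR fR eR by simp
      also have "h c \<otimes>\<^bsub>S\<^esub> h (\<delta> f) = \<ominus>\<^bsub>S\<^esub> h (\<delta> x)"
        unfolding c(2) 2 using u(1) dx eR by (simp add: S.l_minus S.r_minus S.m_ac)
      finally show "h (\<delta> (x \<oplus> c \<otimes> f)) = \<zero>\<^bsub>S\<^esub>" using eR by (simp add: S.r_neg)
    qed
    hence "x \<oplus> c \<otimes> f \<in> I 1" using I(3)[of 0] by auto
    hence "(x \<oplus> c \<otimes> f) \<oplus> (\<ominus> c) \<otimes> f \<in> I 1" using I(2)[of 1] f(1) C(2)[OF c(1)] by simp
    moreover have "(x \<oplus> c \<otimes> f) \<oplus> (\<ominus> c) \<otimes> f = x" using x cR fR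
      by (simp add: R.l_minus R.r_neg R.a_assoc)
    ultimately show "x \<in> I (Suc 0)" by simp
  qed (use Wc Wa WC I W'W in auto)
  then obtain D g where D: "\<And>i. i < N \<Longrightarrow> D i \<in> W' \<and> g i \<in> carrier R \<and> D i (g i) \<noteq> \<zero> \<and> (\<forall>l<i. D i (g l) = \<zero>)"
    by blast
  have df0: "d f \<noteq> \<zero>" using d(2) by auto
  show ?case
  proof (rule exI[of _ "case_nat d D"], rule exI[of _ "case_nat f g"], intro allI impI)
    fix i assume i: "i < Suc N"
    show "case_nat d D i \<in> W \<and> case_nat f g i \<in> carrier R \<and> case_nat d D i (case_nat f g i) \<noteq> \<zero> \<and>
        (\<forall>l<i. case_nat d D i (case_nat f g l) = \<zero>)"
    proof (cases i)
      case 0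
      thus ?thesis using d fR df0 by simp
    next
      case (Suc j)
      have j: "D j \<in> W'" "g j \<in> carrier R" "D j (g j) \<noteq> \<zero>" "\<And>l. l < j \<Longrightarrow> D j (g l) = \<zero>"
        using D[of j] i Suc by auto
      have "case_nat d D i (case_nat f g l) = \<zero>" if "l < i" for l
        using j that Suc by (cases l) (auto simp: W'_def)
      thus ?thesis using j Suc W'W by auto
    qed
  qed
qed

text \<open>\<open>pd n x\<close> is \<open>n x\<^sup>n\<^sup>-\<^sup>1\<close>, and \<open>dv p x\<close> is the value of the derivative of \<open>p\<close> at \<open>x\<close>.\<close>

primrec (in ring) pd :: "nat \<Rightarrow> 'a \<Rightarrow> 'a" where
  "pd 0 x = \<zero>"
| "pd (Suc n) x = x \<otimes> pd n x \<oplus> x [^] n"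

primrec (in ring) dv :: "'a list \<Rightarrow> 'a \<Rightarrow> 'a" where
  "dv [] x = \<zero>"
| "dv (a # p) x = a \<otimes> pd (length p) x \<oplus> dv p x"

lemma (in ring) pd_closed: "x \<in> carrier R \<Longrightarrow> pd n x \<in> carrier R"
  by (induction n) auto

lemma (in ring) dv_closed: "set p \<subseteq> carrier R \<Longrightarrow> x \<in> carrier R \<Longrightarrow> dv p x \<in> carrier R"
  by (induction p) (auto simp: pd_closed)

lemma (in ring) eval_in_subring:
  assumes "subring C R" "set p \<subseteq> C" "x \<in> C"
  shows "eval p x \<in> C"
proof -
  interpret C: subring C R by fact
  have "x [^] n \<in> C" for n :: nat
    using C.m_closed assms(3) by (induction n) (auto simp: C.one_closed)
  thus ?thesis using assms(2) by (induction p) (auto intro: subringE(7)[OF assms(1)] subringE(2)[OF assms(1)] C.m_closed)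
qed

text \<open>The chain rule, for a derivation along \<open>h\<close> that is controlled only on a
  subring \<open>C\<close>: commutators reduced modulo the maximal ideal satisfy the Leibniz rule
  only there. The coefficients of \<open>p\<close> count as constants.\<close>

lemma (in ring_hom_cring) derivation_eval:
  assumes C: "subring C R" and d: "\<And>x. x \<in> C \<Longrightarrow> d x \<in> carrier S"
    and da: "\<And>x y. x \<in> C \<Longrightarrow> y \<in> C \<Longrightarrow> d (x \<oplus> y) = d x \<oplus>\<^bsub>S\<^esub> d y"
    and dm: "\<And>x y. x \<in> C \<Longrightarrow> y \<in> C \<Longrightarrow> d (x \<otimes> y) = h x \<otimes>\<^bsub>S\<^esub> d y \<oplus>\<^bsub>S\<^esub> h y \<otimes>\<^bsub>S\<^esub> d x"
    and p: "set p \<subseteq> C" "\<And>s. s \<in> set p \<Longrightarrow> d s = \<zero>\<^bsub>S\<^esub>" and x: "x \<in> C"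
  shows "d (R.eval p x) = h (R.dv p x) \<otimes>\<^bsub>S\<^esub> d x"
proof -
  interpret C: subring C R by fact
  have xR: "x \<in> carrier R" and dx: "d x \<in> carrier S" using x C.subset d by auto
  have xn: "x [^] n \<in> C" for n :: nat
    using C.m_closed x by (induction n) (auto simp: C.one_closed)
  have d1: "d \<one> = \<zero>\<^bsub>S\<^esub>"
  proof -
    have "d \<one> = d \<one> \<oplus>\<^bsub>S\<^esub> d \<one>" using dm[OF C.one_closed C.one_closed] d[OF C.one_closed] by simp
    thus ?thesis using d[OF C.one_closed] by (metis S.add.r_cancel_one')
  qed
  have d0: "d \<zero> = \<zero>\<^bsub>S\<^esub>"
  proof -
    have "d \<zero> = d \<zero> \<oplus>\<^bsub>S\<^esub> d \<zero>" using da[OF subringE(2)[OF C] subringE(2)[OF C]] by simp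
    thus ?thesis using d[OF subringE(2)[OF C]] by (metis S.add.r_cancel_one')
  qed
  have dpow: "d (x [^] n) = h (R.pd n x) \<otimes>\<^bsub>S\<^esub> d x" for n :: nat
  proof (induction n)
    case 0
    show ?case using d1 dx by simp
  next
    case (Suc n)
    have "d (x [^] Suc n) = h (x [^] n) \<otimes>\<^bsub>S\<^esub> d x \<oplus>\<^bsub>S\<^esub> h x \<otimes>\<^bsub>S\<^esub> (h (R.pd n x) \<otimes>\<^bsub>S\<^esub> d x)"
      using dm[OF xn x] Suc by simp
    also have "\<dots> = (h x \<otimes>\<^bsub>S\<^esub> h (R.pd n x) \<oplus>\<^bsub>S\<^esub> h (x [^] n)) \<otimes>\<^bsub>S\<^esub> d x"
      using hom_closed[OF xR] hom_closed[OF R.pd_closed[OF xR]] hom_closed[OF R.nat_pow_closed[OF xR]] dx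
      by (simp add: S.l_distr S.m_assoc S.a_comm del: hom_nat_pow)
    finally show ?case using xR R.pd_closed[OF xR] by simp
  qed
  show ?thesis using p
  proof (induction p)
    case Nil
    show ?case using d0 dx by simp
  next
    case (Cons a p)
    have a: "a \<in> C" "a \<in> carrier R" "d a = \<zero>\<^bsub>S\<^esub>" using Cons.prems C.subset by auto
    have pR: "set p \<subseteq> carrier R" using Cons.prems C.subset by auto
    have e: "R.eval p x \<in> C" using R.eval_in_subring[OF C _ x] Cons.prems by simp
    have "d (R.eval (a # p) x) = d (a \<otimes> x [^] length p) \<oplus>\<^bsub>S\<^esub> d (R.eval p x)"
      using da[OF C.m_closed[OF a(1) xn] e] by simp
    also have "d (a \<otimes> x [^] length p) = h a \<otimes>\<^bsub>S\<^esub> (h (R.pd (length p) x) \<otimes>\<^bsub>S\<^esub> d x)"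
      using dm[OF a(1) xn, of "length p"] dpow a xR R.pd_closed[OF xR] dx by simp
    also have "d (R.eval p x) = h (R.dv p x) \<otimes>\<^bsub>S\<^esub> d x" using Cons by simp
    finally show ?case using a(2) R.pd_closed[OF xR] R.dv_closed[OF pR xR] dx
      by (simp add: S.l_distr S.m_assoc)
  qed
qed

text \<open>Newton's method: the correction \<open>p(r) / p'(r)\<close> improves \<open>r\<close>
  from order \<open>n\<close> to order \<open>Suc n\<close>. For fixed \<open>g\<close> the map from
  \<open>x\<close> to \<open>[\<delta>, x] g\<close> modulo the kernel behaves as a derivation along
  \<open>C n\<close>, and it takes the same value at \<open>r\<close> and at the correction, so it
  vanishes at their difference. Order zero is free, as operators of that order are linear.\<close>

lemma (in ring_hom_cring) operator_lift:
  assumes S: "field S" and A: "subring A R"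
    and sep: "\<And>a. a \<in> carrier R \<Longrightarrow>
      \<exists>p. set p \<subseteq> A \<and> h (R.eval p a) = \<zero>\<^bsub>S\<^esub> \<and> h (R.dv p a) \<noteq> \<zero>\<^bsub>S\<^esub>"
    and hR: "h ` carrier R = carrier S"
  defines "C \<equiv> \<lambda>n. {r \<in> carrier R. \<forall>\<delta>\<in>R.dop A n. \<forall>g\<in>carrier R. h (\<delta> (r \<otimes> g)) = h r \<otimes>\<^bsub>S\<^esub> h (\<delta> g)}"
  shows "\<And>a. a \<in> carrier R \<Longrightarrow> \<exists>c\<in>C n. h c = h a" and "\<And>c. c \<in> C n \<Longrightarrow> \<ominus> c \<in> C n"
proof -
  interpret S: field S by fact
  interpret A: subring A R by fact
  have lin: "\<delta> \<in> R.lin A" if "\<delta> \<in> R.dop A n" for \<delta> n using R.dop_lin[OF that A.subset] .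
  have CI: "r \<in> C n" if "r \<in> carrier R" "\<And>\<delta> g. \<delta> \<in> R.dop A n \<Longrightarrow> g \<in> carrier R \<Longrightarrow> h (\<delta> (r \<otimes> g)) = h r \<otimes>\<^bsub>S\<^esub> h (\<delta> g)" for r n
    using that by (simp add: C_def)
  have CD: "h (\<delta> (r \<otimes> g)) = h r \<otimes>\<^bsub>S\<^esub> h (\<delta> g)" if "r \<in> C n" "\<delta> \<in> R.dop A n" "g \<in> carrier R" for r n \<delta> g
    using that by (simp add: C_def)
  have CR: "C n \<subseteq> carrier R" for n by (auto simp: C_def)
  have Cm: "r \<otimes> s \<in> C n" if r: "r \<in> C n" and s: "s \<in> C n" for r s n
  proof (rule CI)
    have R: "r \<in> carrier R" "s \<in> carrier R" using r s CR by auto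
    thus "r \<otimes> s \<in> carrier R" by simp
    fix \<delta> g assume \<delta>: "\<delta> \<in> R.dop A n" and g: "g \<in> carrier R"
    have "\<delta> g \<in> carrier R" using R.linD(1)[OF lin[OF \<delta>] g] .
    thus "h (\<delta> (r \<otimes> s \<otimes> g)) = h (r \<otimes> s) \<otimes>\<^bsub>S\<^esub> h (\<delta> g)"
      using CD[OF r \<delta>, of "s \<otimes> g"] CD[OF s \<delta> g] R g by (simp add: R.m_assoc S.m_assoc)
  qed
  have Ca: "r \<oplus> s \<in> C n" if r: "r \<in> C n" and s: "s \<in> C n" for r s n
  proof (rule CI)
    have R: "r \<in> carrier R" "s \<in> carrier R" using r s CR by auto
    thus "r \<oplus> s \<in> carrier R" by simp
    fix \<delta> g assume \<delta>: "\<delta> \<in> R.dop A n" and g: "g \<in> carrier R"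
    note l = R.linD[OF lin[OF \<delta>]]
    have "\<delta> g \<in> carrier R" "\<delta> (r \<otimes> g) \<in> carrier R" "\<delta> (s \<otimes> g) \<in> carrier R" using l(1) R g by auto
    thus "h (\<delta> ((r \<oplus> s) \<otimes> g)) = h (r \<oplus> s) \<otimes>\<^bsub>S\<^esub> h (\<delta> g)"
      using CD[OF r \<delta> g] CD[OF s \<delta> g] R g l(2)[of "r \<otimes> g" "s \<otimes> g"] by (simp add: R.l_distr S.l_distr)
  qed
  show Cu: "\<ominus> r \<in> C n" if r: "r \<in> C n" for r n
  proof (rule CI)
    have R: "r \<in> carrier R" using r CR by auto
    thus "\<ominus> r \<in> carrier R" by simp
    fix \<delta> g assume \<delta>: "\<delta> \<in> R.dop A n" and g: "g \<in> carrier R"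
    note l = R.linD(1)[OF lin[OF \<delta>]]
    have "\<delta> g \<in> carrier R" "\<delta> (r \<otimes> g) \<in> carrier R" using l R g by auto
    thus "h (\<delta> (\<ominus> r \<otimes> g)) = h (\<ominus> r) \<otimes>\<^bsub>S\<^esub> h (\<delta> g)"
      using CD[OF r \<delta> g] R g R.lin_uminus[OF lin[OF \<delta>], of "r \<otimes> g"] by (simp add: R.l_minus S.l_minus)
  qed
  have AC: "A \<subseteq> C n" for n
  proof
    fix s assume s: "s \<in> A"
    show "s \<in> C n"
    proof (rule CI)
      show sR: "s \<in> carrier R" using s A.subset by auto
      fix \<delta> g assume \<delta>: "\<delta> \<in> R.dop A n" and g: "g \<in> carrier R"
      show "h (\<delta> (s \<otimes> g)) = h s \<otimes>\<^bsub>S\<^esub> h (\<delta> g)"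
        using R.linD(3)[OF lin[OF \<delta>] s g] R.linD(1)[OF lin[OF \<delta>] g] sR by simp
    qed
  qed
  have Csub: "subring (C n) R" for n
    by (rule R.subringI) (use CR AC[of n] A.one_closed Cm Ca Cu in auto)
  show "\<exists>c\<in>C n. h c = h a" if "a \<in> carrier R" for a
    using that
  proof (induction n arbitrary: a)
    case 0
    have "a \<in> C 0"
    proof (rule CI)
      fix \<delta> g assume "\<delta> \<in> R.dop A 0" and g: "g \<in> carrier R"
      hence l: "\<delta> \<in> R.lin (carrier R)" by simp
      show "h (\<delta> (a \<otimes> g)) = h a \<otimes>\<^bsub>S\<^esub> h (\<delta> g)"
        using R.linD(3)[OF l 0 g] R.linD(1)[OF l g] 0 by simp
    qed fact
    thus ?case by blast
  next
    case (Suc n)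
    obtain r where r: "r \<in> C n" "h r = h a" using Suc by blast
    have rR: "r \<in> carrier R" using r CR by auto
    obtain p where p: "set p \<subseteq> A" "h (R.eval p r) = \<zero>\<^bsub>S\<^esub>" "h (R.dv p r) \<noteq> \<zero>\<^bsub>S\<^esub>" using sep[OF rR] by blast
    have pR: "set p \<subseteq> carrier R" and pC: "set p \<subseteq> C n" using p(1) A.subset AC by auto
    have dvR: "R.dv p r \<in> carrier R" using R.dv_closed[OF pR rR] .
    have eC: "R.eval p r \<in> C n" using R.eval_in_subring[OF Csub pC r(1)] .
    hence eR: "R.eval p r \<in> carrier R" using CR by auto
    obtain u where u: "u \<in> carrier R" "h u \<otimes>\<^bsub>S\<^esub> h (R.dv p r) = \<one>\<^bsub>S\<^esub>"
    proof -
      have "h (R.dv p r) \<in> Units S" using S.field_Units p(3) dvR by auto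
      hence "inv\<^bsub>S\<^esub> h (R.dv p r) \<in> carrier S" "inv\<^bsub>S\<^esub> h (R.dv p r) \<otimes>\<^bsub>S\<^esub> h (R.dv p r) = \<one>\<^bsub>S\<^esub>" by auto
      thus thesis using that hR by (metis imageE)
    qed
    define v where "v = u \<otimes> R.eval p r"
    have vR: "v \<in> carrier R" and hv: "h v = \<zero>\<^bsub>S\<^esub>" using u(1) eR p(2) by (auto simp: v_def)
    have "r \<oplus> \<ominus> v \<in> C (Suc n)"
    proof (rule CI)
      show "r \<oplus> \<ominus> v \<in> carrier R" using rR vR by simp
      fix \<delta> g assume \<delta>: "\<delta> \<in> R.dop A (Suc n)" and g: "g \<in> carrier R"
      note \<delta>l = lin[OF \<delta>]
      have comR: "R.com \<delta> x y \<in> carrier R" if "x \<in> carrier R" "y \<in> carrier R" for x y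
        using R.linD(1)[OF R.lin_com[OF \<delta>l A.subset that(1)] that(2)] .
      define d where "d x = h (R.com \<delta> x g)" for x
      have dS: "d x \<in> carrier S" if "x \<in> carrier R" for x using comR[OF that g] by (simp add: d_def)
      \<comment> \<open>Only \<open>y\<close> has to be in \<open>C n\<close>: the commutator with
        an arbitrary \<open>x\<close> has order at most \<open>n\<close> and so lets
        \<open>y\<close> pass. For this reason the lift \<open>u\<close> of the inverse derivative
        may be chosen freely.\<close>
      have dm: "d (x \<otimes> y) = h x \<otimes>\<^bsub>S\<^esub> d y \<oplus>\<^bsub>S\<^esub> h y \<otimes>\<^bsub>S\<^esub> d x" if x: "x \<in> carrier R" and y: "y \<in> C n" for x y
      proof -
        have yR: "y \<in> carrier R" using y CR by auto
        have "h (R.com \<delta> x (y \<otimes> g)) = h y \<otimes>\<^bsub>S\<^esub> h (R.com \<delta> x g)"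
          using CD[OF y R.dop_com[OF \<delta> x] g] .
        thus ?thesis unfolding d_def R.com_mult[OF \<delta>l x yR g]
          using comR[OF x, of "y \<otimes> g"] comR[OF x g] comR[OF yR g] x yR g by (simp add: S.a_comm)
      qed
      have da: "d (x \<oplus> y) = d x \<oplus>\<^bsub>S\<^esub> d y" if "x \<in> carrier R" "y \<in> carrier R" for x y
        unfolding d_def R.com_add[OF \<delta>l that g] using comR[OF _ g] that by simp
      have de: "d (R.eval p r) = h (R.dv p r) \<otimes>\<^bsub>S\<^esub> d r"
      proof (rule derivation_eval[OF Csub _ _ _ pC _ r(1)])
        fix s assume "s \<in> set p"
        hence "s \<in> A" using p(1) by auto
        thus "d s = \<zero>\<^bsub>S\<^esub>" using R.com_scalar[OF \<delta>l _ A.subset g] by (simp add: d_def)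
      qed (use dS da dm CR[of n] in \<open>simp_all add: subset_iff\<close>)
      \<comment> \<open>In the Leibniz rule for \<open>v\<close> the term with \<open>d u\<close>
        carries the factor \<open>h (R.eval p r)\<close>, which is zero; in the other term
        \<open>h u\<close> cancels the derivative of \<open>p\<close>.\<close>
      have "d v = d r"
        unfolding v_def dm[OF u(1) eC] de p(2) using u dS[OF rR] dS[OF u(1)] dvR
        by (simp flip: S.m_assoc)
      moreover have "d (\<ominus> v) = \<ominus>\<^bsub>S\<^esub> d v"
      proof -
        have "d v \<oplus>\<^bsub>S\<^esub> d (\<ominus> v) = d \<zero>" using da[OF vR, of "\<ominus> v"] vR by (simp add: R.r_neg)
        also have "d \<zero> = \<zero>\<^bsub>S\<^esub>"
        proof -
          have "d \<zero> = d \<zero> \<oplus>\<^bsub>S\<^esub> d \<zero>" using da[of \<zero> \<zero>] by simp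
          thus ?thesis using dS[OF R.zero_closed] by (metis S.add.r_cancel_one')
        qed
        finally show ?thesis using dS vR by (metis S.a_comm S.minus_equality R.a_inv_closed)
      qed
      ultimately have "d (r \<oplus> \<ominus> v) = \<zero>\<^bsub>S\<^esub>" using da[OF rR, of "\<ominus> v"] vR dS[OF rR] by (simp add: S.r_neg)
      moreover have "\<delta> g \<in> carrier R" "\<delta> ((r \<oplus> \<ominus> v) \<otimes> g) \<in> carrier R"
        using R.linD(1)[OF \<delta>l] rR vR g by auto
      ultimately show "h (\<delta> ((r \<oplus> \<ominus> v) \<otimes> g)) = h (r \<oplus> \<ominus> v) \<otimes>\<^bsub>S\<^esub> h (\<delta> g)"
        unfolding d_def R.com_def using rR vR S.r_right_minus_eq by (simp add: a_minus_def R.minus_eq S.minus_eq)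
    qed
    moreover have "h (r \<oplus> \<ominus> v) = h a" using r(2) rR vR hv that Suc.prems by simp
    ultimately show ?case by blast
  qed
qed

section \<open>Operators are determined by their values at monomials\<close>

fun (in ring) monomials :: "(nat \<Rightarrow> 'a) \<Rightarrow> nat \<Rightarrow> nat \<Rightarrow> 'a set" where
  "monomials x 0 n = {\<one>}"
| "monomials x (Suc q) 0 = {\<one>}"
| "monomials x (Suc q) (Suc n) = monomials x q (Suc n) \<union> (\<lambda>m. x q \<otimes> m) ` monomials x (Suc q) n"

text \<open>The recursion is that of Pascal's triangle: a monomial avoids the last variable or is a
  multiple of it. It is only an upper bound, since different exponents may give the same element of
  the ring.\<close>

lemma (in ring) monomials_card: "finite (monomials x q n) \<and> card (monomials x q n) \<le> (n + q) choose q"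
proof (induction x q n rule: monomials.induct)
  case (3 x q n)
  have "card (monomials x (Suc q) (Suc n)) \<le> card (monomials x q (Suc n)) + card ((\<lambda>m. x q \<otimes> m) ` monomials x (Suc q) n)"
    by (simp add: card_Un_le)
  also have "\<dots> \<le> ((Suc n + q) choose q) + ((n + Suc q) choose Suc q)"
    using 3 card_image_le[of "monomials x (Suc q) n" "\<lambda>m. x q \<otimes> m"] by auto
  finally show ?case using 3 by simp
qed auto

context cring
begin

lemma monomials_carrier: "(\<And>i. i < q \<Longrightarrow> x i \<in> carrier R) \<Longrightarrow> monomials x q n \<subseteq> carrier R"
  by (induction x q n rule: monomials.induct) (auto simp: image_subset_iff subset_iff)

lemma one_in_monomials: "\<one> \<in> monomials x q n"
  by (induction x q n rule: monomials.induct) auto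

lemma monomials_Suc: "monomials x q n \<subseteq> monomials x q (Suc n)"
proof (induction x q n rule: monomials.induct)
  case (2 x q) show ?case using one_in_monomials[of x q "Suc 0"] by simp
next
  case (3 x q n) thus ?case by auto
qed simp

lemma generator_in_monomials:
  assumes "\<And>i. i < q \<Longrightarrow> x i \<in> carrier R" "i < q"
  shows "x i \<in> monomials x q (Suc 0)"
  using assms by (induction q) (auto simp: less_Suc_eq)

lemma monomials_mult:
  assumes "\<And>i. i < q \<Longrightarrow> x i \<in> carrier R" "i < q" "m \<in> monomials x q n"
  shows "x i \<otimes> m \<in> monomials x q (Suc n)"
  using assms
proof (induction x q n arbitrary: m rule: monomials.induct)
  case (1 x n) thus ?case by simp
next
  case (2 x q)
  show ?case using generator_in_monomials[of "Suc q" x i] 2 by (simp del: monomials.simps(3))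
next
  case (3 x q n)
  show ?case
  proof (cases "i = q")
    case True
    thus ?thesis using 3 by simp
  next
    case False
    hence i: "i < q" using 3 by simp
    from 3(5) consider "m \<in> monomials x q (Suc n)" | m' where "m' \<in> monomials x (Suc q) n" "m = x q \<otimes> m'" by auto
    thus ?thesis
    proof cases
      case 1
      thus ?thesis using 3(1)[of m] 3 i by simp
    next
      case 2
      have "x i \<in> carrier R" "x q \<in> carrier R" "m' \<in> carrier R"
        using 3 i monomials_carrier[of "Suc q" x n] 2 by auto
      hence "x i \<otimes> m = x q \<otimes> (x i \<otimes> m')" using 2 by (simp add: m_lcomm)
      moreover have "x i \<otimes> m' \<in> monomials x (Suc q) (Suc n)" using 3(2)[of m'] 3 2 by simp
      ultimately show ?thesis by (subst monomials.simps) blast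
    qed
  qed
qed

text \<open>The commutators \<open>[\<delta>, r]\<close> again commute with the \<open>x i\<close>,
  so they are linear by induction on the order. The Leibniz rule for commutators then makes
  \<open>[\<delta>, r] \<one>\<close> a derivation in \<open>r\<close>; it vanishes at the
  \<open>x i\<close> and is therefore zero.\<close>

lemma dop_linear:
  assumes A: "A \<subseteq> carrier R" and x: "\<And>i. i < q \<Longrightarrow> x i \<in> carrier R"
    and der: "\<And>d. d \<in> der A \<Longrightarrow> (\<And>i. i < q \<Longrightarrow> d (x i) = \<zero>) \<Longrightarrow> (\<And>y. y \<in> carrier R \<Longrightarrow> d y = \<zero>)"
    and "\<delta> \<in> dop A n" "\<And>i y. i < (q::nat) \<Longrightarrow> y \<in> carrier R \<Longrightarrow> com \<delta> (x i) y = \<zero>"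
    and "r \<in> carrier R" "y \<in> carrier R"
  shows "\<delta> (r \<otimes> y) = r \<otimes> \<delta> y"
  using assms(4-7)
proof (induction n arbitrary: \<delta> r y)
  case 0
  thus ?case using linD(3)[of \<delta> "carrier R"] by simp
next
  case (Suc n)
  note l = dop_lin[OF Suc.prems(1) A]
  have comR: "com \<delta> r y \<in> carrier R" if "r \<in> carrier R" "y \<in> carrier R" for r y
    using linD(1)[OF lin_com[OF l A that(1)] that(2)] .
  have comlin: "com \<delta> r (s \<otimes> y) = s \<otimes> com \<delta> r y" if r: "r \<in> carrier R" and "s \<in> carrier R" "y \<in> carrier R" for r s y
  proof (rule Suc.IH[OF dop_com[OF Suc.prems(1) r] _ that(2,3)])
    fix i z assume i: "i < q" and z: "z \<in> carrier R"
    have xi: "x i \<in> carrier R" using x[OF i] .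
    have eq: "\<delta> (x i \<otimes> u) = x i \<otimes> \<delta> u" if u: "u \<in> carrier R" for u
      using Suc.prems(2)[OF i u] linD(1)[OF l] u xi by (simp add: com_def)
    have c: "\<delta> z \<in> carrier R" "\<delta> (r \<otimes> z) \<in> carrier R" using linD(1)[OF l] r z by auto
    have "\<delta> (r \<otimes> (x i \<otimes> z)) = x i \<otimes> \<delta> (r \<otimes> z)" using eq[of "r \<otimes> z"] r z xi by (simp add: m_lcomm)
    hence "com (com \<delta> r) (x i) z = (x i \<otimes> \<delta> (r \<otimes> z) \<ominus> r \<otimes> (x i \<otimes> \<delta> z)) \<ominus> x i \<otimes> (\<delta> (r \<otimes> z) \<ominus> r \<otimes> \<delta> z)"
      unfolding com_def using eq[OF z] by simp
    also have "\<dots> = \<zero>" using c r xi by algebra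
    finally show "com (com \<delta> r) (x i) z = \<zero>" .
  qed
  define d where "d r = com \<delta> r \<one>" for r
  have d: "d \<in> der A"
    unfolding der_def
  proof (intro CollectI conjI ballI linI)
    fix u v assume u: "u \<in> carrier R"
    show "d u \<in> carrier R" using comR u by (simp add: d_def)
    { assume v: "v \<in> carrier R"
      show "d (u \<oplus> v) = d u \<oplus> d v" using com_add[OF l u v] by (simp add: d_def)
      show "d (u \<otimes> v) = u \<otimes> d v \<oplus> v \<otimes> d u"
        using com_mult[OF l u v one_closed] comlin[OF u v one_closed] comR u v by (simp add: d_def a_comm) }
    fix s assume s: "s \<in> A"
    hence sR: "s \<in> carrier R" using A by auto
    show "d (s \<otimes> u) = s \<otimes> d u"
      using com_mult[OF l sR u one_closed] com_scalar[OF l s A] comR[OF u] sR u by (simp add: d_def)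
  qed
  have "com \<delta> r y = y \<otimes> d r" using comlin[OF Suc.prems(3,4) one_closed] Suc.prems by (simp add: d_def)
  also have "d r = \<zero>" using der[OF d _ Suc.prems(3)] Suc.prems(2) one_closed by (simp add: d_def)
  finally show ?case using Suc.prems linD(1)[OF l] by (simp add: com_def)
qed

text \<open>Commutation with \<open>x i\<close> lowers the order and the degree together:
  \<open>[\<delta>, x i]\<close> vanishes on the monomials of one degree less and is zero by
  induction. So \<delta> is linear, and its value at \<open>\<one>\<close> is zero because
  \<open>\<one>\<close> is a monomial.\<close>

lemma dop_determined:
  assumes A: "A \<subseteq> carrier R" and x: "\<And>i. i < (q::nat) \<Longrightarrow> x i \<in> carrier R"
    and der: "\<And>d. d \<in> der A \<Longrightarrow> (\<And>i. i < q \<Longrightarrow> d (x i) = \<zero>) \<Longrightarrow> (\<And>y. y \<in> carrier R \<Longrightarrow> d y = \<zero>)"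
    and "\<delta> \<in> dop A n" "\<And>m. m \<in> monomials x q n \<Longrightarrow> \<delta> m = \<zero>" "y \<in> carrier R"
  shows "\<delta> y = \<zero>"
  using assms(4-6)
proof (induction n arbitrary: \<delta> y)
  case 0
  have "\<delta> \<one> = \<zero>" using 0 one_in_monomials by blast
  thus ?case using linD(3)[of \<delta> "carrier R" y \<one>] 0 by simp
next
  case (Suc n)
  note l = dop_lin[OF Suc.prems(1) A]
  have "com \<delta> (x i) z = \<zero>" if i: "i < q" and z: "z \<in> carrier R" for i z
  proof (rule Suc.IH[OF dop_com[OF Suc.prems(1) x[OF i]] _ z])
    fix m assume m: "m \<in> monomials x q n"
    show "com \<delta> (x i) m = \<zero>"
      using Suc.prems(2)[OF monomials_mult[OF x i m]] Suc.prems(2)[of m] m monomials_Suc[of x q n] x[OF i]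
      by (simp add: com_def a_minus_def subset_iff)
  qed
  note com0 = this
  have "\<delta> (y \<otimes> \<one>) = y \<otimes> \<delta> \<one>"
  proof (rule dop_linear[OF A _ _ Suc.prems(1) _ Suc.prems(3) one_closed])
    fix d z assume "d \<in> der A" "\<And>i. i < q \<Longrightarrow> d (x i) = \<zero>" "z \<in> carrier R"
    thus "d z = \<zero>" by (rule der)
  qed (fact x com0)+
  moreover have "\<delta> \<one> = \<zero>" using Suc.prems(2) one_in_monomials by blast
  ultimately show ?case using Suc.prems(3) by simp
qed

end

text \<open>Through the injective linear map \<phi> the operators live in a free module with basis
  \<open>J\<close>, where triangular systems are short. As \<open>W\<close> is merely a set of
  functions closed under binary combinations, a combination of \<open>N\<close> operators is
  assembled one operator at a time, together with its image under \<phi>.\<close>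

lemma (in domain) triangular_functions_le_card:
  assumes W: "(\<lambda>x. \<zero>) \<in> W"
    "\<And>a b \<delta> \<epsilon>. a \<in> carrier R \<Longrightarrow> b \<in> carrier R \<Longrightarrow> \<delta> \<in> W \<Longrightarrow> \<epsilon> \<in> W \<Longrightarrow>
       (\<lambda>x. a \<otimes> \<delta> x \<oplus> b \<otimes> \<epsilon> x) \<in> W"
    and Wc: "\<And>\<delta> x. \<delta> \<in> W \<Longrightarrow> x \<in> carrier R \<Longrightarrow> \<delta> x \<in> carrier R"
    and J: "finite J"
    and \<phi>: "\<And>\<delta> j. \<delta> \<in> W \<Longrightarrow> j \<in> J \<Longrightarrow> \<phi> \<delta> j \<in> carrier R"
      "\<And>\<delta> \<epsilon> a b j. j \<in> J \<Longrightarrow> a \<in> carrier R \<Longrightarrow> b \<in> carrier R \<Longrightarrow> \<delta> \<in> W \<Longrightarrow> \<epsilon> \<in> W \<Longrightarrow>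
         \<phi> (\<lambda>x. a \<otimes> \<delta> x \<oplus> b \<otimes> \<epsilon> x) j = a \<otimes> \<phi> \<delta> j \<oplus> b \<otimes> \<phi> \<epsilon> j"
    and inj: "\<And>\<delta> x. \<delta> \<in> W \<Longrightarrow> (\<And>j. j \<in> J \<Longrightarrow> \<phi> \<delta> j = \<zero>) \<Longrightarrow> x \<in> carrier R \<Longrightarrow> \<delta> x = \<zero>"
    and D: "\<And>i. i < N \<Longrightarrow> D i \<in> W" "\<And>i. i < N \<Longrightarrow> f i \<in> carrier R" 
      "\<And>i. i < N \<Longrightarrow> D i (f i) \<noteq> \<zero>" "\<And>i l. l < i \<Longrightarrow> i < N \<Longrightarrow> D i (f l) = \<zero>"
  shows "N \<le> card J"
proof (rule triangular_le_card[OF J, where a = "\<lambda>i. \<phi> (D i)" and b = "\<lambda>i l. D i (f l)"])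
  fix c l assume c: "c \<in> {..<N} \<rightarrow> carrier R" and z: "\<forall>j\<in>J. (\<Oplus>i\<in>{..<N}. c i \<otimes> \<phi> (D i) j) = \<zero>" and l: "l < N"
  have W0: "\<phi> (\<lambda>x. \<zero>) j = \<zero>" if "j \<in> J" for j
    using \<phi>(2)[OF that zero_closed zero_closed W(1) W(1)] \<phi>(1)[OF W(1) that] by simp
  have "\<exists>E\<in>W. (\<forall>x\<in>carrier R. E x = (\<Oplus>i\<in>{..<M}. c i \<otimes> D i x)) \<and>
      (\<forall>j\<in>J. \<phi> E j = (\<Oplus>i\<in>{..<M}. c i \<otimes> \<phi> (D i) j))" if "M \<le> N" for M
    using that
  proof (induction M)
    case 0
    show ?case using W(1) W0 by (intro bexI[of _ "\<lambda>x. \<zero>"]) auto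
  next
    case (Suc M)
    obtain E where E: "E \<in> W" "\<And>x. x \<in> carrier R \<Longrightarrow> E x = (\<Oplus>i\<in>{..<M}. c i \<otimes> D i x)"
      "\<And>j. j \<in> J \<Longrightarrow> \<phi> E j = (\<Oplus>i\<in>{..<M}. c i \<otimes> \<phi> (D i) j)"
      using Suc by fastforce
    have M: "c M \<in> carrier R" "D M \<in> W" using Suc.prems c D(1)[of M] by auto
    have cM: "c i \<in> carrier R" "D i \<in> W" if "i < M" for i using Suc.prems c D(1)[of i] that by auto
    have s: "(\<Oplus>i\<in>{..<Suc M}. c i \<otimes> g i) = c M \<otimes> g M \<oplus> (\<Oplus>i\<in>{..<M}. c i \<otimes> g i)"
      if "\<And>i. i < Suc M \<Longrightarrow> g i \<in> carrier R" for g
      unfolding lessThan_Suc using M cM that by (intro finsum_insert) auto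
    have DM: "D i \<in> W" if "i < Suc M" for i using Suc.prems D(1)[of i] that by simp
    show ?case
    proof (rule bexI[OF _ W(2)[OF one_closed M(1) E(1) M(2)]], intro conjI ballI)
      fix x assume x: "x \<in> carrier R"
      show "\<one> \<otimes> E x \<oplus> c M \<otimes> D M x = (\<Oplus>i\<in>{..<Suc M}. c i \<otimes> D i x)"
        using s[OF Wc[OF DM x]] E(2)[OF x] Wc[OF E(1) x] Wc[OF M(2) x] M(1)
        by (simp add: a_comm)
    next
      fix j assume j: "j \<in> J"
      show "\<phi> (\<lambda>x. \<one> \<otimes> E x \<oplus> c M \<otimes> D M x) j = (\<Oplus>i\<in>{..<Suc M}. c i \<otimes> \<phi> (D i) j)"
        using s[OF \<phi>(1)[OF DM j]] \<phi>(2)[OF j one_closed M(1) E(1) M(2)] E(3)[OF j] \<phi>(1)[OF E(1) j]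
          \<phi>(1)[OF M(2) j] M(1)
        by (simp add: a_comm)
    qed
  qed
  then obtain E where E: "E \<in> W" "\<And>x. x \<in> carrier R \<Longrightarrow> E x = (\<Oplus>i\<in>{..<N}. c i \<otimes> D i x)"
    "\<And>j. j \<in> J \<Longrightarrow> \<phi> E j = (\<Oplus>i\<in>{..<N}. c i \<otimes> \<phi> (D i) j)"
    by blast
  have "E (f l) = \<zero>" using inj[OF E(1) _ D(2)[OF l]] E(3) z by simp
  thus "(\<Oplus>i\<in>{..<N}. c i \<otimes> D i (f l)) = \<zero>" using E(2)[OF D(2)[OF l]] by simp
qed (use \<phi>(1) D Wc in auto)

section \<open>Extending derivations to the fraction field\<close>

lemma (in field) eq_of_mult_right_nonzero:
  assumes "a \<in> carrier R" "b \<in> carrier R" "c \<in> carrier R" "c \<noteq> \<zero>" "a \<otimes> c = b \<otimes> c"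
  shows "a = b"
  using assms m_rcancel by blast

text \<open>The derivation extends to the fraction field by the quotient rule, which is used in the
  linear form \<open>d(y) s = d(a) - y d(s)\<close> for \<open>y = a / s\<close>.\<close>

lemma (in ring_hom_cring) derivation_zero:
  assumes S: "field S" and inj: "inj_on h (carrier R)"
    and fr: "\<And>y. y \<in> carrier S \<Longrightarrow> \<exists>a\<in>carrier R. \<exists>s\<in>carrier R. h s \<noteq> \<zero>\<^bsub>S\<^esub> \<and> h a = y \<otimes>\<^bsub>S\<^esub> h s"
    and A: "A \<subseteq> carrier R" and d: "d \<in> R.der A" and B: "B \<subseteq> carrier S"
    and dB: "\<And>y. y \<in> B \<Longrightarrow> \<exists>a\<in>carrier R. \<exists>s\<in>carrier R. h s \<noteq> \<zero>\<^bsub>S\<^esub> \<and> h a = y \<otimes>\<^bsub>S\<^esub> h s \<and>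
        s \<otimes> d a = a \<otimes> d s"
    and sep: "\<And>y. y \<in> carrier S \<Longrightarrow> \<exists>p. set p \<subseteq> generate_field S (h ` A \<union> B) \<and>
        S.eval p y = \<zero>\<^bsub>S\<^esub> \<and> S.dv p y \<noteq> \<zero>\<^bsub>S\<^esub>"
    and x: "x \<in> carrier R"
  shows "d x = \<zero>"
proof -
  interpret S: field S by fact
  note l = R.derD(1)[OF d] and Leib = R.derD(2)[OF d]
  have dR: "d a \<in> carrier R" if "a \<in> carrier R" for a using R.linD(1)[OF l that] .
  \<comment> \<open>Representing fractions are chosen once, so that \<open>D\<close> is a function
    on the field before anything is known about its dependence on the choice.\<close>
  obtain num den where nd: "\<And>y. y \<in> carrier S \<Longrightarrow> num y \<in> carrier R \<and> den y \<in> carrier R \<and>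
      h (den y) \<noteq> \<zero>\<^bsub>S\<^esub> \<and> h (num y) = y \<otimes>\<^bsub>S\<^esub> h (den y)"
    using fr by metis
  define D where "D y = (h (d (num y)) \<ominus>\<^bsub>S\<^esub> y \<otimes>\<^bsub>S\<^esub> h (d (den y))) \<otimes>\<^bsub>S\<^esub> inv\<^bsub>S\<^esub> h (den y)" for y
  have DS: "D y \<in> carrier S" if y: "y \<in> carrier S" for y
    using nd[OF y] dR y S.inv_nonzero_closed[of "h (den y)"] by (simp add: D_def)
  have Dden: "D y \<otimes>\<^bsub>S\<^esub> h (den y) = h (d (num y)) \<ominus>\<^bsub>S\<^esub> y \<otimes>\<^bsub>S\<^esub> h (d (den y))" if y: "y \<in> carrier S" for y
    using nd[OF y] dR y S.inv_mult_cancel(2)[of "h (den y)"] S.inv_nonzero_closed[of "h (den y)"]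
    by (simp add: D_def S.m_assoc)
  \<comment> \<open>Independence of the representing fraction: for another fraction
    \<open>a / s\<close> of \<open>y\<close>, the identity \<open>a * den y = num y * s\<close> is
    differentiated in \<open>R\<close>.\<close>
  have D: "D y \<otimes>\<^bsub>S\<^esub> h s = h (d a) \<ominus>\<^bsub>S\<^esub> y \<otimes>\<^bsub>S\<^esub> h (d s)"
    if y: "y \<in> carrier S" and as: "a \<in> carrier R" "s \<in> carrier R" "h a = y \<otimes>\<^bsub>S\<^esub> h s" for y a s
  proof -
    let ?n = "num y" and ?m = "den y"
    have c: "?n \<in> carrier R" "?m \<in> carrier R" "h ?m \<noteq> \<zero>\<^bsub>S\<^esub>" "h ?n = y \<otimes>\<^bsub>S\<^esub> h ?m" using nd[OF y] by auto
    have "h (a \<otimes> ?m) = h (?n \<otimes> s)" using as c y by (simp add: S.m_ac)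
    hence "a \<otimes> ?m = ?n \<otimes> s" by (rule inj_onD[OF inj]) (use as c in simp_all)
    hence "a \<otimes> d ?m \<oplus> ?m \<otimes> d a = ?n \<otimes> d s \<oplus> s \<otimes> d ?n"
      using Leib[of a ?m] Leib[of ?n s] as c by simp
    hence "h (a \<otimes> d ?m \<oplus> ?m \<otimes> d a) = h (?n \<otimes> d s \<oplus> s \<otimes> d ?n)" by simp
    hence 1: "(y \<otimes>\<^bsub>S\<^esub> h s) \<otimes>\<^bsub>S\<^esub> h (d ?m) \<oplus>\<^bsub>S\<^esub> h ?m \<otimes>\<^bsub>S\<^esub> h (d a) =
        (y \<otimes>\<^bsub>S\<^esub> h ?m) \<otimes>\<^bsub>S\<^esub> h (d s) \<oplus>\<^bsub>S\<^esub> h s \<otimes>\<^bsub>S\<^esub> h (d ?n)"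
      using as c dR by simp
    have cS: "h s \<in> carrier S" "h ?m \<in> carrier S" "h (d a) \<in> carrier S" "h (d s) \<in> carrier S"
      "h (d ?n) \<in> carrier S" "h (d ?m) \<in> carrier S" using as c dR by auto
    have "(D y \<otimes>\<^bsub>S\<^esub> h s) \<otimes>\<^bsub>S\<^esub> h ?m = (D y \<otimes>\<^bsub>S\<^esub> h ?m) \<otimes>\<^bsub>S\<^esub> h s" using cS DS[OF y] by (simp add: S.m_ac)
    also have "\<dots> = ((y \<otimes>\<^bsub>S\<^esub> h ?m) \<otimes>\<^bsub>S\<^esub> h (d s) \<oplus>\<^bsub>S\<^esub> h s \<otimes>\<^bsub>S\<^esub> h (d ?n)) \<ominus>\<^bsub>S\<^esub>
        (y \<otimes>\<^bsub>S\<^esub> h s) \<otimes>\<^bsub>S\<^esub> h (d ?m) \<ominus>\<^bsub>S\<^esub> (y \<otimes>\<^bsub>S\<^esub> h ?m) \<otimes>\<^bsub>S\<^esub> h (d s)"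
      unfolding Dden[OF y] using cS y by algebra
    also have "\<dots> = (h (d a) \<ominus>\<^bsub>S\<^esub> y \<otimes>\<^bsub>S\<^esub> h (d s)) \<otimes>\<^bsub>S\<^esub> h ?m"
      unfolding 1[symmetric] using cS y by algebra
    finally show ?thesis
      by (rule S.eq_of_mult_right_nonzero[rotated 4]) (use cS c(3) DS[OF y] y in auto)
  qed
  have cancel: "u = v" if "u \<in> carrier S" "v \<in> carrier S" "s \<in> carrier R" "t \<in> carrier R" "h s \<noteq> \<zero>\<^bsub>S\<^esub>" "h t \<noteq> \<zero>\<^bsub>S\<^esub>"
    "u \<otimes>\<^bsub>S\<^esub> (h s \<otimes>\<^bsub>S\<^esub> h t) = v \<otimes>\<^bsub>S\<^esub> (h s \<otimes>\<^bsub>S\<^esub> h t)" for u v s t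
    by (rule S.eq_of_mult_right_nonzero[OF that(1,2) _ _ that(7)]) (use that S.mult_nonzero in auto)
  have Dadd: "D (y \<oplus>\<^bsub>S\<^esub> z) = D y \<oplus>\<^bsub>S\<^esub> D z" and Dmult: "D (y \<otimes>\<^bsub>S\<^esub> z) = y \<otimes>\<^bsub>S\<^esub> D z \<oplus>\<^bsub>S\<^esub> z \<otimes>\<^bsub>S\<^esub> D y"
    if y: "y \<in> carrier S" and z: "z \<in> carrier S" for y z
  proof -
    define a s b t where abst: "a = num y" "s = den y" "b = num z" "t = den z"
    have c: "a \<in> carrier R" "s \<in> carrier R" "b \<in> carrier R" "t \<in> carrier R" "h s \<noteq> \<zero>\<^bsub>S\<^esub>" "h t \<noteq> \<zero>\<^bsub>S\<^esub>"
      and ha: "h a = y \<otimes>\<^bsub>S\<^esub> h s" "h b = z \<otimes>\<^bsub>S\<^esub> h t" using nd[OF y] nd[OF z] by (auto simp: abst)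
    have da: "h (d a) = D y \<otimes>\<^bsub>S\<^esub> h s \<oplus>\<^bsub>S\<^esub> y \<otimes>\<^bsub>S\<^esub> h (d s)" "h (d b) = D z \<otimes>\<^bsub>S\<^esub> h t \<oplus>\<^bsub>S\<^esub> z \<otimes>\<^bsub>S\<^esub> h (d t)"
      using D[OF y c(1,2) ha(1)] D[OF z c(3,4) ha(2)] c y z dR by (simp_all add: S.minus_eq S.a_assoc S.l_neg)
    have cS: "h s \<in> carrier S" "h t \<in> carrier S" "h (d s) \<in> carrier S" "h (d t) \<in> carrier S"
      "D y \<in> carrier S" "D z \<in> carrier S" using c dR DS y z by auto
    have st: "h (s \<otimes> t) = h s \<otimes>\<^bsub>S\<^esub> h t" "h (d (s \<otimes> t)) = h s \<otimes>\<^bsub>S\<^esub> h (d t) \<oplus>\<^bsub>S\<^esub> h t \<otimes>\<^bsub>S\<^esub> h (d s)"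
      using c dR Leib[of s t] by auto
    have "d (a \<otimes> t \<oplus> b \<otimes> s) = (a \<otimes> d t \<oplus> t \<otimes> d a) \<oplus> (b \<otimes> d s \<oplus> s \<otimes> d b)"
      using R.linD(2)[OF l, of "a \<otimes> t" "b \<otimes> s"] Leib c by simp
    hence n: "h (d (a \<otimes> t \<oplus> b \<otimes> s)) = (h a \<otimes>\<^bsub>S\<^esub> h (d t) \<oplus>\<^bsub>S\<^esub> h t \<otimes>\<^bsub>S\<^esub> h (d a)) \<oplus>\<^bsub>S\<^esub> (h b \<otimes>\<^bsub>S\<^esub> h (d s) \<oplus>\<^bsub>S\<^esub> h s \<otimes>\<^bsub>S\<^esub> h (d b))"
      using c dR by simp
    have "h (a \<otimes> t \<oplus> b \<otimes> s) = (y \<otimes>\<^bsub>S\<^esub> h s) \<otimes>\<^bsub>S\<^esub> h t \<oplus>\<^bsub>S\<^esub> (z \<otimes>\<^bsub>S\<^esub> h t) \<otimes>\<^bsub>S\<^esub> h s"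
      using c ha by simp
    also have "\<dots> = (y \<oplus>\<^bsub>S\<^esub> z) \<otimes>\<^bsub>S\<^esub> h (s \<otimes> t)" unfolding st using cS y z by algebra
    finally have "D (y \<oplus>\<^bsub>S\<^esub> z) \<otimes>\<^bsub>S\<^esub> (h s \<otimes>\<^bsub>S\<^esub> h t) = h (d (a \<otimes> t \<oplus> b \<otimes> s)) \<ominus>\<^bsub>S\<^esub> (y \<oplus>\<^bsub>S\<^esub> z) \<otimes>\<^bsub>S\<^esub> h (d (s \<otimes> t))"
      using D[of "y \<oplus>\<^bsub>S\<^esub> z" "a \<otimes> t \<oplus> b \<otimes> s" "s \<otimes> t"] y z c st(1) by simp
    also have "\<dots> = (D y \<oplus>\<^bsub>S\<^esub> D z) \<otimes>\<^bsub>S\<^esub> (h s \<otimes>\<^bsub>S\<^esub> h t)"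
      unfolding n st da ha using cS y z by algebra
    finally show "D (y \<oplus>\<^bsub>S\<^esub> z) = D y \<oplus>\<^bsub>S\<^esub> D z"
      by (rule cancel[rotated 6]) (use c cS y z DS in auto)
    have n: "h (d (a \<otimes> b)) = h a \<otimes>\<^bsub>S\<^esub> h (d b) \<oplus>\<^bsub>S\<^esub> h b \<otimes>\<^bsub>S\<^esub> h (d a)"
      using c dR Leib[of a b] by simp
    have "h (a \<otimes> b) = (y \<otimes>\<^bsub>S\<^esub> h s) \<otimes>\<^bsub>S\<^esub> (z \<otimes>\<^bsub>S\<^esub> h t)" using c ha by simp
    also have "\<dots> = (y \<otimes>\<^bsub>S\<^esub> z) \<otimes>\<^bsub>S\<^esub> h (s \<otimes> t)" unfolding st using cS y z by algebra
    finally have "D (y \<otimes>\<^bsub>S\<^esub> z) \<otimes>\<^bsub>S\<^esub> (h s \<otimes>\<^bsub>S\<^esub> h t) = h (d (a \<otimes> b)) \<ominus>\<^bsub>S\<^esub> (y \<otimes>\<^bsub>S\<^esub> z) \<otimes>\<^bsub>S\<^esub> h (d (s \<otimes> t))"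
      using D[of "y \<otimes>\<^bsub>S\<^esub> z" "a \<otimes> b" "s \<otimes> t"] y z c st(1) by simp
    also have "\<dots> = (y \<otimes>\<^bsub>S\<^esub> D z \<oplus>\<^bsub>S\<^esub> z \<otimes>\<^bsub>S\<^esub> D y) \<otimes>\<^bsub>S\<^esub> (h s \<otimes>\<^bsub>S\<^esub> h t)"
      unfolding n st da ha using cS y z by algebra
    finally show "D (y \<otimes>\<^bsub>S\<^esub> z) = y \<otimes>\<^bsub>S\<^esub> D z \<oplus>\<^bsub>S\<^esub> z \<otimes>\<^bsub>S\<^esub> D y"
      by (rule cancel[rotated 6]) (use c cS y z DS in auto)
  qed
  have d1: "d \<one> = \<zero>"
  proof -
    have "d \<one> = d \<one> \<oplus> d \<one>" using Leib[of \<one> \<one>] dR by simp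
    thus ?thesis using dR[OF R.one_closed] by (metis R.add.r_cancel_one')
  qed
  have Dh: "D (h a) = h (d a)" if a: "a \<in> carrier R" for a
  proof -
    have "D (h a) \<otimes>\<^bsub>S\<^esub> h \<one> = h (d a) \<ominus>\<^bsub>S\<^esub> h a \<otimes>\<^bsub>S\<^esub> h (d \<one>)"
      using D[of "h a" a \<one>] a by simp
    thus ?thesis using d1 DS[of "h a"] a dR[OF a] by (simp add: S.minus_eq)
  qed
  \<comment> \<open>The constants of the extended derivation form a field that contains the images
    of the scalars and \<open>B\<close>, hence everything generated by them. Differentiating a
    separable relation over it leaves a nonzero multiple of \<open>D (h x)\<close>, which must be
    zero.\<close>
  define C where "C = {y \<in> carrier S. D y = \<zero>\<^bsub>S\<^esub>}"
  have hC: "h a \<in> C" if "a \<in> carrier R" "d a = \<zero>" for a using Dh that by (simp add: C_def)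
  have Cm: "y \<otimes>\<^bsub>S\<^esub> z \<in> C" if "y \<in> C" "z \<in> C" for y z using Dmult[of y z] that by (simp add: C_def)
  have Ca: "y \<oplus>\<^bsub>S\<^esub> z \<in> C" if "y \<in> C" "z \<in> C" for y z using Dadd[of y z] that by (simp add: C_def)
  have d0: "d \<zero> = \<zero>" using R.lin_zero[OF l] .
  have Cn: "\<ominus>\<^bsub>S\<^esub> \<one>\<^bsub>S\<^esub> \<in> C" using hC[of "\<ominus> \<one>"] d1 R.lin_uminus[OF l, of \<one>] by simp
  have C1: "\<one>\<^bsub>S\<^esub> \<in> C" using hC[of \<one>] d1 by simp
  have CS: "C \<subseteq> carrier S" by (auto simp: C_def)
  have "subfield C S"
  proof (rule S.subfieldI')
    have neg: "\<ominus>\<^bsub>S\<^esub> y \<in> C" if y: "y \<in> C" for y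
    proof -
      have "\<ominus>\<^bsub>S\<^esub> y = \<ominus>\<^bsub>S\<^esub> \<one>\<^bsub>S\<^esub> \<otimes>\<^bsub>S\<^esub> y" using y CS by (auto simp: S.l_minus)
      thus ?thesis using Cm[OF Cn y] by simp
    qed
    show "subring C S" by (rule S.subringI) (use CS C1 neg Cm Ca in auto)
    fix y assume y: "y \<in> C - {\<zero>\<^bsub>S\<^esub>}"
    have yS: "y \<in> carrier S" "y \<noteq> \<zero>\<^bsub>S\<^esub>" "D y = \<zero>\<^bsub>S\<^esub>" using y by (auto simp: C_def)
    have iS: "inv\<^bsub>S\<^esub> y \<in> carrier S" using S.inv_nonzero_closed yS by simp
    have i: "inv\<^bsub>S\<^esub> y \<otimes>\<^bsub>S\<^esub> y = \<one>\<^bsub>S\<^esub>" using S.inv_mult_cancel(2) yS by simp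
    have "\<zero>\<^bsub>S\<^esub> = D (inv\<^bsub>S\<^esub> y \<otimes>\<^bsub>S\<^esub> y)" using C1 i by (simp add: C_def)
    also have "\<dots> = D (inv\<^bsub>S\<^esub> y) \<otimes>\<^bsub>S\<^esub> y" using Dmult[OF iS yS(1)] yS iS DS[OF iS] by (simp add: S.m_comm)
    finally have "D (inv\<^bsub>S\<^esub> y) = \<zero>\<^bsub>S\<^esub>" using S.integral[of "D (inv\<^bsub>S\<^esub> y)" y] DS[OF iS] yS by auto
    thus "inv\<^bsub>S\<^esub> y \<in> C" using iS by (simp add: C_def)
  qed
  moreover have "h ` A \<subseteq> C"
  proof
    fix y assume "y \<in> h ` A"
    then obtain a where a: "a \<in> A" "y = h a" by auto
    hence aR: "a \<in> carrier R" using A by auto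
    have "d (a \<otimes> \<one>) = a \<otimes> d \<one>" using R.linD(3)[OF l a(1) R.one_closed] .
    thus "y \<in> C" using hC[OF aR] d1 aR a(2) by simp
  qed
  moreover have "B \<subseteq> C"
  proof
    fix y assume y: "y \<in> B"
    then obtain a s where as: "a \<in> carrier R" "s \<in> carrier R" "h s \<noteq> \<zero>\<^bsub>S\<^esub>" "h a = y \<otimes>\<^bsub>S\<^esub> h s" "s \<otimes> d a = a \<otimes> d s"
      using dB by blast
    have yS: "y \<in> carrier S" using y B by auto
    have c: "h s \<in> carrier S" "h (d a) \<in> carrier S" "h (d s) \<in> carrier S" using as dR by auto
    have "h (s \<otimes> d a) = h (a \<otimes> d s)" using as(5) by simp
    hence 1: "h s \<otimes>\<^bsub>S\<^esub> h (d a) = (y \<otimes>\<^bsub>S\<^esub> h s) \<otimes>\<^bsub>S\<^esub> h (d s)"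
      using as(1-4) dR by simp
    have "D y \<otimes>\<^bsub>S\<^esub> (h s \<otimes>\<^bsub>S\<^esub> h s) = (D y \<otimes>\<^bsub>S\<^esub> h s) \<otimes>\<^bsub>S\<^esub> h s" using c DS[OF yS] by (simp add: S.m_assoc)
    also have "\<dots> = h s \<otimes>\<^bsub>S\<^esub> h (d a) \<ominus>\<^bsub>S\<^esub> (y \<otimes>\<^bsub>S\<^esub> h s) \<otimes>\<^bsub>S\<^esub> h (d s)"
      unfolding D[OF yS as(1,2,4)] using c yS by algebra
    also have "\<dots> = \<zero>\<^bsub>S\<^esub> \<otimes>\<^bsub>S\<^esub> (h s \<otimes>\<^bsub>S\<^esub> h s)" unfolding 1 using c yS by (simp add: S.r_right_minus_eq)
    finally have "D y = \<zero>\<^bsub>S\<^esub>" by (rule cancel[rotated 6]) (use as DS[OF yS] in auto)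
    thus "y \<in> C" using yS by (simp add: C_def)
  qed
  moreover have "h ` A \<union> B \<subseteq> carrier S" using A B by auto
  ultimately have gen: "generate_field S (h ` A \<union> B) \<subseteq> C" by (intro S.generate_field_min_subfield1) auto
  obtain p where p: "set p \<subseteq> C" "S.eval p (h x) = \<zero>\<^bsub>S\<^esub>" "S.dv p (h x) \<noteq> \<zero>\<^bsub>S\<^esub>"
    using sep[of "h x"] gen x by blast
  have hx: "h x \<in> carrier S" using x by simp
  interpret I: ring_hom_cring S S id
    by unfold_locales (auto simp: ring_hom_def)
  have "D (S.eval p (h x)) = id (S.dv p (h x)) \<otimes>\<^bsub>S\<^esub> D (h x)"
    by (rule I.derivation_eval[OF S.carrier_is_subring]) (use DS Dadd Dmult p CS hx in \<open>auto simp: C_def\<close>)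
  moreover have "D (S.eval p (h x)) = \<zero>\<^bsub>S\<^esub>" using p(2) d0 Dh[of \<zero>] by simp
  moreover have "set p \<subseteq> carrier S" using p CS by auto
  ultimately have "D (h x) = \<zero>\<^bsub>S\<^esub>" using S.integral[of "S.dv p (h x)" "D (h x)"] p(3) DS[OF hx] S.dv_closed[OF _ hx] by auto
  hence "h (d x) = h \<zero>" using Dh[OF x] by simp
  thus ?thesis using inj dR[OF x] by (simp add: inj_on_eq_iff del: hom_zero)
qed

text \<open>Taking numerators and denominators of a transcendence basis would give up to
  \<open>2 * e\<close> elements and spoil the exponent. Instead a longest triangular system of
  derivations and elements is taken. The \<open>e\<close> values
  \<open>s j * d (a j) - a j * d (s j)\<close> determine a derivation, so its length is at most
  \<open>e\<close>; and a nonzero derivation vanishing on all its elements would prolong it.\<close>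

lemma (in domain) derivation_determining_elements:
  assumes A: "A \<subseteq> carrier R" and b: "\<And>j. j < e \<Longrightarrow> a j \<in> carrier R \<and> s j \<in> carrier R"
    and inj: "\<And>d x. d \<in> der A \<Longrightarrow> (\<And>j. j < (e::nat) \<Longrightarrow> s j \<otimes> d (a j) = a j \<otimes> d (s j)) \<Longrightarrow> x \<in> carrier R \<Longrightarrow> d x = \<zero>"
  shows "\<exists>q\<le>e. \<exists>x. (\<forall>i<q. x i \<in> carrier R) \<and> 
    (\<forall>d\<in>der A. (\<forall>i<q. d (x i) = \<zero>) \<longrightarrow> (\<forall>y\<in>carrier R. d y = \<zero>))"
proof -
  define P where "P q D x \<longleftrightarrow> (\<forall>i<q. D i \<in> der A \<and> x i \<in> carrier R \<and> D i (x i) \<noteq> \<zero> \<and> (\<forall>l<i. D i (x l) = \<zero>))"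
    for q :: nat and D x
  have derc: "d x \<in> carrier R" if "d \<in> der A" "x \<in> carrier R" for d x
    using linD(1)[OF derD(1)[OF that(1)] that(2)] .
  have bound: "q \<le> e" if P: "P q D x" for q D x
  proof -
    have "q \<le> card {..<e}"
    proof (rule triangular_functions_le_card[where W = "der A" and \<phi> = "\<lambda>d j. s j \<otimes> d (a j) \<ominus> a j \<otimes> d (s j)" and D = D and f = x])
      fix d j assume d: "d \<in> der A" and j: "j \<in> {..<e}"
      show "s j \<otimes> d (a j) \<ominus> a j \<otimes> d (s j) \<in> carrier R" using b j derc[OF d] by simp
    next
      fix \<delta> \<epsilon> u v j assume j: "j \<in> {..<e}" and u: "u \<in> carrier R" "v \<in> carrier R" and d: "\<delta> \<in> der A" "\<epsilon> \<in> der A"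
      have "a j \<in> carrier R" "s j \<in> carrier R" using b j by auto
      moreover from this have "\<delta> (a j) \<in> carrier R" "\<delta> (s j) \<in> carrier R" "\<epsilon> (a j) \<in> carrier R" "\<epsilon> (s j) \<in> carrier R"
        using derc d by auto
      ultimately show "s j \<otimes> (u \<otimes> \<delta> (a j) \<oplus> v \<otimes> \<epsilon> (a j)) \<ominus> a j \<otimes> (u \<otimes> \<delta> (s j) \<oplus> v \<otimes> \<epsilon> (s j)) =
         u \<otimes> (s j \<otimes> \<delta> (a j) \<ominus> a j \<otimes> \<delta> (s j)) \<oplus> v \<otimes> (s j \<otimes> \<epsilon> (a j) \<ominus> a j \<otimes> \<epsilon> (s j))"
        using u by algebra
    next
      fix d y assume d: "d \<in> der A" and z: "\<And>j. j \<in> {..<e} \<Longrightarrow> s j \<otimes> d (a j) \<ominus> a j \<otimes> d (s j) = \<zero>" and y: "y \<in> carrier R"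
      show "d y = \<zero>"
      proof (rule inj[OF d _ y])
        fix j assume j: "j < e"
        show "s j \<otimes> d (a j) = a j \<otimes> d (s j)" using z[of j] j b[OF j] derc[OF d] by (simp add: r_right_minus_eq)
      qed
    next
      show "(\<lambda>x. \<zero>) \<in> der A" by (rule zero_der[OF A])
    next
      fix a b \<delta> \<epsilon> assume "a \<in> carrier R" "b \<in> carrier R" "\<delta> \<in> der A" "\<epsilon> \<in> der A"
      thus "(\<lambda>x. a \<otimes> \<delta> x \<oplus> b \<otimes> \<epsilon> x) \<in> der A" by (intro der_comb[OF _ _ A])
    qed (use P derc in \<open>auto simp: P_def\<close>)
    thus ?thesis by simp
  qed
  define Q where "Q q \<longleftrightarrow> (\<exists>D x. P q D x)" for q
  have Q0: "Q 0" by (auto simp: Q_def P_def)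
  have Qb: "\<And>q. Q q \<Longrightarrow> q \<le> e" using bound by (auto simp: Q_def)
  define q where "q = (GREATEST q. Q q)"
  have q: "Q q" unfolding q_def using GreatestI_nat[of Q 0 e] Q0 Qb by blast
  have qm: "q' \<le> q" if "Q q'" for q' unfolding q_def using Greatest_le_nat[of Q q' e] that Qb by blast
  obtain D x where P: "P q D x" using q by (auto simp: Q_def)
  have "d y = \<zero>" if d: "d \<in> der A" "\<forall>i<q. d (x i) = \<zero>" and y: "y \<in> carrier R" for d y
  proof (rule ccontr)
    assume ne: "d y \<noteq> \<zero>"
    have "P (Suc q) (D(q := d)) (x(q := y))"
      unfolding P_def using P d y ne by (auto simp: P_def less_Suc_eq)
    hence "Q (Suc q)" unfolding Q_def by blast
    hence "Suc q \<le> q" by (rule qm)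
    thus False by simp
  qed
  thus ?thesis using Qb[OF q] P by (intro exI[of _ q] conjI exI[of _ x]) (auto simp: P_def)
qed

section \<open>Separability and algebraic independence\<close>

context cring
begin

lemma operator_chain_bound:
  fixes S (structure)
  assumes R: "domain R" and S: "field S" and h: "h \<in> ring_hom R S" "h ` carrier R = carrier S"
    and A: "subring A R"
    and sep: "\<And>a. a \<in> carrier R \<Longrightarrow> \<exists>p. set p \<subseteq> A \<and> h (eval p a) = \<zero>\<^bsub>S\<^esub> \<and> h (dv p a) \<noteq> \<zero>\<^bsub>S\<^esub>"
    and x: "\<And>i. i < q \<Longrightarrow> x i \<in> carrier R"
    and der: "\<And>d y. d \<in> der A \<Longrightarrow> (\<And>i. i < (q::nat) \<Longrightarrow> d (x i) = \<zero>\<^bsub>R\<^esub>) \<Longrightarrow> y \<in> carrier R \<Longrightarrow> d y = \<zero>\<^bsub>R\<^esub>"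
    and I: "\<And>i. i \<le> N \<Longrightarrow> I i \<subseteq> carrier R"
      "\<And>i u v r. i \<le> N \<Longrightarrow> u \<in> I i \<Longrightarrow> v \<in> I i \<Longrightarrow> r \<in> carrier R \<Longrightarrow> u \<oplus>\<^bsub>R\<^esub> r \<otimes>\<^bsub>R\<^esub> v \<in> I i" "\<And>i. i < N \<Longrightarrow> I i \<subset> I (Suc i)"
    and I0: "{f \<in> carrier R. \<forall>\<delta>\<in>dop A n. h (\<delta> f) = \<zero>\<^bsub>S\<^esub>} \<subseteq> I 0"
  shows "N \<le> (n + q) choose q"
proof -
  interpret R: domain R by fact
  interpret S: field S by fact
  interpret h: ring_hom_cring R S h by unfold_locales fact
  have Ac: "A \<subseteq> carrier R" using subringE(1)[OF A] .
  have lin: "\<delta> \<in> lin A" if "\<delta> \<in> dop A n" for \<delta> using dop_lin[OF that Ac] .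
  define C where "C = {r \<in> carrier R. \<forall>\<delta>\<in>dop A n. \<forall>g\<in>carrier R. h (\<delta> (r \<otimes>\<^bsub>R\<^esub> g)) = h r \<otimes>\<^bsub>S\<^esub> h (\<delta> g)}"
  note lift = h.operator_lift[OF S A sep h(2), of _ n, folded C_def]
  have "\<exists>D f. \<forall>i<N. D i \<in> dop A n \<and> f i \<in> carrier R \<and> D i (f i) \<noteq> \<zero>\<^bsub>R\<^esub> \<and> (\<forall>l<i. D i (f l) = \<zero>\<^bsub>R\<^esub>)"
  proof (rule h.quotient_chain_triangular[OF S h(2), where C = C and I = I])
    fix a b \<delta> \<epsilon> assume "a \<in> carrier R" "b \<in> carrier R" "\<delta> \<in> dop A n" "\<epsilon> \<in> dop A n"
    thus "(\<lambda>x. a \<otimes>\<^bsub>R\<^esub> \<delta> x \<oplus>\<^bsub>R\<^esub> b \<otimes>\<^bsub>R\<^esub> \<epsilon> x) \<in> dop A n" by (intro dop_comb[OF _ _ Ac])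
  next
    fix i u v c assume i: "i \<le> N" and u: "u \<in> I i" "v \<in> I i" and c: "c \<in> C"
    have "c \<in> carrier R" using c by (simp add: C_def)
    thus "u \<oplus>\<^bsub>R\<^esub> c \<otimes>\<^bsub>R\<^esub> v \<in> I i" by (rule I(2)[OF i u])
  next
    fix y assume "y \<in> carrier R" "\<And>\<delta>. \<delta> \<in> dop A n \<Longrightarrow> h (\<delta> y) = \<zero>\<^bsub>S\<^esub>"
    thus "y \<in> I 0" using I0 by blast
  qed (use linD[OF lin] I(1,3) lift in \<open>simp_all add: C_def\<close>)
  then obtain D f where D: "\<And>i. i < N \<Longrightarrow> D i \<in> dop A n \<and> f i \<in> carrier R \<and> D i (f i) \<noteq> \<zero>\<^bsub>R\<^esub> \<and> (\<forall>l<i. D i (f l) = \<zero>\<^bsub>R\<^esub>)"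
    by blast
  have mc: "monomials x q n \<subseteq> carrier R" using monomials_carrier x by blast
  have "N \<le> card (monomials x q n)"
  proof (rule R.triangular_functions_le_card[where W = "dop A n" and \<phi> = "\<lambda>\<delta>. \<delta>" and D = D and f = f])
    show "(\<lambda>x. \<zero>\<^bsub>R\<^esub>) \<in> dop A n" by (rule zero_fun_dop[OF Ac]) simp
  next
    fix a b \<delta> \<epsilon> assume "a \<in> carrier R" "b \<in> carrier R" "\<delta> \<in> dop A n" "\<epsilon> \<in> dop A n"
    thus "(\<lambda>x. a \<otimes>\<^bsub>R\<^esub> \<delta> x \<oplus>\<^bsub>R\<^esub> b \<otimes>\<^bsub>R\<^esub> \<epsilon> x) \<in> dop A n" by (intro dop_comb[OF _ _ Ac])
  next
    show "finite (monomials x q n)" using monomials_card by blast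
  next
    fix \<delta> j assume "\<delta> \<in> dop A n" "j \<in> monomials x q n"
    thus "\<delta> j \<in> carrier R" using linD(1)[OF lin] mc by blast
  next
    fix \<delta> y assume d: "\<delta> \<in> dop A n" "\<And>j. j \<in> monomials x q n \<Longrightarrow> \<delta> j = \<zero>\<^bsub>R\<^esub>" "y \<in> carrier R"
    show "\<delta> y = \<zero>\<^bsub>R\<^esub>"
      by (rule dop_determined[OF Ac _ _ d(1) _ d(3)]) (fact x der d(2))+
  qed (use D linD[OF lin] in simp_all)
  also have "\<dots> \<le> (n + q) choose q" using monomials_card by blast
  finally show ?thesis .
qed

end

section \<open>Simple roots of minimal polynomials\<close>

context ring
begin

lemma eval_derivative_coefficients:
  assumes "set p \<subseteq> carrier R" "x \<in> carrier R"
  shows "eval (map (\<lambda>i. add_pow R i (coeff p i)) (rev [1..<length p])) x = dv p x"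
  using assms(1)
proof (induction p)
  case (Cons a p)
  have a: "a \<in> carrier R" and p: "set p \<subseteq> carrier R" using Cons.prems by auto
  have pd: "pd (Suc n) x = add_pow R (Suc n) (x [^] n)" for n :: nat
  proof (induction n)
    case (Suc n)
    have "pd (Suc (Suc n)) x = x \<otimes> add_pow R (Suc n) (x [^] n) \<oplus> x [^] Suc n" using Suc by simp
    also have "x \<otimes> add_pow R (Suc n) (x [^] n) = add_pow R (Suc n) (x [^] Suc n)"
      using assms(2) by (simp only: add_pow_rdistr nat_pow_closed nat_pow_Suc2)
    finally show ?case by (simp add: add.nat_pow_Suc)
  qed (use assms(2) in simp)
  show ?case
  proof (cases p)
    case Nil
    thus ?thesis using a by simp
  next
    case (Cons b p')
    define m where "m = length p'"
    have m: "length p = Suc m" using Cons by (simp add: m_def)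
    have eq: "map (\<lambda>i. add_pow R i (coeff (a # p) i)) (rev [1..<length (a # p)]) =
        add_pow R (Suc m) a # map (\<lambda>i. add_pow R i (coeff p i)) (rev [1..<length p])"
      using m by (auto simp: upt_Suc_append)
    have "add_pow R (Suc m) a \<otimes> x [^] m = a \<otimes> pd (Suc m) x"
      using a assms(2) unfolding pd by (simp only: add_pow_ldistr add_pow_rdistr nat_pow_closed)
    thus ?thesis unfolding eq using m Cons.IH[OF p] by (simp del: upt_Suc pd.simps add.nat_pow_Suc)
  qed
qed simp

lemma eval_formal_deriv:
  assumes "set p \<subseteq> carrier R" "x \<in> carrier R"
  shows "eval (formal_deriv p) x = dv p x"
proof -
  have "set (map (\<lambda>i. add_pow R i (coeff p i)) (rev [1..<length p])) \<subseteq> carrier R"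
    using assms by auto
  thus ?thesis
    unfolding formal_deriv_def using eval_normalize assms(2) eval_derivative_coefficients[OF assms] by simp
qed

end

text \<open>If the derivative vanished at \<open>x\<close>, the minimal polynomial would divide it
  and so would be a common divisor of itself and its derivative, hence a unit. The leading
  coefficient one is split off so that the same relation serves as a monic equation and as a
  polynomial with a simple root.\<close>

lemma (in domain) separable_over_relation:
  assumes L: "subfield L R" and x: "x \<in> carrier R" and sep: "separable_over L x"
  shows "\<exists>p. set p \<subseteq> L \<and> x [^] length p \<oplus> eval p x = \<zero> \<and> dv (\<one> # p) x \<noteq> \<zero>"
proof -
  have Ls: "subring L R" using subfieldE(1)[OF L] .
  have alg: "(algebraic over L) x" using sep by (simp add: separable_over_def)
  let ?p = "Irr L x"
  note I = IrrE[OF L x alg]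
  have ne: "?p \<noteq> []" "?p \<notin> Units (L[X])" using pirreducibleE[OF Ls I(1,2)] by auto
  then obtain p where p: "?p = \<one> # p" using I(3) by (cases ?p) auto
  have pL: "set ?p \<subseteq> L" using I(1) by (auto simp: univ_poly_def polynomial_def)
  have pR: "set ?p \<subseteq> carrier R" using pL subringE(1)[OF Ls] by auto
  have pr: "set p \<subseteq> L" "set p \<subseteq> carrier R" using pL pR p by auto
  have "dv ?p x \<noteq> \<zero>"
  proof
    assume "dv ?p x = \<zero>"
    hence z: "eval (formal_deriv ?p) x = \<zero>" using eval_formal_deriv[OF pR x] by simp
    have "coeff q i \<in> L" if "set q \<subseteq> L" for q i
      using that subringE(2)[OF Ls] by (induction q) auto
    hence cL: "coeff ?p i \<in> L" for i using pL by blast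
    have "add_pow R (i::nat) c \<in> L" if "c \<in> L" for i c
      using that subringE(2,7)[OF Ls] by (induction i) auto
    hence "set (map (\<lambda>i. add_pow R i (coeff ?p i)) (rev [1..<length ?p])) \<subseteq> L" using cL by auto
    hence F: "formal_deriv ?p \<in> carrier (L[X])"
      unfolding formal_deriv_def univ_poly_carrier[symmetric] by (rule normalize_gives_polynomial)
    have "?p divides\<^bsub>L[X]\<^esub> formal_deriv ?p"
      using Irr_minimal[OF L x alg F z] pdivides_iff_shell[OF L I(1) F] by simp
    moreover have "?p divides\<^bsub>L[X]\<^esub> ?p"
    proof -
      interpret UP: domain "L[X]" using univ_poly_is_domain[OF Ls] .
      show ?thesis using I(1) by simp
    qed
    ultimately have "?p \<in> Units (L[X])" using sep I(1) by (auto simp: separable_over_def)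
    thus False using ne by simp
  qed
  moreover have "x [^] length p \<oplus> eval p x = \<zero>" using I(4) p x by simp
  ultimately show ?thesis using pr p by auto
qed

lemma (in ring_hom_ring) eval_dv_image:
  assumes "set p \<subseteq> carrier R" "x \<in> carrier R"
  shows "h (R.eval p x) = S.eval (map h p) (h x)" "h (R.dv p x) = S.dv (map h p) (h x)"
proof -
  have "h (R.pd n x) = S.pd n (h x)" for n :: nat
    using R.pd_closed[OF assms(2)] assms(2) by (induction n) (auto simp: hom_nat_pow)
  thus "h (R.eval p x) = S.eval (map h p) (h x)" "h (R.dv p x) = S.dv (map h p) (h x)"
    using assms R.eval_in_carrier R.dv_closed R.pd_closed by (induction p) (auto simp: hom_nat_pow)
qed

section \<open>Evaluation of multivariate polynomials\<close>

context cring
begin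

definition mval :: "'a multiset \<Rightarrow> 'a" where
  "mval m = (\<Otimes>b\<in>set_mset m. b [^] count m b)"

lemma mval_superset:
  assumes "finite U" "U \<subseteq> carrier R" "set_mset m \<subseteq> U"
  shows "mval m = (\<Otimes>b\<in>U. b [^] count m b)"
  unfolding mval_def using assms
  by (intro finprod_mono_neutral_cong_left) (auto simp: subset_iff Pi_def not_in_iff)

lemma mval_closed: "set_mset m \<subseteq> carrier R \<Longrightarrow> mval m \<in> carrier R"
  unfolding mval_def by (intro finprod_closed) auto

lemma mval_add:
  assumes "set_mset m \<subseteq> carrier R" "x \<in> carrier R"
  shows "mval (add_mset x m) = mval m \<otimes> x"
proof -
  let ?U = "insert x (set_mset m)" and ?V = "set_mset m - {x}"
  have U: "finite ?U" "?U \<subseteq> carrier R" "?U = insert x ?V" using assms by auto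
  have s: "mval m' = x [^] count m' x \<otimes> (\<Otimes>b\<in>?V. b [^] count m' b)" if "set_mset m' \<subseteq> ?U" for m'
    unfolding mval_superset[OF U(1,2) that] unfolding U(3) using assms by (intro finprod_insert) auto
  have "(\<Otimes>b\<in>?V. b [^] count (add_mset x m) b) = (\<Otimes>b\<in>?V. b [^] count m b)"
    using assms by (intro finprod_cong') auto
  moreover have "(\<Otimes>b\<in>?V. b [^] count m b) \<in> carrier R" using assms by (intro finprod_closed) auto
  ultimately show ?thesis using s[of m] s[of "add_mset x m"] assms(2) by (simp add: m_ac subset_insertI)
qed

text \<open>What the evaluation as a finite sum needs: coefficients in the ring, finite support, and
  variables in a given set. The inductive \<open>indexed_pset\<close> does not display this and is
  shown to imply it.\<close>

definition index_poly :: "'a set \<Rightarrow> ('a multiset \<Rightarrow> 'a) \<Rightarrow> bool" where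
  "index_poly I P \<longleftrightarrow> (\<forall>m. P m \<in> carrier R) \<and> finite {m. P m \<noteq> \<zero>} \<and> (\<forall>m. P m \<noteq> \<zero> \<longrightarrow> set_mset m \<subseteq> I)"

lemma index_poly_mono: "index_poly I P \<Longrightarrow> I \<subseteq> J \<Longrightarrow> index_poly J P"
  by (fastforce simp: index_poly_def)

lemma tautological_eval_superset:
  assumes "index_poly (carrier R) P" "finite M" "{m. P m \<noteq> \<zero>} \<subseteq> M" "\<And>m. m \<in> M \<Longrightarrow> set_mset m \<subseteq> carrier R"
  shows "tautological_eval P = (\<Oplus>m\<in>M. P m \<otimes> mval m)"
  unfolding tautological_eval_def mval_def[symmetric] using assms mval_closed
  by (intro add.finprod_mono_neutral_cong_left) (auto simp: index_poly_def Pi_def)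

lemma tautological_eval_closed:
  assumes "index_poly (carrier R) P"
  shows "tautological_eval P \<in> carrier R"
  unfolding tautological_eval_def mval_def[symmetric] using assms mval_closed
  by (intro finsum_closed) (auto simp: index_poly_def)

lemma indexed_const_poly:
  assumes "k \<in> carrier R"
  shows "index_poly I (indexed_const k)" "tautological_eval (indexed_const k) = k"
proof -
  show p: "index_poly I (indexed_const k)" for I
    using assms by (auto simp: index_poly_def indexed_const_def)
  have "tautological_eval (indexed_const k) = (\<Oplus>m\<in>{{#}}. indexed_const k m \<otimes> mval m)"
    by (rule tautological_eval_superset[OF p]) (auto simp: indexed_const_def)
  thus "tautological_eval (indexed_const k) = k" using assms by (simp add: indexed_const_def mval_def)
qed

lemma indexed_padd_poly:
  assumes "index_poly I P" "index_poly I Q" "I \<subseteq> carrier R"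
  shows "index_poly I (indexed_padd P Q)"
    "tautological_eval (indexed_padd P Q) = tautological_eval P \<oplus> tautological_eval Q"
proof -
  let ?M = "{m. P m \<noteq> \<zero>} \<union> {m. Q m \<noteq> \<zero>}"
  note c = index_poly_mono[OF assms(1,3)] index_poly_mono[OF assms(2,3)]
  have M: "finite ?M" "\<And>m. m \<in> ?M \<Longrightarrow> set_mset m \<subseteq> carrier R" using c by (auto simp: index_poly_def)
  have s: "{m. indexed_padd P Q m \<noteq> \<zero>} \<subseteq> ?M" by (auto simp: indexed_padd_def)
  show i: "index_poly I (indexed_padd P Q)"
    unfolding index_poly_def
  proof (intro conjI allI impI)
    fix m
    show "indexed_padd P Q m \<in> carrier R" using c by (simp add: index_poly_def indexed_padd_def)
    show "finite {m. indexed_padd P Q m \<noteq> \<zero>}" using finite_subset[OF s M(1)] .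
    assume "indexed_padd P Q m \<noteq> \<zero>"
    hence "P m \<noteq> \<zero> \<or> Q m \<noteq> \<zero>" using s by blast
    thus "set_mset m \<subseteq> I" using assms(1,2) unfolding index_poly_def by blast
  qed
  note i' = index_poly_mono[OF i assms(3)]
  have Pc: "P m \<in> carrier R" "Q m \<in> carrier R" for m using c by (auto simp: index_poly_def)
  have mc: "mval m \<in> carrier R" if "m \<in> ?M" for m using mval_closed[OF M(2)[OF that]] .
  have "tautological_eval (indexed_padd P Q) = (\<Oplus>m\<in>?M. indexed_padd P Q m \<otimes> mval m)"
    by (rule tautological_eval_superset[OF i' M(1) s]) (rule M(2))
  also have "\<dots> = (\<Oplus>m\<in>?M. P m \<otimes> mval m \<oplus> Q m \<otimes> mval m)"
    by (rule add.finprod_cong') (use Pc mc in \<open>auto simp: indexed_padd_def l_distr\<close>)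
  also have "\<dots> = (\<Oplus>m\<in>?M. P m \<otimes> mval m) \<oplus> (\<Oplus>m\<in>?M. Q m \<otimes> mval m)"
    by (rule finsum_addf) (use Pc mc in auto)
  finally show "tautological_eval (indexed_padd P Q) = tautological_eval P \<oplus> tautological_eval Q"
    using tautological_eval_superset[OF c(1) M(1) _ M(2)] tautological_eval_superset[OF c(2) M(1) _ M(2)] by simp
qed

lemma indexed_pmult_poly:
  assumes "index_poly I P" "x \<in> I" "I \<subseteq> carrier R"
  shows "index_poly I (indexed_pmult P x)"
    "tautological_eval (indexed_pmult P x) = tautological_eval P \<otimes> x"
proof -
  let ?M = "{m. P m \<noteq> \<zero>}"
  note c = index_poly_mono[OF assms(1,3)]
  have x: "x \<in> carrier R" using assms by auto
  have M: "finite ?M" "\<And>m. m \<in> ?M \<Longrightarrow> set_mset m \<subseteq> carrier R" using c by (auto simp: index_poly_def)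
  have s: "{m. indexed_pmult P x m \<noteq> \<zero>} \<subseteq> add_mset x ` ?M"
  proof
    fix m assume "m \<in> {m. indexed_pmult P x m \<noteq> \<zero>}"
    hence "x \<in># m" "P (m - {#x#}) \<noteq> \<zero>" by (auto simp: indexed_pmult_def split: if_splits)
    thus "m \<in> add_mset x ` ?M" by (intro image_eqI[of _ _ "m - {#x#}"]) auto
  qed
  show i: "index_poly I (indexed_pmult P x)"
    unfolding index_poly_def
  proof (intro conjI allI impI)
    fix m
    show "indexed_pmult P x m \<in> carrier R" using c by (simp add: index_poly_def indexed_pmult_def)
    show "finite {m. indexed_pmult P x m \<noteq> \<zero>}" using finite_subset[OF s finite_imageI[OF M(1)]] .
    assume "indexed_pmult P x m \<noteq> \<zero>"
    hence "m \<in> add_mset x ` ?M" using s by blast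
    then obtain m' where "m = add_mset x m'" "P m' \<noteq> \<zero>" by auto
    thus "set_mset m \<subseteq> I" using assms(1,2) by (auto simp: index_poly_def)
  qed
  note i' = index_poly_mono[OF i assms(3)]
  have Pc: "P m \<in> carrier R" for m using c by (auto simp: index_poly_def)
  have mc: "mval m \<in> carrier R" if "m \<in> ?M" for m using mval_closed[OF M(2)[OF that]] .
  have va: "mval (add_mset x m) = mval m \<otimes> x" if "m \<in> ?M" for m using mval_add[OF M(2)[OF that] x] .
  have "tautological_eval (indexed_pmult P x) = (\<Oplus>m\<in>add_mset x ` ?M. indexed_pmult P x m \<otimes> mval m)"
  proof (rule tautological_eval_superset[OF i' finite_imageI[OF M(1)] s])
    fix m assume "m \<in> add_mset x ` ?M"
    then obtain m' where "m = add_mset x m'" "m' \<in> ?M" by blast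
    thus "set_mset m \<subseteq> carrier R" using M(2)[of m'] x by simp
  qed
  also have "\<dots> = (\<Oplus>m\<in>?M. indexed_pmult P x (add_mset x m) \<otimes> mval (add_mset x m))"
    by (rule add.finprod_reindex) (use Pc va mc x in \<open>auto simp: indexed_pmult_def inj_on_def\<close>)
  also have "\<dots> = (\<Oplus>m\<in>?M. (P m \<otimes> mval m) \<otimes> x)"
    by (rule add.finprod_cong') (use Pc va mc x in \<open>auto simp: indexed_pmult_def m_assoc\<close>)
  also have "\<dots> = (\<Oplus>m\<in>?M. P m \<otimes> mval m) \<otimes> x"
    by (rule finsum_ldistr[symmetric]) (use M(1) x Pc mc in auto)
  finally show "tautological_eval (indexed_pmult P x) = tautological_eval P \<otimes> x"
    using tautological_eval_superset[OF c M(1) _ M(2)] by simp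
qed

lemma indexed_pset_poly:
  assumes "P \<in> indexed_pset I K" "K \<subseteq> carrier R" "I \<subseteq> carrier R"
  shows "index_poly I P"
  using assms(1)
proof (induction rule: indexed_pset.induct)
  case (indexed_const k)
  thus ?case using indexed_const_poly(1)[of k I] assms(2) by blast
next
  case (indexed_padd P Q)
  show ?case by (rule indexed_padd_poly(1)[OF indexed_padd.IH assms(3)])
next
  case (indexed_pmult P i)
  show ?case by (rule indexed_pmult_poly(1)[OF indexed_pmult.IH indexed_pmult.hyps(2) assms(3)])
qed

lemma indexed_pset_mono:
  assumes "P \<in> indexed_pset I K" "I \<subseteq> J"
  shows "P \<in> indexed_pset J K"
  using assms by (induction rule: indexed_pset.induct) (auto intro: indexed_pset.intros)

definition pmult_pow :: "('a multiset \<Rightarrow> 'a) \<Rightarrow> 'a \<Rightarrow> nat \<Rightarrow> 'a multiset \<Rightarrow> 'a" where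
  "pmult_pow P x n = ((\<lambda>Q. indexed_pmult Q x) ^^ n) P"

text \<open>The last two claims keep the contributions of different powers of \<open>x\<close> on
  disjoint sets of multisets, which is why they cannot cancel later on.\<close>

lemma pmult_pow_properties:
  assumes "P \<in> indexed_pset I K" "K \<subseteq> carrier R" "I \<subseteq> carrier R" "x \<in> I"
  shows "pmult_pow P x n \<in> indexed_pset I K"
    and "tautological_eval (pmult_pow P x n) = tautological_eval P \<otimes> x [^] n"
    and "pmult_pow P x n (m + replicate_mset n x) = P m"
    and "(\<And>m. P m \<noteq> \<zero> \<Longrightarrow> x \<notin># m) \<Longrightarrow> pmult_pow P x n m \<noteq> \<zero> \<Longrightarrow> count m x = n"
proof -
  have x: "x \<in> carrier R" using assms by auto
  note c = index_poly_mono[OF indexed_pset_poly[OF assms(1-3)] assms(3)]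
  show 1: "pmult_pow P x n \<in> indexed_pset I K" for n
    unfolding pmult_pow_def using assms(1,4) by (induction n) (auto intro: indexed_pset.indexed_pmult)
  show "tautological_eval (pmult_pow P x n) = tautological_eval P \<otimes> x [^] n"
  proof (induction n)
    case 0
    show ?case using tautological_eval_closed[OF c] by (simp add: pmult_pow_def)
  next
    case (Suc n)
    have "tautological_eval (pmult_pow P x (Suc n)) = tautological_eval (pmult_pow P x n) \<otimes> x"
      using indexed_pmult_poly(2)[OF indexed_pset_poly[OF 1 assms(2,3)] assms(4,3)] by (simp add: pmult_pow_def)
    thus ?case using Suc tautological_eval_closed[OF c] x by (simp add: m_assoc)
  qed
  show "pmult_pow P x n (m + replicate_mset n x) = P m"
    by (induction n) (auto simp: pmult_pow_def indexed_pmult_def)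
  show "count m x = n" if "\<And>m. P m \<noteq> \<zero> \<Longrightarrow> x \<notin># m" "pmult_pow P x n m \<noteq> \<zero>"
    using that(2)
  proof (induction n arbitrary: m)
    case 0
    thus ?case using that(1)[of m] by (simp add: pmult_pow_def not_in_iff)
  next
    case (Suc n)
    hence "x \<in># m" "pmult_pow P x n (m - {#x#}) \<noteq> \<zero>"
      by (auto simp: pmult_pow_def indexed_pmult_def split: if_splits)
    thus ?case using Suc.IH[of "m - {#x#}"] by (simp add: count_greater_zero_iff[symmetric] del: count_greater_zero_iff)
  qed
qed

end

text \<open>A univariate polynomial that vanishes at \<open>b i\<close>, with coefficients in the
  ring of the earlier elements, is turned into a multivariate polynomial by choosing one for each
  coefficient. The result is nonzero because the part from the leading coefficient has a higher
  exponent of \<open>b i\<close> than all other parts.\<close>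

lemma (in field) algebraically_independent_alg_indep:
  assumes K: "subring K R" and B: "B \<subseteq> carrier R" "algebraically_independent K B"
    and b: "inj_on b {..<e}" "b ` {..<e} \<subseteq> B"
  shows "alg_indep K b e"
  unfolding alg_indep_def
proof (intro allI impI conjI)
  have Kc: "K \<subseteq> carrier R" using subringE(1)[OF K] .
  have bc: "b i \<in> carrier R" if "i < e" for i using that b(2) B(1) by auto
  have sub: "b ` {..<i} \<subseteq> carrier R" if "i \<le> e" for i using bc that by auto
  fix i assume i: "i < e"
  show "b i \<in> carrier R" using bc[OF i] .
  have ex: "\<exists>P\<in>indexed_pset (b ` {..<k}) K. tautological_eval P = c" if "c \<in> pring K b k" "k \<le> e" for c k
    using that
  proof (induction k arbitrary: c)
    case 0
    hence c: "c \<in> K" using pring_0[OF K] by simp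
    show ?case using indexed_const_poly(2)[of c] c Kc by (intro bexI[of _ "indexed_const c"]) (auto intro: indexed_pset.indexed_const)
  next
    case (Suc k)
    let ?I = "b ` {..<Suc k}"
    have Ic: "?I \<subseteq> carrier R" using sub[OF Suc.prems(2)] .
    have bk: "b k \<in> ?I" by auto
    have "c \<in> simple_extension (pring K b k) (b k)"
      using Suc.prems pring_Suc[OF K, of k b] bc by simp
    thus ?case
    proof (induction rule: simple_extension.induct)
      case zero
      have "\<zero> \<in> K" using subringE(2)[OF K] .
      thus ?case using indexed_const_poly(2)[OF zero_closed] by (intro bexI[of _ "indexed_const \<zero>"]) (auto intro: indexed_pset.indexed_const)
    next
      case (lin k1 k2)
      obtain P1 where P1: "P1 \<in> indexed_pset ?I K" "tautological_eval P1 = k1" using lin.IH by blast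
      obtain P2 where P2: "P2 \<in> indexed_pset (b ` {..<k}) K" "tautological_eval P2 = k2"
        using Suc.IH[OF lin.hyps(2)] Suc.prems(2) by auto
      have P2': "P2 \<in> indexed_pset ?I K" by (rule indexed_pset_mono[OF P2(1)]) auto
      note p = indexed_pset_poly[OF P1(1) Kc Ic] indexed_pset_poly[OF P2' Kc Ic]
      note m = indexed_pmult_poly[OF p(1) bk Ic]
      have "tautological_eval (indexed_padd (indexed_pmult P1 (b k)) P2) = k1 \<otimes> b k \<oplus> k2"
        using indexed_padd_poly(2)[OF m(1) p(2) Ic] m(2) P1(2) P2(2) by simp
      thus ?case using P1(1) P2' bk by (intro bexI[of _ "indexed_padd (indexed_pmult P1 (b k)) P2"]) (auto intro: indexed_pset.intros)
    qed
  qed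
  let ?C = "pring K b i" and ?I = "b ` {..<Suc i}"
  have Ic: "?I \<subseteq> carrier R" using sub[of "Suc i"] i by simp
  have xI: "b i \<in> ?I" by auto
  \<comment> \<open>Injectivity of \<open>b\<close> makes \<open>b i\<close> a variable that does
    not occur in the polynomials chosen for the coefficients, so exponents of \<open>b i\<close>
    come from powers of the univariate variable alone.\<close>
  have new: "b i \<notin> b ` {..<i}" using inj_onD[OF b(1), of i] i by force
  have list: "\<exists>P\<in>indexed_pset ?I K. tautological_eval P = eval p (b i) \<and> (\<forall>m. P m \<noteq> \<zero> \<longrightarrow> count m (b i) < length p) \<and>
      (p \<noteq> [] \<longrightarrow> lead_coeff p \<noteq> \<zero> \<longrightarrow> P \<noteq> (\<lambda>_. \<zero>))" if "set p \<subseteq> ?C" for p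
    using that
  proof (induction p)
    case Nil
    have "indexed_const \<zero> \<in> indexed_pset ?I K"
      by (rule indexed_pset.indexed_const[OF subringE(2)[OF K]])
    moreover have "\<forall>m. indexed_const \<zero> m = \<zero>" by (simp add: indexed_const_def)
    ultimately show ?case using indexed_const_poly(2)[OF zero_closed]
      by (intro bexI[of _ "indexed_const \<zero>"]) simp_all
  next
    case (Cons a p)
    obtain P where P: "P \<in> indexed_pset ?I K" "tautological_eval P = eval p (b i)" "\<And>m. P m \<noteq> \<zero> \<Longrightarrow> count m (b i) < length p"
      using Cons by auto
    obtain Q where Q: "Q \<in> indexed_pset (b ` {..<i}) K" "tautological_eval Q = a" using ex[of a i] Cons.prems i by auto
    have Q': "Q \<in> indexed_pset ?I K" by (rule indexed_pset_mono[OF Q(1)]) auto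
    have "index_poly (b ` {..<i}) Q" using indexed_pset_poly[OF Q(1) Kc] sub[of i] i by simp
    hence Qf: "\<And>m. Q m \<noteq> \<zero> \<Longrightarrow> b i \<notin># m" using new by (auto simp: index_poly_def)
    let ?n = "length p"
    let ?Q = "pmult_pow Q (b i) ?n"
    note pw = pmult_pow_properties[OF Q' Kc Ic xI, of ?n]
    note ip = indexed_pset_poly[OF pw(1) Kc Ic] indexed_pset_poly[OF P(1) Kc Ic]
    show ?case
    proof (rule bexI[of _ "indexed_padd ?Q P"], intro conjI impI allI)
      show "indexed_padd ?Q P \<in> indexed_pset ?I K" using pw(1) P(1) by (rule indexed_pset.indexed_padd)
      show "tautological_eval (indexed_padd ?Q P) = eval (a # p) (b i)"
        using indexed_padd_poly(2)[OF ip Ic] pw(2) P(2) Q(2) by simp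
      fix m assume "indexed_padd ?Q P m \<noteq> \<zero>"
      hence "?Q m \<noteq> \<zero> \<or> P m \<noteq> \<zero>" by (auto simp: indexed_padd_def)
      thus "count m (b i) < length (a # p)" using pw(4)[OF Qf, of m] P(3)[of m] by auto
    next
      assume "lead_coeff (a # p) \<noteq> \<zero>"
      hence "tautological_eval Q \<noteq> \<zero>" using Q(2) by simp
      moreover have "tautological_eval (\<lambda>_. \<zero>) = \<zero>" by (simp add: tautological_eval_def)
      ultimately have "Q \<noteq> (\<lambda>_. \<zero>)" by metis
      then obtain m where m: "Q m \<noteq> \<zero>" by auto
      let ?m = "m + replicate_mset ?n (b i)"
      have "count m (b i) = 0" using Qf[OF m] by (simp add: not_in_iff)
      hence "P ?m = \<zero>" using P(3)[of ?m] by auto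
      moreover have "Q m \<in> carrier R" using indexed_pset_poly[OF Q' Kc Ic] by (simp add: index_poly_def)
      ultimately have "indexed_padd ?Q P ?m \<noteq> \<zero>" using m by (simp add: indexed_padd_def pw(3))
      thus "indexed_padd ?Q P \<noteq> (\<lambda>_. \<zero>)" by metis
    qed
  qed
  show "(transcendental over ?C) (b i)"
  proof (rule transcendentalI)
    show "subring ?C R" using Kc bc i by (intro pring_subring) auto
    show "b i \<in> carrier R" using bc[OF i] .
    fix p assume p: "p \<in> carrier (?C[X])" and z: "eval p (b i) = \<zero>"
    show "p = []"
    proof (rule ccontr)
      assume ne: "p \<noteq> []"
      have pC: "set p \<subseteq> ?C" and lc: "lead_coeff p \<noteq> \<zero>" using p ne by (auto simp: univ_poly_def polynomial_def)
      obtain P where P: "P \<in> indexed_pset ?I K" "tautological_eval P = \<zero>" "P \<noteq> (\<lambda>_. \<zero>)"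
        using list[OF pC] ne lc z by auto
      have "?I \<subseteq> B" using b(2) i by auto
      hence "P \<in> indexed_pset B K" by (rule indexed_pset_mono[OF P(1)])
      thus False using B(2) P by (auto simp: algebraically_independent_def)
    qed
  qed
qed

section \<open>Length of the quotients by differential powers\<close>

lemma scalars_hom:
  assumes "algebra K R"
  shows "(\<lambda>c. c \<odot>\<^bsub>R\<^esub> \<one>\<^bsub>R\<^esub>) \<in> ring_hom K R"
proof -
  interpret algebra K R by fact
  show ?thesis
  proof (rule ring_hom_memI)
    fix a b assume a: "a \<in> carrier K" and b: "b \<in> carrier K"
    show "(a \<otimes>\<^bsub>K\<^esub> b) \<odot>\<^bsub>R\<^esub> \<one>\<^bsub>R\<^esub> = (a \<odot>\<^bsub>R\<^esub> \<one>\<^bsub>R\<^esub>) \<otimes>\<^bsub>R\<^esub> (b \<odot>\<^bsub>R\<^esub> \<one>\<^bsub>R\<^esub>)"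
      using a b by (simp add: smult_assoc1 smult_assoc2)
  qed (simp_all add: smult_l_distr)
qed

lemma smult_as_scalar:
  assumes "algebra K R" "c \<in> carrier K" "x \<in> carrier R"
  shows "c \<odot>\<^bsub>R\<^esub> x = (c \<odot>\<^bsub>R\<^esub> \<one>\<^bsub>R\<^esub>) \<otimes>\<^bsub>R\<^esub> x"
proof -
  interpret algebra K R by fact
  show ?thesis using assms(2,3) by (simp add: smult_assoc2)
qed

lemma mod_hom_lin:
  assumes "algebra K R"
  shows "mod_hom K R R = ring.lin R (scalars K R)"
proof -
  interpret B: cring R by (rule algebra.M_cring) fact
  interpret algebra K R by fact
  have "(\<forall>r\<in>carrier K. \<forall>x\<in>carrier R. f (r \<odot>\<^bsub>R\<^esub> x) = r \<odot>\<^bsub>R\<^esub> f x) \<longleftrightarrow>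
      (\<forall>s\<in>scalars K R. \<forall>x\<in>carrier R. f (s \<otimes>\<^bsub>R\<^esub> x) = s \<otimes>\<^bsub>R\<^esub> f x)" if "f \<in> carrier R \<rightarrow> carrier R" for f
    unfolding scalars_def using that by (simp add: smult_as_scalar[OF assms, symmetric] Pi_iff)
  thus ?thesis unfolding mod_hom_def B.lin_def by blast
qed

lemma diff_op_dop:
  assumes "algebra K R"
  shows "diff_op K R n = ring.dop R (scalars K R) n"
proof -
  interpret B: cring R by (rule algebra.M_cring) fact
  interpret algebra K R by fact
  show ?thesis
  proof (induction n)
    case 0
    show ?case unfolding diff_op.simps B.dop.simps
      by (auto simp: mod_hom_def regular_module_def B.lin_def)
  next
    case (Suc n)
    thus ?case by (simp add: mod_hom_lin[OF assms] B.com_def)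
  qed
qed

lemma quotient_image: "(\<lambda>x. I +>\<^bsub>R\<^esub> x) ` carrier R = carrier (R Quot I)"
  by (auto simp: FactRing_def A_RCOSETS_def')

lemma (in ideal) coset_eq_zero_iff: "x \<in> carrier R \<Longrightarrow> I +> x = \<zero>\<^bsub>R Quot I\<^esub> \<longleftrightarrow> x \<in> I"
  using rcos_const_imp_mem a_rcos_const by (auto simp: FactRing_def)

lemma submodule_preimage_closed:
  assumes J: "ideal J R" and N: "submodule N R (quotient_module R J)"
    and uv: "u \<in> carrier R" "J +>\<^bsub>R\<^esub> u \<in> N" "v \<in> carrier R" "J +>\<^bsub>R\<^esub> v \<in> N" and r: "r \<in> carrier R"
  shows "J +>\<^bsub>R\<^esub> (u \<oplus>\<^bsub>R\<^esub> r \<otimes>\<^bsub>R\<^esub> v) \<in> N"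
proof -
  interpret J: ideal J R by fact
  interpret N: submodule N R "quotient_module R J" by fact
  have h: "(\<lambda>x. J +>\<^bsub>R\<^esub> x) \<in> ring_hom R (R Quot J)" using J.rcos_ring_hom .
  have "r \<odot>\<^bsub>quotient_module R J\<^esub> (J +>\<^bsub>R\<^esub> v) \<in> N" using N.smult_closed[OF r uv(4)] .
  hence "J +>\<^bsub>R\<^esub> (r \<otimes>\<^bsub>R\<^esub> v) \<in> N"
    using ring_hom_mult[OF h r uv(3)] by (simp add: quotient_module_def)
  hence "(J +>\<^bsub>R\<^esub> u) \<oplus>\<^bsub>quotient_module R J\<^esub> (J +>\<^bsub>R\<^esub> (r \<otimes>\<^bsub>R\<^esub> v)) \<in> N"
    using N.m_closed[OF uv(2)] by simp
  thus ?thesis using ring_hom_add[OF h uv(1), of "r \<otimes>\<^bsub>R\<^esub> v"] r uv(3) by (simp add: quotient_module_def)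
qed

lemma submodule_zero:
  assumes J: "ideal J R" and N: "submodule N R (quotient_module R J)" and "x \<in> J"
  shows "J +>\<^bsub>R\<^esub> x \<in> N"
proof -
  interpret J: ideal J R by fact
  interpret N: submodule N R "quotient_module R J" by fact
  have "J +>\<^bsub>R\<^esub> x = J" using J.a_rcos_const[OF assms(3)] .
  thus ?thesis using N.one_closed by (simp add: quotient_module_def FactRing_def)
qed

lemma submodule_carrier:
  assumes "submodule N R (quotient_module R J)"
  shows "N \<subseteq> carrier (R Quot J)"
proof -
  interpret N: submodule N R "quotient_module R J" by fact
  show ?thesis using N.subset by (simp add: quotient_module_def)
qed

text \<open>Preimages turn a chain of submodules of the quotient into a chain of submodules of the
  ring that starts above the common zeros of the operators, and the operator count applies to this
  chain. Strictness survives because every coset has a representative.\<close>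

lemma (in domain) module_length_bound:
  fixes S (structure)
  assumes S: "field S" and h: "h \<in> ring_hom R S" "h ` carrier R = carrier S"
    and A: "subring A R"
    and sep: "\<And>a. a \<in> carrier R \<Longrightarrow> \<exists>p. set p \<subseteq> A \<and> h (eval p a) = \<zero>\<^bsub>S\<^esub> \<and> h (dv p a) \<noteq> \<zero>\<^bsub>S\<^esub>"
    and x: "\<And>i. i < q \<Longrightarrow> x i \<in> carrier R"
    and der: "\<And>d y. d \<in> der A \<Longrightarrow> (\<And>i. i < (q::nat) \<Longrightarrow> d (x i) = \<zero>\<^bsub>R\<^esub>) \<Longrightarrow> y \<in> carrier R \<Longrightarrow> d y = \<zero>\<^bsub>R\<^esub>"
  shows "module_length R (quotient_module R {f \<in> carrier R. \<forall>\<delta>\<in>dop A n. h (\<delta> f) = \<zero>\<^bsub>S\<^esub>})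
      \<le> enat ((n + q) choose q)"
proof -
  interpret S: field S by fact
  interpret h: ring_hom_cring R S h by unfold_locales fact
  have Ac: "A \<subseteq> carrier R" using subringE(1)[OF A] .
  have lin: "\<delta> \<in> lin A" if "\<delta> \<in> dop A n" for \<delta> using dop_lin[OF that Ac] .
  define J where "J = {f \<in> carrier R. \<forall>\<delta>\<in>dop A n. h (\<delta> f) = \<zero>\<^bsub>S\<^esub>}"
  have JR: "J \<subseteq> carrier R" by (auto simp: J_def)
  have Jl: "r \<otimes>\<^bsub>R\<^esub> f \<in> J" if f: "f \<in> J" and r: "r \<in> carrier R" for f r
  proof -
    have "h (\<delta> (r \<otimes>\<^bsub>R\<^esub> f)) = \<zero>\<^bsub>S\<^esub>" if "\<delta> \<in> dop A n" for \<delta>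
      using f dop_mult_right[OF that Ac r] by (auto simp: J_def)
    thus ?thesis using f r by (simp add: J_def)
  qed
  have J: "ideal J R"
  proof (rule idealI)
    show "subgroup J (add_monoid R)"
    proof (rule add.subgroupI)
      have "h (\<delta> \<zero>\<^bsub>R\<^esub>) = \<zero>\<^bsub>S\<^esub>" if "\<delta> \<in> dop A n" for \<delta> by (simp add: lin_zero[OF lin[OF that]])
      thus "J \<noteq> {}" unfolding J_def by blast
      fix a b assume a: "a \<in> J" and b: "b \<in> J"
      have "\<ominus>\<^bsub>R\<^esub> a = (\<ominus>\<^bsub>R\<^esub> \<one>\<^bsub>R\<^esub>) \<otimes>\<^bsub>R\<^esub> a" using a JR by (auto simp: l_minus)
      thus "\<ominus>\<^bsub>R\<^esub> a \<in> J" using Jl[OF a, of "\<ominus>\<^bsub>R\<^esub> \<one>\<^bsub>R\<^esub>"] by simp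
      have "h (\<delta> (a \<oplus>\<^bsub>R\<^esub> b)) = \<zero>\<^bsub>S\<^esub>" if "\<delta> \<in> dop A n" for \<delta>
        using linD(2)[OF lin[OF that], of a b] linD(1)[OF lin[OF that]] a b that by (simp add: J_def)
      thus "a \<oplus>\<^bsub>R\<^esub> b \<in> J" using a b by (simp add: J_def)
    qed (use JR in auto)
    fix a r assume a: "a \<in> J" and r: "r \<in> carrier R"
    show "r \<otimes>\<^bsub>R\<^esub> a \<in> J" using Jl[OF a r] .
    thus "a \<otimes>\<^bsub>R\<^esub> r \<in> J" using a r JR m_comm[of a r] by auto
  qed (rule ring_axioms)
  have "N \<le> (n + q) choose q"
    if M: "\<forall>i\<le>N. submodule (M i) R (quotient_module R J)" "\<forall>i<N. M i \<subset> M (Suc i)" for N M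
  proof (rule operator_chain_bound[OF domain_axioms S h A sep,
        where x = x and I = "\<lambda>i. {f \<in> carrier R. J +>\<^bsub>R\<^esub> f \<in> M i}" and n = n])
    fix i u v r assume "i \<le> N" "u \<in> {f \<in> carrier R. J +>\<^bsub>R\<^esub> f \<in> M i}" "v \<in> {f \<in> carrier R. J +>\<^bsub>R\<^esub> f \<in> M i}" "r \<in> carrier R"
    thus "u \<oplus>\<^bsub>R\<^esub> r \<otimes>\<^bsub>R\<^esub> v \<in> {f \<in> carrier R. J +>\<^bsub>R\<^esub> f \<in> M i}"
      using submodule_preimage_closed[OF J, of "M i" u v r] M(1) by simp
  next
    fix i assume i: "i < N"
    then obtain c where c: "c \<in> M (Suc i)" "c \<notin> M i" using M(2) by blast
    have "c \<in> carrier (R Quot J)" using c(1) submodule_carrier M(1) i by (meson Suc_leI subsetD)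
    then obtain f where "f \<in> carrier R" "c = J +>\<^bsub>R\<^esub> f" by (auto simp flip: quotient_image)
    thus "{f \<in> carrier R. J +>\<^bsub>R\<^esub> f \<in> M i} \<subset> {f \<in> carrier R. J +>\<^bsub>R\<^esub> f \<in> M (Suc i)}"
      using c M(2) i by blast
  next
    fix d y assume "d \<in> der A" "\<And>i. i < q \<Longrightarrow> d (x i) = \<zero>\<^bsub>R\<^esub>" "y \<in> carrier R"
    thus "d y = \<zero>\<^bsub>R\<^esub>" by (rule der)
  next
    show "{f \<in> carrier R. \<forall>\<delta>\<in>dop A n. h (\<delta> f) = \<zero>\<^bsub>S\<^esub>} \<subseteq> {f \<in> carrier R. J +>\<^bsub>R\<^esub> f \<in> M 0}"
      unfolding J_def[symmetric] using submodule_zero[OF J, of "M 0"] M(1) JR by auto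
  qed (auto intro: x)
  thus ?thesis
    unfolding module_length_def J_def[symmetric] by (intro Sup_least) auto
qed

section \<open>Generators of the algebra and the final estimate\<close>

lemma fin_gen_image:
  assumes "fin_gen_algebra K A" "f \<in> mod_hom K A R" "f \<in> ring_hom A R" "cring R"
  shows "\<exists>T. finite T \<and> T \<subseteq> carrier R \<and> f ` carrier A = generate_ring R (scalars K R \<union> T)"
proof -
  obtain T where A: "algebra K A" and T: "finite T" "T \<subseteq> carrier A" "carrier A = generate_ring A (scalars K A \<union> T)"
    using assms(1) by (auto simp: fin_gen_algebra_def)
  interpret B: cring A by (rule algebra.M_cring) fact
  interpret A: algebra K A by fact
  interpret R: cring R by fact
  interpret f: ring_hom_ring A R f using B.ring_axioms R.ring_axioms assms(3) by (rule ring_hom_ringI2)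
  have "f ` scalars K A = scalars K R"
  proof -
    have "f (c \<odot>\<^bsub>A\<^esub> \<one>\<^bsub>A\<^esub>) = c \<odot>\<^bsub>R\<^esub> \<one>\<^bsub>R\<^esub>" if "c \<in> carrier K" for c
      using assms(2) that by (simp add: mod_hom_def)
    thus ?thesis unfolding scalars_def image_image by (rule image_cong[OF refl])
  qed
  moreover have "scalars K A \<subseteq> carrier A" by (auto simp: scalars_def)
  ultimately have "f ` carrier A = generate_ring R (scalars K R \<union> f ` T)"
    using f.generate_ring_image[of "scalars K A \<union> T"] T by (simp add: image_Un)
  moreover have "f ` T \<subseteq> carrier R" using T(2) by auto
  ultimately show ?thesis using T(1) by (intro exI[of _ "f ` T"]) simp
qed

text \<open>This puts the graded and the local case on the same footing. In the graded case the
  denominator one suffices; in the local case the denominators are units of \<open>R\<close> and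
  thus lie outside \<open>\<mm>\<close>.\<close>

lemma pseudocoefficient_generators:
  assumes "pseudocoefficient_algebra K R \<mm>"
  shows "maximalideal \<mm> R" and "\<exists>T. finite T \<and> T \<subseteq> carrier R \<and> (\<forall>b\<in>carrier R.
      \<exists>a\<in>generate_ring R (scalars K R \<union> T). \<exists>s\<in>generate_ring R (scalars K R \<union> T) - \<mm>. b \<otimes>\<^bsub>R\<^esub> s = a)"
proof -
  have R: "algebra K R" and c: "graded_case K R \<mm> \<or> local_case K R \<mm>"
    using assms by (auto simp: pseudocoefficient_algebra_def)
  interpret B: cring R by (rule algebra.M_cring) fact
  interpret algebra K R by fact
  show m: "maximalideal \<mm> R" using c by (auto simp: graded_case_def local_case_def)
  interpret m: maximalideal \<mm> R by fact
  have one: "u \<notin> \<mm>" if u: "u \<in> Units R" for u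
  proof
    assume um: "u \<in> \<mm>"
    have "inv\<^bsub>R\<^esub> u \<otimes>\<^bsub>R\<^esub> u \<in> \<mm>" by (rule m.I_l_closed[OF um]) (use u in simp)
    hence "\<one>\<^bsub>R\<^esub> \<in> \<mm>" using u by simp
    thus False using m.one_imp_carrier m.I_notcarr by simp
  qed
  from c show "\<exists>T. finite T \<and> T \<subseteq> carrier R \<and> (\<forall>b\<in>carrier R.
      \<exists>a\<in>generate_ring R (scalars K R \<union> T). \<exists>s\<in>generate_ring R (scalars K R \<union> T) - \<mm>. b \<otimes>\<^bsub>R\<^esub> s = a)"
  proof
    assume "graded_case K R \<mm>"
    then obtain T where T: "finite T" "T \<subseteq> carrier R" "carrier R = generate_ring R (scalars K R \<union> T)"
      by (auto simp: graded_case_def fin_gen_algebra_def)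
    have "\<exists>a\<in>carrier R. \<exists>s\<in>carrier R - \<mm>. b \<otimes>\<^bsub>R\<^esub> s = a" if "b \<in> carrier R" for b
      using that one[OF B.Units_one_closed] by (intro bexI[of _ b] bexI[of _ "\<one>\<^bsub>R\<^esub>"]) auto
    thus ?thesis using T by metis
  next
    assume "local_case K R \<mm>"
    then obtain A :: "('a, 'c) module" and S f where A: "fin_gen_algebra K A" "is_localization A S R f" "f \<in> mod_hom K A R"
      by (auto simp: local_case_def ess_finite_type_def)
    have f: "f \<in> ring_hom A R" "f ` S \<subseteq> Units R" "submonoid S A"
      "\<And>b. b \<in> carrier R \<Longrightarrow> \<exists>a\<in>carrier A. \<exists>s\<in>S. b \<otimes>\<^bsub>R\<^esub> f s = f a"
      using A(2) by (auto simp: is_localization_def)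
    obtain T where T: "finite T" "T \<subseteq> carrier R" "f ` carrier A = generate_ring R (scalars K R \<union> T)"
      using fin_gen_image[OF A(1,3) f(1) B.is_cring] by blast
    have SA: "S \<subseteq> carrier A" using submonoid.subset[OF f(3)] .
    have "\<exists>a\<in>f ` carrier A. \<exists>s\<in>f ` carrier A - \<mm>. b \<otimes>\<^bsub>R\<^esub> s = a" if "b \<in> carrier R" for b
      using f(4)[OF that] f(2) SA one by blast
    thus ?thesis using T by metis
  qed
qed

text \<open>From \<open>((m + d) choose d) * fact d \<le> (m + d) ^ d\<close> with
  \<open>n = Suc m\<close> the quotient is at most \<open>(1 + d / n) ^ d\<close>, which tends to
  one. The shift of the index reflects that operators of order at most \<open>n\<close> define the
  differential power of index \<open>Suc n\<close>.\<close>

lemma limsup_binomial_le_1: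
  assumes L: "\<And>n. L (Suc n) \<le> enat ((n + d) choose d)"
  shows "limsup (\<lambda>n. ereal_of_enat (L n) / ereal (real n ^ d / fact d)) \<le> 1"
proof -
  have "ereal_of_enat (L n) / ereal (real n ^ d / fact d) \<le> ereal ((1 + real d / real n) ^ d)" if n: "n \<ge> 1" for n
  proof -
    obtain m where m: "n = Suc m" using n by (cases n) auto
    have pos: "0 < real n ^ d / fact d" using n by simp
    have "real ((m + d) choose d) * fact d = real (((m + d) choose d) * fact d)" by simp
    also have "\<dots> \<le> real ((m + d) ^ d)" using binomial_fact_pow[of "m + d" d] of_nat_le_iff by blast
    also have "\<dots> \<le> (real n + real d) ^ d" using m by (simp add: power_mono)
    finally have le: "real ((m + d) choose d) \<le> (real n + real d) ^ d / fact d" by (simp add: field_simps)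
    have "ereal_of_enat (L n) \<le> ereal_of_enat (enat ((m + d) choose d))"
      using L[of m] m by (simp only: ereal_of_enat_le_iff)
    also have "\<dots> \<le> ereal ((real n + real d) ^ d / fact d)" using le by simp
    finally have "ereal_of_enat (L n) / ereal (real n ^ d / fact d) \<le>
        ereal ((real n + real d) ^ d / fact d) / ereal (real n ^ d / fact d)"
      using pos by (intro ereal_divide_right_mono) auto
    also have "\<dots> = ereal (((real n + real d) ^ d / fact d) / (real n ^ d / fact d))" using pos n by simp
    also have "((real n + real d) ^ d / fact d) / (real n ^ d / fact d) = ((real n + real d) / real n) ^ d"
      by (simp add: power_divide)
    also have "(real n + real d) / real n = 1 + real d / real n" using n by (simp add: field_simps)
    finally show ?thesis .
  qed
  hence "limsup (\<lambda>n. ereal_of_enat (L n) / ereal (real n ^ d / fact d)) \<le>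
      limsup (\<lambda>n. ereal ((1 + real d / real n) ^ d))"
    by (intro Limsup_mono eventually_sequentiallyI[of 1]) auto
  also have "limsup (\<lambda>n. ereal ((1 + real d / real n) ^ d)) = ereal 1"
  proof (rule lim_imp_Limsup)
    have "(\<lambda>n. (1 + real d / real n) ^ d) \<longlonglongrightarrow> (1 + 0) ^ d"
      by (intro tendsto_intros lim_const_over_n)
    thus "(\<lambda>n. ereal ((1 + real d / real n) ^ d)) \<longlonglongrightarrow> ereal 1" by simp
  qed simp
  finally show ?thesis by (simp add: one_ereal_def)
qed

lemma (in cring) eval_in_power_span:
  assumes A: "subring A R" and p: "set p \<subseteq> A" and t: "t \<in> carrier R"
  shows "eval p t \<in> lspan A ((\<lambda>j::nat. t [^] j) ` {..<length p})"
  using p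
proof (induction p)
  case (Cons a p)
  let ?V = "\<lambda>n. (\<lambda>j::nat. t [^] j) ` {..<n::nat}"
  have V: "?V n \<subseteq> carrier R" for n using t by auto
  have Ac: "A \<subseteq> carrier R" using subringE(1)[OF A] .
  have "eval p t \<in> lspan A (?V (length p))" using Cons by simp
  moreover have "lspan A (?V (length p)) \<subseteq> lspan A (?V (length (a # p)))"
    by (rule lspan_mono) auto
  ultimately have "eval p t \<in> lspan A (?V (length (a # p)))" by blast
  moreover have "a \<otimes> t [^] length p \<in> lspan A (?V (length (a # p)))"
    using Cons.prems by (intro lspan_smult_closed[OF A V] lspan_incl[OF A V]) auto
  ultimately show ?case using lspan_add_closed[OF Ac V] by simp
qed (simp add: lspan.intros)

lemma krull_dim_eq:
  assumes "\<exists>Q. (\<forall>i\<le>d. primeideal (Q i) R) \<and> (\<forall>i<d. Q i \<subset> Q (Suc i))"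
    and "\<And>n Q. (\<forall>i\<le>n. primeideal (Q i) R) \<and> (\<forall>i<n. Q i \<subset> Q (Suc i)) \<Longrightarrow> n \<le> d"
  shows "krull_dim R = enat d"
proof (rule antisym)
  show "krull_dim R \<le> enat d" unfolding krull_dim_def using assms(2) by (intro Sup_least) auto
  show "enat d \<le> krull_dim R" unfolding krull_dim_def using assms(1) by (intro Sup_upper) blast
qed

lemma (in field) algebraically_independent_finite:
  assumes K: "subring K R" and B: "B \<subseteq> carrier R" "algebraically_independent K B"
    and bound: "\<And>e b. \<forall>i<e. b i \<in> carrier R \<Longrightarrow> alg_indep K b e \<Longrightarrow> e \<le> d"
  shows "finite B" "card B \<le> d"
proof -
  have c: "card C \<le> d" if C: "finite C" "C \<subseteq> B" for C
  proof -
    obtain b where "bij_betw b {..<card C} C" using ex_bij_betw_nat_finite[OF C(1)] by (auto simp: atLeast0LessThan)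
    hence b: "inj_on b {..<card C}" "b ` {..<card C} = C" by (auto simp: bij_betw_def)
    show ?thesis
    proof (rule bound[of _ b])
      show "\<forall>i<card C. b i \<in> carrier R" using b(2) C(2) B(1) by blast
      show "alg_indep K b (card C)" using b C(2) by (intro algebraically_independent_alg_indep[OF K B]) auto
    qed
  qed
  show f: "finite B"
  proof (rule ccontr)
    assume "infinite B"
    then obtain C where "finite C" "card C = Suc d" "C \<subseteq> B" using infinite_arbitrarily_large by blast
    thus False using c[of C] by simp
  qed
  show "card B \<le> d" using c[OF f] by simp
qed

theorem proposition4p23:
  fixes K :: "('k, 'x) ring_scheme"
    and R :: "('k, 'a, 'y) module_scheme"
    and \<mm> :: "'a set"
    and F :: "('f, 'z) ring_scheme"
    and \<iota> :: "'a \<Rightarrow> 'f"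
  assumes "pseudocoefficient_algebra K R \<mm>"
    and "domain R"
    and "is_fraction_field R F \<iota>"
    and "ring.separable_extension F (\<iota> ` scalars K R) (carrier F)"
  shows "diff_signature K R \<mm> \<le> 1"
proof -
  have alg: "algebra K R" and K: "field K" using assms(1) by (auto simp: pseudocoefficient_algebra_def)
  have m: "maximalideal \<mm> R" using pseudocoefficient_generators(1)[OF assms(1)] .
  interpret K: field K by fact
  interpret R: domain R by fact
  interpret m: maximalideal \<mm> R by fact
  have F: "field F" and \<iota>: "\<iota> \<in> ring_hom R F"
    and \<iota>u: "\<iota> ` (carrier R - {\<zero>\<^bsub>R\<^esub>}) \<subseteq> Units F"
    and \<iota>f: "\<And>y. y \<in> carrier F \<Longrightarrow> \<exists>a\<in>carrier R. \<exists>s\<in>carrier R - {\<zero>\<^bsub>R\<^esub>}. y \<otimes>\<^bsub>F\<^esub> \<iota> s = \<iota> a"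
    using assms(3) by (auto simp: is_fraction_field_def is_localization_def)
  interpret F: field F by fact
  interpret \<iota>r: ring_hom_ring R F \<iota> by (rule ring_hom_ringI2[OF R.ring_axioms F.ring_axioms \<iota>])
  interpret \<iota>: ring_hom_cring R F \<iota> by unfold_locales fact
  let ?Q = "R Quot \<mm>" and ?h = "\<lambda>x. \<mm> +>\<^bsub>R\<^esub> x"
  have Q: "field ?Q" using m.quotient_is_field[OF R.is_cring] .
  interpret Q: field ?Q by fact
  have h: "?h \<in> ring_hom R ?Q" using m.rcos_ring_hom .
  interpret hr: ring_hom_ring R ?Q ?h by (rule ring_hom_ringI2[OF R.ring_axioms Q.ring_axioms h])
  interpret h: ring_hom_cring R ?Q ?h by unfold_locales fact
  have hQ: "?h ` carrier R = carrier ?Q" using quotient_image .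
  have hm: "?h x = \<zero>\<^bsub>?Q\<^esub> \<longleftrightarrow> x \<in> \<mm>" if "x \<in> carrier R" for x using m.coset_eq_zero_iff[OF that] .

  have \<iota>0: "\<iota> s \<noteq> \<zero>\<^bsub>F\<^esub>" if "s \<in> carrier R" "s \<noteq> \<zero>\<^bsub>R\<^esub>" for s
    using \<iota>u that F.field_Units by blast
  have inj: "inj_on \<iota> (carrier R)"
  proof (rule inj_onI)
    fix a b assume a: "a \<in> carrier R" and b: "b \<in> carrier R" and eq: "\<iota> a = \<iota> b"
    have "\<iota> (a \<ominus>\<^bsub>R\<^esub> b) = \<zero>\<^bsub>F\<^esub>" using a b eq by (simp add: R.minus_eq F.r_neg)
    hence "a \<ominus>\<^bsub>R\<^esub> b = \<zero>\<^bsub>R\<^esub>" using \<iota>0[of "a \<ominus>\<^bsub>R\<^esub> b"] a b by auto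
    thus "a = b" using a b by simp
  qed
  have fr: "\<exists>a\<in>carrier R. \<exists>s\<in>carrier R. \<iota> s \<noteq> \<zero>\<^bsub>F\<^esub> \<and> \<iota> a = y \<otimes>\<^bsub>F\<^esub> \<iota> s" if "y \<in> carrier F" for y
    using \<iota>f[OF that] \<iota>0 by (metis Diff_iff insertI1)
  have fracs: "carrier F \<subseteq> F.fracs (\<iota> ` carrier R)"
  proof
    fix y assume y: "y \<in> carrier F"
    then obtain a s where as: "a \<in> carrier R" "s \<in> carrier R" "\<iota> s \<noteq> \<zero>\<^bsub>F\<^esub>" "\<iota> a = y \<otimes>\<^bsub>F\<^esub> \<iota> s" using fr by blast
    show "y \<in> F.fracs (\<iota> ` carrier R)"
      by (rule F.fracsI[of _ "\<iota> s"]) (use as y in \<open>auto simp: F.m_comm[of "\<iota> s"] simp flip: as(4)\<close>)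
  qed

  define A where "A = scalars K R"
  have Adef: "A = (\<lambda>c. c \<odot>\<^bsub>R\<^esub> \<one>\<^bsub>R\<^esub>) ` carrier K" by (simp add: A_def scalars_def)
  interpret \<phi>: ring_hom_ring K R "\<lambda>c. c \<odot>\<^bsub>R\<^esub> \<one>\<^bsub>R\<^esub>"
    by (rule ring_hom_ringI2[OF K.ring_axioms R.ring_axioms scalars_hom[OF alg]])
  have Asf: "subfield A R" unfolding Adef using \<phi>.img_is_subfield(2)[OF K.carrier_is_subfield] by simp
  have A: "subring A R" using subfieldE(1)[OF Asf] .
  have Ac: "A \<subseteq> carrier R" using subringE(1)[OF A] .
  have A1: "\<one>\<^bsub>R\<^esub> \<in> A" using subringE(3)[OF A] .
  have \<iota>A: "subfield (\<iota> ` A) F" using \<iota>r.img_is_subfield(2)[OF Asf] by simp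
  have hA: "subfield (?h ` A) ?Q" using hr.img_is_subfield(2)[OF Asf] by simp

  \<comment> \<open>Separability of the residue field, pulled back to \<open>R\<close>: the
    coefficients are lifted to scalars, and the value of the polynomial is zero only modulo
    \<open>\<mm>\<close>. The relation serves both for Newton's method and for the generators in the
    dimension bound.\<close>
  have rel: "\<exists>p. set p \<subseteq> A \<and> ?h (a [^]\<^bsub>R\<^esub> length p \<oplus>\<^bsub>R\<^esub> R.eval p a) = \<zero>\<^bsub>?Q\<^esub> \<and>
      ?h (R.dv (\<one>\<^bsub>R\<^esub> # p) a) \<noteq> \<zero>\<^bsub>?Q\<^esub>" if a: "a \<in> carrier R" for a
  proof -
    have ha: "?h a \<in> carrier ?Q" using a hQ by blast
    have "Q.separable_over (?h ` A) (?h a)"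
      using assms(1) ha by (simp add: pseudocoefficient_algebra_def Q.finite_separable_extension_def A_def)
    then obtain p' where p': "set p' \<subseteq> ?h ` A" "?h a [^]\<^bsub>?Q\<^esub> length p' \<oplus>\<^bsub>?Q\<^esub> Q.eval p' (?h a) = \<zero>\<^bsub>?Q\<^esub>"
      "Q.dv (\<one>\<^bsub>?Q\<^esub> # p') (?h a) \<noteq> \<zero>\<^bsub>?Q\<^esub>"
      using Q.separable_over_relation[OF hA ha] by blast
    have "p' \<in> map ?h ` lists A" using p'(1) unfolding lists_image[symmetric] by (auto simp: lists_eq_set)
    then obtain p where p: "set p \<subseteq> A" "p' = map ?h p" by (auto simp: lists_eq_set)
    have pc: "set p \<subseteq> carrier R" "set (\<one>\<^bsub>R\<^esub> # p) \<subseteq> carrier R" using p(1) Ac by auto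
    have "?h (a [^]\<^bsub>R\<^esub> length p \<oplus>\<^bsub>R\<^esub> R.eval p a) = \<zero>\<^bsub>?Q\<^esub>"
      using p'(2) p(2) hr.eval_dv_image(1)[OF pc(1) a] R.eval_in_carrier[OF pc(1) a] a by (simp add: h.hom_add hr.hom_nat_pow)
    moreover have "?h (R.dv (\<one>\<^bsub>R\<^esub> # p) a) \<noteq> \<zero>\<^bsub>?Q\<^esub>"
      using p'(3) p(2) hr.eval_dv_image(2)[OF pc(2) a] h.hom_one by simp
    ultimately show ?thesis using p(1) by blast
  qed
  have sep: "\<exists>p. set p \<subseteq> A \<and> ?h (R.eval p a) = \<zero>\<^bsub>?Q\<^esub> \<and> ?h (R.dv p a) \<noteq> \<zero>\<^bsub>?Q\<^esub>" if a: "a \<in> carrier R" for a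
  proof -
    obtain p where p: "set p \<subseteq> A" "?h (a [^]\<^bsub>R\<^esub> length p \<oplus>\<^bsub>R\<^esub> R.eval p a) = \<zero>\<^bsub>?Q\<^esub>"
      "?h (R.dv (\<one>\<^bsub>R\<^esub> # p) a) \<noteq> \<zero>\<^bsub>?Q\<^esub>" using rel[OF a] by blast
    thus ?thesis using A1 a by (intro exI[of _ "\<one>\<^bsub>R\<^esub> # p"]) (simp del: R.dv.simps)
  qed

  obtain T where T: "finite T" "T \<subseteq> carrier R" and loc: "\<And>b. b \<in> carrier R \<Longrightarrow>
      \<exists>a\<in>generate_ring R (A \<union> T). \<exists>s\<in>generate_ring R (A \<union> T) - \<mm>. b \<otimes>\<^bsub>R\<^esub> s = a"
    using pseudocoefficient_generators(2)[OF assms(1)] by (auto simp: A_def)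
  have "\<exists>d. (\<exists>Q. (\<forall>i\<le>d. primeideal (Q i) R) \<and> (\<forall>i<d. Q i \<subset> Q (Suc i))) \<and>
    (\<forall>n Q. (\<forall>i\<le>n. primeideal (Q i) R) \<and> (\<forall>i<n. Q i \<subset> Q (Suc i)) \<longrightarrow> n \<le> d) \<and>
    (\<forall>e b. (\<forall>i<e. b i \<in> carrier F) \<and> ring.alg_indep F (\<iota> ` A) b e \<longrightarrow> e \<le> d)"
  proof (rule prime_chain_bounds[OF assms(2) F \<iota> inj fracs Ac \<iota>A T _ loc])
    show "primeideal \<mm> R" using R.maximalideal_prime[OF m] .
    fix t assume "t \<in> T"
    hence t: "t \<in> carrier R" using T by auto
    obtain p where p: "set p \<subseteq> A" "?h (t [^]\<^bsub>R\<^esub> length p \<oplus>\<^bsub>R\<^esub> R.eval p t) = \<zero>\<^bsub>?Q\<^esub>" using rel[OF t] by blast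
    have e: "R.eval p t \<in> carrier R" by (rule R.eval_in_carrier[OF subset_trans[OF p(1) Ac] t])
    have V: "(\<lambda>j. t [^]\<^bsub>R\<^esub> j) ` {..<length p} \<subseteq> carrier R" using t by auto
    have "\<ominus>\<^bsub>R\<^esub> R.eval p t \<in> R.lspan A ((\<lambda>j. t [^]\<^bsub>R\<^esub> j) ` {..<length p})"
      by (rule R.lspan_uminus_closed[OF A V R.eval_in_power_span[OF A p(1) t]])
    moreover have "t [^]\<^bsub>R\<^esub> length p \<ominus>\<^bsub>R\<^esub> (\<ominus>\<^bsub>R\<^esub> R.eval p t) \<in> \<mm>"
      using p(2) hm[of "t [^]\<^bsub>R\<^esub> length p \<oplus>\<^bsub>R\<^esub> R.eval p t"] e t by (simp add: R.minus_eq)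
    ultimately show "\<exists>n::nat. \<exists>y\<in>R.lspan A ((\<lambda>j. t [^]\<^bsub>R\<^esub> j) ` {..<n}). t [^]\<^bsub>R\<^esub> n \<ominus>\<^bsub>R\<^esub> y \<in> \<mm>"
      by (intro exI[of _ "length p"] bexI)
  qed
  then obtain d where D: "(\<exists>Q. (\<forall>i\<le>d. primeideal (Q i) R) \<and> (\<forall>i<d. Q i \<subset> Q (Suc i))) \<and>
    (\<forall>n Q. (\<forall>i\<le>n. primeideal (Q i) R) \<and> (\<forall>i<n. Q i \<subset> Q (Suc i)) \<longrightarrow> n \<le> d) \<and>
    (\<forall>e b. (\<forall>i<e. b i \<in> carrier F) \<and> F.alg_indep (\<iota> ` A) b e \<longrightarrow> e \<le> d)" ..
  have d: "\<exists>Q. (\<forall>i\<le>d. primeideal (Q i) R) \<and> (\<forall>i<d. Q i \<subset> Q (Suc i))"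
    "\<And>n Q. (\<forall>i\<le>n. primeideal (Q i) R) \<and> (\<forall>i<n. Q i \<subset> Q (Suc i)) \<Longrightarrow> n \<le> d"
    "\<And>e b. \<forall>i<e. b i \<in> carrier F \<Longrightarrow> F.alg_indep (\<iota> ` A) b e \<Longrightarrow> e \<le> d"
    using D by (fast, metis, metis)
  have dim: "krull_dim R = enat d" by (rule krull_dim_eq[OF d(1,2)])

  \<comment> \<open>Separable generation is given for finitely generated subextensions. The whole
    fraction field is one of them, because the denominators needed to reach \<open>R\<close> from
    the generators are nonzero.\<close>
  have gen: "generate_field F (\<iota> ` A \<union> \<iota> ` T) = carrier F"
  proof
    let ?L = "generate_field F (\<iota> ` A \<union> \<iota> ` T)"
    have c: "\<iota> ` A \<union> \<iota> ` T \<subseteq> carrier F" using Ac T by auto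
    show "?L \<subseteq> carrier F" by (rule F.generate_field_incl[OF c])
    have L: "subfield ?L F" by (rule F.generate_field_is_subfield[OF c])
    note Lr = subfieldE(1)[OF L]
    have AT: "A \<union> T \<subseteq> carrier R" using Ac T by auto
    have "\<iota> ` generate_ring R (A \<union> T) = generate_ring F (\<iota> ` (A \<union> T))"
      by (rule \<iota>r.generate_ring_image[OF AT])
    also have "\<dots> \<subseteq> ?L"
      by (rule F.generate_ring_min_subring1[OF _ Lr]) (use c in \<open>auto intro: generate_field.incl\<close>)
    finally have gL: "\<iota> ` generate_ring R (A \<union> T) \<subseteq> ?L" .
    have quot: "y \<in> ?L" if y: "y \<in> carrier F" and s: "s \<in> ?L" "s \<noteq> \<zero>\<^bsub>F\<^esub>" and ys: "y \<otimes>\<^bsub>F\<^esub> s \<in> ?L" for y s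
    proof -
      have sc: "s \<in> carrier F" using s(1) F.generate_field_incl[OF c] by blast
      have "y = (y \<otimes>\<^bsub>F\<^esub> s) \<otimes>\<^bsub>F\<^esub> inv\<^bsub>F\<^esub> s"
        using y sc s(2) F.inv_mult_cancel(1)[OF sc s(2)] F.inv_nonzero_closed[OF sc s(2)] by (simp add: F.m_assoc)
      thus ?thesis using generate_field.eng_mult[OF ys generate_field.m_inv[OF s]] by simp
    qed
    have RL: "\<iota> b \<in> ?L" if b: "b \<in> carrier R" for b
    proof -
      obtain s where s: "s \<in> generate_ring R (A \<union> T) - \<mm>" "b \<otimes>\<^bsub>R\<^esub> s \<in> generate_ring R (A \<union> T)" using loc[OF b] by blast
      have sc: "s \<in> carrier R" using s(1) R.generate_ring_incl[OF AT] by blast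
      have "s \<noteq> \<zero>\<^bsub>R\<^esub>" using s(1) m.zero_closed by blast
      hence "\<iota> s \<noteq> \<zero>\<^bsub>F\<^esub>" using \<iota>0 sc by blast
      moreover have "\<iota> b \<otimes>\<^bsub>F\<^esub> \<iota> s \<in> ?L" using s(2) gL b sc by (force simp flip: \<iota>.hom_mult)
      moreover have "\<iota> s \<in> ?L" using s(1) gL by blast
      ultimately show ?thesis using quot b by simp
    qed
    show "carrier F \<subseteq> ?L"
    proof
      fix y assume y: "y \<in> carrier F"
      then obtain a s where as: "a \<in> carrier R" "s \<in> carrier R" "\<iota> s \<noteq> \<zero>\<^bsub>F\<^esub>" "\<iota> a = y \<otimes>\<^bsub>F\<^esub> \<iota> s" using fr by blast
      thus "y \<in> ?L" using quot[OF y RL[OF as(2)] as(3)] RL[OF as(1)] by simp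
    qed
  qed
  have "F.separably_generated (\<iota> ` A) (carrier F)"
  proof -
    have "\<iota> ` T \<subseteq> carrier F" "finite (\<iota> ` T)" using T by auto
    hence "F.separably_generated (\<iota> ` A) (generate_field F (\<iota> ` A \<union> \<iota> ` T))"
      using assms(4) by (simp only: F.separable_extension_def A_def)
    thus ?thesis by (simp only: gen)
  qed
  then obtain B where B': "B \<subseteq> carrier F \<and> F.algebraically_independent (\<iota> ` A) B \<and>
      (\<forall>y\<in>carrier F. F.separable_over (generate_field F (\<iota> ` A \<union> B)) y)"
    unfolding F.separably_generated_def ..
  have B: "B \<subseteq> carrier F" "F.algebraically_independent (\<iota> ` A) B"
    "\<And>y. y \<in> carrier F \<Longrightarrow> F.separable_over (generate_field F (\<iota> ` A \<union> B)) y"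
    using B' by simp_all
  \<comment> \<open>A basis with more than \<open>d\<close> elements, infinite or not, would contain
    an independent family of more than \<open>d\<close> members, which \<open>d(3)\<close>
    excludes.\<close>
  have fB: "finite B"
    by (rule F.algebraically_independent_finite(1)[OF subfieldE(1)[OF \<iota>A] B(1,2)]) (rule d(3))
  have cB: "card B \<le> d"
    by (rule F.algebraically_independent_finite(2)[OF subfieldE(1)[OF \<iota>A] B(1,2)]) (rule d(3))
  have LB: "subfield (generate_field F (\<iota> ` A \<union> B)) F"
    by (rule F.generate_field_is_subfield) (use Ac B(1) in auto)
  have sepF: "\<exists>p. set p \<subseteq> generate_field F (\<iota> ` A \<union> B) \<and> F.eval p y = \<zero>\<^bsub>F\<^esub> \<and> F.dv p y \<noteq> \<zero>\<^bsub>F\<^esub>"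
    if y: "y \<in> carrier F" for y
  proof -
    obtain p where p: "set p \<subseteq> generate_field F (\<iota> ` A \<union> B)" "y [^]\<^bsub>F\<^esub> length p \<oplus>\<^bsub>F\<^esub> F.eval p y = \<zero>\<^bsub>F\<^esub>"
      "F.dv (\<one>\<^bsub>F\<^esub> # p) y \<noteq> \<zero>\<^bsub>F\<^esub>"
      using F.separable_over_relation[OF LB y B(3)[OF y]] by blast
    thus ?thesis using y generate_field.one[of F] by (intro exI[of _ "\<one>\<^bsub>F\<^esub> # p"]) (simp del: F.dv.simps)
  qed
  obtain b where b: "b ` {..<card B} = B"
    using ex_bij_betw_nat_finite[OF fB] by (auto simp: atLeast0LessThan bij_betw_def)
  have bc: "b j \<in> carrier F" if "j < card B" for j using b B(1) that by blast
  have "\<forall>j\<in>{..<card B}. \<exists>a. a \<in> carrier R \<and> (\<exists>s. s \<in> carrier R \<and> \<iota> s \<noteq> \<zero>\<^bsub>F\<^esub> \<and> \<iota> a = b j \<otimes>\<^bsub>F\<^esub> \<iota> s)"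
    using fr[OF bc] by (auto simp: Bex_def)
  from bchoice[OF this] obtain a where a: "\<forall>j\<in>{..<card B}. a j \<in> carrier R \<and>
      (\<exists>s. s \<in> carrier R \<and> \<iota> s \<noteq> \<zero>\<^bsub>F\<^esub> \<and> \<iota> (a j) = b j \<otimes>\<^bsub>F\<^esub> \<iota> s)" ..
  hence "\<forall>j\<in>{..<card B}. \<exists>s. s \<in> carrier R \<and> \<iota> s \<noteq> \<zero>\<^bsub>F\<^esub> \<and> \<iota> (a j) = b j \<otimes>\<^bsub>F\<^esub> \<iota> s" by simp
  from bchoice[OF this] obtain s where s: "\<forall>j\<in>{..<card B}. s j \<in> carrier R \<and> \<iota> (s j) \<noteq> \<zero>\<^bsub>F\<^esub> \<and>
      \<iota> (a j) = b j \<otimes>\<^bsub>F\<^esub> \<iota> (s j)" ..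
  have as: "a j \<in> carrier R \<and> s j \<in> carrier R \<and> \<iota> (s j) \<noteq> \<zero>\<^bsub>F\<^esub> \<and> \<iota> (a j) = b j \<otimes>\<^bsub>F\<^esub> \<iota> (s j)"
    if "j < card B" for j
    using a s that by simp
  \<comment> \<open>The basis elements are the fractions \<open>a j / s j\<close>. By the quotient
    rule \<open>s j * D (a j) = a j * D (s j)\<close> says that the extended derivation kills
    \<open>b j\<close>, and a derivation that kills the whole separating basis is zero.\<close>
  have "\<exists>q\<le>card B. \<exists>x. (\<forall>i<q. x i \<in> carrier R) \<and>
    (\<forall>D\<in>R.der A. (\<forall>i<q. D (x i) = \<zero>\<^bsub>R\<^esub>) \<longrightarrow> (\<forall>y\<in>carrier R. D y = \<zero>\<^bsub>R\<^esub>))"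
  proof (rule R.derivation_determining_elements[OF Ac, of "card B" a s])
    fix D x assume D: "D \<in> R.der A" and z: "\<And>j. j < card B \<Longrightarrow> s j \<otimes>\<^bsub>R\<^esub> D (a j) = a j \<otimes>\<^bsub>R\<^esub> D (s j)"
      and x: "x \<in> carrier R"
    show "D x = \<zero>\<^bsub>R\<^esub>"
    proof (rule \<iota>.derivation_zero[OF F inj fr Ac D B(1) _ sepF x])
      fix y assume "y \<in> B"
      then obtain j where j: "j < card B" "y = b j" using b by blast
      thus "\<exists>a\<in>carrier R. \<exists>s\<in>carrier R. \<iota> s \<noteq> \<zero>\<^bsub>F\<^esub> \<and> \<iota> a = y \<otimes>\<^bsub>F\<^esub> \<iota> s \<and> s \<otimes>\<^bsub>R\<^esub> D a = a \<otimes>\<^bsub>R\<^esub> D s"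
        using as[OF j(1)] z[OF j(1)] by blast
    qed
  qed (use as in blast)
  then obtain q x where q: "q \<le> card B" and x: "\<And>i. i < q \<Longrightarrow> x i \<in> carrier R"
    and der: "\<And>D y. D \<in> R.der A \<Longrightarrow> (\<And>i. i < q \<Longrightarrow> D (x i) = \<zero>\<^bsub>R\<^esub>) \<Longrightarrow> y \<in> carrier R \<Longrightarrow> D y = \<zero>\<^bsub>R\<^esub>"
    by blast

  \<comment> \<open>Only positive indices are estimated; the differential power of index zero does
    not affect the limit superior.\<close>
  have len: "module_length R (quotient_module R (diff_power K R \<mm> (Suc n))) \<le> enat ((n + d) choose d)" for n
  proof -
    have "diff_power K R \<mm> (Suc n) = {f \<in> carrier R. \<forall>\<delta>\<in>R.dop A n. ?h (\<delta> f) = \<zero>\<^bsub>?Q\<^esub>}"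
      unfolding diff_power.simps diff_op_dop[OF alg] A_def[symmetric]
      using hm R.linD(1)[OF R.dop_lin[OF _ Ac]] by blast
    moreover have "module_length R (quotient_module R {f \<in> carrier R. \<forall>\<delta>\<in>R.dop A n. ?h (\<delta> f) = \<zero>\<^bsub>?Q\<^esub>})
        \<le> enat ((n + q) choose q)"
      by (rule R.module_length_bound[where h = ?h and x = x, OF Q h hQ A sep]) (assumption | fact x der)+
    ultimately have "module_length R (quotient_module R (diff_power K R \<mm> (Suc n))) \<le> enat ((n + q) choose q)"
      by simp
    \<comment> \<open>\<open>q\<close> may be smaller than \<open>d\<close>. In the form
      \<open>choose n\<close> only the upper index depends on it, so monotonicity in the upper index
      suffices.\<close>
    also have "(n + q) choose q = (n + q) choose n" using binomial_symmetric[of q "n + q"] by simp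
    also have "\<dots> \<le> (n + d) choose n" using q cB by (intro binomial_right_mono) simp
    also have "(n + d) choose n = (n + d) choose d" using binomial_symmetric[of d "n + d"] by simp
    finally show ?thesis by simp
  qed
  show ?thesis unfolding diff_signature_def Let_def dim the_enat.simps
    by (rule limsup_binomial_le_1[OF len])
qed

end
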